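(* Let $\varphi\colon R\to S=R/I$ be a surjective local homomorphism of commutative noetherian local rings with common residue field $k$, such that $S$ has finite projective dimension over $R$. Let $z\in\pi^2(\varphi)$. If the homomorphism $I/I^2\to k$ corresponding to $z$ factors (as a composite of $S$-module maps $I/I^2\to N\to k$) through a finitely generated $S$-module $N$ of finite projective dimension over $S$, then $z$ is in the radical of the homotopy Lie algebra $\pi^*(\varphi)$.
   Context: Minimal model. Let $\mathfrak{m}_R$ be the maximal ideal of $R$. A minimal model for $\varphi$ is a factorisation $R\to A\to S$ where $A$ is a dg $R$-algebra such that: (1) $A=R[X]$ is the free strictly graded commutative $R$-algebra on a graded set $X=X_1,X_2,\dots$, with $X_i$ a set of variables of homological degree $i$ (strictly: squares of odd degree elements vanish); (2) the differential satisfies $\partial(\mathfrak{m}_A)\subseteq\mathfrak{m}_RA+\mathfrak{m}_A^2$, where $\mathfrak{m}_A=(\mathfrak{m}_R,X)$ is the kernel of $A\to k$; (3) $A\to S$ is a quasi-isomorphism. It exists and is unique up to isomorphism of dg $R$-algebras over $S$. Put $A^{(1)}=A\otimes_Rk=k[X]$, with maximal ideal $\mathfrak{m}_{A^{(1)}}=(X)$. Homotopy Lie algebra. Let $\operatorname{ind}A^{(1)}=\mathfrak{m}_{A^{(1)}}/\mathfrak{m}_{A^{(1)}}^2$, a graded $k$-vector space with basis $X_i$ in degree $i$, and $\operatorname{ind}^2A^{(1)}=\mathfrak{m}_{A^{(1)}}^2/\mathfrak{m}_{A^{(1)}}^3$. Let $\Sigma$ be the degree shift, $(\Sigma M)_i=M_{i-1}$,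 with tautological degree $1$ map $\Sigma\colon M\to\Sigma M$, and let $(-)^\vee$ be the graded $k$-dual. Define $\pi^*(\varphi)=(\Sigma\operatorname{ind}A^{(1)})^\vee$, so $\pi^i(\varphi)$ is the dual of the span of $X_{i-1}$. With $\langle u,x\rangle=u(\Sigma x)$, define for $u\in\pi^i(\varphi)$, $v\in\pi^j(\varphi)$ $$\langle u\otimes v,xy\rangle=\langle v,x\rangle\langle u,y\rangle+(-1)^{(i+1)(j+1)}\langle u,x\rangle\langle v,y\rangle.$$ The differential of $A$ induces $\overline{\partial}\colon\operatorname{ind}A^{(1)}\to\operatorname{ind}^2A^{(1)}$, and the Lie bracket on $\pi^*(\varphi)$ is defined by $\langle[u,v],x\rangle=(-1)^j\langle u\otimes v,\overline{\partial}(x)\rangle$. Correspondence. The elements $\partial x$, $x\in X_1$, minimally generate $I$, giving natural isomorphisms $\pi^2(\varphi)\cong\operatorname{Hom}_R(RX_1,k)\cong\operatorname{Hom}_R(I,k)\cong\operatorname{Hom}_S(I/I^2,k)$; $z$ corresponds to the map sending the class of $\partial x$ to $z(\Sigma x)$ for $x\in X_1$. Radical. The radical of a graded Lie algebra is the sum of all its solvable ideals. Since the projective dimension of $S$ over $R$ is finite, it is known that $z\in\pi^*(\varphi)$ lies in the radical if and only if there is an $n$ such that $[z,-]\colon\pi^{>n}(\varphi)\to\pi^{>n}(\varphi)$ is zero; this criterion may be taken as the definition of the radical. *)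

theory Defs
  imports
    "HOL-Library.Multiset"
    "HOL-Algebra.Module"
    "HOL-Algebra.Ideal_Product"
    "HOL-Algebra.Ring_Divisibility"
begin

hide_const (open) Multiset.mult

section \<open>Local rings and modules\<close>

definition max_ideal :: "('a, 'm) ring_scheme \<Rightarrow> 'a set" where
  "max_ideal R = (THE \<mm>. maximalideal \<mm> R)"

definition noetherian_local_ring :: "('a, 'm) ring_scheme \<Rightarrow> bool" where
  "noetherian_local_ring R \<longleftrightarrow> cring R \<and> noetherian_ring R \<and> (\<exists>!\<mm>. maximalideal \<mm> R)"

definition lin_maps ::
  "('a, 'm) ring_scheme \<Rightarrow> ('a, 'b, 'p) module_scheme \<Rightarrow> ('a, 'c, 'q) module_scheme \<Rightarrow> ('b \<Rightarrow> 'c) set" where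
  "lin_maps R M N = {f \<in> carrier M \<rightarrow> carrier N.
     (\<forall>x\<in>carrier M. \<forall>y\<in>carrier M. f (x \<oplus>\<^bsub>M\<^esub> y) = f x \<oplus>\<^bsub>N\<^esub> f y) \<and>
     (\<forall>r\<in>carrier R. \<forall>x\<in>carrier M. f (r \<odot>\<^bsub>M\<^esub> x) = r \<odot>\<^bsub>N\<^esub> f x)}"

text \<open>The target of a ring homomorphism \<open>f\<close>, regarded as a module over the source of \<open>f\<close>.\<close>

definition module_via :: "('a \<Rightarrow> 'b) \<Rightarrow> ('b, 'm) ring_scheme \<Rightarrow> ('a, 'b) module" where
  "module_via f T = \<lparr>carrier = carrier T, mult = mult T, one = one T, zero = zero T, add = add T,
     smult = (\<lambda>r t. f r \<otimes>\<^bsub>T\<^esub> t)\<rparr>"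

text \<open>The quotient \<open>P/Q\<close> of submodules \<open>Q \<subseteq> P\<close> of \<open>M\<close>; its elements are the cosets of \<open>Q\<close> in \<open>P\<close>.
  The ring multiplication fields of a module record play no role.\<close>

definition quot_module :: "('a, 'b, 'm) module_scheme \<Rightarrow> 'b set \<Rightarrow> 'b set \<Rightarrow> ('a, 'b set) module" where
  "quot_module M P Q = \<lparr>carrier = (\<lambda>x. Q +>\<^bsub>M\<^esub> x) ` P, mult = undefined, one = undefined,
     zero = Q, add = (\<lambda>Y Z. Y <+>\<^bsub>M\<^esub> Z), smult = (\<lambda>c Y. Q <+>\<^bsub>M\<^esub> ((\<lambda>y. c \<odot>\<^bsub>M\<^esub> y) ` Y))\<rparr>"

definition finitely_generated :: "('a, 'm) ring_scheme \<Rightarrow> ('a, 'b, 'p) module_scheme \<Rightarrow> bool" where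
  "finitely_generated R M \<longleftrightarrow> (\<exists>B. finite B \<and> B \<subseteq> carrier M \<and>
     (\<forall>x\<in>carrier M. \<exists>c\<in>B \<rightarrow> carrier R. x = (\<Oplus>\<^bsub>M\<^esub>b\<in>B. c b \<odot>\<^bsub>M\<^esub> b)))"

definition free_module :: "('a, 'm) ring_scheme \<Rightarrow> 'j set \<Rightarrow> ('a, 'j \<Rightarrow> 'a) module" where
  "free_module R J = \<lparr>carrier = {f. (\<forall>j. f j \<in> carrier R) \<and> (\<forall>j. j \<notin> J \<longrightarrow> f j = \<zero>\<^bsub>R\<^esub>) \<and>
       finite {j. f j \<noteq> \<zero>\<^bsub>R\<^esub>}},
     mult = undefined, one = undefined, zero = (\<lambda>_. \<zero>\<^bsub>R\<^esub>), add = (\<lambda>f g j. f j \<oplus>\<^bsub>R\<^esub> g j),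
     smult = (\<lambda>r f j. r \<otimes>\<^bsub>R\<^esub> f j)\<rparr>"

text \<open>Projective: a direct summand of a free module. An index set within the type of elements
  of \<open>P\<close> is no restriction, since \<open>P\<close> is a quotient of the free module on \<open>carrier P\<close>.\<close>

definition projective_module :: "('a, 'm) ring_scheme \<Rightarrow> ('a, 'p) module \<Rightarrow> bool" where
  "projective_module R P \<longleftrightarrow> module R P \<and>
     (\<exists>(J :: 'p set) i q. i \<in> lin_maps R P (free_module R J) \<and> q \<in> lin_maps R (free_module R J) P \<and>
       (\<forall>x\<in>carrier P. q (i x) = x))"

text \<open>\<open>P\<close> with maps \<open>\<delta> n : P (n + 1) \<rightarrow> P n\<close> and augmentation \<open>e : P 0 \<rightarrow> M\<close>.\<close>

definition projective_resolution ::
  "('a, 'm) ring_scheme \<Rightarrow> ('a, 'b, 'q) module_scheme \<Rightarrow> (nat \<Rightarrow> ('a, 'p) module) \<Rightarrow>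
   (nat \<Rightarrow> 'p \<Rightarrow> 'p) \<Rightarrow> ('p \<Rightarrow> 'b) \<Rightarrow> bool" where
  "projective_resolution R M P \<delta> e \<longleftrightarrow>
     (\<forall>n. projective_module R (P n)) \<and>
     (\<forall>n. \<delta> n \<in> lin_maps R (P (Suc n)) (P n)) \<and> e \<in> lin_maps R (P 0) M \<and>
     e ` carrier (P 0) = carrier M \<and>
     {x \<in> carrier (P 0). e x = \<zero>\<^bsub>M\<^esub>} = \<delta> 0 ` carrier (P (Suc 0)) \<and>
     (\<forall>n. {x \<in> carrier (P (Suc n)). \<delta> n x = \<zero>\<^bsub>P n\<^esub>} = \<delta> (Suc n) ` carrier (P (Suc (Suc n))))"

text \<open>Every module with elements in \<open>'b\<close> has a resolution by free modules of rank at most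
  \<open>\<kappa> = card (nat \<times> 'b \<times> 'a)\<close>, whose syzygies again have cardinality at most \<open>\<kappa>\<close>. So if \<open>M\<close> has
  finite projective dimension, it has a finite projective resolution by modules with elements in
  the type below, and this choice of type loses no generality.\<close>

definition finite_projdim :: "('a, 'm) ring_scheme \<Rightarrow> ('a, 'b) module \<Rightarrow> bool" where
  "finite_projdim R M \<longleftrightarrow>
     (\<exists>(P :: nat \<Rightarrow> ('a, nat \<times> 'b \<times> 'a \<Rightarrow> 'a) module) \<delta> e.
        projective_resolution R M P \<delta> e \<and> (\<exists>n. \<forall>i>n. carrier (P i) = {\<zero>\<^bsub>P i\<^esub>}))"


section \<open>The free strictly graded commutative algebra\<close>

definition signed :: "('a, 'm) ring_scheme \<Rightarrow> nat \<Rightarrow> 'a \<Rightarrow> 'a" where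
  "signed R n r = (if even n then r else \<ominus>\<^bsub>R\<^esub> r)"

text \<open>A multiset \<open>{x\<^sub>1 \<le> \<dots> \<le> x\<^sub>n}\<close> of variables stands for the product \<open>x\<^sub>1 \<dots> x\<^sub>n\<close>, with the factors
  in increasing order. Products with a repeated odd factor vanish, and the others form a basis
  of \<open>R[X]\<close>.\<close>

definition gc_monos :: "'x set \<Rightarrow> ('x \<Rightarrow> nat) \<Rightarrow> 'x multiset set" where
  "gc_monos X vdeg = {m. set_mset m \<subseteq> X \<and> (\<forall>x. odd (vdeg x) \<longrightarrow> count m x \<le> 1)}"

definition gc_deg :: "('x \<Rightarrow> nat) \<Rightarrow> 'x multiset \<Rightarrow> nat" where
  "gc_deg vdeg m = (\<Sum>x\<in>#m. vdeg x)"

text \<open>The number of transpositions of odd variables needed to sort \<open>m m'\<close>.\<close>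

definition inversions :: "('x::linorder \<Rightarrow> nat) \<Rightarrow> 'x multiset \<Rightarrow> 'x multiset \<Rightarrow> nat" where
  "inversions vdeg m m' =
     card {(x, y). x \<in># m \<and> y \<in># m' \<and> odd (vdeg x) \<and> odd (vdeg y) \<and> y < x}"

definition gc_algebra ::
  "('a, 'm) ring_scheme \<Rightarrow> 'x::linorder set \<Rightarrow> ('x \<Rightarrow> nat) \<Rightarrow> ('a, 'x multiset \<Rightarrow> 'a) module" where
  "gc_algebra R X vdeg = (free_module R (gc_monos X vdeg))
     \<lparr>mult := (\<lambda>f g m. if m \<in> gc_monos X vdeg
        then \<Oplus>\<^bsub>R\<^esub>a\<in>{a. a \<subseteq># m}. signed R (inversions vdeg a (m - a)) (f a \<otimes>\<^bsub>R\<^esub> g (m - a))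
        else \<zero>\<^bsub>R\<^esub>),
      one := (\<lambda>m. if m = {#} then \<one>\<^bsub>R\<^esub> else \<zero>\<^bsub>R\<^esub>)\<rparr>"

definition gc_const :: "('a, 'm) ring_scheme \<Rightarrow> 'a \<Rightarrow> 'x multiset \<Rightarrow> 'a" where
  "gc_const R r = (\<lambda>m. if m = {#} then r else \<zero>\<^bsub>R\<^esub>)"

definition gc_var :: "('a, 'm) ring_scheme \<Rightarrow> 'x \<Rightarrow> 'x multiset \<Rightarrow> 'a" where
  "gc_var R x = (\<lambda>m. if m = {#x#} then \<one>\<^bsub>R\<^esub> else \<zero>\<^bsub>R\<^esub>)"

definition gc_comp ::
  "('a, 'm) ring_scheme \<Rightarrow> 'x::linorder set \<Rightarrow> ('x \<Rightarrow> nat) \<Rightarrow> nat \<Rightarrow> ('x multiset \<Rightarrow> 'a) set" where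
  "gc_comp R X vdeg n =
     {f \<in> carrier (gc_algebra R X vdeg). \<forall>m. f m \<noteq> \<zero>\<^bsub>R\<^esub> \<longrightarrow> gc_deg vdeg m = n}"


section \<open>Minimal models\<close>

text \<open>Here \<open>G n\<close> is the component of \<open>A\<close> in homological degree \<open>n\<close>.\<close>

definition dg_differential ::
  "('a, 'm) ring_scheme \<Rightarrow> ('a, 'c, 'q) module_scheme \<Rightarrow> (nat \<Rightarrow> 'c set) \<Rightarrow> ('c \<Rightarrow> 'c) \<Rightarrow> bool" where
  "dg_differential R A G d \<longleftrightarrow> d \<in> lin_maps R A A \<and>
     (\<forall>n. d ` G (Suc n) \<subseteq> G n) \<and> (\<forall>f\<in>G 0. d f = \<zero>\<^bsub>A\<^esub>) \<and>
     (\<forall>f\<in>carrier A. d (d f) = \<zero>\<^bsub>A\<^esub>) \<and>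
     (\<forall>n. \<forall>f\<in>G n. \<forall>g\<in>carrier A.
        d (f \<otimes>\<^bsub>A\<^esub> g) = (d f \<otimes>\<^bsub>A\<^esub> g) \<oplus>\<^bsub>A\<^esub> signed A n (f \<otimes>\<^bsub>A\<^esub> d g))"

text \<open>An additive map \<open>\<alpha>\<close> of nonnegatively graded complexes that is a chain map and is injective
  and surjective on homology.\<close>

definition quasi_iso ::
  "('c, 'm) ring_scheme \<Rightarrow> (nat \<Rightarrow> 'c set) \<Rightarrow> ('c \<Rightarrow> 'c) \<Rightarrow>
   ('b, 'n) ring_scheme \<Rightarrow> (nat \<Rightarrow> 'b set) \<Rightarrow> ('b \<Rightarrow> 'b) \<Rightarrow> ('c \<Rightarrow> 'b) \<Rightarrow> bool" where
  "quasi_iso A G d B H \<delta> \<alpha> \<longleftrightarrow>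
     (\<forall>n. \<alpha> ` G n \<subseteq> H n) \<and> (\<forall>a\<in>carrier A. \<alpha> (d a) = \<delta> (\<alpha> a)) \<and>
     (\<forall>n. \<forall>a\<in>G n. d a = \<zero>\<^bsub>A\<^esub> \<and> \<alpha> a \<in> \<delta> ` H (Suc n) \<longrightarrow> a \<in> d ` G (Suc n)) \<and>
     (\<forall>n. \<forall>b\<in>H n. \<delta> b = \<zero>\<^bsub>B\<^esub> \<longrightarrow>
        (\<exists>a\<in>G n. d a = \<zero>\<^bsub>A\<^esub> \<and> b \<ominus>\<^bsub>B\<^esub> \<alpha> a \<in> \<delta> ` H (Suc n)))"

text \<open>\<open>A = R[X]\<close> with differential \<open>d\<close> is a minimal model of \<open>\<phi> : R \<rightarrow> S\<close>, where \<open>S\<close> is a complex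
  concentrated in degree \<open>0\<close>. \<open>X\<close> is the set of all variables, and \<open>X\<^sub>i\<close> consists of those with
  \<open>vdeg x = i\<close>. The linear order on the variables only serves to name the monomial basis.\<close>

definition minimal_model ::
  "('a, 'm) ring_scheme \<Rightarrow> ('b, 'n) ring_scheme \<Rightarrow> ('a \<Rightarrow> 'b) \<Rightarrow>
   'x::linorder set \<Rightarrow> ('x \<Rightarrow> nat) \<Rightarrow> (('x multiset \<Rightarrow> 'a) \<Rightarrow> ('x multiset \<Rightarrow> 'a)) \<Rightarrow> bool" where
  "minimal_model R S \<phi> X vdeg d \<longleftrightarrow>
     (let A = gc_algebra R X vdeg;
          \<mm>R_A = Idl\<^bsub>A\<^esub> (gc_const R ` max_ideal R);
          \<mm>_A = Idl\<^bsub>A\<^esub> (gc_const R ` max_ideal R \<union> gc_var R ` X)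
      in (\<forall>x\<in>X. vdeg x \<ge> 1) \<and>
         dg_differential R A (gc_comp R X vdeg) d \<and>
         d ` \<mm>_A \<subseteq> \<mm>R_A <+>\<^bsub>A\<^esub> ideal_prod A \<mm>_A \<mm>_A \<and>
         (\<exists>\<alpha>\<in>ring_hom A S. (\<forall>r\<in>carrier R. \<alpha> (gc_const R r) = \<phi> r) \<and>
            quasi_iso A (gc_comp R X vdeg) d
              S (\<lambda>n. if n = 0 then carrier S else {\<zero>\<^bsub>S\<^esub>}) (\<lambda>_. \<zero>\<^bsub>S\<^esub>) \<alpha>))"


section \<open>The homotopy Lie algebra\<close>

text \<open>In this section \<open>k\<close> is the residue field, \<open>\<rho> : R \<rightarrow> k\<close> is the residue map, and
  \<open>A\<^sup>1 = A \<otimes>\<^sub>R k\<close> is \<open>gc_algebra k X vdeg\<close>, onto which \<open>A\<close> maps by applying \<open>\<rho>\<close> to the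
  coefficients.\<close>

definition fibre_ideal ::
  "('k, 'm) ring_scheme \<Rightarrow> 'x::linorder set \<Rightarrow> ('x \<Rightarrow> nat) \<Rightarrow> ('x multiset \<Rightarrow> 'k) set" where
  "fibre_ideal k X vdeg = Idl\<^bsub>gc_algebra k X vdeg\<^esub> (gc_var k ` X)"

definition fibre_ideal_sq ::
  "('k, 'm) ring_scheme \<Rightarrow> 'x::linorder set \<Rightarrow> ('x \<Rightarrow> nat) \<Rightarrow> ('x multiset \<Rightarrow> 'k) set" where
  "fibre_ideal_sq k X vdeg =
     ideal_prod (gc_algebra k X vdeg) (fibre_ideal k X vdeg) (fibre_ideal k X vdeg)"

definition fibre_ideal_cube ::
  "('k, 'm) ring_scheme \<Rightarrow> 'x::linorder set \<Rightarrow> ('x \<Rightarrow> nat) \<Rightarrow> ('x multiset \<Rightarrow> 'k) set" where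
  "fibre_ideal_cube k X vdeg =
     ideal_prod (gc_algebra k X vdeg) (fibre_ideal_sq k X vdeg) (fibre_ideal k X vdeg)"

definition ind ::
  "('k, 'm) ring_scheme \<Rightarrow> 'x::linorder set \<Rightarrow> ('x \<Rightarrow> nat) \<Rightarrow> ('k, ('x multiset \<Rightarrow> 'k) set) module" where
  "ind k X vdeg = quot_module (gc_algebra k X vdeg) (fibre_ideal k X vdeg) (fibre_ideal_sq k X vdeg)"

definition ind2 ::
  "('k, 'm) ring_scheme \<Rightarrow> 'x::linorder set \<Rightarrow> ('x \<Rightarrow> nat) \<Rightarrow> ('k, ('x multiset \<Rightarrow> 'k) set) module" where
  "ind2 k X vdeg = quot_module (gc_algebra k X vdeg) (fibre_ideal_sq k X vdeg) (fibre_ideal_cube k X vdeg)"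

definition ind_class ::
  "('k, 'm) ring_scheme \<Rightarrow> 'x::linorder set \<Rightarrow> ('x \<Rightarrow> nat) \<Rightarrow> ('x multiset \<Rightarrow> 'k) \<Rightarrow> ('x multiset \<Rightarrow> 'k) set" where
  "ind_class k X vdeg f = fibre_ideal_sq k X vdeg +>\<^bsub>gc_algebra k X vdeg\<^esub> f"

definition ind2_class ::
  "('k, 'm) ring_scheme \<Rightarrow> 'x::linorder set \<Rightarrow> ('x \<Rightarrow> nat) \<Rightarrow> ('x multiset \<Rightarrow> 'k) \<Rightarrow> ('x multiset \<Rightarrow> 'k) set" where
  "ind2_class k X vdeg f = fibre_ideal_cube k X vdeg +>\<^bsub>gc_algebra k X vdeg\<^esub> f"

text \<open>The component of degree \<open>i\<close> of the graded dual of \<open>\<Sigma> (ind A\<^sup>1)\<close>: functionals on \<open>ind A\<^sup>1\<close>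
  that vanish on all components of degree other than \<open>i - 1\<close>. The shift only changes degrees, so
  \<open>\<langle>u, x\<rangle> = u (\<Sigma> x)\<close> is the value of \<open>u\<close> at the class of \<open>x\<close>.\<close>

definition homotopy_pi ::
  "('k, 'm) ring_scheme \<Rightarrow> 'x::linorder set \<Rightarrow> ('x \<Rightarrow> nat) \<Rightarrow> nat \<Rightarrow> (('x multiset \<Rightarrow> 'k) set \<Rightarrow> 'k) set" where
  "homotopy_pi k X vdeg i = {u \<in> lin_maps k (ind k X vdeg) (module_via id k).
     \<forall>n. \<forall>f\<in>fibre_ideal k X vdeg \<inter> gc_comp k X vdeg n.
       Suc n \<noteq> i \<longrightarrow> u (ind_class k X vdeg f) = \<zero>\<^bsub>k\<^esub>}"

text \<open>For \<open>u\<close> and \<open>v\<close> of degrees \<open>i\<close> and \<open>j\<close>, the functional \<open>\<langle>u \<otimes> v, -\<rangle>\<close> on \<open>ind\<^sup>2 A\<^sup>1\<close>. It is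
  determined by the formula because the products \<open>x y\<close> span \<open>ind\<^sup>2 A\<^sup>1\<close>; the formula is bilinear and
  compatible with the sign rule of \<open>A\<^sup>1\<close>, so that \<open>x\<close> and \<open>y\<close> need not be homogeneous.\<close>

definition tensor_pairing ::
  "('k, 'm) ring_scheme \<Rightarrow> 'x::linorder set \<Rightarrow> ('x \<Rightarrow> nat) \<Rightarrow> nat \<Rightarrow> nat \<Rightarrow>
   (('x multiset \<Rightarrow> 'k) set \<Rightarrow> 'k) \<Rightarrow> (('x multiset \<Rightarrow> 'k) set \<Rightarrow> 'k) \<Rightarrow> ('x multiset \<Rightarrow> 'k) set \<Rightarrow> 'k" where
  "tensor_pairing k X vdeg i j u v =
     (THE \<beta>. \<beta> \<in> lin_maps k (ind2 k X vdeg) (module_via id k) \<inter> extensional (carrier (ind2 k X vdeg)) \<and>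
        (\<forall>x\<in>fibre_ideal k X vdeg. \<forall>y\<in>fibre_ideal k X vdeg.
           \<beta> (ind2_class k X vdeg (x \<otimes>\<^bsub>gc_algebra k X vdeg\<^esub> y)) =
             (v (ind_class k X vdeg x) \<otimes>\<^bsub>k\<^esub> u (ind_class k X vdeg y)) \<oplus>\<^bsub>k\<^esub>
             signed k ((i + 1) * (j + 1)) (u (ind_class k X vdeg x) \<otimes>\<^bsub>k\<^esub> v (ind_class k X vdeg y))))"

text \<open>The differential \<open>d \<otimes> k\<close>.\<close>

definition fibre_diff ::
  "('a, 'm) ring_scheme \<Rightarrow> ('k, 'n) ring_scheme \<Rightarrow> ('a \<Rightarrow> 'k) \<Rightarrow> 'x::linorder set \<Rightarrow> ('x \<Rightarrow> nat) \<Rightarrow>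
   (('x multiset \<Rightarrow> 'a) \<Rightarrow> ('x multiset \<Rightarrow> 'a)) \<Rightarrow> ('x multiset \<Rightarrow> 'k) \<Rightarrow> ('x multiset \<Rightarrow> 'k)" where
  "fibre_diff R k \<rho> X vdeg d =
     (THE D. D \<in> lin_maps k (gc_algebra k X vdeg) (gc_algebra k X vdeg) \<inter>
               extensional (carrier (gc_algebra k X vdeg)) \<and>
        (\<forall>f\<in>carrier (gc_algebra R X vdeg). D (\<rho> \<circ> f) = \<rho> \<circ> d f))"

text \<open>The map \<open>ind A\<^sup>1 \<rightarrow> ind\<^sup>2 A\<^sup>1\<close> induced by \<open>d \<otimes> k\<close>: the image of a coset \<open>c\<close> of \<open>\<mm>\<^sup>2\<close> is contained
  in one coset of \<open>\<mm>\<^sup>3\<close>.\<close>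

definition ind_diff ::
  "('a, 'm) ring_scheme \<Rightarrow> ('k, 'n) ring_scheme \<Rightarrow> ('a \<Rightarrow> 'k) \<Rightarrow> 'x::linorder set \<Rightarrow> ('x \<Rightarrow> nat) \<Rightarrow>
   (('x multiset \<Rightarrow> 'a) \<Rightarrow> ('x multiset \<Rightarrow> 'a)) \<Rightarrow> ('x multiset \<Rightarrow> 'k) set \<Rightarrow> ('x multiset \<Rightarrow> 'k) set" where
  "ind_diff R k \<rho> X vdeg d c =
     fibre_ideal_cube k X vdeg <+>\<^bsub>gc_algebra k X vdeg\<^esub> (fibre_diff R k \<rho> X vdeg d ` c)"

text \<open>The bracket of \<open>u\<close> of degree \<open>i\<close> and \<open>v\<close> of degree \<open>j\<close>.\<close>

definition lie_bracket ::
  "('a, 'm) ring_scheme \<Rightarrow> ('k, 'n) ring_scheme \<Rightarrow> ('a \<Rightarrow> 'k) \<Rightarrow> 'x::linorder set \<Rightarrow> ('x \<Rightarrow> nat) \<Rightarrow>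
   (('x multiset \<Rightarrow> 'a) \<Rightarrow> ('x multiset \<Rightarrow> 'a)) \<Rightarrow> nat \<Rightarrow> nat \<Rightarrow>
   (('x multiset \<Rightarrow> 'k) set \<Rightarrow> 'k) \<Rightarrow> (('x multiset \<Rightarrow> 'k) set \<Rightarrow> 'k) \<Rightarrow> ('x multiset \<Rightarrow> 'k) set \<Rightarrow> 'k" where
  "lie_bracket R k \<rho> X vdeg d i j u v c =
     signed k j (tensor_pairing k X vdeg i j u v (ind_diff R k \<rho> X vdeg d c))"

text \<open>A homogeneous element \<open>z\<close> of degree \<open>i\<close> lies in the radical iff \<open>[z, -]\<close> vanishes in all
  sufficiently high degrees. Since the bracket is bilinear, it suffices to consider homogeneous
  arguments. This criterion, valid when \<open>S\<close> has finite projective dimension over \<open>R\<close>, is taken as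
  the definition of the radical.\<close>

definition in_radical ::
  "('a, 'm) ring_scheme \<Rightarrow> ('k, 'n) ring_scheme \<Rightarrow> ('a \<Rightarrow> 'k) \<Rightarrow> 'x::linorder set \<Rightarrow> ('x \<Rightarrow> nat) \<Rightarrow>
   (('x multiset \<Rightarrow> 'a) \<Rightarrow> ('x multiset \<Rightarrow> 'a)) \<Rightarrow> nat \<Rightarrow> (('x multiset \<Rightarrow> 'k) set \<Rightarrow> 'k) \<Rightarrow> bool" where
  "in_radical R k \<rho> X vdeg d i z \<longleftrightarrow>
     (\<exists>n. \<forall>j>n. \<forall>u\<in>homotopy_pi k X vdeg j. \<forall>c\<in>carrier (ind k X vdeg).
        lie_bracket R k \<rho> X vdeg d i j z u c = \<zero>\<^bsub>k\<^esub>)"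


section \<open>The conormal module\<close>

text \<open>\<open>I/I\<^sup>2\<close> as an \<open>S\<close>-module, for \<open>\<phi> : R \<rightarrow> S\<close> surjective with kernel \<open>I\<close>: \<open>s \<in> S\<close> acts on a coset
  through any preimage of \<open>s\<close> in \<open>R\<close>.\<close>

definition conormal_module ::
  "('a, 'm) ring_scheme \<Rightarrow> ('b, 'n) ring_scheme \<Rightarrow> ('a \<Rightarrow> 'b) \<Rightarrow> ('b, 'a set) module" where
  "conormal_module R S \<phi> =
     (let I = a_kernel R S \<phi>; I2 = ideal_prod R I I
      in \<lparr>carrier = (\<lambda>a. I2 +>\<^bsub>R\<^esub> a) ` I, mult = undefined, one = undefined, zero = I2,
          add = (\<lambda>Y Z. Y <+>\<^bsub>R\<^esub> Z),
          smult = (\<lambda>s Y. I2 <+>\<^bsub>R\<^esub> {r \<otimes>\<^bsub>R\<^esub> y | r y. r \<in> carrier R \<and> \<phi> r = s \<and> y \<in> Y})\<rparr>)"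

text \<open>\<open>\<zeta> : I/I\<^sup>2 \<rightarrow> k\<close> is the \<open>S\<close>-linear map corresponding to \<open>z\<close> of degree \<open>2\<close>. For \<open>x\<close> of degree \<open>1\<close>,
  \<open>d x\<close> lies in the component of \<open>A\<close> of degree \<open>0\<close>, and the element of \<open>R\<close> that it stands for
  is its coefficient at the empty monomial. \<open>\<epsilon> : S \<rightarrow> k\<close> is the residue map.\<close>

definition conormal_hom ::
  "('a, 'm) ring_scheme \<Rightarrow> ('b, 'n) ring_scheme \<Rightarrow> ('a \<Rightarrow> 'b) \<Rightarrow> ('k, 'p) ring_scheme \<Rightarrow> ('b \<Rightarrow> 'k) \<Rightarrow>
   'x::linorder set \<Rightarrow> ('x \<Rightarrow> nat) \<Rightarrow> (('x multiset \<Rightarrow> 'a) \<Rightarrow> ('x multiset \<Rightarrow> 'a)) \<Rightarrow>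
   (('x multiset \<Rightarrow> 'k) set \<Rightarrow> 'k) \<Rightarrow> ('a set \<Rightarrow> 'k) \<Rightarrow> bool" where
  "conormal_hom R S \<phi> k \<epsilon> X vdeg d z \<zeta> \<longleftrightarrow>
     (let I = a_kernel R S \<phi>
      in \<zeta> \<in> lin_maps S (conormal_module R S \<phi>) (module_via \<epsilon> k) \<and>
         (\<forall>x\<in>X. vdeg x = 1 \<longrightarrow>
            \<zeta> (ideal_prod R I I +>\<^bsub>R\<^esub> (d (gc_var R x) {#})) = z (ind_class k X vdeg (gc_var k x))))"

end

theory Submission
  imports Defs
begin

text \<open>The idea is to extend the map \<open>g : I/I\<^sup>2 \<rightarrow> N\<close> to a derivation of the minimal model
  \<open>A = R[X] \<rightarrow> S\<close>, and to read off \<open>[z, -]\<close> from the linear coefficients of this derivation.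

  As \<open>N\<close> has finite projective dimension, it has a free resolution over \<open>S\<close> with nothing in degrees
  above some \<open>l\<close>: a bounded projective resolution becomes free after adding contractible complexes
  (\<open>free_resolution_of_projective_resolution\<close>). Since \<open>A \<rightarrow> S\<close> is a quasi-isomorphism, the matrices of
  the resolution lift to \<open>A\<close>, with correction terms, and define a semifree dg \<open>A\<close>-module \<open>F\<close> with
  cells in the same degrees (\<open>lifts_exist\<close>); \<open>F\<close> is as exact as the resolution (\<open>lifts_exact\<close>).

  The assignment \<open>x \<mapsto> g(\<partial> x)\<close> on the variables of degree \<open>1\<close> is the beginning of a derivation
  \<open>\<theta> : A \<rightarrow> F\<close> of degree \<open>-1\<close> with \<open>\<partial> \<theta> = - \<theta> \<partial>\<close>. Its values on the other variables exist because \<open>F\<close> is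
  exact, by induction on the degree; the first step works because \<open>g\<close> is defined on all of \<open>I\<close> and
  linear over \<open>R\<close> (\<open>derivation_lifts\<close>).

  Now let \<open>x'\<close> be a variable of degree \<open>n \<ge> l\<close>, let \<open>x\<close> have degree \<open>n + 2\<close>, and compare the coefficients
  of \<open>x'\<close> on the cells of degree \<open>0\<close> in \<open>\<partial> \<theta>(x) = - \<theta>(\<partial> x)\<close>, after the map \<open>F\<^sub>0 \<rightarrow> N \<rightarrow> k\<close>. On the left
  they vanish: \<open>\<theta>(x)\<close> has degree \<open>n + 1\<close>, and the only way to get a linear term that minimality of \<open>A\<close>
  and exactness at \<open>N\<close> do not exclude is a cell of degree \<open>n + 1 > l\<close>, with a constant coefficient. On
  the right they give \<open>\<Sum>\<^sub>y z(y) c\<^sub>y\<close>, where \<open>y\<close> runs over the variables of degree \<open>1\<close> and \<open>c\<^sub>y\<close> is,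
  up to sign, the coefficient of \<open>y x'\<close> in \<open>\<partial> x\<close>, since \<open>z\<close> is the composite of \<open>g\<close> and \<open>N \<rightarrow> k\<close>. This is
  \<open>obstruction_vanishes\<close>. For \<open>u\<close> in \<open>\<pi>\<^sup>j\<close>, the sum of these values times \<open>u(x')\<close> over the variables \<open>x'\<close> of
  degree \<open>j - 1\<close> is, up to sign, the value of \<open>[z, u]\<close> at \<open>x\<close> (\<open>tensor_pairing_eq\<close>). Hence \<open>[z, -]\<close> vanishes in high
  degrees.

  All computations in \<open>A\<close> go through its monomial basis. Derivations are expressed by the partial
  derivatives \<open>pd\<close>, which also compute the pairing that defines the bracket.\<close>

section \<open>Finitely supported vectors and matrices\<close>

definition single :: "('a, 'm) ring_scheme \<Rightarrow> 'i \<Rightarrow> 'a \<Rightarrow> 'i \<Rightarrow> 'a" where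
  "single R i a = (\<lambda>j. if j = i then a else \<zero>\<^bsub>R\<^esub>)"

text \<open>The product of the matrix \<open>U\<close> with rows \<open>U i\<close> and the vector \<open>f\<close>. The entries of \<open>f\<close> stand on the
  right, which makes the product linear for right multiplication over a noncommutative ring such as
  a graded commutative algebra.\<close>

definition comb :: "('a, 'm) ring_scheme \<Rightarrow> ('i \<Rightarrow> 'j \<Rightarrow> 'a) \<Rightarrow> ('i \<Rightarrow> 'a) \<Rightarrow> 'j \<Rightarrow> 'a" where
  "comb R U f j = (\<Oplus>\<^bsub>R\<^esub>i\<in>{i. f i \<noteq> \<zero>\<^bsub>R\<^esub>}. U i j \<otimes>\<^bsub>R\<^esub> f i)"

lemma mem_free_module:
  "f \<in> carrier (free_module R J) \<longleftrightarrow>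
     (\<forall>j. f j \<in> carrier R) \<and> (\<forall>j. j \<notin> J \<longrightarrow> f j = \<zero>\<^bsub>R\<^esub>) \<and> finite {j. f j \<noteq> \<zero>\<^bsub>R\<^esub>}"
  by (simp add: free_module_def)

lemma free_module_simps [simp]:
  "zero (free_module R J) = (\<lambda>_. \<zero>\<^bsub>R\<^esub>)"
  "add (free_module R J) f g = (\<lambda>j. f j \<oplus>\<^bsub>R\<^esub> g j)"
  "smult (free_module R J) r f = (\<lambda>j. r \<otimes>\<^bsub>R\<^esub> f j)"
  by (simp_all add: free_module_def)

context ring
begin

lemma free_module_zero: "(\<lambda>_. \<zero>) \<in> carrier (free_module R J)"
  by (simp add: mem_free_module)

lemma free_module_add:
  assumes "f \<in> carrier (free_module R J)" "g \<in> carrier (free_module R J)"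
  shows "(\<lambda>j. f j \<oplus> g j) \<in> carrier (free_module R J)"
proof -
  have "{j. f j \<oplus> g j \<noteq> \<zero>} \<subseteq> {j. f j \<noteq> \<zero>} \<union> {j. g j \<noteq> \<zero>}"
    by auto
  then show ?thesis
    using assms by (auto simp: mem_free_module intro: finite_subset)
qed

lemma free_module_map:
  assumes "f \<in> carrier (free_module R J)" "\<And>j a. a \<in> carrier R \<Longrightarrow> h j a \<in> carrier R" "\<And>j. h j \<zero> = \<zero>"
  shows "(\<lambda>j. h j (f j)) \<in> carrier (free_module R J)"
proof -
  have "{j. h j (f j) \<noteq> \<zero>} \<subseteq> {j. f j \<noteq> \<zero>}"
    using assms(3) by (metis (mono_tags, lifting) Collect_mono)
  then show ?thesis
    using assms by (auto simp: mem_free_module intro: finite_subset)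
qed

lemma free_module_uminus:
  "f \<in> carrier (free_module R J) \<Longrightarrow> (\<lambda>j. \<ominus> f j) \<in> carrier (free_module R J)"
  using free_module_map[where h = "\<lambda>_ a. \<ominus> a"] by simp

lemma free_module_rmult:
  "f \<in> carrier (free_module R J) \<Longrightarrow> a \<in> carrier R \<Longrightarrow> (\<lambda>j. f j \<otimes> a) \<in> carrier (free_module R J)"
  using free_module_map[where h = "\<lambda>_ b. b \<otimes> a"] by simp

lemma free_module_lmult:
  "f \<in> carrier (free_module R J) \<Longrightarrow> a \<in> carrier R \<Longrightarrow> (\<lambda>j. a \<otimes> f j) \<in> carrier (free_module R J)"
  using free_module_map[where h = "\<lambda>_ b. a \<otimes> b"] by simp

lemma single_mem: "i \<in> J \<Longrightarrow> a \<in> carrier R \<Longrightarrow> single R i a \<in> carrier (free_module R J)"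
proof -
  assume "i \<in> J" "a \<in> carrier R"
  moreover have "finite {j. single R i a j \<noteq> \<zero>}"
    by (rule finite_subset[of _ "{i}"]) (auto simp: single_def)
  ultimately show ?thesis
    by (auto simp: mem_free_module single_def)
qed

lemma free_module_abelian_group: "abelian_group (free_module R J)"
proof (rule abelian_groupI)
  fix f assume f: "f \<in> carrier (free_module R J)"
  show "\<exists>g\<in>carrier (free_module R J). g \<oplus>\<^bsub>free_module R J\<^esub> f = \<zero>\<^bsub>free_module R J\<^esub>"
    using f by (intro bexI[OF _ free_module_uminus[OF f]]) (auto simp: mem_free_module l_neg)
next
  fix f g assume "f \<in> carrier (free_module R J)" "g \<in> carrier (free_module R J)"
  then show "f \<oplus>\<^bsub>free_module R J\<^esub> g \<in> carrier (free_module R J)"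
    using free_module_add by simp
qed (auto simp: free_module_zero mem_free_module intro!: ext a_assoc a_comm)

text \<open>The additive counterpart of linear extension from a basis: a property of vectors that is
  stable under sums need only be checked on the entries of \<open>f\<close>.\<close>

lemma free_module_induct [consumes 1, case_names zero add single]:
  assumes f: "f \<in> carrier (free_module R J)"
    and zero: "P (\<lambda>_. \<zero>)"
    and add: "\<And>g h. g \<in> carrier (free_module R J) \<Longrightarrow> h \<in> carrier (free_module R J) \<Longrightarrow>
      P g \<Longrightarrow> P h \<Longrightarrow> P (\<lambda>j. g j \<oplus> h j)"
    and single: "\<And>i. i \<in> J \<Longrightarrow> f i \<noteq> \<zero> \<Longrightarrow> f i \<in> carrier R \<Longrightarrow> P (single R i (f i))"
  shows "P f"
proof -
  have "P (\<lambda>j. if j \<in> T then f j else \<zero>) \<and> (\<lambda>j. if j \<in> T then f j else \<zero>) \<in> carrier (free_module R J)"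
    if "finite T" "T \<subseteq> {j. f j \<noteq> \<zero>}" for T
    using that
  proof (induction T rule: finite_induct)
    case empty
    then show ?case using zero free_module_zero by simp
  next
    case (insert i T)
    let ?g = "\<lambda>j. if j \<in> T then f j else \<zero>"
    have i: "i \<in> J" "f i \<in> carrier R" "f i \<noteq> \<zero>"
      using insert.prems f by (auto simp: mem_free_module)
    have g: "P ?g" "?g \<in> carrier (free_module R J)"
      using insert by auto
    have eq: "(\<lambda>j. if j \<in> insert i T then f j else \<zero>) = (\<lambda>j. single R i (f i) j \<oplus> ?g j)"
      using f insert.hyps by (auto simp: single_def mem_free_module fun_eq_iff)
    show ?case
      unfolding eq using g i single_mem[of i J "f i"] by (auto intro!: add single free_module_add)
  qed
  from this[of "{j. f j \<noteq> \<zero>}"] have "P (\<lambda>j. if j \<in> {j. f j \<noteq> \<zero>} then f j else \<zero>)"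
    using f by (auto simp: mem_free_module)
  also have "(\<lambda>j. if j \<in> {j. f j \<noteq> \<zero>} then f j else \<zero>) = f"
    by auto
  finally show ?thesis .
qed

lemma comb_superset:
  assumes "finite T" "{i. f i \<noteq> \<zero>} \<subseteq> T" "\<And>i. f i \<in> carrier R" "\<And>i. i \<in> T \<Longrightarrow> U i j \<in> carrier R"
  shows "comb R U f j = (\<Oplus>i\<in>T. U i j \<otimes> f i)"
  unfolding comb_def
  by (rule add.finprod_mono_neutral_cong_left) (use assms in auto)

lemma comb_closed:
  assumes "f \<in> carrier (free_module R I)" "\<And>i. U i j \<in> carrier R"
  shows "comb R U f j \<in> carrier R"
  unfolding comb_def using assms by (auto simp: mem_free_module intro!: finsum_closed)

lemma comb_add:
  assumes "f \<in> carrier (free_module R I)" "g \<in> carrier (free_module R I)" "\<And>i. U i j \<in> carrier R"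
  shows "comb R U (\<lambda>i. f i \<oplus> g i) j = comb R U f j \<oplus> comb R U g j"
proof -
  let ?T = "{i. f i \<noteq> \<zero>} \<union> {i. g i \<noteq> \<zero>}"
  have fin: "finite ?T" and fc: "\<And>i. f i \<in> carrier R" and gc: "\<And>i. g i \<in> carrier R"
    using assms by (auto simp: mem_free_module)
  have "comb R U (\<lambda>i. f i \<oplus> g i) j = (\<Oplus>i\<in>?T. U i j \<otimes> (f i \<oplus> g i))"
    by (rule comb_superset) (use fin fc gc assms in auto)
  also have "\<dots> = (\<Oplus>i\<in>?T. U i j \<otimes> f i \<oplus> U i j \<otimes> g i)"
    using fc gc assms by (intro finsum_cong') (auto simp: r_distr)
  also have "\<dots> = (\<Oplus>i\<in>?T. U i j \<otimes> f i) \<oplus> (\<Oplus>i\<in>?T. U i j \<otimes> g i)"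
    using fc gc assms by (intro finsum_addf) auto
  also have "(\<Oplus>i\<in>?T. U i j \<otimes> f i) = comb R U f j"
    by (rule comb_superset[symmetric]) (use fin fc gc assms in auto)
  also have "(\<Oplus>i\<in>?T. U i j \<otimes> g i) = comb R U g j"
    by (rule comb_superset[symmetric]) (use fin fc gc assms in auto)
  finally show ?thesis .
qed

lemma comb_zero: "comb R U (\<lambda>_. \<zero>) j = \<zero>"
  by (simp add: comb_def)

lemma comb_single:
  assumes "a \<in> carrier R" "U i j \<in> carrier R"
  shows "comb R U (single R i a) j = U i j \<otimes> a"
proof -
  have "comb R U (single R i a) j = (\<Oplus>i'\<in>{i}. U i' j \<otimes> single R i a i')"
    by (rule comb_superset) (use assms in \<open>auto simp: single_def\<close>)
  then show ?thesis using assms by (simp add: single_def)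
qed

lemma comb_cong:
  assumes "\<And>i. f i \<noteq> \<zero> \<Longrightarrow> U i j = U' i j" "\<And>i. U i j \<in> carrier R" "\<And>i. f i \<in> carrier R"
  shows "comb R U f j = comb R U' f j"
  unfolding comb_def
proof (rule finsum_cong')
  show "(\<lambda>i. U' i j \<otimes> f i) \<in> {i. f i \<noteq> \<zero>} \<rightarrow> carrier R"
  proof (rule Pi_I)
    fix i assume "i \<in> {i. f i \<noteq> \<zero>}"
    then have "U' i j \<otimes> f i = U i j \<otimes> f i"
      using assms(1) by simp
    then show "U' i j \<otimes> f i \<in> carrier R"
      using assms(2,3) by simp
  qed
qed (use assms(1) in auto)

lemma comb_rmult:
  assumes "f \<in> carrier (free_module R I)" "\<And>i. U i j \<in> carrier R" "a \<in> carrier R"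
  shows "comb R U (\<lambda>i. f i \<otimes> a) j = comb R U f j \<otimes> a"
proof -
  let ?T = "{i. f i \<noteq> \<zero>}"
  have fin: "finite ?T" and fc: "\<And>i. f i \<in> carrier R"
    using assms by (auto simp: mem_free_module)
  have "comb R U (\<lambda>i. f i \<otimes> a) j = (\<Oplus>i\<in>?T. U i j \<otimes> (f i \<otimes> a))"
    by (rule comb_superset) (use fin fc assms in auto)
  also have "\<dots> = (\<Oplus>i\<in>?T. (U i j \<otimes> f i) \<otimes> a)"
    using fc assms by (intro finsum_cong') (auto simp: m_assoc)
  also have "\<dots> = comb R U f j \<otimes> a"
    unfolding comb_def using fc fin assms by (intro finsum_ldistr[symmetric]) auto
  finally show ?thesis .
qed

lemma comb_uminus:
  assumes "f \<in> carrier (free_module R I)" "\<And>i. U i j \<in> carrier R"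
  shows "comb R U (\<lambda>i. \<ominus> f i) j = \<ominus> comb R U f j"
proof -
  have "comb R U (\<lambda>i. f i \<otimes> (\<ominus> \<one>)) j = comb R U f j \<otimes> (\<ominus> \<one>)"
    by (rule comb_rmult) (use assms in auto)
  moreover have "(\<lambda>i. f i \<otimes> (\<ominus> \<one>)) = (\<lambda>i. \<ominus> f i)"
    using assms by (auto simp: mem_free_module r_minus)
  ultimately show ?thesis
    using comb_closed[of f I U j] assms by (simp add: r_minus)
qed

lemma comb_mem:
  assumes f: "f \<in> carrier (free_module R I)" and U: "\<And>i. U i \<in> carrier (free_module R J)"
  shows "comb R U f \<in> carrier (free_module R J)"
  using f
proof (induction rule: free_module_induct)
  case zero
  then show ?case using free_module_zero by (simp add: comb_def)
next
  case (add g h)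
  have "comb R U (\<lambda>j. g j \<oplus> h j) = (\<lambda>j. comb R U g j \<oplus> comb R U h j)"
    using add U by (intro ext comb_add) (auto simp: mem_free_module)
  then show ?case using add free_module_add by simp
next
  case (single i)
  have "comb R U (single R i (f i)) = (\<lambda>j. U i j \<otimes> f i)"
    using single U by (intro ext comb_single) (auto simp: mem_free_module)
  then show ?case using free_module_rmult[OF U[of i] single(3)] by simp
qed

lemma signed_closed [simp, intro]: "a \<in> carrier R \<Longrightarrow> signed R n a \<in> carrier R"
  by (simp add: signed_def)

lemma signed_zero [simp]: "signed R n \<zero> = \<zero>"
  by (simp add: signed_def)

lemma signed_eq_zero [simp]: "a \<in> carrier R \<Longrightarrow> signed R n a = \<zero> \<longleftrightarrow> a = \<zero>"
  by (auto simp: signed_def)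

lemma signed_add: "a \<in> carrier R \<Longrightarrow> b \<in> carrier R \<Longrightarrow> signed R n (a \<oplus> b) = signed R n a \<oplus> signed R n b"
  by (auto simp: signed_def minus_add a_comm)

lemma signed_uminus: "a \<in> carrier R \<Longrightarrow> signed R n (\<ominus> a) = \<ominus> signed R n a"
  by (auto simp: signed_def)

lemma signed_rmult: "a \<in> carrier R \<Longrightarrow> b \<in> carrier R \<Longrightarrow> signed R n a \<otimes> b = signed R n (a \<otimes> b)"
  by (auto simp: signed_def l_minus)

lemma signed_lmult: "a \<in> carrier R \<Longrightarrow> b \<in> carrier R \<Longrightarrow> a \<otimes> signed R n b = signed R n (a \<otimes> b)"
  by (auto simp: signed_def r_minus)

lemma signed_signed: "a \<in> carrier R \<Longrightarrow> signed R m (signed R n a) = signed R (m + n) a"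
  by (auto simp: signed_def)

end

section \<open>Bounded free resolutions\<close>

definition free_resolution ::
  "('a, 'm) ring_scheme \<Rightarrow> ('a, 'b, 'q) module_scheme \<Rightarrow> (nat \<Rightarrow> 'i set) \<Rightarrow>
   (nat \<Rightarrow> ('i \<Rightarrow> 'a) \<Rightarrow> ('i \<Rightarrow> 'a)) \<Rightarrow> (('i \<Rightarrow> 'a) \<Rightarrow> 'b) \<Rightarrow> bool" where
  "free_resolution R N B D \<eta> \<longleftrightarrow>
     (\<forall>j. D j \<in> lin_maps R (free_module R (B (Suc j))) (free_module R (B j))) \<and>
     \<eta> \<in> lin_maps R (free_module R (B 0)) N \<and>
     \<eta> ` carrier (free_module R (B 0)) = carrier N \<and>
     {x \<in> carrier (free_module R (B 0)). \<eta> x = \<zero>\<^bsub>N\<^esub>} = D 0 ` carrier (free_module R (B (Suc 0))) \<and>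
     (\<forall>j. {x \<in> carrier (free_module R (B (Suc j))). D j x = \<zero>\<^bsub>free_module R (B j)\<^esub>} =
        D (Suc j) ` carrier (free_module R (B (Suc (Suc j)))))"

lemma lin_maps_mem: "f \<in> lin_maps R M N \<Longrightarrow> x \<in> carrier M \<Longrightarrow> f x \<in> carrier N"
  by (auto simp: lin_maps_def)

lemma lin_maps_add:
  "f \<in> lin_maps R M N \<Longrightarrow> x \<in> carrier M \<Longrightarrow> y \<in> carrier M \<Longrightarrow> f (x \<oplus>\<^bsub>M\<^esub> y) = f x \<oplus>\<^bsub>N\<^esub> f y"
  by (auto simp: lin_maps_def)

lemma lin_maps_smult:
  "f \<in> lin_maps R M N \<Longrightarrow> r \<in> carrier R \<Longrightarrow> x \<in> carrier M \<Longrightarrow> f (r \<odot>\<^bsub>M\<^esub> x) = r \<odot>\<^bsub>N\<^esub> f x"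
  by (auto simp: lin_maps_def)

lemma lin_maps_compose:
  "f \<in> lin_maps R M N \<Longrightarrow> g \<in> lin_maps R N P \<Longrightarrow> (\<lambda>x. g (f x)) \<in> lin_maps R M P"
  by (auto simp: lin_maps_def Pi_iff)

lemma lin_maps_zero:
  assumes "f \<in> lin_maps R M N" "abelian_group M" "abelian_group N"
  shows "f \<zero>\<^bsub>M\<^esub> = \<zero>\<^bsub>N\<^esub>"
proof -
  interpret M: abelian_group M by fact
  interpret N: abelian_group N by fact
  have "f \<zero>\<^bsub>M\<^esub> \<oplus>\<^bsub>N\<^esub> f \<zero>\<^bsub>M\<^esub> = f \<zero>\<^bsub>M\<^esub>"
    using lin_maps_add[OF assms(1), of "\<zero>\<^bsub>M\<^esub>" "\<zero>\<^bsub>M\<^esub>"] by simp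
  then show ?thesis
    using lin_maps_mem[OF assms(1), of "\<zero>\<^bsub>M\<^esub>"] N.add.r_cancel_one by auto
qed

lemma lin_maps_uminus:
  assumes "f \<in> lin_maps R M N" "abelian_group M" "abelian_group N" "x \<in> carrier M"
  shows "f (\<ominus>\<^bsub>M\<^esub> x) = \<ominus>\<^bsub>N\<^esub> f x"
proof -
  interpret M: abelian_group M by fact
  interpret N: abelian_group N by fact
  have "f (\<ominus>\<^bsub>M\<^esub> x) \<oplus>\<^bsub>N\<^esub> f x = \<zero>\<^bsub>N\<^esub>"
    using lin_maps_add[OF assms(1), of "\<ominus>\<^bsub>M\<^esub> x" x] lin_maps_zero[OF assms(1-3)] assms(4)
    by (simp add: M.l_neg)
  then show ?thesis
    using lin_maps_mem[OF assms(1)] assms(4) by (simp add: N.minus_equality)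
qed

lemma (in cring) free_module_uminus_eq:
  assumes "f \<in> carrier (free_module R J)"
  shows "\<ominus>\<^bsub>free_module R J\<^esub> f = (\<lambda>j. \<ominus> f j)"
proof -
  interpret E: abelian_group "free_module R J" by (rule free_module_abelian_group)
  show ?thesis
    using assms free_module_uminus[OF assms]
    by (intro E.minus_equality) (auto simp: mem_free_module l_neg)
qed

text \<open>Linear maps between free modules are given by matrices, which can be lifted entry by entry
  along a surjective ring homomorphism.\<close>

lemma (in cring) lin_map_comb:
  assumes f: "f \<in> lin_maps R (free_module R I) (free_module R J)" and x: "x \<in> carrier (free_module R I)"
  shows "f x = comb R (\<lambda>i. if i \<in> I then f (single R i \<one>) else (\<lambda>_. \<zero>)) x"
    (is "_ = comb R ?U x")
  using x
proof (induction rule: free_module_induct)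
  have U: "?U i \<in> carrier (free_module R J)" for i
    using lin_maps_mem[OF f single_mem[of i I \<one>]] free_module_zero by auto
  {
    case zero
    then show ?case
      using lin_maps_zero[OF f free_module_abelian_group free_module_abelian_group] by (simp add: comb_def)
  next
    case (add g h)
    have "comb R ?U (\<lambda>j. g j \<oplus> h j) = (\<lambda>j. comb R ?U g j \<oplus> comb R ?U h j)"
      by (intro ext comb_add) (use add U in \<open>auto simp: mem_free_module\<close>)
    then show ?case
      using lin_maps_add[OF f, of g h] add by simp
  next
    case (single i)
    have "single R i (x i) = x i \<odot>\<^bsub>free_module R I\<^esub> single R i \<one>"
      using single by (auto simp: single_def)
    then have "f (single R i (x i)) = (\<lambda>j. x i \<otimes> ?U i j)"
      using lin_maps_smult[OF f, of "x i" "single R i \<one>"] single single_mem[of i I \<one>] by simp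
    also have "\<dots> = comb R ?U (single R i (x i))"
    proof
      fix j
      have "?U i j \<in> carrier R"
        using U[of i] by (simp add: mem_free_module)
      then show "x i \<otimes> ?U i j = comb R ?U (single R i (x i)) j"
        using single comb_single[of "x i" ?U i j] by (simp only: m_comm)
    qed
    finally show ?case .
  }
qed

text \<open>A projective module \<open>P j\<close> is a retract of a free module, by maps \<open>i\<close> and \<open>q\<close>, and so it is the
  image of the idempotent \<open>e = i q\<close>. With \<open>a = i \<delta> q\<close>, a projective resolution becomes a complex
  of free modules that is exact up to the idempotents.\<close>

lemma projective_resolution_idempotents:
  fixes R :: "('a, 'm) ring_scheme" (structure) and N :: "('a, 'b, 'q) module_scheme"
    and P :: "nat \<Rightarrow> ('a, 'p) module"
  assumes R: "cring R" and N: "abelian_group N"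
    and res: "projective_resolution R N P \<delta> \<epsilon>"
    and bd: "\<forall>j>n. carrier (P j) = {\<zero>\<^bsub>P j\<^esub>}"
  obtains J :: "nat \<Rightarrow> 'p set" and a e \<eta> where
    "\<And>j. j > n \<Longrightarrow> J j = {}"
    "\<And>j. e j \<in> lin_maps R (free_module R (J j)) (free_module R (J j))"
    "\<And>j. a j \<in> lin_maps R (free_module R (J (Suc j))) (free_module R (J j))"
    "\<eta> \<in> lin_maps R (free_module R (J 0)) N"
    "\<And>j x. x \<in> carrier (free_module R (J j)) \<Longrightarrow> e j (e j x) = e j x"
    "\<And>j x. x \<in> carrier (free_module R (J (Suc j))) \<Longrightarrow> e j (a j x) = a j x"
    "\<And>j x. x \<in> carrier (free_module R (J (Suc (Suc j)))) \<Longrightarrow> a j (a (Suc j) x) = (\<lambda>_. \<zero>\<^bsub>R\<^esub>)"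
    "\<And>j x. x \<in> carrier (free_module R (J (Suc j))) \<Longrightarrow> a j x = (\<lambda>_. \<zero>\<^bsub>R\<^esub>) \<Longrightarrow>
       \<exists>u\<in>carrier (free_module R (J (Suc (Suc j)))). a (Suc j) u = e (Suc j) x"
    "\<And>j x. x \<in> carrier (free_module R (J (Suc j))) \<Longrightarrow> a j (e (Suc j) x) = a j x"
    "\<And>x. x \<in> carrier (free_module R (J 0)) \<Longrightarrow> \<eta> (e 0 x) = \<eta> x"
    "\<And>x. x \<in> carrier (free_module R (J (Suc 0))) \<Longrightarrow> \<eta> (a 0 x) = \<zero>\<^bsub>N\<^esub>"
    "\<And>x. x \<in> carrier (free_module R (J 0)) \<Longrightarrow> \<eta> x = \<zero>\<^bsub>N\<^esub> \<Longrightarrow>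
       \<exists>u\<in>carrier (free_module R (J (Suc 0))). a 0 u = e 0 x"
    "\<eta> ` carrier (free_module R (J 0)) = carrier N"
proof -
  interpret cring R by fact
  have proj: "projective_module R (P j)" and dl: "\<delta> j \<in> lin_maps R (P (Suc j)) (P j)" for j
    using res by (auto simp: projective_resolution_def)
  have el: "\<epsilon> \<in> lin_maps R (P 0) N" and esurj: "\<epsilon> ` carrier (P 0) = carrier N"
    and ex0: "{x \<in> carrier (P 0). \<epsilon> x = \<zero>\<^bsub>N\<^esub>} = \<delta> 0 ` carrier (P (Suc 0))"
    and ex: "\<And>j. {x \<in> carrier (P (Suc j)). \<delta> j x = \<zero>\<^bsub>P j\<^esub>} = \<delta> (Suc j) ` carrier (P (Suc (Suc j)))"
    using res by (auto simp: projective_resolution_def)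
  have Pm: "abelian_group (P j)" for j
    using proj[of j] by (auto simp: projective_module_def module_def)
  have "\<forall>j. \<exists>T :: 'p set \<times> _ \<times> _. case T of (J, i, q) \<Rightarrow> (j > n \<longrightarrow> J = {}) \<and> i \<in> lin_maps R (P j) (free_module R J) \<and>
      q \<in> lin_maps R (free_module R J) (P j) \<and> (\<forall>x\<in>carrier (P j). q (i x) = x)"
  proof
    fix j
    show "\<exists>T :: 'p set \<times> _ \<times> _. case T of (J, i, q) \<Rightarrow> (j > n \<longrightarrow> J = {}) \<and>
      i \<in> lin_maps R (P j) (free_module R J) \<and> q \<in> lin_maps R (free_module R J) (P j) \<and>
      (\<forall>x\<in>carrier (P j). q (i x) = x)"
  proof (cases "j > n")
    case True
    interpret M: module R "P j" using proj[of j] by (simp add: projective_module_def)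
    have z: "carrier (P j) = {\<zero>\<^bsub>P j\<^esub>}" using bd True by blast
    show ?thesis
      by (intro exI[of _ "({}, \<lambda>_ _. \<zero>, \<lambda>_. \<zero>\<^bsub>P j\<^esub>)"])
        (use z in \<open>auto simp: lin_maps_def free_module_zero\<close>)
  next
    case False
    from proj[of j] obtain J :: "'p set" and i q where "i \<in> lin_maps R (P j) (free_module R J)"
      "q \<in> lin_maps R (free_module R J) (P j)" "\<forall>x\<in>carrier (P j). q (i x) = x"
      unfolding projective_module_def by blast
    then show ?thesis using False by (intro exI[of _ "(J, i, q)"]) simp
  qed
  qed
  from choice[OF this] obtain T :: "nat \<Rightarrow> 'p set \<times> _ \<times> _" where T: "\<forall>j. case T j of (J, i, q) \<Rightarrow>
      (j > n \<longrightarrow> J = {}) \<and> i \<in> lin_maps R (P j) (free_module R J) \<and>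
      q \<in> lin_maps R (free_module R J) (P j) \<and> (\<forall>x\<in>carrier (P j). q (i x) = x)"
    by (elim exE)
  define J where "J = (\<lambda>j. fst (T j))"
  define i where "i = (\<lambda>j. fst (snd (T j)))"
  define q where "q = (\<lambda>j. snd (snd (T j)))"
  have Tj: "(j > n \<longrightarrow> J j = {}) \<and> i j \<in> lin_maps R (P j) (free_module R (J j)) \<and>
      q j \<in> lin_maps R (free_module R (J j)) (P j) \<and> (\<forall>x\<in>carrier (P j). q j (i j x) = x)" for j
    using spec[OF T, of j] by (simp add: J_def i_def q_def split: prod.splits)
  have J: "j > n \<Longrightarrow> J j = {}" and i: "i j \<in> lin_maps R (P j) (free_module R (J j))"
    and q: "q j \<in> lin_maps R (free_module R (J j)) (P j)"
    and qi: "x \<in> carrier (P j) \<Longrightarrow> q j (i j x) = x" for j x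
    using Tj[of j] by auto
  note mem = lin_maps_mem[OF i] lin_maps_mem[OF q] lin_maps_mem[OF dl] lin_maps_mem[OF el]
  have dd: "\<delta> j (\<delta> (Suc j) x) = \<zero>\<^bsub>P j\<^esub>" if "x \<in> carrier (P (Suc (Suc j)))" for j x
    using ex[of j] that by blast
  have ed: "\<epsilon> (\<delta> 0 x) = \<zero>\<^bsub>N\<^esub>" if "x \<in> carrier (P (Suc 0))" for x
    using ex0 that by blast
  have i0: "i j \<zero>\<^bsub>P j\<^esub> = (\<lambda>_. \<zero>)" for j
    using lin_maps_zero[OF i Pm free_module_abelian_group] by simp
  \<comment> \<open>Only the two exactness statements (8 and 12) and the surjectivity of the augmentation (13)
    need more than the equations above.\<close>
  show ?thesis
  proof (rule that[of J "\<lambda>j x. i j (q j x)" "\<lambda>j x. i j (\<delta> j (q (Suc j) x))" "\<lambda>x. \<epsilon> (q 0 x)"], goal_cases)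
    case (8 j x)
    have "\<delta> j (q (Suc j) x) = \<zero>\<^bsub>P j\<^esub>"
      using 8 qi[of "\<delta> j (q (Suc j) x)" j] qi[of "\<zero>\<^bsub>P j\<^esub>" j] mem i0[of j] abelian_group.axioms(1)[OF Pm]
      by (metis abelian_group.axioms(1) abelian_monoid.zero_closed)
    then have "q (Suc j) x \<in> \<delta> (Suc j) ` carrier (P (Suc (Suc j)))"
      using ex[of j] mem 8 by blast
    then obtain p where "p \<in> carrier (P (Suc (Suc j)))" "q (Suc j) x = \<delta> (Suc j) p"
      by blast
    then show ?case
      using mem qi by (intro bexI[of _ "i (Suc (Suc j)) p"]) auto
  next
    case (12 x)
    have "q 0 x \<in> \<delta> 0 ` carrier (P (Suc 0))"
      using ex0 mem 12 by blast
    then obtain p where "p \<in> carrier (P (Suc 0))" "q 0 x = \<delta> 0 p"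
      by blast
    then show ?case
      using mem qi by (intro bexI[of _ "i (Suc 0) p"]) auto
  next
    case 13
    have "q 0 ` carrier (free_module R (J 0)) = carrier (P 0)"
    proof
      show "carrier (P 0) \<subseteq> q 0 ` carrier (free_module R (J 0))"
        using mem(1) qi by (metis image_eqI subsetI)
    qed (use mem in auto)
    then show ?case using esurj by (metis image_image)
  qed (use J mem qi dd ed i0 in \<open>auto intro!: lin_maps_compose[OF q] lin_maps_compose[OF dl] i el\<close>)
qed

text \<open>Eilenberg's swindle. With \<open>E j\<close> free and \<open>e j\<close> an idempotent with image \<open>P j\<close>, the module
  \<open>P j \<oplus> E j \<oplus> E j \<oplus> \<dots>\<close> is isomorphic to \<open>E j \<oplus> E j \<oplus> \<dots>\<close>: the vectors \<open>x\<^sub>0, x\<^sub>1, \<dots>\<close> correspond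
  to \<open>e x\<^sub>0\<close> and the \<open>(1 - e) x\<^sub>k + e x\<^sub>k\<^sub>+\<^sub>1\<close>. So the contractible complexes \<open>E j \<oplus> E j \<oplus> \<dots>\<close>
  in degrees \<open>j\<close> and \<open>j + 1\<close>, added to the projective resolution, make it free. In the indices below,
  \<open>True\<close> marks the copies of \<open>E j\<close> in degree \<open>j\<close>, and \<open>False\<close> those in degree \<open>j + 1\<close>.\<close>

lemma free_resolution_of_projective_resolution:
  fixes R :: "('a, 'm) ring_scheme" (structure) and N :: "('a, 'b, 'q) module_scheme"
    and P :: "nat \<Rightarrow> ('a, 'p) module"
  assumes R: "cring R" and N: "abelian_group N"
    and res: "projective_resolution R N P \<delta> \<epsilon>"
    and bd: "\<forall>j>n. carrier (P j) = {\<zero>\<^bsub>P j\<^esub>}"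
  obtains B :: "nat \<Rightarrow> (bool \<times> nat \<times> 'p) set" and D \<eta> where
    "free_resolution R N B D \<eta>" "\<And>j. j > Suc n \<Longrightarrow> B j = {}"
proof -
  interpret cring R by fact
  obtain J :: "nat \<Rightarrow> 'p set" and a e \<eta> where
    J: "\<And>j. j > n \<Longrightarrow> J j = {}"
    and e: "\<And>j. e j \<in> lin_maps R (free_module R (J j)) (free_module R (J j))"
    and a: "\<And>j. a j \<in> lin_maps R (free_module R (J (Suc j))) (free_module R (J j))"
    and \<eta>: "\<eta> \<in> lin_maps R (free_module R (J 0)) N"
    and ee: "\<And>j x. x \<in> carrier (free_module R (J j)) \<Longrightarrow> e j (e j x) = e j x"
    and ea: "\<And>j x. x \<in> carrier (free_module R (J (Suc j))) \<Longrightarrow> e j (a j x) = a j x"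
    and aa: "\<And>j x. x \<in> carrier (free_module R (J (Suc (Suc j)))) \<Longrightarrow> a j (a (Suc j) x) = (\<lambda>_. \<zero>\<^bsub>R\<^esub>)"
    and aex: "\<And>j x. x \<in> carrier (free_module R (J (Suc j))) \<Longrightarrow> a j x = (\<lambda>_. \<zero>\<^bsub>R\<^esub>) \<Longrightarrow>
       \<exists>u\<in>carrier (free_module R (J (Suc (Suc j)))). a (Suc j) u = e (Suc j) x"
    and ae: "\<And>j x. x \<in> carrier (free_module R (J (Suc j))) \<Longrightarrow> a j (e (Suc j) x) = a j x"
    and \<eta>e: "\<And>x. x \<in> carrier (free_module R (J 0)) \<Longrightarrow> \<eta> (e 0 x) = \<eta> x"
    and \<eta>a: "\<And>x. x \<in> carrier (free_module R (J (Suc 0))) \<Longrightarrow> \<eta> (a 0 x) = \<zero>\<^bsub>N\<^esub>"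
    and \<eta>ex: "\<And>x. x \<in> carrier (free_module R (J 0)) \<Longrightarrow> \<eta> x = \<zero>\<^bsub>N\<^esub> \<Longrightarrow>
       \<exists>u\<in>carrier (free_module R (J (Suc 0))). a 0 u = e 0 x"
    and \<eta>surj: "\<eta> ` carrier (free_module R (J 0)) = carrier N"
    by (rule projective_resolution_idempotents[OF assms]; rule that; assumption)
  \<comment> \<open>\<open>B j\<close> consists of countably many copies of \<open>J j\<close> and of \<open>J (j - 1)\<close>, and \<open>sl\<close> cuts a vector
    into its components on these copies.\<close>
  define Bs where "Bs = (\<lambda>j t. if t then J j else if j = 0 then {} else J (j - 1))"
  define B :: "nat \<Rightarrow> (bool \<times> nat \<times> 'p) set" where "B = (\<lambda>j. {(t, k, b). b \<in> Bs j t})"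
  define sl :: "(bool \<times> nat \<times> 'p \<Rightarrow> 'a) \<Rightarrow> bool \<Rightarrow> nat \<Rightarrow> 'p \<Rightarrow> 'a" where "sl = (\<lambda>l t k b. l (t, k, b))"
  \<comment> \<open>the complementary idempotents \<open>1 - e\<close>\<close>
  define c where "c = (\<lambda>j y b. y b \<ominus> e j y b)"
  define D where "D = (\<lambda>j l (t, k, b). if t then
      (if k = 0 then a j (sl l True 0) b \<oplus> c j (sl l False 0) b
       else e j (sl l False (k - 1)) b \<oplus> c j (sl l False k) b) else \<zero>)"
  have B0: "B j = {}" if "j > Suc n" for j
    using that J by (auto simp: B_def Bs_def)
  have E: "abelian_group (free_module R I)" for I :: "'p set"
    by (rule free_module_abelian_group)
  have map0: "f (\<lambda>_. \<zero>) = (\<lambda>_. \<zero>)" if "f \<in> lin_maps R (free_module R I) (free_module R I')"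
    for f and I I' :: "'p set"
    using lin_maps_zero[OF that E E] by simp
  note addl = lin_maps_add[where M = "free_module R I" for I, simplified free_module_simps]
  note smultl = lin_maps_smult[where M = "free_module R I" for I, simplified free_module_simps]
  have cl: "c j \<in> lin_maps R (free_module R (J j)) (free_module R (J j))" for j
  proof -
    have cm: "c j y \<in> carrier (free_module R (J j))" if "y \<in> carrier (free_module R (J j))" for y
      using free_module_add[OF that free_module_uminus[OF lin_maps_mem[OF e that]]]
      by (simp add: c_def a_minus_def)
    show ?thesis
      unfolding lin_maps_def
    proof (intro CollectI conjI ballI Pi_I)
      fix x y assume xy: "x \<in> carrier (free_module R (J j))" "y \<in> carrier (free_module R (J j))"
      then have "x b \<in> carrier R" "y b \<in> carrier R" "e j x b \<in> carrier R" "e j y b \<in> carrier R" for b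
        using lin_maps_mem[OF e[of j]] by (auto simp: mem_free_module)
      then show "c j (x \<oplus>\<^bsub>free_module R (J j)\<^esub> y) = c j x \<oplus>\<^bsub>free_module R (J j)\<^esub> c j y"
        using addl[OF e[of j] xy] by (auto simp: c_def a_minus_def minus_add a_ac intro!: ext)
    next
      fix r x assume r: "r \<in> carrier R" and x: "x \<in> carrier (free_module R (J j))"
      then have "x b \<in> carrier R" "e j x b \<in> carrier R" for b
        using lin_maps_mem[OF e[of j]] by (auto simp: mem_free_module)
      then show "c j (r \<odot>\<^bsub>free_module R (J j)\<^esub> x) = r \<odot>\<^bsub>free_module R (J j)\<^esub> c j x"
        using smultl[OF e[of j] r x] r by (auto simp: c_def a_minus_def r_distr r_minus intro!: ext)
    qed (use cm in auto)
  qed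
  have cc_minus: "f (c j x) = (\<lambda>b. f x b \<ominus> f (e j x) b)"
    if f: "f \<in> lin_maps R (free_module R (J j)) (free_module R (J j))" and x: "x \<in> carrier (free_module R (J j))"
    for f j x
  proof -
    have ex: "e j x \<in> carrier (free_module R (J j))" using lin_maps_mem[OF e x] .
    have "f (\<ominus>\<^bsub>free_module R (J j)\<^esub> e j x) = \<ominus>\<^bsub>free_module R (J j)\<^esub> f (e j x)"
      by (rule lin_maps_uminus[OF f E E ex])
    then have "f (\<lambda>b. \<ominus> e j x b) = (\<lambda>b. \<ominus> f (e j x) b)"
      using free_module_uminus_eq[OF ex] free_module_uminus_eq[OF lin_maps_mem[OF f ex]] by simp
    then show ?thesis
      using addl[OF f x free_module_uminus[OF ex]] by (simp add: c_def a_minus_def)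
  qed
  have ec: "e j (c j x) = (\<lambda>_. \<zero>)" if x: "x \<in> carrier (free_module R (J j))" for j x
    using lin_maps_mem[OF e[of j] x] cc_minus[OF e[of j] x]
    by (auto simp: ee[OF x] a_minus_def r_neg mem_free_module)
  have cz: "c j x = (\<lambda>_. \<zero>)" if x: "x \<in> carrier (free_module R (J j))" "e j x = x" for j x
    using x by (auto simp: c_def a_minus_def r_neg mem_free_module)
  have cc: "c j (c j x) = c j x" if x: "x \<in> carrier (free_module R (J j))" for j x
    using lin_maps_mem[OF cl[of j] x] ec[OF x] by (auto simp: c_def[of] a_minus_def mem_free_module)
  have dec: "(\<lambda>b. e j x b \<oplus> c j x b) = x" if x: "x \<in> carrier (free_module R (J j))" for j x
  proof
    fix b
    have "x b \<in> carrier R" "e j x b \<in> carrier R"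
      using x lin_maps_mem[OF e[of j] x] by (auto simp: mem_free_module)
    then show "e j x b \<oplus> c j x b = x b"
      by (simp add: c_def a_minus_def a_lcomm r_neg)
  qed
  have zero_mem: "(\<lambda>_. \<zero>) \<in> carrier (free_module R I)" for I :: "'p set"
    by (rule free_module_zero)
  have slm: "sl l t k \<in> carrier (free_module R (Bs j t))" if "l \<in> carrier (free_module R (B j))" for l j t k
  proof -
    have "finite ((\<lambda>b. (t, k, b)) -` {i. l i \<noteq> \<zero>})"
      using that by (intro finite_vimageI) (auto simp: mem_free_module inj_on_def)
    then show ?thesis using that by (auto simp: mem_free_module sl_def B_def vimage_def)
  qed
  have slfin: "finite {k. sl l t k \<noteq> (\<lambda>_. \<zero>)}" if "l \<in> carrier (free_module R (B j))" for l j t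
  proof -
    have "{k. sl l t k \<noteq> (\<lambda>_. \<zero>)} \<subseteq> (\<lambda>i. fst (snd i)) ` {i. l i \<noteq> \<zero>}"
      by (force simp: sl_def fun_eq_iff image_iff)
    then show ?thesis using that by (auto simp: mem_free_module intro: finite_subset)
  qed
  have asm: "(\<lambda>(t, k, b). v t k b) \<in> carrier (free_module R (B j))"
    if v: "\<And>t k. v t k \<in> carrier (free_module R (Bs j t))" and fin: "\<And>t. finite {k. v t k \<noteq> (\<lambda>_. \<zero>)}" for v j
  proof -
    have "{i. (case i of (t, k, b) \<Rightarrow> v t k b) \<noteq> \<zero>} \<subseteq>
        (\<Union>t. \<Union>k\<in>{k. v t k \<noteq> (\<lambda>_. \<zero>)}. (\<lambda>b. (t, k, b)) ` {b. v t k b \<noteq> \<zero>})"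
      by (auto simp: fun_eq_iff)
    moreover have "finite \<dots>"
      using fin v by (intro finite_UN_I finite_imageI) (auto simp: mem_free_module)
    ultimately have "finite {i. (case i of (t, k, b) \<Rightarrow> v t k b) \<noteq> \<zero>}"
      by (rule finite_subset)
    then show ?thesis using v by (auto simp: mem_free_module B_def)
  qed
  have slx: "sl l True k \<in> carrier (free_module R (J j))" if "l \<in> carrier (free_module R (B j))" for l j k
    using slm[OF that, of True k] by (simp add: Bs_def)
  have sly: "sl l False k \<in> carrier (free_module R (J j))" if "l \<in> carrier (free_module R (B (Suc j)))" for l j k
    using slm[OF that, of False k] by (simp add: Bs_def)
  have sl_add: "sl (\<lambda>i. f i \<oplus> g i) t k = (\<lambda>b. sl f t k b \<oplus> sl g t k b)"
    and sl_smult: "sl (\<lambda>i. r \<otimes> f i) t k = (\<lambda>b. r \<otimes> sl f t k b)" for f g r t k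
    by (simp_all add: sl_def)
  have carr: "x b \<in> carrier R" if "x \<in> carrier (free_module R I)" for x b and I :: "'p set"
    using that by (simp add: mem_free_module)
  note lm = lin_maps_mem[OF a] lin_maps_mem[OF e] lin_maps_mem[OF cl] slx sly
  have Dm: "D j l \<in> carrier (free_module R (B j))" if l: "l \<in> carrier (free_module R (B (Suc j)))" for j l
  proof -
    let ?v = "\<lambda>t k. if t then
      (if k = 0 then (\<lambda>b. a j (sl l True 0) b \<oplus> c j (sl l False 0) b)
       else (\<lambda>b. e j (sl l False (k - 1)) b \<oplus> c j (sl l False k) b)) else (\<lambda>_. \<zero>)"
    let ?K = "{k. sl l False k \<noteq> (\<lambda>_. \<zero>)}"
    have "D j l = (\<lambda>(t, k, b). ?v t k b)"
      by (auto simp: D_def fun_eq_iff)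
    moreover have "{k. ?v t k \<noteq> (\<lambda>_. \<zero>)} \<subseteq> insert 0 (?K \<union> Suc ` ?K)" for t
    proof
      fix k assume k: "k \<in> {k. ?v t k \<noteq> (\<lambda>_. \<zero>)}"
      show "k \<in> insert 0 (?K \<union> Suc ` ?K)"
      proof (rule ccontr)
        assume n: "k \<notin> insert 0 (?K \<union> Suc ` ?K)"
        then obtain k' where k': "k = Suc k'" by (cases k) auto
        with n have "sl l False k' = (\<lambda>_. \<zero>)" "sl l False k = (\<lambda>_. \<zero>)" by auto
        then show False using k k' map0[OF e] map0[OF cl] by (auto split: if_splits)
      qed
    qed
    then have "finite {k. ?v t k \<noteq> (\<lambda>_. \<zero>)}" for t
      by (rule finite_subset) (use slfin[OF l] in simp)
    moreover have "?v t k \<in> carrier (free_module R (Bs j t))" for t k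
      using free_module_add[OF lm(1)[OF lm(4)[OF l]] lm(3)[OF lm(5)[OF l]]]
        free_module_add[OF lm(2)[OF lm(5)[OF l]] lm(3)[OF lm(5)[OF l]]] zero_mem
      by (auto simp: Bs_def)
    ultimately show ?thesis using asm[of ?v j] by simp
  qed
  have Dl: "D j \<in> lin_maps R (free_module R (B (Suc j))) (free_module R (B j))" for j
    unfolding lin_maps_def
  proof (intro CollectI conjI ballI Pi_I)
    fix f g assume fg: "f \<in> carrier (free_module R (B (Suc j)))" "g \<in> carrier (free_module R (B (Suc j)))"
    note lf = lm(4,5)[OF fg(1)] and lg = lm(4,5)[OF fg(2)]
    show "D j (f \<oplus>\<^bsub>free_module R (B (Suc j))\<^esub> g) = D j f \<oplus>\<^bsub>free_module R (B j)\<^esub> D j g"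
      using addl[OF a lf(1) lg(1)] addl[OF cl lf(2) lg(2)] addl[OF e lf(2) lg(2)]
        carr[OF lm(1)[OF lf(1)]] carr[OF lm(2)[OF lf(2)]] carr[OF lm(3)[OF lf(2)]]
        carr[OF lm(1)[OF lg(1)]] carr[OF lm(2)[OF lg(2)]] carr[OF lm(3)[OF lg(2)]]
      by (auto simp: D_def sl_add fun_eq_iff a_ac)
  next
    fix r f assume r: "r \<in> carrier R" and f: "f \<in> carrier (free_module R (B (Suc j)))"
    note lf = lm(4,5)[OF f]
    show "D j (r \<odot>\<^bsub>free_module R (B (Suc j))\<^esub> f) = r \<odot>\<^bsub>free_module R (B j)\<^esub> D j f"
      using smultl[OF a r lf(1)] smultl[OF cl r lf(2)] smultl[OF e r lf(2)] r
        carr[OF lm(1)[OF lf(1)]] carr[OF lm(2)[OF lf(2)]] carr[OF lm(3)[OF lf(2)]]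
      by (auto simp: D_def sl_smult fun_eq_iff r_distr)
  qed (use Dm in auto)
  \<comment> \<open>A vector with vanishing \<open>False\<close> components, and with \<open>x\<^sub>0\<close> such that \<open>e x\<^sub>0\<close> comes from the right,
    is in the image of \<open>D\<close>.\<close>
  have im: "l \<in> D j ` carrier (free_module R (B (Suc j)))"
    if l: "l \<in> carrier (free_module R (B j))" and y0: "\<And>k. sl l False k = (\<lambda>_. \<zero>)"
      and u: "u \<in> carrier (free_module R (J (Suc j)))" "a j u = e j (sl l True 0)" for l j u
  proof
    let ?v = "\<lambda>t k. if t then (if k = 0 then u else (\<lambda>_. \<zero>))
      else (\<lambda>b. c j (sl l True k) b \<oplus> e j (sl l True (Suc k)) b)"
    let ?l = "\<lambda>(t, k, b). ?v t k b"
    let ?K = "{k. sl l True k \<noteq> (\<lambda>_. \<zero>)}"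
    have x: "sl l True k \<in> carrier (free_module R (J j))" for k
      by (rule slx[OF l])
    have y: "(\<lambda>b. c j (sl l True k) b \<oplus> e j (sl l True (Suc k)) b) \<in> carrier (free_module R (J j))" for k
      using x lm by (intro free_module_add) auto
    have "{k. ?v t k \<noteq> (\<lambda>_. \<zero>)} \<subseteq> insert 0 (?K \<union> Suc -` ?K)" for t
    proof
      fix k assume k: "k \<in> {k. ?v t k \<noteq> (\<lambda>_. \<zero>)}"
      show "k \<in> insert 0 (?K \<union> Suc -` ?K)"
      proof (rule ccontr)
        assume n: "k \<notin> insert 0 (?K \<union> Suc -` ?K)"
        then have "sl l True k = (\<lambda>_. \<zero>)" "sl l True (Suc k) = (\<lambda>_. \<zero>)" "k \<noteq> 0" by auto
        then show False using k map0[OF e] map0[OF cl] by (auto split: if_splits)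
      qed
    qed
    moreover have "finite (insert 0 (?K \<union> Suc -` ?K))"
      using slfin[OF l, of True] finite_vimageI[OF slfin[OF l, of True], of Suc] by simp
    ultimately have "finite {k. ?v t k \<noteq> (\<lambda>_. \<zero>)}" for t
      by (rule finite_subset)
    moreover have "?v t k \<in> carrier (free_module R (Bs (Suc j) t))" for t k
      using u y zero_mem by (auto simp: Bs_def)
    ultimately show "?l \<in> carrier (free_module R (B (Suc j)))"
      using asm[of ?v "Suc j"] by simp
    have sl': "sl ?l True 0 = u" "sl ?l False k = (\<lambda>b. c j (sl l True k) b \<oplus> e j (sl l True (Suc k)) b)" for k
      by (auto simp: sl_def)
    have cy: "c j (\<lambda>b. c j (sl l True k) b \<oplus> e j (sl l True (Suc k)) b) = c j (sl l True k)" for k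
    proof -
      have "c j (e j (sl l True (Suc k))) = (\<lambda>_. \<zero>)"
        by (rule cz) (use lm x ee in auto)
      then show ?thesis
        using addl[OF cl lm(3)[OF x] lm(2)[OF x], of k "Suc k"] cc[OF x, of k] carr[OF lm(3)[OF x]]
        by simp
    qed
    have ey: "e j (\<lambda>b. c j (sl l True k) b \<oplus> e j (sl l True (Suc k)) b) = e j (sl l True (Suc k))" for k
      using addl[OF e lm(3)[OF x] lm(2)[OF x], of k "Suc k"] ec[OF x, of k] ee[OF x] carr[OF lm(2)[OF x]]
      by simp
    have "D j ?l (t, k, b) = l (t, k, b)" for t k b
    proof (cases t)
      case True
      have "e j (sl l True k) b \<oplus> c j (sl l True k) b = l (True, k, b)" for k
        using fun_cong[OF dec[OF x], of k b] by (simp add: sl_def)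
      then show ?thesis
        using True u(2) by (cases k) (simp_all add: D_def sl' cy ey)
    next
      case False
      then show ?thesis using fun_cong[OF y0[of k], of b] by (simp add: D_def sl_def)
    qed
    then show "l = D j ?l" by auto
  qed
  have y0: "sl (D j l) False k = (\<lambda>_. \<zero>)" and x0: "sl (D j l) True 0 = (\<lambda>b. a j (sl l True 0) b \<oplus> c j (sl l False 0) b)"
    and xS: "sl (D j l) True (Suc k) = (\<lambda>b. e j (sl l False k) b \<oplus> c j (sl l False (Suc k)) b)" for j l k
    by (auto simp: D_def sl_def)
  have esplit: "e j (\<lambda>b. x b \<oplus> c j y b) = e j x"
    if "x \<in> carrier (free_module R (J j))" "y \<in> carrier (free_module R (J j))" for j x y
    using addl[OF e that(1) lm(3)[OF that(2)]] ec[OF that(2)] carr[OF lm(2)[OF that(1)]] by simp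
  have csplit: "c j (\<lambda>b. x b \<oplus> c j y b) = c j y"
    if "x \<in> carrier (free_module R (J j))" "e j x = x" "y \<in> carrier (free_module R (J j))" for j x y
    using addl[OF cl that(1) lm(3)[OF that(3)]] cz[OF that(1,2)] cc[OF that(3)] carr[OF lm(3)[OF that(3)]] by simp
  have ker_y: "sl l False k = (\<lambda>_. \<zero>)" and ker_x: "a j (sl l True 0) = (\<lambda>_. \<zero>)"
    if l: "l \<in> carrier (free_module R (B (Suc j)))" and z: "D j l = (\<lambda>_. \<zero>)" for j l k
  proof -
    have X: "a j (sl l True 0) \<in> carrier (free_module R (J j))" "e j (a j (sl l True 0)) = a j (sl l True 0)"
      using lm(1)[OF lm(4)[OF l]] ea[OF lm(4)[OF l]] by auto
    have Y: "sl l False k \<in> carrier (free_module R (J j))" for k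
      by (rule lm(5)[OF l])
    have z0: "(\<lambda>b. a j (sl l True 0) b \<oplus> c j (sl l False 0) b) = (\<lambda>_. \<zero>)"
      and zS: "(\<lambda>b. e j (sl l False k) b \<oplus> c j (sl l False (Suc k)) b) = (\<lambda>_. \<zero>)" for k
      using x0[of j l] xS[of j l k] z by (simp_all add: sl_def)
    show "a j (sl l True 0) = (\<lambda>_. \<zero>)"
      using esplit[OF X(1) Y, of 0] z0 X(2) map0[OF e, of j] by simp
    have c0: "c j (sl l False k) = (\<lambda>_. \<zero>)" for k
    proof (cases k)
      case 0
      then show ?thesis using csplit[OF X Y, of 0] z0 map0[OF cl, of j] by simp
    next
      case (Suc k')
      then show ?thesis
        using csplit[OF lm(2)[OF Y] ee[OF Y] Y, of k' k] zS[of k'] map0[OF cl, of j] by simp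
    qed
    have e0: "e j (sl l False k) = (\<lambda>_. \<zero>)"
      using esplit[OF lm(2)[OF Y] Y, of k "Suc k"] zS[of k] map0[OF e, of j] ee[OF Y, of k] by simp
    show "sl l False k = (\<lambda>_. \<zero>)"
      using dec[OF Y, of k] c0[of k] e0 by simp
  qed
  define \<eta>' where "\<eta>' = (\<lambda>l. \<eta> (sl l True 0))"
  have \<eta>'l: "\<eta>' \<in> lin_maps R (free_module R (B 0)) N"
    unfolding lin_maps_def \<eta>'_def
    using lin_maps_mem[OF \<eta> slx] addl[OF \<eta> slx slx] smultl[OF \<eta> _ slx] by (auto simp: sl_add sl_smult)
  have "free_resolution R N B D \<eta>'"
    unfolding free_resolution_def
  proof (intro conjI allI)
    show "\<eta>' ` carrier (free_module R (B 0)) = carrier N"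
    proof
      show "carrier N \<subseteq> \<eta>' ` carrier (free_module R (B 0))"
      proof
        fix y assume "y \<in> carrier N"
        then have "y \<in> \<eta> ` carrier (free_module R (J 0))"
          using \<eta>surj by simp
        then obtain x where x: "x \<in> carrier (free_module R (J 0))" "\<eta> x = y"
          by (elim imageE) simp
        let ?v = "\<lambda>t k. if t \<and> k = (0::nat) then x else (\<lambda>_. \<zero>)"
        have "finite {k. ?v t k \<noteq> (\<lambda>_. \<zero>)}" for t
          by (rule finite_subset[of _ "{0}"]) auto
        then have "(\<lambda>(t, k, b). ?v t k b) \<in> carrier (free_module R (B 0))"
          using x zero_mem by (intro asm) (auto simp: Bs_def)
        moreover have "\<eta>' (\<lambda>(t, k, b). ?v t k b) = y"
          using x by (simp add: \<eta>'_def sl_def)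
        ultimately show "y \<in> \<eta>' ` carrier (free_module R (B 0))" by blast
      qed
    qed (use lin_maps_mem[OF \<eta>'l] in auto)
  next
    show "{x \<in> carrier (free_module R (B 0)). \<eta>' x = \<zero>\<^bsub>N\<^esub>} = D 0 ` carrier (free_module R (B (Suc 0)))"
    proof (intro equalityI subsetI)
      fix l assume "l \<in> {x \<in> carrier (free_module R (B 0)). \<eta>' x = \<zero>\<^bsub>N\<^esub>}"
      then have l: "l \<in> carrier (free_module R (B 0))" and l0: "\<eta> (sl l True 0) = \<zero>\<^bsub>N\<^esub>"
        by (auto simp: \<eta>'_def)
      have "sl l False k = (\<lambda>_. \<zero>)" for k
        using slm[OF l, of False k] by (auto simp: Bs_def mem_free_module)
      then show "l \<in> D 0 ` carrier (free_module R (B (Suc 0)))"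
        using \<eta>ex[OF slx[OF l] l0] im[OF l] by blast
    next
      fix l assume "l \<in> D 0 ` carrier (free_module R (B (Suc 0)))"
      then obtain l' where l': "l' \<in> carrier (free_module R (B (Suc 0)))" "l = D 0 l'" by blast
      have "\<eta>' l = \<eta> (\<lambda>b. a 0 (sl l' True 0) b \<oplus> c 0 (sl l' False 0) b)"
        by (simp add: \<eta>'_def l' x0)
      also have "\<dots> = \<eta> (e 0 (\<lambda>b. a 0 (sl l' True 0) b \<oplus> c 0 (sl l' False 0) b))"
        by (rule \<eta>e[OF free_module_add[OF lm(1)[OF slx[OF l'(1)]] lm(3)[OF sly[OF l'(1)]]], symmetric])
      also have "\<dots> = \<zero>\<^bsub>N\<^esub>"
        using esplit[OF lm(1)[OF slx[OF l'(1)]] sly[OF l'(1)]] ea[OF slx[OF l'(1)]] \<eta>a[OF slx[OF l'(1)]] by simp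
      finally show "l \<in> {x \<in> carrier (free_module R (B 0)). \<eta>' x = \<zero>\<^bsub>N\<^esub>}"
        using Dm l' by simp
    qed
  next
    fix j
    show "{x \<in> carrier (free_module R (B (Suc j))). D j x = \<zero>\<^bsub>free_module R (B j)\<^esub>} =
        D (Suc j) ` carrier (free_module R (B (Suc (Suc j))))"
    proof (intro equalityI subsetI)
      fix l assume "l \<in> {x \<in> carrier (free_module R (B (Suc j))). D j x = \<zero>\<^bsub>free_module R (B j)\<^esub>}"
      then have l: "l \<in> carrier (free_module R (B (Suc j)))" and z: "D j l = (\<lambda>_. \<zero>)"
        by auto
      show "l \<in> D (Suc j) ` carrier (free_module R (B (Suc (Suc j))))"
        using aex[OF slx[OF l] ker_x[OF l z]] im[OF l ker_y[OF l z]] by (elim bexE)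
    next
      fix l assume "l \<in> D (Suc j) ` carrier (free_module R (B (Suc (Suc j))))"
      then obtain l' where l': "l' \<in> carrier (free_module R (B (Suc (Suc j))))" "l = D (Suc j) l'" by blast
      have l: "l \<in> carrier (free_module R (B (Suc j)))"
        using Dm l' by simp
      have "a j (sl l True 0) = (\<lambda>_. \<zero>)"
      proof -
        let ?y = "sl l' False 0"
        have y: "?y \<in> carrier (free_module R (J (Suc j)))" by (rule sly[OF l'(1)])
        have "c (Suc j) ?y \<in> carrier (free_module R (J (Suc j)))" by (rule lm(3)[OF y])
        moreover have "a j (c (Suc j) ?y) = (\<lambda>_. \<zero>)"
        proof -
          have ey: "e (Suc j) ?y \<in> carrier (free_module R (J (Suc j)))" by (rule lm(2)[OF y])
          have "a j (\<lambda>b. e (Suc j) ?y b \<oplus> c (Suc j) ?y b) =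
              (\<lambda>b. a j (e (Suc j) ?y) b \<oplus> a j (c (Suc j) ?y) b)"
            using addl[OF a ey lm(3)[OF y]] by simp
          then have eq: "a j ?y = (\<lambda>b. a j ?y b \<oplus> a j (c (Suc j) ?y) b)"
            using dec[OF y] ae[OF y] by simp
          show ?thesis
          proof
            fix b
            have "a j ?y b \<in> carrier R" "a j (c (Suc j) ?y) b \<in> carrier R"
              using carr lm(1)[OF y] lm(1)[OF lm(3)[OF y]] by blast+
            then show "a j (c (Suc j) ?y) b = \<zero>"
              using fun_cong[OF eq, of b] by (metis (no_types) add.l_cancel_one')
          qed
        qed
        ultimately show ?thesis
          using addl[OF a lm(1)[OF slx[OF l'(1)]]] aa[OF slx[OF l'(1)]] by (simp add: l' x0)
      qed
      then have "D j l = (\<lambda>_. \<zero>)"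
        using y0[of "Suc j" l', folded l'(2)] map0[OF e, of j] map0[OF cl, of j]
        by (intro ext) (simp add: D_def split: prod.splits)
      then show "l \<in> {x \<in> carrier (free_module R (B (Suc j))). D j x = \<zero>\<^bsub>free_module R (B j)\<^esub>}"
        using l by simp
    qed
  qed (use Dl \<eta>'l in auto)
  then show ?thesis by (rule that) (rule B0)
qed

section \<open>Semifree modules over a differential graded ring\<close>

locale dg_ring = ring A for A (structure) +
  fixes G :: "nat \<Rightarrow> 'a set" and d :: "'a \<Rightarrow> 'a"
  assumes G_carrier: "a \<in> G n \<Longrightarrow> a \<in> carrier A"
    and G_zero: "\<zero> \<in> G n"
    and G_add: "a \<in> G n \<Longrightarrow> b \<in> G n \<Longrightarrow> a \<oplus> b \<in> G n"
    and G_uminus: "a \<in> G n \<Longrightarrow> \<ominus> a \<in> G n"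
    and G_mult: "a \<in> G m \<Longrightarrow> b \<in> G n \<Longrightarrow> a \<otimes> b \<in> G (m + n)"
    and d_closed: "a \<in> carrier A \<Longrightarrow> d a \<in> carrier A"
    and d_add: "a \<in> carrier A \<Longrightarrow> b \<in> carrier A \<Longrightarrow> d (a \<oplus> b) = d a \<oplus> d b"
    and d_deg: "a \<in> G (Suc n) \<Longrightarrow> d a \<in> G n"
    and d_deg0: "a \<in> G 0 \<Longrightarrow> d a = \<zero>"
    and d_d: "a \<in> carrier A \<Longrightarrow> d (d a) = \<zero>"
    and d_mult: "a \<in> G n \<Longrightarrow> b \<in> carrier A \<Longrightarrow> d (a \<otimes> b) = (d a \<otimes> b) \<oplus> signed A n (a \<otimes> d b)"
begin

lemma d_zero: "d \<zero> = \<zero>"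
  using d_deg0 G_zero by blast

lemma d_uminus: "a \<in> carrier A \<Longrightarrow> d (\<ominus> a) = \<ominus> d a"
  using d_add[of "\<ominus> a" a] d_closed d_zero by (simp add: l_neg minus_equality)

lemma d_signed: "a \<in> carrier A \<Longrightarrow> d (signed A n a) = signed A n (d a)"
  by (simp add: signed_def d_uminus)

lemma G_signed: "a \<in> G n \<Longrightarrow> signed A m a \<in> G n"
  by (simp add: signed_def G_uminus)

text \<open>A cell is a pair of its degree and an index. The semifree module with basis the cells
  \<open>B\<close> consists of the vectors over the cells, on which \<open>A\<close> acts from the right.\<close>

abbreviation vectors :: "(nat \<Rightarrow> 'i set) \<Rightarrow> (nat \<times> 'i \<Rightarrow> 'a) set" where
  "vectors B \<equiv> carrier (free_module A (Sigma UNIV B))"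

text \<open>The component of degree \<open>m\<close>: the coefficient of a cell of degree \<open>j\<close> has degree \<open>m - j\<close>.\<close>

definition homog :: "(nat \<Rightarrow> 'i set) \<Rightarrow> nat \<Rightarrow> (nat \<times> 'i \<Rightarrow> 'a) set" where
  "homog B m = {f \<in> vectors B. \<forall>j i. f (j, i) \<in> (if j \<le> m then G (m - j) else {\<zero>})}"

text \<open>The differential of the semifree module in which the cell \<open>e\<close> has boundary \<open>W e\<close>:
  \<open>\<partial>(e a) = \<partial>(e) a + (-1)\<^sup>j e \<partial>(a)\<close>, where \<open>j\<close> is the degree of \<open>e\<close>.\<close>

definition bd :: "(nat \<times> 'i \<Rightarrow> nat \<times> 'i \<Rightarrow> 'a) \<Rightarrow> (nat \<times> 'i \<Rightarrow> 'a) \<Rightarrow> nat \<times> 'i \<Rightarrow> 'a" where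
  "bd W f = (\<lambda>c. comb A W f c \<oplus> signed A (fst c) (d (f c)))"

text \<open>The condition \<open>\<partial> \<partial> = 0\<close> is only imposed on the cells; \<open>bd_bd\<close> extends it to all vectors. The
  conditions also bind the rows \<open>W (j, i)\<close> with \<open>i \<notin> B j\<close>, since products with \<open>W\<close> are formed over all
  indices; such rows may be zero.\<close>

definition semifree :: "(nat \<Rightarrow> 'i set) \<Rightarrow> (nat \<times> 'i \<Rightarrow> nat \<times> 'i \<Rightarrow> 'a) \<Rightarrow> bool" where
  "semifree B W \<longleftrightarrow> (\<forall>i. W (0, i) = (\<lambda>_. \<zero>)) \<and>
     (\<forall>j i. W (Suc j, i) \<in> homog B j \<and> bd W (W (Suc j, i)) = (\<lambda>_. \<zero>))"

lemma homog_vectors: "f \<in> homog B m \<Longrightarrow> f \<in> vectors B"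
  by (simp add: homog_def)

lemma vectors_carrier: "f \<in> vectors B \<Longrightarrow> f c \<in> carrier A"
  by (cases c) (simp add: mem_free_module)

lemma homog_G: "f \<in> homog B m \<Longrightarrow> j \<le> m \<Longrightarrow> f (j, i) \<in> G (m - j)"
  by (auto simp: homog_def split: if_splits dest!: spec[of _ j])

lemma homog_above: "f \<in> homog B m \<Longrightarrow> m < j \<Longrightarrow> f (j, i) = \<zero>"
  by (auto simp: homog_def split: if_splits dest!: spec[of _ j])

lemma homogI:
  "f \<in> vectors B \<Longrightarrow> (\<And>j i. j \<le> m \<Longrightarrow> f (j, i) \<in> G (m - j)) \<Longrightarrow> (\<And>j i. m < j \<Longrightarrow> f (j, i) = \<zero>) \<Longrightarrow>
   f \<in> homog B m"
  by (auto simp: homog_def)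

lemma homog_zero: "(\<lambda>_. \<zero>) \<in> homog B m"
  by (rule homogI) (auto simp: free_module_zero G_zero)

lemma homog_add: "f \<in> homog B m \<Longrightarrow> g \<in> homog B m \<Longrightarrow> (\<lambda>c. f c \<oplus> g c) \<in> homog B m"
  by (rule homogI) (auto simp: free_module_add homog_vectors homog_G homog_above G_add)

lemma homog_uminus: "f \<in> homog B m \<Longrightarrow> (\<lambda>c. \<ominus> f c) \<in> homog B m"
  by (rule homogI) (auto simp: free_module_uminus homog_vectors homog_G homog_above G_uminus)

lemma homog_rmult: "f \<in> homog B m \<Longrightarrow> a \<in> G n \<Longrightarrow> (\<lambda>c. f c \<otimes> a) \<in> homog B (m + n)"
proof (rule homogI)
  fix j i assume f: "f \<in> homog B m" and a: "a \<in> G n" and j: "j \<le> m + n"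
  show "f (j, i) \<otimes> a \<in> G (m + n - j)"
  proof (cases "j \<le> m")
    case True
    then show ?thesis using G_mult[OF homog_G[OF f True] a] by simp
  next
    case False
    then show ?thesis using homog_above[OF f] a G_carrier G_zero by simp
  qed
qed (auto simp: free_module_rmult homog_vectors G_carrier homog_above)

lemma semifree_homog: "semifree B W \<Longrightarrow> W (Suc j, i) \<in> homog B j"
  by (simp add: semifree_def)

lemma semifree_bd: "semifree B W \<Longrightarrow> bd W (W (Suc j, i)) = (\<lambda>_. \<zero>)"
  by (simp add: semifree_def)

lemma semifree_0: "semifree B W \<Longrightarrow> W (0, i) = (\<lambda>_. \<zero>)"
  by (simp add: semifree_def)

lemma semifree_vectors: "semifree B W \<Longrightarrow> W e \<in> vectors B"
proof -
  assume W: "semifree B W"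
  obtain j i where e: "e = (j, i)" by (cases e)
  show "W e \<in> vectors B"
    using homog_vectors[OF semifree_homog[OF W]] semifree_0[OF W, of i] free_module_zero
    by (cases j) (auto simp: e)
qed

lemma semifree_carrier: "semifree B W \<Longrightarrow> W e c \<in> carrier A"
  using semifree_vectors vectors_carrier by blast

lemma semifree_vanish: "semifree B W \<Longrightarrow> j \<le> j' \<Longrightarrow> W (j, i) (j', i') = \<zero>"
  by (cases j) (auto simp: semifree_0 intro: homog_above[OF semifree_homog])

lemma comb_vectors:
  assumes "semifree B W" "f \<in> vectors B"
  shows "comb A W f \<in> vectors B"
  by (rule comb_mem[OF assms(2)]) (rule semifree_vectors[OF assms(1)])

lemma bd_vectors:
  assumes "semifree B W" "f \<in> vectors B"
  shows "bd W f \<in> vectors B"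
proof -
  have "(\<lambda>c. signed A (fst c) (d (f c))) \<in> vectors B"
    by (rule free_module_map[where h = "\<lambda>c a. signed A (fst c) (d a)"]) (use assms d_zero d_closed in auto)
  then show ?thesis
    unfolding bd_def using comb_vectors[OF assms] by (rule free_module_add[rotated])
qed

lemma bd_add:
  assumes "semifree B W" "f \<in> vectors B" "g \<in> vectors B"
  shows "bd W (\<lambda>c. f c \<oplus> g c) = (\<lambda>c. bd W f c \<oplus> bd W g c)"
proof
  fix c
  have "comb A W f c \<in> carrier A" "comb A W g c \<in> carrier A"
    using comb_vectors[OF assms(1,2)] comb_vectors[OF assms(1,3)] by (auto intro: vectors_carrier)
  moreover have "comb A W (\<lambda>c. f c \<oplus> g c) c = comb A W f c \<oplus> comb A W g c"
    by (rule comb_add[OF assms(2,3)]) (rule semifree_carrier[OF assms(1)])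
  moreover have "f c \<in> carrier A" "g c \<in> carrier A"
    using assms(2,3) by (auto intro: vectors_carrier)
  ultimately show "bd W (\<lambda>c. f c \<oplus> g c) c = bd W f c \<oplus> bd W g c"
    using d_closed by (simp add: bd_def d_add signed_add a_ac)
qed

lemma bd_zero: "bd W (\<lambda>_. \<zero>) = (\<lambda>_. \<zero>)"
  by (simp add: bd_def comb_zero d_zero)

lemma bd_uminus:
  assumes "semifree B W" "f \<in> vectors B"
  shows "bd W (\<lambda>c. \<ominus> f c) = (\<lambda>c. \<ominus> bd W f c)"
proof
  fix c
  have "comb A W (\<lambda>c. \<ominus> f c) c = \<ominus> comb A W f c"
    by (rule comb_uminus[OF assms(2)]) (rule semifree_carrier[OF assms(1)])
  moreover have "comb A W f c \<in> carrier A"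
    by (rule vectors_carrier[OF comb_vectors[OF assms]])
  moreover have "f c \<in> carrier A"
    by (rule vectors_carrier[OF assms(2)])
  ultimately show "bd W (\<lambda>c. \<ominus> f c) c = \<ominus> bd W f c"
    using d_closed by (simp add: bd_def d_uminus signed_uminus minus_add a_comm)
qed

lemma bd_signed:
  "semifree B W \<Longrightarrow> f \<in> vectors B \<Longrightarrow> bd W (\<lambda>c. signed A n (f c)) = (\<lambda>c. signed A n (bd W f c))"
  by (auto simp: signed_def bd_uminus)

lemma bd_rmult:
  fixes B :: "nat \<Rightarrow> 'i set"
  assumes W: "semifree B W" and f: "f \<in> homog B m" and a: "a \<in> carrier A"
  shows "bd W (\<lambda>c. f c \<otimes> a) = (\<lambda>c. (bd W f c \<otimes> a) \<oplus> signed A m (f c \<otimes> d a))"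
proof
  fix c :: "nat \<times> 'i"
  obtain j i where c: "c = (j, i)" by (cases c)
  have fv: "f \<in> vectors B" by (rule homog_vectors[OF f])
  have fc: "f c \<in> carrier A" by (rule vectors_carrier[OF fv])
  have "comb A W (\<lambda>c. f c \<otimes> a) c = comb A W f c \<otimes> a"
    by (rule comb_rmult[OF fv _ a]) (rule semifree_carrier[OF W])
  moreover have "comb A W f c \<in> carrier A"
    by (rule vectors_carrier[OF comb_vectors[OF W fv]])
  moreover have "signed A j (d (f c \<otimes> a)) = (signed A j (d (f c)) \<otimes> a) \<oplus> signed A m (f c \<otimes> d a)"
  proof (cases "j \<le> m")
    case True
    then show ?thesis
      using d_mult[OF homog_G[OF f True, of i] a] fc a d_closed
      by (simp add: c signed_add signed_rmult signed_signed)
  next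
    case False
    then show ?thesis
      using homog_above[OF f] a d_closed by (simp add: c d_zero)
  qed
  ultimately show "bd W (\<lambda>c. f c \<otimes> a) c = (bd W f c \<otimes> a) \<oplus> signed A m (f c \<otimes> d a)"
    using fc a d_closed by (simp add: bd_def c l_distr a_assoc)
qed

lemma bd_single:
  assumes "semifree B W" "a \<in> carrier A"
  shows "bd W (single A (j, i) a) = (\<lambda>c. (W (j, i) c \<otimes> a) \<oplus> single A (j, i) (signed A j (d a)) c)"
proof
  fix c
  have "comb A W (single A (j, i) a) c = W (j, i) c \<otimes> a"
    by (rule comb_single[OF assms(2)]) (rule semifree_carrier[OF assms(1)])
  then show "bd W (single A (j, i) a) c = (W (j, i) c \<otimes> a) \<oplus> single A (j, i) (signed A j (d a)) c"
    by (simp add: bd_def single_def d_zero)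
qed

lemma G_finsum:
  "(\<And>i. i \<in> I \<Longrightarrow> f i \<in> G n) \<Longrightarrow> (\<Oplus>i\<in>I. f i) \<in> G n"
proof (induction I rule: infinite_finite_induct)
  case (insert i I)
  then show ?case by (subst finsum_insert) (auto intro: G_add G_carrier)
qed (auto simp: G_zero)

lemma bd_homog:
  assumes W: "semifree B W" and f: "f \<in> homog B (Suc m)"
  shows "bd W f \<in> homog B m"
proof (rule homogI)
  have fin: "finite {e. f e \<noteq> \<zero>}" and fc: "f e \<in> carrier A" for e
    using homog_vectors[OF f] unfolding mem_free_module by blast+
  show "bd W f \<in> vectors B"
    using assms homog_vectors bd_vectors by blast
  fix j i
  {
    assume j: "j \<le> m"
    have "W e (j, i) \<otimes> f e \<in> G (m - j)" if e: "f e \<noteq> \<zero>" for e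
    proof -
      obtain j' i' where [simp]: "e = (j', i')" by (cases e)
      have j': "j' \<le> Suc m" using homog_above[OF f, of j' i'] e by (rule_tac ccontr) simp
      show ?thesis
      proof (cases "j < j'")
        case True
        then obtain j0 where j0: "j' = Suc j0" by (cases j') auto
        have "W e (j, i) \<in> G (j0 - j)" "f e \<in> G (m - j0)"
          using homog_G[OF semifree_homog[OF W], of j j0 i' i] homog_G[OF f j', of i'] True j0 by auto
        from G_mult[OF this] show ?thesis
          using True j0 j j' by simp
      next
        case False
        then show ?thesis using semifree_vanish[OF W] fc[of e] G_zero by simp
      qed
    qed
    then have "comb A W f (j, i) \<in> G (m - j)"
      unfolding comb_def by (intro G_finsum) auto
    moreover have "signed A j (d (f (j, i))) \<in> G (m - j)"
      using homog_G[OF f, of j i] j by (intro G_signed d_deg) (simp add: Suc_diff_le)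
    ultimately show "bd W f (j, i) \<in> G (m - j)"
      by (simp add: bd_def G_add)
  next
    assume j: "m < j"
    have "W e (j, i) \<otimes> f e = \<zero>" if e: "f e \<noteq> \<zero>" for e
    proof -
      obtain j' i' where [simp]: "e = (j', i')" by (cases e)
      have "j' \<le> Suc m" using homog_above[OF f, of j' i'] e by (rule_tac ccontr) simp
      then show ?thesis using semifree_vanish[OF W, of j' j] fc[of e] j by simp
    qed
    then have "comb A W f (j, i) = \<zero>"
      unfolding comb_def by (intro add.finprod_one_eqI) auto
    moreover have "d (f (j, i)) = \<zero>"
      using homog_G[OF f, of j i] homog_above[OF f, of j i] j
      by (cases "j = Suc m") (auto simp: d_deg0 d_zero)
    ultimately show "bd W f (j, i) = \<zero>"
      by (simp add: bd_def)
  }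
qed

lemma bd_homog0:
  fixes B :: "nat \<Rightarrow> 'i set"
  assumes W: "semifree B W" and f: "f \<in> homog B 0"
  shows "bd W f = (\<lambda>_. \<zero>)"
proof
  fix c :: "nat \<times> 'i"
  have fc: "f e \<in> carrier A" for e
    using homog_vectors[OF f] unfolding mem_free_module by blast+
  have "W e c \<otimes> f e = \<zero>" if e: "f e \<noteq> \<zero>" for e
  proof -
    obtain j' i' where [simp]: "e = (j', i')" by (cases e)
    have "j' = 0" using homog_above[OF f, of j' i'] e by (rule_tac ccontr) simp
    then show ?thesis using semifree_0[OF W] fc[of e] by simp
  qed
  then have "comb A W f c = \<zero>"
    unfolding comb_def by (intro add.finprod_one_eqI) auto
  moreover have "d (f c) = \<zero>"
    using homog_G[OF f, of 0 "snd c"] homog_above[OF f, of "fst c" "snd c"]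
    by (cases c; cases "fst c = 0") (auto simp: d_deg0 d_zero)
  ultimately show "bd W f c = \<zero>"
    by (simp add: bd_def)
qed

text \<open>On the multiple \<open>e a\<close> of a cell, the two terms \<open>\<partial>(e) \<partial>(a)\<close> of \<open>\<partial> \<partial> (e a)\<close> cancel, because the degrees
  of \<open>e\<close> and \<open>\<partial>(e)\<close> have different parities.\<close>

lemma bd_bd:
  assumes W: "semifree B W" and f: "f \<in> homog B m"
  shows "bd W (bd W f) = (\<lambda>_. \<zero>)"
  using homog_vectors[OF f]
proof (induction rule: free_module_induct)
  case zero
  then show ?case by (simp add: bd_zero)
next
  case (add g h)
  then show ?case by (simp add: bd_add[OF W] bd_vectors[OF W])
next
  case (single e)
  obtain j i where e: "e = (j, i)" by (cases e)
  let ?a = "f e"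
  have da: "d ?a \<in> carrier A" using single d_closed by simp
  have e2: "single A (j, i) (signed A j (d ?a)) \<in> vectors B"
    using single da e by (intro single_mem) auto
  have zero: "single A (j, i) (signed A j (d (signed A j (d ?a)))) c = \<zero>" for c
    using single da by (simp add: d_signed d_d single_def)
  have 2: "bd W (single A (j, i) (signed A j (d ?a))) = (\<lambda>c. signed A j (W (j, i) c \<otimes> d ?a))"
    using da semifree_carrier[OF W] zero by (simp add: bd_single[OF W] signed_lmult)
  show ?case
  proof (cases j)
    case 0
    then have "bd W (single A e ?a) = single A (j, i) (signed A j (d ?a))"
      using single(3) vectors_carrier[OF e2] by (auto simp: e bd_single[OF W] semifree_0[OF W])
    then show ?thesis using 2 0 da semifree_0[OF W] by simp
  next
    case (Suc j0)
    have W1: "bd W (\<lambda>c. W (j, i) c \<otimes> ?a) = (\<lambda>c. signed A j0 (W (j, i) c \<otimes> d ?a))"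
      using bd_rmult[OF W semifree_homog[OF W, of j0 i] single(3)] semifree_bd[OF W, of j0 i]
        single da semifree_carrier[OF W] Suc by simp
    have "bd W (bd W (single A e ?a)) =
        (\<lambda>c. signed A j0 (W (j, i) c \<otimes> d ?a) \<oplus> signed A j (W (j, i) c \<otimes> d ?a))"
      using bd_add[OF W free_module_rmult[OF semifree_vectors[OF W] single(3)] e2, of "(j, i)"] W1 2
        bd_single[OF W single(3), of j i] by (simp add: e)
    also have "\<dots> = (\<lambda>_. \<zero>)"
      using da semifree_carrier[OF W] by (auto simp: Suc signed_def l_neg r_neg)
    finally show ?thesis .
  qed
qed

text \<open>This holds because \<open>W\<close> lowers the degree of cells.\<close>

lemma bd_top:
  assumes W: "semifree B W" and f: "f \<in> vectors B" and top: "\<And>j i. q < j \<Longrightarrow> f (j, i) = \<zero>" and j: "q \<le> j"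
  shows "bd W f (j, i) = signed A j (d (f (j, i)))"
proof -
  have "W e (j, i) \<otimes> f e = \<zero>" if e: "f e \<noteq> \<zero>" for e
  proof -
    obtain j' i' where [simp]: "e = (j', i')" by (cases e)
    have "j' \<le> q" using top[of j' i'] e by (cases "j' \<le> q") auto
    then show ?thesis using semifree_vanish[OF W, of j' j] vectors_carrier[OF f, of e] j by simp
  qed
  then have "comb A W f (j, i) = \<zero>"
    unfolding comb_def by (intro add.finprod_one_eqI) auto
  then show ?thesis
    using vectors_carrier[OF f] d_closed by (simp add: bd_def)
qed

end

section \<open>Lifting a free resolution along a quasi-isomorphism\<close>

text \<open>A quasi-isomorphism to a ring \<open>S\<close> in degree \<open>0\<close>, in the form in which it is used: \<open>\<alpha>\<close> is surjective
  with acyclic kernel.\<close>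

locale dg_resolution = dg_ring A G d + S: cring S
  for A (structure) and G :: "nat \<Rightarrow> 'a set" and d and S :: "('b, 'n) ring_scheme" +
  fixes \<alpha> :: "'a \<Rightarrow> 'b"
  assumes \<alpha>_hom: "\<alpha> \<in> ring_hom A S"
    and \<alpha>_pos: "a \<in> G (Suc n) \<Longrightarrow> \<alpha> a = \<zero>\<^bsub>S\<^esub>"
    and \<alpha>_d: "a \<in> carrier A \<Longrightarrow> \<alpha> (d a) = \<zero>\<^bsub>S\<^esub>"
    and \<alpha>_exact: "a \<in> G n \<Longrightarrow> d a = \<zero> \<Longrightarrow> \<alpha> a = \<zero>\<^bsub>S\<^esub> \<Longrightarrow> a \<in> d ` G (Suc n)"
    and \<alpha>_surj: "\<alpha> ` G 0 = carrier S"
begin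

lemma \<alpha>_closed: "a \<in> carrier A \<Longrightarrow> \<alpha> a \<in> carrier S"
  using \<alpha>_hom by (simp add: ring_hom_closed)

lemma \<alpha>_add: "a \<in> carrier A \<Longrightarrow> b \<in> carrier A \<Longrightarrow> \<alpha> (a \<oplus> b) = \<alpha> a \<oplus>\<^bsub>S\<^esub> \<alpha> b"
  using \<alpha>_hom by (simp add: ring_hom_add)

lemma \<alpha>_mult: "a \<in> carrier A \<Longrightarrow> b \<in> carrier A \<Longrightarrow> \<alpha> (a \<otimes> b) = \<alpha> a \<otimes>\<^bsub>S\<^esub> \<alpha> b"
  using \<alpha>_hom by (simp add: ring_hom_mult)

lemma \<alpha>_zero: "\<alpha> \<zero> = \<zero>\<^bsub>S\<^esub>"
  using \<alpha>_hom S.ring_axioms ring_axioms by (simp add: ring_hom_zero)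

lemma \<alpha>_uminus: "a \<in> carrier A \<Longrightarrow> \<alpha> (\<ominus> a) = \<ominus>\<^bsub>S\<^esub> \<alpha> a"
  using \<alpha>_add[of "\<ominus> a" a] \<alpha>_closed \<alpha>_zero by (simp add: l_neg S.minus_equality)

lemma \<alpha>_signed: "a \<in> carrier A \<Longrightarrow> \<alpha> a = \<zero>\<^bsub>S\<^esub> \<Longrightarrow> \<alpha> (signed A n a) = \<zero>\<^bsub>S\<^esub>"
  by (simp add: signed_def \<alpha>_uminus)

lemma reduction_mem:
  assumes "f \<in> vectors B"
  shows "(\<lambda>i. \<alpha> (f (m, i))) \<in> carrier (free_module S (B m))"
proof -
  have "finite ((\<lambda>i. (m, i)) -` {c. f c \<noteq> \<zero>})"
    using assms by (intro finite_vimageI) (auto simp: mem_free_module inj_on_def)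
  then have "finite {i. \<alpha> (f (m, i)) \<noteq> \<zero>\<^bsub>S\<^esub>}"
    by (rule finite_subset[rotated]) (auto simp: \<alpha>_zero)
  then show ?thesis
    using assms by (auto simp: mem_free_module \<alpha>_closed \<alpha>_zero)
qed

text \<open>Zero entries are lifted to zero, which keeps the support finite.\<close>

lemma lift_vector:
  assumes l: "l \<in> carrier (free_module S (B m))"
  obtains u where "u \<in> homog B m" "\<And>i. \<alpha> (u (m, i)) = l i"
proof -
  have "\<exists>r. r \<in> G 0 \<and> \<alpha> r = l i \<and> (l i = \<zero>\<^bsub>S\<^esub> \<longrightarrow> r = \<zero>)" for i
  proof (cases "l i = \<zero>\<^bsub>S\<^esub>")
    case True
    then show ?thesis using G_zero \<alpha>_zero by auto
  next
    case False
    have "l i \<in> \<alpha> ` G 0" using l \<alpha>_surj by (simp add: mem_free_module)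
    then show ?thesis using False by auto
  qed
  then obtain r where r: "\<And>i. r i \<in> G 0" "\<And>i. \<alpha> (r i) = l i" "\<And>i. l i = \<zero>\<^bsub>S\<^esub> \<Longrightarrow> r i = \<zero>"
    by metis
  let ?u = "\<lambda>(j, i). if j = m then r i else \<zero>"
  have "{c. ?u c \<noteq> \<zero>} \<subseteq> Pair m ` {i. l i \<noteq> \<zero>\<^bsub>S\<^esub>}"
    using r by (auto split: if_splits)
  then have "finite {c. ?u c \<noteq> \<zero>}"
    by (rule finite_subset) (use l in \<open>auto simp: mem_free_module\<close>)
  then have "?u \<in> vectors B"
    using l r G_carrier[OF r(1)] by (auto simp: mem_free_module)
  then have "?u \<in> homog B m"
    using r G_zero by (intro homogI) auto
  then show thesis using that[of ?u] r by simp
qed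

text \<open>The map \<open>\<alpha>\<close> kills the differentials of coefficients; moreover \<open>f\<close> has no cells of degree above \<open>m + 1\<close>,
  and the boundary of a cell of degree at most \<open>m\<close> has no cells of degree \<open>m\<close>.\<close>

lemma \<alpha>_bd:
  assumes W: "semifree B W" and f: "f \<in> homog B (Suc m)"
  shows "\<alpha> (bd W f (m, i)) = comb S (\<lambda>i' i. \<alpha> (W (Suc m, i') (m, i))) (\<lambda>i'. \<alpha> (f (Suc m, i'))) i"
    (is "_ = comb S ?U _ i")
proof -
  have U: "?U i' i \<in> carrier S" for i'
    using \<alpha>_closed semifree_carrier[OF W] by simp
  show ?thesis
    using homog_vectors[OF f]
  proof (induction rule: free_module_induct)
    case zero
    then show ?case by (simp add: bd_zero \<alpha>_zero S.comb_zero)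
  next
    case (add g h)
    have "comb S ?U (\<lambda>i'. \<alpha> (g (Suc m, i')) \<oplus>\<^bsub>S\<^esub> \<alpha> (h (Suc m, i'))) i =
        comb S ?U (\<lambda>i'. \<alpha> (g (Suc m, i'))) i \<oplus>\<^bsub>S\<^esub> comb S ?U (\<lambda>i'. \<alpha> (h (Suc m, i'))) i"
      by (rule S.comb_add) (use reduction_mem add U in auto)
    then show ?case
      using add by (simp add: bd_add[OF W] \<alpha>_add vectors_carrier[OF bd_vectors[OF W]] vectors_carrier)
  next
    case (single e)
    obtain j i0 where e: "e = (j, i0)" by (cases e)
    have dc: "d (f e) \<in> carrier A" using single d_closed by simp
    have "\<alpha> (single A (j, i0) (signed A j (d (f e))) (m, i)) = \<zero>\<^bsub>S\<^esub>"
      using single dc \<alpha>_d by (simp add: single_def \<alpha>_zero \<alpha>_signed)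
    then have L: "\<alpha> (bd W (single A e (f e)) (m, i)) = \<alpha> (W e (m, i)) \<otimes>\<^bsub>S\<^esub> \<alpha> (f e)"
      using single dc semifree_carrier[OF W] single_mem[of "(j, i0)" UNIV "signed A j (d (f e))"]
      by (simp add: e bd_single[OF W] \<alpha>_add \<alpha>_mult \<alpha>_closed mem_free_module)
    show ?case
    proof (cases "j = Suc m")
      case True
      have "(\<lambda>i'. \<alpha> (single A e (f e) (Suc m, i'))) = single S i0 (\<alpha> (f e))"
        by (auto simp: single_def e True \<alpha>_zero)
      then show ?thesis
        using L S.comb_single[of "\<alpha> (f e)" ?U i0 i] U single \<alpha>_closed by (simp add: e True)
    next
      case False
      have "j \<le> Suc m" using homog_above[OF f, of j i0] single e by (cases "j \<le> Suc m") auto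
      with False have "W e (m, i) = \<zero>" using semifree_vanish[OF W, of j m] e by simp
      moreover have "(\<lambda>i'. \<alpha> (single A e (f e) (Suc m, i'))) = (\<lambda>_. \<zero>\<^bsub>S\<^esub>)"
        using False by (auto simp: single_def e \<alpha>_zero)
      ultimately show ?thesis
        using L single \<alpha>_closed by (simp add: \<alpha>_zero S.comb_zero)
    qed
  qed
qed

text \<open>Cycles that reduce to \<open>0\<close> over \<open>S\<close> are boundaries: the coefficients in top cell degree are
  cycles of the acyclic kernel of \<open>\<alpha>\<close>, hence boundaries, which allows lowering the top cell degree.\<close>

lemma acyclic:
  assumes W: "semifree B W" and f: "f \<in> homog B m" and cyc: "bd W f = (\<lambda>_. \<zero>)"
    and red: "\<And>i. \<alpha> (f (m, i)) = \<zero>\<^bsub>S\<^esub>"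
  obtains g where "g \<in> homog B (Suc m)" "bd W g = f" "\<And>i. g (Suc m, i) = \<zero>"
proof -
  have "\<exists>g\<in>homog B (Suc m). bd W g = f \<and> (\<forall>i. g (Suc m, i) = \<zero>)"
    if "f \<in> homog B m" "bd W f = (\<lambda>_. \<zero>)" "\<And>i. \<alpha> (f (m, i)) = \<zero>\<^bsub>S\<^esub>"
      "\<And>j i. q \<le> j \<Longrightarrow> f (j, i) = \<zero>" for q f
    using that
  proof (induction q arbitrary: f)
    case 0
    then have "f = (\<lambda>_. \<zero>)" by auto
    then show ?case using homog_zero bd_zero by (intro bexI[of _ "\<lambda>_. \<zero>"]) auto
  next
    case (Suc q)
    note f = \<open>f \<in> homog B m\<close>
    note fv = homog_vectors[OF f]
    show ?case
    proof (cases "q \<le> m")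
      case False
      then have "f (j, i) = \<zero>" if "q \<le> j" for j i
        using homog_above[OF f, of j i] that by simp
      then show ?thesis using Suc by blast
    next
      case True
      have "\<exists>b. b \<in> G (Suc (m - q)) \<and> d b = f (q, i) \<and> (f (q, i) = \<zero> \<longrightarrow> b = \<zero>)" for i
      proof (cases "f (q, i) = \<zero>")
        case True
        then show ?thesis using G_zero d_zero by auto
      next
        case False
        have "signed A q (d (f (q, i))) = \<zero>"
          using bd_top[OF W fv, of q q i] Suc.prems by simp
        then have "d (f (q, i)) = \<zero>"
          using vectors_carrier[OF fv] d_closed by simp
        moreover have "\<alpha> (f (q, i)) = \<zero>\<^bsub>S\<^esub>"
          using Suc.prems(3) homog_G[OF f True, of i] \<alpha>_pos[of "f (q, i)" "m - q - 1"] True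
          by (cases "q = m") (auto simp: Suc_diff_Suc)
        ultimately have "f (q, i) \<in> d ` G (Suc (m - q))"
          using homog_G[OF f True] \<alpha>_exact by blast
        then show ?thesis using False by auto
      qed
      then obtain b where b: "\<And>i. b i \<in> G (Suc (m - q))" "\<And>i. d (b i) = f (q, i)"
        "\<And>i. f (q, i) = \<zero> \<Longrightarrow> b i = \<zero>"
        by metis
      let ?g = "\<lambda>(j, i). if j = q then signed A q (b i) else \<zero>"
      have "{c. ?g c \<noteq> \<zero>} \<subseteq> {c. f c \<noteq> \<zero>}"
        using b by (auto split: if_splits)
      then have "finite {c. ?g c \<noteq> \<zero>}"
        by (rule finite_subset) (use fv in \<open>auto simp: mem_free_module\<close>)
      moreover have "?g c = \<zero>" if "c \<notin> Sigma UNIV B" for c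
        using b(3)[of "snd c"] fv that by (cases c) (auto simp: mem_free_module)
      ultimately have gv: "?g \<in> vectors B"
        using G_carrier[OF b(1)] by (auto simp: mem_free_module)
      have g: "?g \<in> homog B (Suc m)"
        using b True gv by (intro homogI) (auto simp: G_signed G_zero Suc_diff_le)
      let ?f = "\<lambda>c. f c \<oplus> \<ominus> bd W ?g c"
      have bg: "bd W ?g \<in> homog B m" using bd_homog[OF W g] .
      have f': "?f \<in> homog B m"
        using f bg by (intro homog_add homog_uminus)
      have low: "?f (j, i) = \<zero>" if "q \<le> j" for j i
      proof -
        have "bd W ?g (j, i) = signed A j (d (?g (j, i)))"
          by (rule bd_top[OF W gv, of q]) (use that in auto)
        also have "\<dots> = f (j, i)"
          using b G_carrier Suc.prems(4)[of j i] that vectors_carrier[OF fv]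
          by (cases "j = q") (auto simp: d_uminus[OF G_carrier[OF b(1)]] signed_def d_zero)
        finally show ?thesis using vectors_carrier[OF fv] by (simp add: r_neg)
      qed
      have "bd W ?f = (\<lambda>_. \<zero>)"
        using bd_add[OF W fv free_module_uminus[OF homog_vectors[OF bg]]] Suc.prems(2)
          bd_uminus[OF W homog_vectors[OF bg]] bd_bd[OF W g] by simp
      then obtain g1 where g1: "g1 \<in> homog B (Suc m)" "bd W g1 = ?f" "\<forall>i. g1 (Suc m, i) = \<zero>"
        using Suc.IH[OF f'] low True \<alpha>_zero by auto
      have "bd W (\<lambda>c. ?g c \<oplus> g1 c) = (\<lambda>c. bd W ?g c \<oplus> ?f c)"
        using bd_add[OF W gv homog_vectors[OF g1(1)]] g1(2) by simp
      also have "\<dots> = f"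
      proof
        fix c
        have "bd W ?g c \<in> carrier A" "f c \<in> carrier A"
          using vectors_carrier[OF homog_vectors[OF bg]] vectors_carrier[OF fv] by auto
        then show "bd W ?g c \<oplus> (f c \<oplus> \<ominus> bd W ?g c) = f c"
          by (simp add: a_lcomm r_neg)
      qed
      finally have "bd W (\<lambda>c. ?g c \<oplus> g1 c) = f" .
      moreover have "?g (Suc m, i) \<oplus> g1 (Suc m, i) = \<zero>" for i
        using True g1(3) by simp
      ultimately show ?thesis
        using homog_add[OF g g1(1)] by (intro bexI[of _ "\<lambda>c. ?g c \<oplus> g1 c"]) auto
    qed
  qed
  from this[of f "Suc m"] show thesis
    using assms that homog_above[OF f] by fastforce
qed

text \<open>Only the entries of \<open>W\<close> between cells of neighbouring degrees are prescribed by \<open>D\<close>. The others are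
  the corrections that make \<open>\<partial> \<partial> = 0\<close> hold over \<open>A\<close>.\<close>

definition lifts :: "(nat \<Rightarrow> 'i set) \<Rightarrow> (nat \<Rightarrow> ('i \<Rightarrow> 'b) \<Rightarrow> 'i \<Rightarrow> 'b) \<Rightarrow>
    (nat \<times> 'i \<Rightarrow> nat \<times> 'i \<Rightarrow> 'a) \<Rightarrow> bool" where
  "lifts B D W \<longleftrightarrow> semifree B W \<and> (\<forall>j i i'. \<alpha> (W (Suc j, i) (j, i')) =
     (if i \<in> B (Suc j) then D j (single S i \<one>\<^bsub>S\<^esub>) i' else \<zero>\<^bsub>S\<^esub>))"

lemma lifts_\<alpha>_bd:
  assumes W: "lifts B D W" and D: "D m \<in> lin_maps S (free_module S (B (Suc m))) (free_module S (B m))"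
    and f: "f \<in> homog B (Suc m)"
  shows "(\<lambda>i. \<alpha> (bd W f (m, i))) = D m (\<lambda>i. \<alpha> (f (Suc m, i)))"
proof -
  have "(\<lambda>i' i. \<alpha> (W (Suc m, i') (m, i))) =
      (\<lambda>i'. if i' \<in> B (Suc m) then D m (single S i' \<one>\<^bsub>S\<^esub>) else (\<lambda>_. \<zero>\<^bsub>S\<^esub>))"
    using W by (auto simp: lifts_def)
  then show ?thesis
    using \<alpha>_bd[of B W f m] W f S.lin_map_comb[OF D reduction_mem[OF homog_vectors[OF f]]]
    by (auto simp: lifts_def)
qed

text \<open>A preimage over \<open>S\<close> lifts to a vector whose boundary agrees with the cycle \<open>f\<close> over \<open>S\<close>; the
  difference is a boundary by \<open>acyclic\<close>.\<close>

lemma lifts_exact: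
  assumes W: "lifts B D W" and D: "D m \<in> lin_maps S (free_module S (B (Suc m))) (free_module S (B m))"
    and f: "f \<in> homog B m" and cyc: "bd W f = (\<lambda>_. \<zero>)"
    and im: "(\<lambda>i. \<alpha> (f (m, i))) \<in> D m ` carrier (free_module S (B (Suc m)))"
  obtains g where "g \<in> homog B (Suc m)" "bd W g = f"
proof -
  have W': "semifree B W" using W by (simp add: lifts_def)
  from im obtain l where l: "l \<in> carrier (free_module S (B (Suc m)))" "(\<lambda>i. \<alpha> (f (m, i))) = D m l"
    by blast
  obtain u where u: "u \<in> homog B (Suc m)" "\<And>i. \<alpha> (u (Suc m, i)) = l i"
    using lift_vector[of l B "Suc m"] l by metis
  have bu: "bd W u \<in> homog B m" by (rule bd_homog[OF W' u(1)])
  have \<alpha>u: "\<alpha> (bd W u (m, i)) = \<alpha> (f (m, i))" for i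
  proof -
    have "(\<lambda>i. \<alpha> (u (Suc m, i))) = l" using u(2) by auto
    then show ?thesis
      using fun_cong[OF lifts_\<alpha>_bd[OF W D u(1)], of i] fun_cong[OF l(2), of i] by simp
  qed
  let ?f = "\<lambda>c. f c \<oplus> \<ominus> bd W u c"
  have f': "?f \<in> homog B m" using f bu by (intro homog_add homog_uminus)
  have "bd W ?f = (\<lambda>_. \<zero>)"
    using bd_add[OF W' homog_vectors[OF f] free_module_uminus[OF homog_vectors[OF bu]]] cyc
      bd_uminus[OF W' homog_vectors[OF bu]] bd_bd[OF W' u(1)] by simp
  moreover have "\<alpha> (?f (m, i)) = \<zero>\<^bsub>S\<^esub>" for i
  proof -
    have "f (m, i) \<in> carrier A" "bd W u (m, i) \<in> carrier A"
      using vectors_carrier homog_vectors f bu by blast+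
    then show ?thesis using \<alpha>u[of i] \<alpha>_closed by (simp add: \<alpha>_add \<alpha>_uminus S.r_neg)
  qed
  ultimately obtain g where g: "g \<in> homog B (Suc m)" "bd W g = ?f"
    using acyclic[OF W' f'] by blast
  have "bd W (\<lambda>c. u c \<oplus> g c) = (\<lambda>c. bd W u c \<oplus> ?f c)"
    using bd_add[OF W' homog_vectors[OF u(1)] homog_vectors[OF g(1)]] g(2) by simp
  also have "\<dots> = f"
  proof
    fix c
    have "f c \<in> carrier A" "bd W u c \<in> carrier A"
      using vectors_carrier homog_vectors f bu by blast+
    then show "bd W u c \<oplus> (f c \<oplus> \<ominus> bd W u c) = f c"
      by (simp add: a_lcomm r_neg)
  qed
  finally show thesis using that homog_add[OF u(1) g(1)] by blast
qed

text \<open>The cells are attached in the order of their degrees. A lift of the matrix of \<open>D j\<close> to \<open>A\<close>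
  has as boundary a cycle that reduces to \<open>0\<close> over \<open>S\<close>; so it can be corrected to a cycle.\<close>

lemma lifts_exist:
  fixes B :: "nat \<Rightarrow> 'i set"
  assumes D: "\<And>j. D j \<in> lin_maps S (free_module S (B (Suc j))) (free_module S (B j))"
    and DD: "\<And>j l. l \<in> carrier (free_module S (B (Suc (Suc j)))) \<Longrightarrow> D j (D (Suc j) l) = (\<lambda>_. \<zero>\<^bsub>S\<^esub>)"
  obtains W where "lifts B D W"
proof -
  \<comment> \<open>For the recursion over cell degrees, the conditions on the row \<open>w\<close> of a cell \<open>e\<close> must only
    depend on the rows of cells of lower degree; \<open>below\<close> discards the others.\<close>
  define below :: "nat \<Rightarrow> (nat \<times> 'i \<Rightarrow> nat \<times> 'i \<Rightarrow> 'a) \<Rightarrow> nat \<times> 'i \<Rightarrow> nat \<times> 'i \<Rightarrow> 'a"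
    where "below = (\<lambda>n W e. if fst e < n then W e else (\<lambda>_. \<zero>))"
  define good where "good = (\<lambda>W (e :: nat \<times> 'i) w. case e of (0, i) \<Rightarrow> w = (\<lambda>_. \<zero>)
    | (Suc j, i) \<Rightarrow> if i \<in> B (Suc j) then w \<in> homog B j \<and> bd (below (Suc j) W) w = (\<lambda>_. \<zero>) \<and>
        (\<forall>i'. \<alpha> (w (j, i')) = D j (single S i \<one>\<^bsub>S\<^esub>) i') else w = (\<lambda>_. \<zero>))"
  have good_homog: "w \<in> homog B j" if "good W (Suc j, i) w" for W j i w
    using that by (auto simp: good_def homog_zero split: if_splits)
  have good_vec: "w \<in> vectors B" if "good W e w" for W e w
    using that good_homog homog_vectors free_module_zero
    by (cases e; cases "fst e") (auto simp: good_def split: if_splits)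
  have bd_below: "bd (below (Suc j) W) f = bd (below n W) f"
    if f: "f \<in> homog B j" and n: "Suc j \<le> n" and W: "\<And>e. fst e < n \<Longrightarrow> W e \<in> vectors B" for W f j n
  proof -
    have "comb A (below (Suc j) W) f c = comb A (below n W) f c" for c
    proof (rule comb_cong)
      fix e assume "f e \<noteq> \<zero>"
      then have "fst e \<le> j" using homog_above[OF f, of "fst e" "snd e"] by (cases "fst e \<le> j") auto
      then show "below (Suc j) W e c = below n W e c" using n by (simp add: below_def)
    next
      fix e show "below (Suc j) W e c \<in> carrier A"
        using vectors_carrier[OF W[of e], of c] n by (simp add: below_def)
    qed (use vectors_carrier[OF homog_vectors[OF f]] in auto)
    then show ?thesis by (simp add: bd_def)
  qed
  have sub: "semifree B (below n W)" if g: "\<And>e. fst e < n \<Longrightarrow> good W e (W e)" for n W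
    unfolding semifree_def
  proof (intro conjI allI)
    fix i show "below n W (0, i) = (\<lambda>_. \<zero>)"
      using g[of "(0, i)"] by (simp add: below_def good_def)
  next
    fix j i
    show h: "below n W (Suc j, i) \<in> homog B j"
      using g[of "(Suc j, i)"] good_homog homog_zero by (auto simp: below_def)
    show "bd (below n W) (below n W (Suc j, i)) = (\<lambda>_. \<zero>)"
    proof (cases "Suc j < n \<and> i \<in> B (Suc j)")
      case True
      then have "bd (below (Suc j) W) (W (Suc j, i)) = (\<lambda>_. \<zero>)" "W (Suc j, i) \<in> homog B j"
        using g[of "(Suc j, i)"] by (auto simp: good_def)
      then show ?thesis
        using bd_below[of "W (Suc j, i)" j n W] good_vec[OF g] True by (simp add: below_def)
    next
      case False
      then have "below n W (Suc j, i) = (\<lambda>_. \<zero>)"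
        using g[of "(Suc j, i)"] by (auto simp: below_def good_def)
      then show ?thesis by (simp add: bd_zero)
    qed
  qed
  have "\<exists>W. \<forall>e. good W e (W e)"
  proof (rule dependent_wf_choice)
    show "wf (inv_image less_than (fst :: nat \<times> 'i \<Rightarrow> nat))" by simp
  next
    fix f g :: "nat \<times> 'i \<Rightarrow> nat \<times> 'i \<Rightarrow> 'a" and x r
    assume "\<And>z. (z, x) \<in> inv_image less_than fst \<Longrightarrow> f z = g z"
    then have "below (fst x) f = below (fst x) g"
      by (auto simp: below_def fun_eq_iff)
    then show "good f x r = good g x r"
      by (cases x; cases "fst x") (auto simp: good_def)
  next
    fix x W assume IH: "\<And>y. (y, x) \<in> inv_image less_than fst \<Longrightarrow> good W y (W y)"
    obtain j i where x: "x = (j, i)" by (cases x)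
    show "\<exists>w. good W x w"
    proof (cases "j = 0 \<or> i \<notin> B j")
      case True
      then show ?thesis by (cases j) (auto simp: good_def x)
    next
      case False
      then obtain j0 where j: "j = Suc j0" and i: "i \<in> B (Suc j0)" by (cases j) auto
      define W' where "W' = below (Suc j0) W"
      have W': "semifree B W'"
        unfolding W'_def by (rule sub) (use IH x j in auto)
      have one: "single S i \<one>\<^bsub>S\<^esub> \<in> carrier (free_module S (B (Suc j0)))"
        using i by (intro S.single_mem) auto
      obtain u where u: "u \<in> homog B j0" "\<And>i'. \<alpha> (u (j0, i')) = D j0 (single S i \<one>\<^bsub>S\<^esub>) i'"
        using lift_vector[where B = B and m = j0, OF lin_maps_mem[OF D one]] by blast
      have "\<exists>w\<in>homog B j0. bd W' w = (\<lambda>_. \<zero>) \<and> (\<forall>i'. \<alpha> (w (j0, i')) = D j0 (single S i \<one>\<^bsub>S\<^esub>) i')"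
      proof (cases j0)
        case 0
        then show ?thesis using u bd_homog0[OF W', of u] by blast
      next
        case (Suc j1)
        have bu: "bd W' u \<in> homog B j1" using bd_homog[OF W'] u Suc by simp
        have mat: "(\<lambda>i' i. \<alpha> (W' (Suc j1, i') (j1, i))) =
            (\<lambda>i'. if i' \<in> B (Suc j1) then D j1 (single S i' \<one>\<^bsub>S\<^esub>) else (\<lambda>_. \<zero>\<^bsub>S\<^esub>))"
        proof (intro ext)
          fix i' i
          have "good W (Suc j1, i') (W (Suc j1, i'))" using IH x j Suc by simp
          then show "\<alpha> (W' (Suc j1, i') (j1, i)) =
            (if i' \<in> B (Suc j1) then D j1 (single S i' \<one>\<^bsub>S\<^esub>) else (\<lambda>_. \<zero>\<^bsub>S\<^esub>)) i"
            using Suc by (auto simp: W'_def below_def good_def \<alpha>_zero)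
        qed
        have ru: "(\<lambda>i'. \<alpha> (u (Suc j1, i'))) = D (Suc j1) (single S i \<one>\<^bsub>S\<^esub>)"
          using u Suc by auto
        have mem: "D (Suc j1) (single S i \<one>\<^bsub>S\<^esub>) \<in> carrier (free_module S (B (Suc j1)))"
          using lin_maps_mem[OF D one] Suc by simp
        have "\<alpha> (bd W' u (j1, i')) = \<zero>\<^bsub>S\<^esub>" for i'
          using \<alpha>_bd[OF W', of u j1 i'] u(1) Suc S.lin_map_comb[OF D mem] DD[of _ j1] one
          by (simp add: mat ru)
        then obtain g where g: "g \<in> homog B (Suc j1)" "bd W' g = bd W' u" "\<And>i. g (Suc j1, i) = \<zero>"
          using acyclic[OF W' bu bd_bd[OF W' u(1)]] by blast
        let ?w = "\<lambda>c. u c \<oplus> \<ominus> g c"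
        have uv: "u \<in> vectors B" and gv: "g \<in> vectors B"
          using homog_vectors[OF u(1)] homog_vectors[OF g(1)] by simp_all
        have "bd W' ?w = (\<lambda>_. \<zero>)"
          using bd_add[OF W' uv free_module_uminus[OF gv]] bd_uminus[OF W' gv] g(2)
            vectors_carrier[OF bd_vectors[OF W' uv]] by (simp add: r_neg)
        moreover have "?w \<in> homog B j0"
          using u g Suc by (intro homog_add homog_uminus) auto
        moreover have "\<alpha> (?w (j0, i')) = D j0 (single S i \<one>\<^bsub>S\<^esub>) i'" for i'
          using u g(3)[of i'] Suc vectors_carrier[OF uv] by simp
        ultimately show ?thesis by blast
      qed
      then show ?thesis using i by (auto simp: good_def x j W'_def)
    qed
  qed
  then obtain W where W: "\<And>e. good W e (W e)" by blast
  have "semifree B W"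
    unfolding semifree_def
  proof (intro conjI allI)
    fix i show "W (0, i) = (\<lambda>_. \<zero>)"
      using W[of "(0, i)"] by (simp add: good_def)
  next
    fix j i
    show h: "W (Suc j, i) \<in> homog B j" using good_homog W by blast
    have "bd (below (Suc j) W) (W (Suc j, i)) = (\<lambda>_. \<zero>)"
      using W[of "(Suc j, i)"] by (auto simp: good_def bd_zero split: if_splits)
    moreover have "comb A W (W (Suc j, i)) c = comb A (below (Suc j) W) (W (Suc j, i)) c" for c
    proof (rule comb_cong)
      fix e assume "W (Suc j, i) e \<noteq> \<zero>"
      then have "fst e \<le> j" using homog_above[OF h, of "fst e" "snd e"] by (cases "fst e \<le> j") auto
      then show "W e c = below (Suc j) W e c" by (simp add: below_def)
    qed (use vectors_carrier[OF homog_vectors[OF h]] vectors_carrier[OF good_vec[OF W]] in auto)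
    ultimately show "bd W (W (Suc j, i)) = (\<lambda>_. \<zero>)"
      by (simp add: bd_def)
  qed
  moreover have "\<alpha> (W (Suc j, i) (j, i')) = (if i \<in> B (Suc j) then D j (single S i \<one>\<^bsub>S\<^esub>) i' else \<zero>\<^bsub>S\<^esub>)"
    for j i i'
    using W[of "(Suc j, i)"] by (auto simp: good_def \<alpha>_zero)
  ultimately have "lifts B D W"
    by (simp add: lifts_def)
  then show thesis by (rule that)
qed

end

section \<open>Signs of products of monomials\<close>

lemma gc_monos_subset: "a \<subseteq># m \<Longrightarrow> m \<in> gc_monos X vdeg \<Longrightarrow> a \<in> gc_monos X vdeg"
  unfolding gc_monos_def mem_Collect_eq by (meson mset_subset_eq_count order_trans set_mset_mono)

lemma gc_monos_add_left: "a + b \<in> gc_monos X vdeg \<Longrightarrow> a \<in> gc_monos X vdeg"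
  by (rule gc_monos_subset) auto

lemma gc_monos_add_right: "a + b \<in> gc_monos X vdeg \<Longrightarrow> b \<in> gc_monos X vdeg"
  by (rule gc_monos_subset) auto

lemma gc_monos_odd_disjoint:
  "a + b \<in> gc_monos X vdeg \<Longrightarrow> odd (vdeg x) \<Longrightarrow> x \<in># a \<Longrightarrow> x \<notin># b"
proof
  assume "a + b \<in> gc_monos X vdeg" "odd (vdeg x)" "x \<in># a" "x \<in># b"
  then have "count a x + count b x \<le> 1" "count a x > 0" "count b x > 0"
    by (auto simp: gc_monos_def)
  then show False by simp
qed

lemma gc_monos_add_mset:
  "add_mset x m \<in> gc_monos X vdeg \<longleftrightarrow> x \<in> X \<and> m \<in> gc_monos X vdeg \<and> (odd (vdeg x) \<longrightarrow> x \<notin># m)"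
proof -
  have "(\<forall>y. odd (vdeg y) \<longrightarrow> count (add_mset x m) y \<le> 1) \<longleftrightarrow>
      (\<forall>y. odd (vdeg y) \<longrightarrow> count m y \<le> 1) \<and> (odd (vdeg x) \<longrightarrow> x \<notin># m)"
  proof (intro iffI conjI allI impI)
    fix y assume *: "\<forall>y. odd (vdeg y) \<longrightarrow> count (add_mset x m) y \<le> 1"
    show "odd (vdeg y) \<Longrightarrow> count m y \<le> 1" using *[rule_format, of y] by (simp split: if_splits)
  next
    assume *: "\<forall>y. odd (vdeg y) \<longrightarrow> count (add_mset x m) y \<le> 1"
    show "odd (vdeg x) \<Longrightarrow> x \<notin># m" using *[rule_format, of x] by (simp add: not_in_iff)
  qed (auto simp: not_in_iff)
  then show ?thesis by (auto simp: gc_monos_def)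
qed

definition odd_vars :: "('x \<Rightarrow> nat) \<Rightarrow> 'x multiset \<Rightarrow> 'x set" where
  "odd_vars vdeg m = {x. x \<in># m \<and> odd (vdeg x)}"

lemma finite_odd_vars [simp]: "finite (odd_vars vdeg m)"
  by (rule finite_subset[of _ "set_mset m"]) (auto simp: odd_vars_def)

lemma inversions_odd_vars:
  "inversions vdeg a b = card {(x, y). x \<in> odd_vars vdeg a \<and> y \<in> odd_vars vdeg b \<and> y < x}"
  unfolding inversions_def odd_vars_def by (rule arg_cong[where f = card]) auto

lemma finite_inversions: "finite {(x, y). x \<in> odd_vars vdeg a \<and> y \<in> odd_vars vdeg b \<and> y < x}"
  by (rule finite_subset[of _ "odd_vars vdeg a \<times> odd_vars vdeg b"]) auto

lemma odd_vars_disjoint: "a + b \<in> gc_monos X vdeg \<Longrightarrow> odd_vars vdeg a \<inter> odd_vars vdeg b = {}"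
  using gc_monos_odd_disjoint by (force simp: odd_vars_def)

lemma odd_vars_add: "odd_vars vdeg (a + b) = odd_vars vdeg a \<union> odd_vars vdeg b"
  by (auto simp: odd_vars_def)

lemma inversions_add_left:
  assumes "a + b \<in> gc_monos X vdeg"
  shows "inversions vdeg (a + b) c = inversions vdeg a c + inversions vdeg b c"
proof -
  have "{(x, y). x \<in> odd_vars vdeg (a + b) \<and> y \<in> odd_vars vdeg c \<and> y < x} =
      {(x, y). x \<in> odd_vars vdeg a \<and> y \<in> odd_vars vdeg c \<and> y < x} \<union>
      {(x, y). x \<in> odd_vars vdeg b \<and> y \<in> odd_vars vdeg c \<and> y < x}"
    by (auto simp: odd_vars_add)
  then show ?thesis
    unfolding inversions_odd_vars
    using odd_vars_disjoint[OF assms] finite_inversions by (auto intro!: card_Un_disjoint)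
qed

lemma inversions_add_right:
  assumes "b + c \<in> gc_monos X vdeg"
  shows "inversions vdeg a (b + c) = inversions vdeg a b + inversions vdeg a c"
proof -
  have "{(x, y). x \<in> odd_vars vdeg a \<and> y \<in> odd_vars vdeg (b + c) \<and> y < x} =
      {(x, y). x \<in> odd_vars vdeg a \<and> y \<in> odd_vars vdeg b \<and> y < x} \<union>
      {(x, y). x \<in> odd_vars vdeg a \<and> y \<in> odd_vars vdeg c \<and> y < x}"
    by (auto simp: odd_vars_add)
  then show ?thesis
    unfolding inversions_odd_vars
    using odd_vars_disjoint[OF assms] finite_inversions by (auto intro!: card_Un_disjoint)
qed

text \<open>Of the two orders of a pair of distinct odd variables, exactly one is an inversion.\<close>

lemma inversions_swap:
  assumes "a + b \<in> gc_monos X vdeg"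
  shows "inversions vdeg a b + inversions vdeg b a = card (odd_vars vdeg a) * card (odd_vars vdeg b)"
proof -
  let ?P = "{(x, y). x \<in> odd_vars vdeg a \<and> y \<in> odd_vars vdeg b \<and> y < x}"
  let ?Q = "{(x, y). x \<in> odd_vars vdeg b \<and> y \<in> odd_vars vdeg a \<and> y < x}"
  have "card ?Q = card (prod.swap ` ?Q)"
    by (rule card_image[symmetric]) (auto simp: inj_on_def)
  moreover have "prod.swap ` ?Q = {(x, y). x \<in> odd_vars vdeg a \<and> y \<in> odd_vars vdeg b \<and> x < y}"
    by (auto simp: image_iff)
  moreover have "?P \<union> {(x, y). x \<in> odd_vars vdeg a \<and> y \<in> odd_vars vdeg b \<and> x < y} =
      odd_vars vdeg a \<times> odd_vars vdeg b"
    using odd_vars_disjoint[OF assms] by (auto simp: disjoint_iff) (metis linorder_neqE)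
  moreover have "finite {(x, y). x \<in> odd_vars vdeg a \<and> y \<in> odd_vars vdeg b \<and> x < y}"
    by (rule finite_subset[of _ "odd_vars vdeg a \<times> odd_vars vdeg b"]) auto
  moreover have "?P \<inter> {(x, y). x \<in> odd_vars vdeg a \<and> y \<in> odd_vars vdeg b \<and> x < y} = {}"
    by auto
  ultimately have "card ?P + card ?Q = card (odd_vars vdeg a \<times> odd_vars vdeg b)"
    using card_Un_disjoint[OF finite_inversions[of vdeg a b],
      of "{(x, y). x \<in> odd_vars vdeg a \<and> y \<in> odd_vars vdeg b \<and> x < y}"] by simp
  then show ?thesis
    unfolding inversions_odd_vars card_cartesian_product .
qed

lemma gc_deg_add: "gc_deg vdeg (a + b) = gc_deg vdeg a + gc_deg vdeg b"
  by (simp add: gc_deg_def)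

lemma gc_deg_add_mset: "gc_deg vdeg (add_mset x m) = vdeg x + gc_deg vdeg m"
  by (simp add: gc_deg_def)

lemma even_gc_deg: "m \<in> gc_monos X vdeg \<Longrightarrow> even (gc_deg vdeg m) = even (card (odd_vars vdeg m))"
proof (induction m)
  case empty
  then show ?case by (simp add: gc_deg_def odd_vars_def)
next
  case (add x m)
  then have "m \<in> gc_monos X vdeg" "odd (vdeg x) \<Longrightarrow> x \<notin> odd_vars vdeg m"
    by (auto simp: gc_monos_add_mset odd_vars_def)
  moreover have "odd_vars vdeg (add_mset x m) =
      (if odd (vdeg x) then insert x (odd_vars vdeg m) else odd_vars vdeg m)"
    by (auto simp: odd_vars_def)
  ultimately show ?case
    using add.IH by (auto simp: gc_deg_add_mset)
qed

lemma even_inversions_swap: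
  assumes "a + b \<in> gc_monos X vdeg"
  shows "even (inversions vdeg a b) = (even (inversions vdeg b a) = even (gc_deg vdeg a * gc_deg vdeg b))"
proof -
  have "even (inversions vdeg a b + inversions vdeg b a) = even (gc_deg vdeg a * gc_deg vdeg b)"
    using inversions_swap[OF assms] even_gc_deg[OF gc_monos_add_left[OF assms]]
      even_gc_deg[OF gc_monos_add_right[OF assms]] by simp
  then show ?thesis by auto
qed

lemma inversions_even_left: "even (vdeg x) \<Longrightarrow> inversions vdeg {#x#} m = 0"
proof -
  assume "even (vdeg x)"
  then have "{(x', y). x' \<in># {#x#} \<and> y \<in># m \<and> odd (vdeg x') \<and> odd (vdeg y) \<and> y < x'} = {}"
    by auto
  then show ?thesis by (simp only: inversions_def card.empty)
qed

lemma inversions_add_even: "even (vdeg x) \<Longrightarrow> inversions vdeg (add_mset x a) b = inversions vdeg a b"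
  unfolding inversions_odd_vars odd_vars_def
  by (auto intro!: arg_cong[where f = card])

lemma inversions_empty [simp]: "inversions vdeg {#} m = 0" "inversions vdeg m {#} = 0"
  by (simp_all add: inversions_def)

section \<open>The ring structure of the free strictly graded commutative algebra\<close>

lemma gc_algebra_simps [simp]:
  "carrier (gc_algebra R X vdeg) = carrier (free_module R (gc_monos X vdeg))"
  "zero (gc_algebra R X vdeg) = (\<lambda>_. \<zero>\<^bsub>R\<^esub>)"
  "add (gc_algebra R X vdeg) f g = (\<lambda>m. f m \<oplus>\<^bsub>R\<^esub> g m)"
  "smult (gc_algebra R X vdeg) r f = (\<lambda>m. r \<otimes>\<^bsub>R\<^esub> f m)"
  by (simp_all add: gc_algebra_def free_module_def)

lemma gc_one: "one (gc_algebra R X vdeg) = single R {#} \<one>\<^bsub>R\<^esub>"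
  by (auto simp: gc_algebra_def single_def)

lemma gc_var_single: "gc_var R x = single R {#x#} \<one>\<^bsub>R\<^esub>"
  by (auto simp: gc_var_def single_def)

lemma gc_const_single: "gc_const R r = single R {#} r"
  by (auto simp: gc_const_def single_def)

lemma finite_submultisets: "finite {a. a \<subseteq># m}"
proof (induction m)
  case empty
  then show ?case by simp
next
  case (add x m)
  have "{a. a \<subseteq># add_mset x m} \<subseteq> {a. a \<subseteq># m} \<union> add_mset x ` {a. a \<subseteq># m}"
  proof
    fix a assume "a \<in> {a. a \<subseteq># add_mset x m}"
    then show "a \<in> {a. a \<subseteq># m} \<union> add_mset x ` {a. a \<subseteq># m}"
    proof (cases "x \<in># a")
      case True
      then show ?thesis using \<open>a \<in> _\<close> by (auto dest!: multi_member_split)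
    next
      case False
      have "count a y \<le> count m y" for y
        using False \<open>a \<in> _\<close> mset_subset_eq_count[of a "add_mset x m" y]
        by (cases "y = x") (auto simp: not_in_iff)
      then have "a \<subseteq># m" by (simp add: subseteq_mset_def)
      then show ?thesis by simp
    qed
  qed
  then show ?case using add finite_subset by fastforce
qed

context cring
begin

lemma single_zero: "single R i \<zero> = (\<lambda>_. \<zero>)"
  by (auto simp: single_def)

lemma gc_mult:
  "(f \<otimes>\<^bsub>gc_algebra R X vdeg\<^esub> g) m = (if m \<in> gc_monos X vdeg
     then \<Oplus>a\<in>{a. a \<subseteq># m}. signed R (inversions vdeg a (m - a)) (f a \<otimes> g (m - a)) else \<zero>)"
  by (simp add: gc_algebra_def)

lemma signed_cong: "even m = even n \<Longrightarrow> signed R m a = signed R n a"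
  by (simp add: signed_def)

lemma gc_mult_single:
  assumes "r \<in> carrier R" "s \<in> carrier R"
  shows "single R a r \<otimes>\<^bsub>gc_algebra R X vdeg\<^esub> single R b s =
    (if a + b \<in> gc_monos X vdeg then single R (a + b) (signed R (inversions vdeg a b) (r \<otimes> s)) else (\<lambda>_. \<zero>))"
proof
  fix m
  show "(single R a r \<otimes>\<^bsub>gc_algebra R X vdeg\<^esub> single R b s) m = (if a + b \<in> gc_monos X vdeg
      then single R (a + b) (signed R (inversions vdeg a b) (r \<otimes> s)) else (\<lambda>_. \<zero>)) m"
  proof (cases "m \<in> gc_monos X vdeg")
    case True
    let ?t = "\<lambda>a'. signed R (inversions vdeg a' (m - a')) (single R a r a' \<otimes> single R b s (m - a'))"
    have "(single R a r \<otimes>\<^bsub>gc_algebra R X vdeg\<^esub> single R b s) m = (\<Oplus>a'\<in>{a. a \<subseteq># m}. ?t a')"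
      using True by (simp add: gc_mult)
    also have "\<dots> = (\<Oplus>a'\<in>{a'. a' = a \<and> m = a + b}. ?t a')"
      using assms finite_submultisets
      by (intro add.finprod_mono_neutral_cong_right) (auto simp: single_def)
    also have "\<dots> = (if m = a + b then signed R (inversions vdeg a b) (r \<otimes> s) else \<zero>)"
    proof (cases "m = a + b")
      case True
      then have "{a'. a' = a \<and> m = a + b} = {a}" by auto
      then show ?thesis using True assms by (simp add: single_def)
    next
      case False
      then have "{a'. a' = a \<and> m = a + b} = {}" by auto
      then show ?thesis using False by simp
    qed
    finally show ?thesis using True by (auto simp: single_def)
  next
    case False
    then show ?thesis by (auto simp: gc_mult single_def)
  qed
qed

lemma gc_l_distr:
  assumes "f \<in> carrier (gc_algebra R X vdeg)" "g \<in> carrier (gc_algebra R X vdeg)" "h \<in> carrier (gc_algebra R X vdeg)"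
  shows "(\<lambda>m. f m \<oplus> g m) \<otimes>\<^bsub>gc_algebra R X vdeg\<^esub> h =
    (\<lambda>m. (f \<otimes>\<^bsub>gc_algebra R X vdeg\<^esub> h) m \<oplus> (g \<otimes>\<^bsub>gc_algebra R X vdeg\<^esub> h) m)"
proof
  fix m
  have c: "f a \<in> carrier R" "g a \<in> carrier R" "h a \<in> carrier R" for a
    using assms by (auto simp: mem_free_module)
  have "(\<Oplus>a\<in>{a. a \<subseteq># m}. signed R (inversions vdeg a (m - a)) ((f a \<oplus> g a) \<otimes> h (m - a))) =
    (\<Oplus>a\<in>{a. a \<subseteq># m}. signed R (inversions vdeg a (m - a)) (f a \<otimes> h (m - a)) \<oplus>
      signed R (inversions vdeg a (m - a)) (g a \<otimes> h (m - a)))"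
    using c by (intro finsum_cong') (auto simp: l_distr signed_add)
  also have "\<dots> = (\<Oplus>a\<in>{a. a \<subseteq># m}. signed R (inversions vdeg a (m - a)) (f a \<otimes> h (m - a))) \<oplus>
      (\<Oplus>a\<in>{a. a \<subseteq># m}. signed R (inversions vdeg a (m - a)) (g a \<otimes> h (m - a)))"
    using c by (intro finsum_addf) auto
  finally show "((\<lambda>m. f m \<oplus> g m) \<otimes>\<^bsub>gc_algebra R X vdeg\<^esub> h) m =
      (f \<otimes>\<^bsub>gc_algebra R X vdeg\<^esub> h) m \<oplus> (g \<otimes>\<^bsub>gc_algebra R X vdeg\<^esub> h) m"
    by (simp add: gc_mult)
qed

lemma gc_r_distr:
  assumes "f \<in> carrier (gc_algebra R X vdeg)" "g \<in> carrier (gc_algebra R X vdeg)" "h \<in> carrier (gc_algebra R X vdeg)"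
  shows "h \<otimes>\<^bsub>gc_algebra R X vdeg\<^esub> (\<lambda>m. f m \<oplus> g m) =
    (\<lambda>m. (h \<otimes>\<^bsub>gc_algebra R X vdeg\<^esub> f) m \<oplus> (h \<otimes>\<^bsub>gc_algebra R X vdeg\<^esub> g) m)"
proof
  fix m
  have c: "f a \<in> carrier R" "g a \<in> carrier R" "h a \<in> carrier R" for a
    using assms by (auto simp: mem_free_module)
  have "(\<Oplus>a\<in>{a. a \<subseteq># m}. signed R (inversions vdeg a (m - a)) (h a \<otimes> (f (m - a) \<oplus> g (m - a)))) =
    (\<Oplus>a\<in>{a. a \<subseteq># m}. signed R (inversions vdeg a (m - a)) (h a \<otimes> f (m - a)) \<oplus>
      signed R (inversions vdeg a (m - a)) (h a \<otimes> g (m - a)))"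
    using c by (intro finsum_cong') (auto simp: r_distr signed_add)
  also have "\<dots> = (\<Oplus>a\<in>{a. a \<subseteq># m}. signed R (inversions vdeg a (m - a)) (h a \<otimes> f (m - a))) \<oplus>
      (\<Oplus>a\<in>{a. a \<subseteq># m}. signed R (inversions vdeg a (m - a)) (h a \<otimes> g (m - a)))"
    using c by (intro finsum_addf) auto
  finally show "(h \<otimes>\<^bsub>gc_algebra R X vdeg\<^esub> (\<lambda>m. f m \<oplus> g m)) m =
      (h \<otimes>\<^bsub>gc_algebra R X vdeg\<^esub> f) m \<oplus> (h \<otimes>\<^bsub>gc_algebra R X vdeg\<^esub> g) m"
    by (simp add: gc_mult)
qed

lemma gc_mult_zero_left: "(\<lambda>_. \<zero>) \<otimes>\<^bsub>gc_algebra R X vdeg\<^esub> g = (\<lambda>_. \<zero>)"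
  if "g \<in> carrier (gc_algebra R X vdeg)"
proof
  fix m
  have "(\<Oplus>a\<in>{a. a \<subseteq># m}. signed R (inversions vdeg a (m - a)) (\<zero> \<otimes> g (m - a))) = \<zero>"
    by (rule add.finprod_one_eqI) (use that in \<open>auto simp: mem_free_module\<close>)
  then show "((\<lambda>_. \<zero>) \<otimes>\<^bsub>gc_algebra R X vdeg\<^esub> g) m = \<zero>"
    by (simp add: gc_mult)
qed

lemma gc_mult_zero_right: "f \<otimes>\<^bsub>gc_algebra R X vdeg\<^esub> (\<lambda>_. \<zero>) = (\<lambda>_. \<zero>)"
  if "f \<in> carrier (gc_algebra R X vdeg)"
proof
  fix m
  have "(\<Oplus>a\<in>{a. a \<subseteq># m}. signed R (inversions vdeg a (m - a)) (f a \<otimes> \<zero>)) = \<zero>"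
    by (rule add.finprod_one_eqI) (use that in \<open>auto simp: mem_free_module\<close>)
  then show "(f \<otimes>\<^bsub>gc_algebra R X vdeg\<^esub> (\<lambda>_. \<zero>)) m = \<zero>"
    by (simp add: gc_mult)
qed

lemma gc_mult_closed:
  assumes f: "f \<in> carrier (gc_algebra R X vdeg)" and g: "g \<in> carrier (gc_algebra R X vdeg)"
  shows "f \<otimes>\<^bsub>gc_algebra R X vdeg\<^esub> g \<in> carrier (gc_algebra R X vdeg)"
  using f[simplified]
proof (induction rule: free_module_induct)
  case zero
  then show ?case using gc_mult_zero_left[OF g] free_module_zero by simp
next
  case (add f f')
  then show ?case using gc_l_distr[of f X vdeg f' g] g free_module_add by simp
next
  case (single a)
  have sc: "single R a (f a) \<in> carrier (gc_algebra R X vdeg)" using single single_mem by simp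
  from g[simplified] show ?case
  proof (induction rule: free_module_induct)
    case zero
    then show ?case using gc_mult_zero_right[OF sc] free_module_zero by simp
  next
    case (add g g')
    then show ?case using gc_r_distr[of g X vdeg g' "single R a (f a)"] sc free_module_add by simp
  next
    case (single b)
    then show ?case
      using gc_mult_single[of "f a" "g b" X vdeg a b] \<open>f a \<in> carrier R\<close>
      by (auto intro!: single_mem free_module_zero)
  qed
qed

text \<open>Both sides have the sign of the inversions of the pairs \<open>a, b\<close> and \<open>a, c\<close> and \<open>b, c\<close>, because the
  number of inversions is additive.\<close>

lemma gc_assoc_single:
  assumes "r \<in> carrier R" "s \<in> carrier R" "t \<in> carrier R"
  shows "(single R a r \<otimes>\<^bsub>gc_algebra R X vdeg\<^esub> single R b s) \<otimes>\<^bsub>gc_algebra R X vdeg\<^esub> single R c t =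
    single R a r \<otimes>\<^bsub>gc_algebra R X vdeg\<^esub> (single R b s \<otimes>\<^bsub>gc_algebra R X vdeg\<^esub> single R c t)"
proof (cases "a + b + c \<in> gc_monos X vdeg")
  case True
  then have T: "a + b \<in> gc_monos X vdeg" "b + c \<in> gc_monos X vdeg"
    using gc_monos_add_left[of "a + b" c] gc_monos_add_right[of a "b + c"] by (auto simp: add.assoc)
  then show ?thesis
    using True assms
    by (simp add: gc_mult_single add.assoc signed_rmult signed_lmult signed_signed m_assoc
      inversions_add_left[OF T(1)] inversions_add_right[OF T(2)] ac_simps)
next
  case False
  have z1: "(\<lambda>_. \<zero>) \<otimes>\<^bsub>gc_algebra R X vdeg\<^esub> single R c t = (\<lambda>_. \<zero>)"
  proof -
    show ?thesis using gc_mult_single[of \<zero> t X vdeg c c] assms by (simp add: single_zero)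
  qed
  have z2: "single R a r \<otimes>\<^bsub>gc_algebra R X vdeg\<^esub> (\<lambda>_. \<zero>) = (\<lambda>_. \<zero>)"
  proof -
    show ?thesis using gc_mult_single[of r \<zero> X vdeg a a] assms by (simp add: single_zero)
  qed
  show ?thesis
    using False z1 z2 assms by (simp add: gc_mult_single add.assoc)
qed

lemma gc_assoc:
  assumes f: "f \<in> carrier (gc_algebra R X vdeg)" and g: "g \<in> carrier (gc_algebra R X vdeg)"
    and h: "h \<in> carrier (gc_algebra R X vdeg)"
  shows "(f \<otimes>\<^bsub>gc_algebra R X vdeg\<^esub> g) \<otimes>\<^bsub>gc_algebra R X vdeg\<^esub> h =
    f \<otimes>\<^bsub>gc_algebra R X vdeg\<^esub> (g \<otimes>\<^bsub>gc_algebra R X vdeg\<^esub> h)"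
  using f[simplified]
proof (induction rule: free_module_induct)
  case zero
  then show ?case using gc_mult_zero_left[OF g] gc_mult_zero_left[OF h] gc_mult_zero_left[OF gc_mult_closed[OF g h]]
    by simp
next
  case (add f f')
  then show ?case
    using gc_l_distr[of f X vdeg f' g] gc_l_distr[of f X vdeg f' "g \<otimes>\<^bsub>gc_algebra R X vdeg\<^esub> h"]
      gc_l_distr[of "f \<otimes>\<^bsub>gc_algebra R X vdeg\<^esub> g" X vdeg "f' \<otimes>\<^bsub>gc_algebra R X vdeg\<^esub> g" h]
      gc_mult_closed[of _ X vdeg] g h by simp
next
  case (single a)
  then have sc: "single R a (f a) \<in> carrier (gc_algebra R X vdeg)" "f a \<in> carrier R" using single_mem by auto
  from g[simplified] show ?case
  proof (induction rule: free_module_induct)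
    case zero
    then show ?case using gc_mult_zero_right[OF sc(1)] gc_mult_zero_left[OF h] by simp
  next
    case (add g g')
    then show ?case
      using gc_r_distr[of g X vdeg g' "single R a (f a)"] gc_l_distr[of g X vdeg g' h]
        gc_r_distr[of "g \<otimes>\<^bsub>gc_algebra R X vdeg\<^esub> h" X vdeg "g' \<otimes>\<^bsub>gc_algebra R X vdeg\<^esub> h" "single R a (f a)"]
        gc_l_distr[of "single R a (f a) \<otimes>\<^bsub>gc_algebra R X vdeg\<^esub> g" X vdeg
          "single R a (f a) \<otimes>\<^bsub>gc_algebra R X vdeg\<^esub> g'" h]
        gc_mult_closed[of _ X vdeg] h sc by simp
  next
    case (single b)
    then have sb: "single R b (g b) \<in> carrier (gc_algebra R X vdeg)" "g b \<in> carrier R" using single_mem by auto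
    from h[simplified] show ?case
    proof (induction rule: free_module_induct)
      case zero
      then show ?case
        using gc_mult_zero_right[OF gc_mult_closed[OF sc(1) sb(1)]] gc_mult_zero_right[OF sb(1)]
          gc_mult_zero_right[OF sc(1)] by simp
    next
      case (add h h')
      then show ?case
        using gc_r_distr[of h X vdeg h' "single R a (f a) \<otimes>\<^bsub>gc_algebra R X vdeg\<^esub> single R b (g b)"]
          gc_r_distr[of h X vdeg h' "single R b (g b)"]
          gc_r_distr[of "single R b (g b) \<otimes>\<^bsub>gc_algebra R X vdeg\<^esub> h" X vdeg
            "single R b (g b) \<otimes>\<^bsub>gc_algebra R X vdeg\<^esub> h'" "single R a (f a)"]
          gc_mult_closed[of _ X vdeg] sc sb by simp
    next
      case (single c)
      then show ?case by (intro gc_assoc_single sc(2) sb(2))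
    qed
  qed
qed

lemma gc_mult_const_left:
  assumes r: "r \<in> carrier R" and f: "f \<in> carrier (gc_algebra R X vdeg)"
  shows "single R {#} r \<otimes>\<^bsub>gc_algebra R X vdeg\<^esub> f = (\<lambda>m. r \<otimes> f m)"
  using f[simplified]
proof (induction rule: free_module_induct)
  case zero
  have "single R {#} r \<in> carrier (gc_algebra R X vdeg)"
    using single_mem[of "{#}" "gc_monos X vdeg" r] r by (simp add: gc_monos_def)
  then show ?case using gc_mult_zero_right r by simp
next
  case (add g h)
  have "single R {#} r \<in> carrier (gc_algebra R X vdeg)"
    using single_mem[of "{#}" "gc_monos X vdeg" r] r by (simp add: gc_monos_def)
  then show ?case using gc_r_distr[of g X vdeg h] add r by (auto simp: r_distr mem_free_module)
next
  case (single m)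
  then have "single R {#} r \<otimes>\<^bsub>gc_algebra R X vdeg\<^esub> single R m (f m) = single R m (r \<otimes> f m)"
    using r by (simp add: gc_mult_single signed_def)
  then show ?case using r by (simp add: single_def fun_eq_iff)
qed

lemma gc_mult_const_right:
  assumes r: "r \<in> carrier R" and f: "f \<in> carrier (gc_algebra R X vdeg)"
  shows "f \<otimes>\<^bsub>gc_algebra R X vdeg\<^esub> single R {#} r = (\<lambda>m. f m \<otimes> r)"
  using f[simplified]
proof (induction rule: free_module_induct)
  case zero
  have "single R {#} r \<in> carrier (gc_algebra R X vdeg)"
    using single_mem[of "{#}" "gc_monos X vdeg" r] r by (simp add: gc_monos_def)
  then show ?case using gc_mult_zero_left r by simp
next
  case (add g h)
  have "single R {#} r \<in> carrier (gc_algebra R X vdeg)"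
    using single_mem[of "{#}" "gc_monos X vdeg" r] r by (simp add: gc_monos_def)
  then show ?case using gc_l_distr[of g X vdeg h] add r by (auto simp: l_distr mem_free_module)
next
  case (single m)
  then have "single R m (f m) \<otimes>\<^bsub>gc_algebra R X vdeg\<^esub> single R {#} r = single R m (f m \<otimes> r)"
    using r by (simp add: gc_mult_single signed_def)
  then show ?case using r by (simp add: single_def fun_eq_iff)
qed

lemma gc_abelian_group: "abelian_group (gc_algebra R X vdeg)"
proof -
  have "add_monoid (gc_algebra R X vdeg) = add_monoid (free_module R (gc_monos X vdeg))"
    by (simp add: gc_algebra_def)
  then show ?thesis
    using free_module_abelian_group[of "gc_monos X vdeg"]
    by (simp add: abelian_group_def abelian_monoid_def abelian_group_axioms_def)
qed

lemma gc_ring: "ring (gc_algebra R X vdeg)"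
proof (rule ringI)
  have one: "single R {#} \<one> \<in> carrier (gc_algebra R X vdeg)"
    using single_mem[of "{#}" "gc_monos X vdeg" \<one>] by (simp add: gc_monos_def)
  show "Group.monoid (gc_algebra R X vdeg)"
    using one gc_mult_closed[of _ X vdeg] gc_assoc[of _ X vdeg]
      gc_mult_const_left[OF one_closed, of _ X vdeg] gc_mult_const_right[OF one_closed, of _ X vdeg]
    by (intro monoidI) (auto simp: gc_one mem_free_module)
qed (use gc_abelian_group gc_l_distr gc_r_distr in auto)

lemma gc_uminus:
  assumes "f \<in> carrier (gc_algebra R X vdeg)"
  shows "\<ominus>\<^bsub>gc_algebra R X vdeg\<^esub> f = (\<lambda>m. \<ominus> f m)"
proof -
  interpret A: ring "gc_algebra R X vdeg" by (rule gc_ring)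
  show ?thesis
    using assms free_module_uminus[of f]
    by (intro A.minus_equality) (auto simp: mem_free_module l_neg)
qed

lemma gc_signed:
  "f \<in> carrier (gc_algebra R X vdeg) \<Longrightarrow> signed (gc_algebra R X vdeg) n f = (\<lambda>m. signed R n (f m))"
  by (cases "even n") (simp_all add: signed_def gc_uminus)

end

section \<open>Grading and partial derivatives\<close>

text \<open>The partial derivative moves a factor \<open>x\<close> to the front of each monomial and deletes it. A
  monomial with \<open>n\<close> factors \<open>x\<close>, where \<open>n \<le> 1\<close> unless \<open>x\<close> is even, offers \<open>n\<close> choices of this factor.\<close>

definition pd :: "('a, 'm) ring_scheme \<Rightarrow> ('x::linorder \<Rightarrow> nat) \<Rightarrow> 'x \<Rightarrow> ('x multiset \<Rightarrow> 'a) \<Rightarrow> 'x multiset \<Rightarrow> 'a" where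
  "pd R vdeg x f = (\<lambda>m. signed R (inversions vdeg {#x#} m) (add_pow R (Suc (count m x)) (f (add_mset x m))))"

context cring
begin

lemma gc_comp_carrier: "f \<in> gc_comp R X vdeg n \<Longrightarrow> f \<in> carrier (gc_algebra R X vdeg)"
  by (simp add: gc_comp_def)

lemma gc_comp_deg: "f \<in> gc_comp R X vdeg n \<Longrightarrow> f m \<noteq> \<zero> \<Longrightarrow> gc_deg vdeg m = n"
  by (simp add: gc_comp_def)

lemma gc_comp_zero: "(\<lambda>_. \<zero>) \<in> gc_comp R X vdeg n"
  by (simp add: gc_comp_def free_module_zero)

lemma gc_comp_add:
  assumes "f \<in> gc_comp R X vdeg n" "g \<in> gc_comp R X vdeg n"
  shows "(\<lambda>m. f m \<oplus> g m) \<in> gc_comp R X vdeg n"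
proof -
  have "gc_deg vdeg m = n" if "f m \<oplus> g m \<noteq> \<zero>" for m
  proof (cases "f m = \<zero>")
    case True
    then have "g m \<noteq> \<zero>" using that by auto
    then show ?thesis by (rule gc_comp_deg[OF assms(2)])
  next
    case False
    then show ?thesis by (rule gc_comp_deg[OF assms(1)])
  qed
  then show ?thesis
    using assms free_module_add[of f "gc_monos X vdeg" g] by (simp add: gc_comp_def)
qed

lemma gc_comp_uminus:
  "f \<in> gc_comp R X vdeg n \<Longrightarrow> \<ominus>\<^bsub>gc_algebra R X vdeg\<^esub> f \<in> gc_comp R X vdeg n"
proof -
  assume f: "f \<in> gc_comp R X vdeg n"
  have "\<ominus>\<^bsub>gc_algebra R X vdeg\<^esub> f = (\<lambda>m. \<ominus> f m)"
    by (rule gc_uminus[OF gc_comp_carrier[OF f]])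
  then show ?thesis
    using f free_module_uminus[of f "gc_monos X vdeg"] by (force simp: gc_comp_def)
qed

lemma gc_comp_single:
  "m \<in> gc_monos X vdeg \<Longrightarrow> r \<in> carrier R \<Longrightarrow> single R m r \<in> gc_comp R X vdeg (gc_deg vdeg m)"
  using single_mem[of m "gc_monos X vdeg" r] by (auto simp: gc_comp_def single_def)

lemma gc_comp_mult:
  assumes f: "f \<in> gc_comp R X vdeg m" and g: "g \<in> gc_comp R X vdeg n"
  shows "f \<otimes>\<^bsub>gc_algebra R X vdeg\<^esub> g \<in> gc_comp R X vdeg (m + n)"
proof -
  have fc: "f a \<in> carrier R" "g a \<in> carrier R" for a
    using f g by (auto simp: gc_comp_def mem_free_module)
  have "gc_deg vdeg c = m + n" if nz: "(f \<otimes>\<^bsub>gc_algebra R X vdeg\<^esub> g) c \<noteq> \<zero>" for c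
  proof (rule ccontr)
    assume c: "gc_deg vdeg c \<noteq> m + n"
    have "(\<Oplus>a\<in>{a. a \<subseteq># c}. signed R (inversions vdeg a (c - a)) (f a \<otimes> g (c - a))) = \<zero>"
    proof (rule add.finprod_one_eqI)
      fix a assume "a \<in> {a. a \<subseteq># c}"
      then have "gc_deg vdeg a + gc_deg vdeg (c - a) = gc_deg vdeg c"
        using gc_deg_add[of vdeg a "c - a"] by simp
      then have "f a = \<zero> \<or> g (c - a) = \<zero>"
        using gc_comp_deg[OF f] gc_comp_deg[OF g] c by metis
      then show "signed R (inversions vdeg a (c - a)) (f a \<otimes> g (c - a)) = \<zero>"
        using fc by auto
    qed
    then show False using nz by (simp add: gc_mult split: if_splits)
  qed
  then show ?thesis
    using gc_mult_closed[OF gc_comp_carrier[OF f] gc_comp_carrier[OF g]] by (simp add: gc_comp_def)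
qed

lemma pd_closed: "(\<And>m. f m \<in> carrier R) \<Longrightarrow> pd R vdeg x f m \<in> carrier R"
  by (simp add: pd_def)

lemma pd_zero: "pd R vdeg x (\<lambda>_. \<zero>) = (\<lambda>_. \<zero>)"
  by (simp add: pd_def)

lemma pd_nonzero: "pd R vdeg x f m \<noteq> \<zero> \<Longrightarrow> f (add_mset x m) \<noteq> \<zero>"
  by (auto simp: pd_def)

lemma pd_mem:
  assumes f: "f \<in> carrier (gc_algebra R X vdeg)"
  shows "pd R vdeg x f \<in> carrier (gc_algebra R X vdeg)"
proof -
  have "{m. pd R vdeg x f m \<noteq> \<zero>} \<subseteq> (\<lambda>m. m - {#x#}) ` {m. f m \<noteq> \<zero>}"
  proof
    fix m assume "m \<in> {m. pd R vdeg x f m \<noteq> \<zero>}"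
    then have "add_mset x m \<in> {m. f m \<noteq> \<zero>}" using pd_nonzero by blast
    then show "m \<in> (\<lambda>m. m - {#x#}) ` {m. f m \<noteq> \<zero>}"
      by (rule rev_image_eqI) simp
  qed
  then have "finite {m. pd R vdeg x f m \<noteq> \<zero>}"
    by (rule finite_subset) (use f in \<open>auto simp: mem_free_module\<close>)
  moreover have "pd R vdeg x f m = \<zero>" if "m \<notin> gc_monos X vdeg" for m
  proof -
    have "f (add_mset x m) = \<zero>" using f that by (auto simp: mem_free_module gc_monos_add_mset)
    then show ?thesis using pd_nonzero by blast
  qed
  ultimately show ?thesis
    using f pd_closed[of f] by (auto simp: mem_free_module)
qed

lemma pd_add:
  assumes "f \<in> carrier (gc_algebra R X vdeg)" "g \<in> carrier (gc_algebra R X vdeg)"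
  shows "pd R vdeg x (\<lambda>m. f m \<oplus> g m) = (\<lambda>m. pd R vdeg x f m \<oplus> pd R vdeg x g m)"
proof
  fix m
  have "f (add_mset x m) \<in> carrier R" "g (add_mset x m) \<in> carrier R"
    using assms by (auto simp: mem_free_module)
  then show "pd R vdeg x (\<lambda>m. f m \<oplus> g m) m = pd R vdeg x f m \<oplus> pd R vdeg x g m"
    by (simp add: pd_def add.nat_pow_distrib[OF _ _] signed_add del: add.nat_pow_Suc)
qed

lemma pd_single:
  assumes "r \<in> carrier R"
  shows "pd R vdeg x (single R m r) = (if x \<in># m
    then single R (m - {#x#}) (signed R (inversions vdeg {#x#} (m - {#x#})) (add_pow R (count m x) r)) else (\<lambda>_. \<zero>))"
proof
  fix m'
  show "pd R vdeg x (single R m r) m' = (if x \<in># m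
    then single R (m - {#x#}) (signed R (inversions vdeg {#x#} (m - {#x#})) (add_pow R (count m x) r)) else (\<lambda>_. \<zero>)) m'"
  proof (cases "m = add_mset x m'")
    case True
    then show ?thesis by (simp add: pd_def single_def)
  next
    case False
    then have "\<not> (x \<in># m \<and> m' = m - {#x#})" by auto
    then show ?thesis using False by (auto simp: pd_def single_def)
  qed
qed

lemma pd_deg:
  assumes f: "f \<in> gc_comp R X vdeg n"
  shows "pd R vdeg x f \<in> gc_comp R X vdeg (n - vdeg x)"
    and "n < vdeg x \<Longrightarrow> pd R vdeg x f = (\<lambda>_. \<zero>)"
proof -
  have deg: "vdeg x + gc_deg vdeg m = n" if "pd R vdeg x f m \<noteq> \<zero>" for m
    using gc_comp_deg[OF f pd_nonzero[OF that]] by (simp add: gc_deg_add_mset)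
  have "gc_deg vdeg m = n - vdeg x" if "pd R vdeg x f m \<noteq> \<zero>" for m
    using deg[OF that] by simp
  then show "pd R vdeg x f \<in> gc_comp R X vdeg (n - vdeg x)"
    using pd_mem[OF gc_comp_carrier[OF f]] by (simp add: gc_comp_def)
  show "pd R vdeg x f = (\<lambda>_. \<zero>)" if "n < vdeg x"
  proof
    fix m
    show "pd R vdeg x f m = \<zero>"
    proof (rule ccontr)
      assume "pd R vdeg x f m \<noteq> \<zero>"
      from deg[OF this] that show False by simp
    qed
  qed
qed

lemma single_add: "(\<lambda>m. single R a r m \<oplus> single R a s m) = single R a (r \<oplus> s)"
  if "r \<in> carrier R" "s \<in> carrier R"
  using that by (auto simp: single_def)

text \<open>The Leibniz rule, on monomials. Writing the second term with \<open>b\<close> on the left makes the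
  rule symmetric in \<open>a\<close> and \<open>b\<close>, and no sign involves the degree of the derivation.\<close>

lemma pd_mult_single:
  assumes a: "a \<in> gc_monos X vdeg" and b: "b \<in> gc_monos X vdeg"
    and r: "r \<in> carrier R" and s: "s \<in> carrier R"
  shows "pd R vdeg x (single R a r \<otimes>\<^bsub>gc_algebra R X vdeg\<^esub> single R b s) = (\<lambda>m.
    (pd R vdeg x (single R a r) \<otimes>\<^bsub>gc_algebra R X vdeg\<^esub> single R b s) m \<oplus>
    signed R (gc_deg vdeg a * gc_deg vdeg b)
      ((pd R vdeg x (single R b s) \<otimes>\<^bsub>gc_algebra R X vdeg\<^esub> single R a r) m))"
proof -
  let ?M = "gc_monos X vdeg"
  let ?inv = "inversions vdeg"
  let ?m = "a + b - {#x#}"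
  let ?rs = "r \<otimes> s"
  have rs: "?rs \<in> carrier R" using r s by simp
  have z: "(\<lambda>_. \<zero>) \<otimes>\<^bsub>gc_algebra R X vdeg\<^esub> single R c t = (\<lambda>_. \<zero>)" if "t \<in> carrier R" for c t
    using gc_mult_single[of \<zero> t X vdeg c c] that by (simp add: single_zero)
  have L: "pd R vdeg x (single R a r \<otimes>\<^bsub>gc_algebra R X vdeg\<^esub> single R b s) =
    (if a + b \<in> ?M \<and> x \<in># a + b then single R ?m (signed R (?inv a b + ?inv {#x#} ?m)
       (add_pow R (count a x + count b x) ?rs)) else (\<lambda>_. \<zero>))"
  proof -
    have "add_pow R n (signed R k ?rs) = signed R k (add_pow R n ?rs)" for n k :: nat
      using rs by (simp add: signed_def add.nat_pow_inv)
    then show ?thesis using r s by (simp add: gc_mult_single pd_single pd_zero signed_signed add.commute)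
  qed
  have T1: "pd R vdeg x (single R a r) \<otimes>\<^bsub>gc_algebra R X vdeg\<^esub> single R b s =
    (if x \<in># a \<and> ?m \<in> ?M then single R ?m (signed R (?inv (a - {#x#}) b + ?inv {#x#} (a - {#x#}))
       (add_pow R (count a x) ?rs)) else (\<lambda>_. \<zero>))"
  proof (cases "x \<in># a")
    case True
    have e: "a - {#x#} + b = ?m" using True by simp
    show ?thesis
      using r s True unfolding pd_single[OF r] if_P[OF True]
      by (subst gc_mult_single) (simp_all add: e signed_rmult signed_signed add_pow_ldistr)
  next
    case False
    then show ?thesis using r s z by (simp add: pd_single)
  qed
  have T2: "pd R vdeg x (single R b s) \<otimes>\<^bsub>gc_algebra R X vdeg\<^esub> single R a r =
    (if x \<in># b \<and> ?m \<in> ?M then single R ?m (signed R (?inv (b - {#x#}) a + ?inv {#x#} (b - {#x#}))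
       (add_pow R (count b x) ?rs)) else (\<lambda>_. \<zero>))"
  proof (cases "x \<in># b")
    case True
    have e: "b - {#x#} + a = ?m" using True by (simp add: add.commute)
    have sr: "s \<otimes> r = r \<otimes> s" using r s by (rule m_comm[rotated])
    show ?thesis
      using r s True unfolding pd_single[OF s] if_P[OF True]
      by (subst gc_mult_single) (simp_all add: e sr signed_rmult signed_signed add_pow_ldistr)
  next
    case False
    then show ?thesis using r s z by (simp add: pd_single)
  qed
  have sgn: "(\<lambda>m. signed R k (single R c t m)) = single R c (signed R k t)" for k c t
    by (auto simp: single_def)
  have R': "(\<lambda>m. (pd R vdeg x (single R a r) \<otimes>\<^bsub>gc_algebra R X vdeg\<^esub> single R b s) m \<oplus>
      signed R (gc_deg vdeg a * gc_deg vdeg b) ((pd R vdeg x (single R b s) \<otimes>\<^bsub>gc_algebra R X vdeg\<^esub> single R a r) m)) =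
    (if ?m \<in> ?M then single R ?m
      ((if x \<in># a then signed R (?inv (a - {#x#}) b + ?inv {#x#} (a - {#x#})) (add_pow R (count a x) ?rs) else \<zero>) \<oplus>
       (if x \<in># b then signed R (gc_deg vdeg a * gc_deg vdeg b + (?inv (b - {#x#}) a + ?inv {#x#} (b - {#x#})))
         (add_pow R (count b x) ?rs) else \<zero>)) else (\<lambda>_. \<zero>))"
  proof -
    have *: "(\<lambda>m. (if P \<and> Q then single R ?m u else (\<lambda>_. \<zero>)) m \<oplus>
        signed R k ((if P' \<and> Q then single R ?m (signed R l v) else (\<lambda>_. \<zero>)) m)) =
      (if Q then single R ?m ((if P then u else \<zero>) \<oplus> (if P' then signed R (k + l) v else \<zero>)) else (\<lambda>_. \<zero>))"
      if "u \<in> carrier R" "v \<in> carrier R" for P Q P' k l u v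
      using that by (cases P; cases P'; cases Q) (simp_all add: single_def signed_signed fun_eq_iff)
    show ?thesis
      unfolding T1 T2 by (rule *) (use rs in simp_all)
  qed
  show ?thesis
  proof (cases "?m \<in> ?M \<and> (x \<in># a \<or> x \<in># b)")
    case False
    have "a + b \<in> ?M \<Longrightarrow> ?m \<in> ?M" by (rule gc_monos_subset[rotated]) auto
    then have "?m \<in> ?M \<or> a + b \<notin> ?M" by blast
    then show ?thesis
      using False unfolding L R' by (cases "?m \<in> ?M") (simp_all add: single_zero)
  next
    case True
    then have m: "?m \<in> ?M" by simp
    have xX: "x \<in> X" using True a b by (auto simp: gc_monos_def)
    have ab: "add_mset x ?m = a + b" using True by auto
    show ?thesis
    proof (cases "even (vdeg x)")
      case True': True
      have abM: "a + b \<in> ?M"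
        using gc_monos_add_mset[of x ?m X vdeg] m xX True' ab by simp
      have inv: "?inv (c - {#x#}) e = ?inv c e" "?inv {#x#} e = 0" for c e
        using inversions_add_even[of vdeg x "c - {#x#}" e] inversions_even_left[of vdeg x] True'
          diff_single_trivial[of x c] by (cases "x \<in># c"; simp)+
      have "signed R (gc_deg vdeg a * gc_deg vdeg b + ?inv b a) t = signed R (?inv a b) t" for t
        by (rule signed_cong) (use even_inversions_swap[OF abM] in auto)
      moreover have "(if x \<in># c then t else \<zero>) = t" if "x \<notin># c \<Longrightarrow> t = \<zero>" for c t
        using that by auto
      ultimately show ?thesis
        unfolding L R' using m abM True rs
        by (simp add: inv not_in_iff signed_add[symmetric] add.nat_pow_mult)
    next
      case False
      have cx: "count a x \<le> 1" "count b x \<le> 1"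
        using a b False by (auto simp: gc_monos_def)
      note parity = even_inversions_swap gc_deg_add_mset
      consider (a) "x \<in># a" "x \<notin># b" | (b) "x \<notin># a" "x \<in># b" | (ab) "x \<in># a" "x \<in># b"
        using True by auto
      then show ?thesis
      proof cases
        case a
        then obtain a' where a': "a = add_mset x a'" by (auto dest: multi_member_split)
        have abM: "a + b \<in> ?M" using gc_monos_add_mset[of x ?m X vdeg] m xX ab a cx by (auto simp: a' not_in_iff)
        have xa: "{#x#} + a' \<in> ?M" "a' + b \<in> ?M"
          using m \<open>a \<in> ?M\<close> by (simp_all add: a')
        have i1: "?inv a b = ?inv {#x#} b + ?inv a' b"
          using inversions_add_left[OF xa(1), of b] by (simp add: a')
        have i2: "?inv {#x#} (a' + b) = ?inv {#x#} a' + ?inv {#x#} b"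
          by (rule inversions_add_right[OF xa(2)])
        have "signed R (?inv a b + ?inv {#x#} (a' + b)) t = signed R (?inv a' b + ?inv {#x#} a') t" for t
          by (rule signed_cong) (auto simp: i1 i2)
        then show ?thesis
          unfolding L R' using a m abM cx rs by (simp add: a' not_in_iff)
      next
        case b
        then obtain b' where b': "b = add_mset x b'" by (auto dest: multi_member_split)
        have abM: "a + b \<in> ?M" using gc_monos_add_mset[of x ?m X vdeg] m xX ab b cx by (auto simp: b' not_in_iff)
        have xb: "{#x#} + b' \<in> ?M" "a + b' \<in> ?M" "a + {#x#} \<in> ?M"
          using m \<open>b \<in> ?M\<close> gc_monos_add_left[of "a + {#x#}" b' X vdeg] abM by (simp_all add: b')
        have i1: "?inv a b = ?inv a {#x#} + ?inv a b'"
          using inversions_add_right[OF xb(1), of a] by (simp add: b')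
        have i2: "?inv {#x#} (a + b') = ?inv {#x#} a + ?inv {#x#} b'"
          by (rule inversions_add_right[OF xb(2)])
        have p1: "even (?inv a {#x#}) = (even (?inv {#x#} a) = even (gc_deg vdeg a))"
          using even_inversions_swap[OF xb(3)] False by (simp add: gc_deg_def)
        have p2: "even (?inv a b') = (even (?inv b' a) = even (gc_deg vdeg a * gc_deg vdeg b'))"
          by (rule even_inversions_swap[OF xb(2)])
        have p3: "even (gc_deg vdeg b) = odd (gc_deg vdeg b')"
          using False by (simp add: b' gc_deg_add_mset)
        have "signed R (?inv a b + ?inv {#x#} (a + b')) t =
            signed R (gc_deg vdeg a * gc_deg vdeg b + (?inv b' a + ?inv {#x#} b')) t" for t
          by (rule signed_cong) (use p1 p2 p3 in \<open>auto simp: i1 i2\<close>)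
        then show ?thesis
          unfolding L R' using b m abM cx rs by (simp add: b' not_in_iff)
      next
        case ab
        then obtain a' b' where a': "a = add_mset x a'" and b': "b = add_mset x b'"
          using multi_member_split[OF ab(1)] multi_member_split[OF ab(2)] by blast
        have abM: "a + b \<notin> ?M" using gc_monos_odd_disjoint[where X = X and vdeg = vdeg and x = x] False ab by blast
        have m': "add_mset x (a' + b') \<in> ?M" using m by (simp add: a' b')
        have M: "{#x#} + b' \<in> ?M" "{#x#} + a' \<in> ?M" "a' + b' \<in> ?M"
          using \<open>a \<in> ?M\<close> \<open>b \<in> ?M\<close> m' by (auto simp: a' b' gc_monos_add_mset)
        have M': "a' + {#x#} \<in> ?M" "b' + {#x#} \<in> ?M" using M by simp_all
        have i1: "?inv a' b = ?inv a' {#x#} + ?inv a' b'"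
          using inversions_add_right[OF M(1), of a'] by (simp add: b')
        have i2: "?inv b' a = ?inv b' {#x#} + ?inv b' a'"
          using inversions_add_right[OF M(2), of b'] by (simp add: a')
        have p1: "even (?inv a' {#x#}) = (even (?inv {#x#} a') = even (gc_deg vdeg a'))"
          using even_inversions_swap[OF M'(1)] False by (simp add: gc_deg_def)
        have p2: "even (?inv b' {#x#}) = (even (?inv {#x#} b') = even (gc_deg vdeg b'))"
          using even_inversions_swap[OF M'(2)] False by (simp add: gc_deg_def)
        have p3: "even (?inv a' b') = (even (?inv b' a') = even (gc_deg vdeg a' * gc_deg vdeg b'))"
          by (rule even_inversions_swap[OF M(3)])
        have p4: "even (gc_deg vdeg b) = odd (gc_deg vdeg b')" "even (gc_deg vdeg a) = odd (gc_deg vdeg a')"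
          using False by (simp_all add: a' b' gc_deg_add_mset)
        have "signed R (gc_deg vdeg a * gc_deg vdeg b + (?inv b' a + ?inv {#x#} b')) t =
            signed R (Suc (?inv a' b + ?inv {#x#} a')) t" for t
          by (rule signed_cong) (use p1 p2 p3 p4 in \<open>auto simp: i1 i2\<close>)
        moreover have "signed R k ?rs \<oplus> signed R (Suc k) ?rs = \<zero>" for k
          using rs by (simp add: signed_def l_neg r_neg)
        ultimately show ?thesis
          unfolding L R' using ab m abM cx rs by (simp add: a' b' single_zero)
      qed
    qed
  qed
qed

lemma pd_mult:
  assumes f: "f \<in> gc_comp R X vdeg p" and g: "g \<in> gc_comp R X vdeg q"
  shows "pd R vdeg x (f \<otimes>\<^bsub>gc_algebra R X vdeg\<^esub> g) =
    (pd R vdeg x f \<otimes>\<^bsub>gc_algebra R X vdeg\<^esub> g) \<oplus>\<^bsub>gc_algebra R X vdeg\<^esub>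
    signed (gc_algebra R X vdeg) (p * q) (pd R vdeg x g \<otimes>\<^bsub>gc_algebra R X vdeg\<^esub> f)"
proof -
  let ?A = "gc_algebra R X vdeg"
  interpret A: ring ?A by (rule gc_ring)
  have fA: "f \<in> carrier ?A" and gA: "g \<in> carrier ?A"
    using f g gc_comp_carrier by auto
  have pda: "pd R vdeg x (u \<oplus>\<^bsub>?A\<^esub> v) = pd R vdeg x u \<oplus>\<^bsub>?A\<^esub> pd R vdeg x v"
    if "u \<in> carrier ?A" "v \<in> carrier ?A" for u v
    using pd_add[OF that] by simp
  note pdm = pd_mem[of _ X vdeg x]
  have one: "pd R vdeg x (f \<otimes>\<^bsub>?A\<^esub> single R b (g b)) =
      (pd R vdeg x f \<otimes>\<^bsub>?A\<^esub> single R b (g b)) \<oplus>\<^bsub>?A\<^esub>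
      signed ?A (p * q) (pd R vdeg x (single R b (g b)) \<otimes>\<^bsub>?A\<^esub> f)"
    if b: "b \<in> gc_monos X vdeg" "g b \<noteq> \<zero>" "g b \<in> carrier R" for b
  proof -
    have sb: "single R b (g b) \<in> carrier ?A" using b single_mem by simp
    from fA[simplified] show ?thesis
    proof (induction rule: free_module_induct)
      case zero
      then show ?case
        using A.l_null[OF sb] A.r_null[OF pdm[OF sb]] A.l_null[OF sb] A.signed_zero by (simp add: pd_zero)
    next
      case (add u v)
      then have uv: "u \<in> carrier ?A" "v \<in> carrier ?A" by auto
      have IH: "pd R vdeg x (u \<otimes>\<^bsub>?A\<^esub> single R b (g b)) = (pd R vdeg x u \<otimes>\<^bsub>?A\<^esub> single R b (g b)) \<oplus>\<^bsub>?A\<^esub>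
          signed ?A (p * q) (pd R vdeg x (single R b (g b)) \<otimes>\<^bsub>?A\<^esub> u)"
        "pd R vdeg x (v \<otimes>\<^bsub>?A\<^esub> single R b (g b)) = (pd R vdeg x v \<otimes>\<^bsub>?A\<^esub> single R b (g b)) \<oplus>\<^bsub>?A\<^esub>
          signed ?A (p * q) (pd R vdeg x (single R b (g b)) \<otimes>\<^bsub>?A\<^esub> v)"
        using add by blast+
      have "pd R vdeg x ((u \<oplus>\<^bsub>?A\<^esub> v) \<otimes>\<^bsub>?A\<^esub> single R b (g b)) =
          (pd R vdeg x (u \<oplus>\<^bsub>?A\<^esub> v) \<otimes>\<^bsub>?A\<^esub> single R b (g b)) \<oplus>\<^bsub>?A\<^esub>
          signed ?A (p * q) (pd R vdeg x (single R b (g b)) \<otimes>\<^bsub>?A\<^esub> (u \<oplus>\<^bsub>?A\<^esub> v))"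
        using uv sb pdm[OF uv(1)] pdm[OF uv(2)] pdm[OF sb] IH
        by (simp only: A.l_distr A.r_distr pda A.m_closed A.signed_add A.signed_closed A.a_closed A.a_ac)
      then show ?case by simp
    next
      case (single a)
      have pq: "gc_deg vdeg a = p" "gc_deg vdeg b = q"
        using single b gc_comp_deg[OF f] gc_comp_deg[OF g] by auto
      have "pd R vdeg x (single R b (g b)) \<otimes>\<^bsub>?A\<^esub> single R a (f a) \<in> carrier ?A"
        using pdm[OF sb] single_mem single by (intro A.m_closed) auto
      then show ?case
        using pd_mult_single[OF single(1) b(1) single(3) b(3), of x] pq by (simp add: gc_signed)
    qed
  qed
  from gA[simplified] show ?thesis
  proof (induction rule: free_module_induct)
    case zero
    then show ?case
      using A.r_null[OF fA] A.r_null[OF pdm[OF fA]] A.l_null[OF fA] A.signed_zero by (simp add: pd_zero)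
  next
    case (add u v)
    then have uv: "u \<in> carrier ?A" "v \<in> carrier ?A" by auto
    have IH: "pd R vdeg x (f \<otimes>\<^bsub>?A\<^esub> u) = (pd R vdeg x f \<otimes>\<^bsub>?A\<^esub> u) \<oplus>\<^bsub>?A\<^esub>
        signed ?A (p * q) (pd R vdeg x u \<otimes>\<^bsub>?A\<^esub> f)"
      "pd R vdeg x (f \<otimes>\<^bsub>?A\<^esub> v) = (pd R vdeg x f \<otimes>\<^bsub>?A\<^esub> v) \<oplus>\<^bsub>?A\<^esub>
        signed ?A (p * q) (pd R vdeg x v \<otimes>\<^bsub>?A\<^esub> f)"
      using add by blast+
    have "pd R vdeg x (f \<otimes>\<^bsub>?A\<^esub> (u \<oplus>\<^bsub>?A\<^esub> v)) = (pd R vdeg x f \<otimes>\<^bsub>?A\<^esub> (u \<oplus>\<^bsub>?A\<^esub> v)) \<oplus>\<^bsub>?A\<^esub>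
        signed ?A (p * q) (pd R vdeg x (u \<oplus>\<^bsub>?A\<^esub> v) \<otimes>\<^bsub>?A\<^esub> f)"
      using uv fA pdm[OF uv(1)] pdm[OF uv(2)] pdm[OF fA] IH
      by (simp only: A.l_distr A.r_distr pda A.m_closed A.signed_add A.signed_closed A.a_closed A.a_ac)
    then show ?case by simp
  next
    case (single b)
    then show ?case by (rule one)
  qed
qed

lemma pd_vector:
  assumes f: "f \<in> carrier (gc_algebra R X vdeg)"
  shows "(\<lambda>x. pd R vdeg x f) \<in> carrier (free_module (gc_algebra R X vdeg) X)"
proof -
  have "{x. pd R vdeg x f \<noteq> (\<lambda>_. \<zero>)} \<subseteq> (\<Union>m\<in>{m. f m \<noteq> \<zero>}. set_mset m)"
  proof
    fix x assume "x \<in> {x. pd R vdeg x f \<noteq> (\<lambda>_. \<zero>)}"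
    then obtain m where "pd R vdeg x f m \<noteq> \<zero>" by auto
    then show "x \<in> (\<Union>m\<in>{m. f m \<noteq> \<zero>}. set_mset m)"
      using pd_nonzero by (intro UN_I[of "add_mset x m"]) auto
  qed
  then have "finite {x. pd R vdeg x f \<noteq> (\<lambda>_. \<zero>)}"
    by (rule finite_subset) (use f in \<open>auto simp: mem_free_module\<close>)
  moreover have "pd R vdeg x f = (\<lambda>_. \<zero>)" if "x \<notin> X" for x
  proof
    fix m
    have "f (add_mset x m) = \<zero>" using f that by (auto simp: mem_free_module gc_monos_add_mset)
    then show "pd R vdeg x f m = \<zero>" using pd_nonzero by blast
  qed
  ultimately show ?thesis
    using pd_mem[OF f] by (auto simp: mem_free_module[of _ "gc_algebra R X vdeg"])
qed

lemma dg_ring_gc_algebra: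
  assumes d: "dg_differential R (gc_algebra R X vdeg) (gc_comp R X vdeg) d"
  shows "dg_ring (gc_algebra R X vdeg) (gc_comp R X vdeg) d"
proof -
  let ?A = "gc_algebra R X vdeg"
  interpret A: ring ?A by (rule gc_ring)
  have lin: "d \<in> lin_maps R ?A ?A" using d by (simp add: dg_differential_def)
  show ?thesis
  proof unfold_locales
    show "\<zero>\<^bsub>?A\<^esub> \<in> gc_comp R X vdeg n" for n using gc_comp_zero by simp
    show "a \<oplus>\<^bsub>?A\<^esub> b \<in> gc_comp R X vdeg n" if "a \<in> gc_comp R X vdeg n" "b \<in> gc_comp R X vdeg n" for a b n
      using gc_comp_add[OF that] by simp
    show "d a \<in> gc_comp R X vdeg n" if "a \<in> gc_comp R X vdeg (Suc n)" for a n
      using d that unfolding dg_differential_def by blast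
  qed (use d lin_maps_mem[OF lin] lin_maps_add[OF lin] gc_comp_carrier gc_comp_uminus gc_comp_mult in
      \<open>auto simp: dg_differential_def\<close>)
qed

end

section \<open>Lifting derivations\<close>

text \<open>From here on, the algebra is mostly treated as a ring, and not as a module of functions.\<close>

declare gc_algebra_simps [simp del]

locale gc_resolution = R: cring R +
  dg_resolution "gc_algebra R X vdeg" "gc_comp R X vdeg" d S \<alpha>
  for R :: "('a, 'm) ring_scheme" (structure) and X :: "'x::linorder set" and vdeg :: "'x \<Rightarrow> nat"
    and d and S :: "('b, 'n) ring_scheme" and \<alpha> +
  assumes vdeg_pos: "x \<in> X \<Longrightarrow> 1 \<le> vdeg x"
begin

abbreviation "A \<equiv> gc_algebra R X vdeg"
abbreviation "G \<equiv> gc_comp R X vdeg"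
abbreviation "var x \<equiv> gc_var R x"

lemma zero_A: "\<zero>\<^bsub>A\<^esub> = (\<lambda>_. \<zero>)"
  by (simp add: gc_algebra_simps)

lemma carrier_A: "carrier A = carrier (free_module R (gc_monos X vdeg))"
  by (simp add: gc_algebra_simps)

lemma A_coeff: "f \<in> carrier A \<Longrightarrow> f m \<in> carrier R"
  by (simp add: carrier_A mem_free_module)

lemma A_coeff_outside: "f \<in> carrier A \<Longrightarrow> m \<notin> gc_monos X vdeg \<Longrightarrow> f m = \<zero>"
  by (simp add: carrier_A mem_free_module)

lemma add_A: "f \<oplus>\<^bsub>A\<^esub> g = (\<lambda>m. f m \<oplus> g m)"
  by (simp add: gc_algebra_simps)

lemma empty_mono: "{#} \<in> gc_monos X vdeg"
  by (simp add: gc_monos_def)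

lemma var_mono: "x \<in> X \<Longrightarrow> {#x#} \<in> gc_monos X vdeg"
  by (simp add: gc_monos_def)

lemma var_G: "x \<in> X \<Longrightarrow> var x \<in> G (vdeg x)"
  using R.gc_comp_single[OF var_mono, of x "\<one>"] by (simp add: gc_var_single gc_deg_def)

lemma const_G: "r \<in> carrier R \<Longrightarrow> single R {#} r \<in> G 0"
  using R.gc_comp_single[OF empty_mono, of r] by (simp add: gc_deg_def)

lemma mono_deg_0: "m \<in> gc_monos X vdeg \<Longrightarrow> gc_deg vdeg m = 0 \<Longrightarrow> m = {#}"
  using vdeg_pos by (cases m) (fastforce simp: gc_deg_add_mset gc_monos_add_mset)+

lemma mono_deg_1:
  assumes m: "m \<in> gc_monos X vdeg" and deg: "gc_deg vdeg m = Suc 0"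
  obtains x where "m = {#x#}" "x \<in> X" "vdeg x = 1"
proof (cases m)
  case empty
  then show thesis using deg by (simp add: gc_deg_def)
next
  case (add x m')
  then have "x \<in> X" "m' \<in> gc_monos X vdeg" using m by (auto simp: gc_monos_add_mset)
  moreover from this have "vdeg x = 1" "gc_deg vdeg m' = 0"
    using vdeg_pos[of x] deg add by (auto simp: gc_deg_add_mset)
  ultimately show thesis using that mono_deg_0[of m'] add by auto
qed

lemma G0_const: "f \<in> G 0 \<Longrightarrow> f = single R {#} (f {#})"
proof
  fix m assume f: "f \<in> G 0"
  show "f m = single R {#} (f {#}) m"
  proof (cases "f m = \<zero>")
    case False
    then have "m = {#}"
      using R.gc_comp_deg[OF f False] mono_deg_0 A_coeff_outside[OF G_carrier[OF f]] by blast
    then show ?thesis by (simp add: single_def)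
  qed (auto simp: single_def)
qed

lemma G_pos_empty: "f \<in> G (Suc n) \<Longrightarrow> f {#} = \<zero>"
  using R.gc_comp_deg[of f X vdeg "Suc n" "{#}"] by (auto simp: gc_deg_def)

lemma pd_A: "f \<in> carrier A \<Longrightarrow> pd R vdeg x f \<in> carrier A"
  by (rule R.pd_mem)

lemma pd_A_add: "f \<in> carrier A \<Longrightarrow> g \<in> carrier A \<Longrightarrow> pd R vdeg x (f \<oplus>\<^bsub>A\<^esub> g) = pd R vdeg x f \<oplus>\<^bsub>A\<^esub> pd R vdeg x g"
  by (simp add: add_A R.pd_add)

lemma pd_A_deg:
  assumes f: "f \<in> G n" and nz: "pd R vdeg x f \<noteq> \<zero>\<^bsub>A\<^esub>"
  shows "vdeg x \<le> n" "x \<in> X" "pd R vdeg x f \<in> G (n - vdeg x)"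
proof -
  show "pd R vdeg x f \<in> G (n - vdeg x)" by (rule R.pd_deg(1)[OF f])
  show "vdeg x \<le> n" using R.pd_deg(2)[OF f, of x] nz by (auto simp: zero_A)
  show "x \<in> X"
    using R.pd_vector[OF G_carrier[OF f]] nz by (auto simp: mem_free_module)
qed

text \<open>The derivation with value \<open>t x\<close> at the variable \<open>x\<close>, by the chain rule. It has degree \<open>-1\<close> when \<open>t\<close>
  satisfies \<open>derivation_data\<close>.\<close>

definition theta :: "('x \<Rightarrow> nat \<times> 'i \<Rightarrow> 'x multiset \<Rightarrow> 'a) \<Rightarrow> ('x multiset \<Rightarrow> 'a) \<Rightarrow> nat \<times> 'i \<Rightarrow> 'x multiset \<Rightarrow> 'a" where
  "theta t f = comb A t (\<lambda>x. pd R vdeg x f)"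

definition derivation_data :: "(nat \<Rightarrow> 'i set) \<Rightarrow> ('x \<Rightarrow> nat \<times> 'i \<Rightarrow> 'x multiset \<Rightarrow> 'a) \<Rightarrow> bool" where
  "derivation_data B t \<longleftrightarrow> (\<forall>x. if x \<in> X then t x \<in> homog B (vdeg x - 1) else t x = (\<lambda>_. \<zero>\<^bsub>A\<^esub>))"

lemma data_homog: "derivation_data B t \<Longrightarrow> x \<in> X \<Longrightarrow> t x \<in> homog B (vdeg x - 1)"
  unfolding derivation_data_def by metis

lemma data_vectors: "derivation_data B t \<Longrightarrow> t x \<in> vectors B"
proof (cases "x \<in> X")
  case True
  assume "derivation_data B t"
  from homog_vectors[OF data_homog[OF this True]] show ?thesis .
next
  case False
  assume "derivation_data B t"
  with False have "t x = (\<lambda>_. \<zero>\<^bsub>A\<^esub>)" unfolding derivation_data_def by metis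
  then show ?thesis using free_module_zero by simp
qed

lemma data_carrier: "derivation_data B t \<Longrightarrow> t x c \<in> carrier A"
  by (rule vectors_carrier[OF data_vectors])

lemma theta_vectors:
  assumes t: "derivation_data B t" and f: "f \<in> carrier A"
  shows "theta t f \<in> vectors B"
  unfolding theta_def by (rule comb_mem[OF R.pd_vector[OF f]]) (rule data_vectors[OF t])

lemma theta_add:
  assumes t: "derivation_data B t" and f: "f \<in> carrier A" and g: "g \<in> carrier A"
  shows "theta t (f \<oplus>\<^bsub>A\<^esub> g) c = theta t f c \<oplus>\<^bsub>A\<^esub> theta t g c"
  unfolding theta_def pd_A_add[OF f g]
  by (rule comb_add[OF R.pd_vector[OF f] R.pd_vector[OF g]]) (rule data_carrier[OF t])

lemma theta_zero: "theta t \<zero>\<^bsub>A\<^esub> = (\<lambda>_. \<zero>\<^bsub>A\<^esub>)"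
proof -
  have "(\<lambda>x. pd R vdeg x \<zero>\<^bsub>A\<^esub>) = (\<lambda>_. \<zero>\<^bsub>A\<^esub>)"
    by (simp add: zero_A R.pd_zero)
  then show ?thesis unfolding theta_def by (intro ext) (simp only: comb_zero)
qed

lemma theta_uminus:
  assumes t: "derivation_data B t" and f: "f \<in> carrier A"
  shows "theta t (\<ominus>\<^bsub>A\<^esub> f) c = \<ominus>\<^bsub>A\<^esub> theta t f c"
proof -
  have "theta t (\<ominus>\<^bsub>A\<^esub> f) c \<oplus>\<^bsub>A\<^esub> theta t f c = \<zero>\<^bsub>A\<^esub>"
    using theta_add[OF t a_inv_closed[OF f] f, of c] theta_zero[of t] f by (simp add: l_neg)
  then show ?thesis
    using vectors_carrier[OF theta_vectors[OF t f]] vectors_carrier[OF theta_vectors[OF t a_inv_closed[OF f]]]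
    by (simp add: minus_equality)
qed

lemma theta_signed:
  assumes "derivation_data B t" and "f \<in> carrier A"
  shows "theta t (signed A n f) c = signed A n (theta t f c)"
  using theta_uminus[OF assms] by (simp add: signed_def)

text \<open>The sign in the second term comes from moving \<open>g\<close> past \<open>f\<close>, in accordance with \<open>pd_mult\<close>.\<close>

lemma theta_mult:
  assumes t: "derivation_data B t" and f: "f \<in> G p" and g: "g \<in> G q"
  shows "theta t (f \<otimes>\<^bsub>A\<^esub> g) c = (theta t f c \<otimes>\<^bsub>A\<^esub> g) \<oplus>\<^bsub>A\<^esub> signed A (p * q) (theta t g c \<otimes>\<^bsub>A\<^esub> f)"
proof -
  have fA: "f \<in> carrier A" and gA: "g \<in> carrier A" using f g G_carrier by auto
  note vf = free_module_rmult[OF R.pd_vector[OF fA] gA] and vg = free_module_rmult[OF R.pd_vector[OF gA] fA]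
  have vg': "(\<lambda>x. signed A (p * q) (pd R vdeg x g \<otimes>\<^bsub>A\<^esub> f)) \<in> carrier (free_module A X)"
    using vg free_module_uminus[OF vg] by (cases "even (p * q)") (simp_all add: signed_def)
  have "theta t (f \<otimes>\<^bsub>A\<^esub> g) c = comb A t (\<lambda>x. pd R vdeg x f \<otimes>\<^bsub>A\<^esub> g) c \<oplus>\<^bsub>A\<^esub>
      comb A t (\<lambda>x. signed A (p * q) (pd R vdeg x g \<otimes>\<^bsub>A\<^esub> f)) c"
    unfolding theta_def R.pd_mult[OF f g] by (rule comb_add[OF vf vg']) (rule data_carrier[OF t])
  also have "comb A t (\<lambda>x. signed A (p * q) (pd R vdeg x g \<otimes>\<^bsub>A\<^esub> f)) c =
      signed A (p * q) (comb A t (\<lambda>x. pd R vdeg x g \<otimes>\<^bsub>A\<^esub> f) c)"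
    using comb_uminus[OF vg, of t c] data_carrier[OF t]
    by (cases "even (p * q)") (simp_all add: signed_def)
  also have "comb A t (\<lambda>x. pd R vdeg x f \<otimes>\<^bsub>A\<^esub> g) c = theta t f c \<otimes>\<^bsub>A\<^esub> g"
    unfolding theta_def by (rule comb_rmult[OF R.pd_vector[OF fA] _ gA]) (rule data_carrier[OF t])
  also have "comb A t (\<lambda>x. pd R vdeg x g \<otimes>\<^bsub>A\<^esub> f) c = theta t g c \<otimes>\<^bsub>A\<^esub> f"
    unfolding theta_def by (rule comb_rmult[OF R.pd_vector[OF gA] _ fA]) (rule data_carrier[OF t])
  finally show ?thesis .
qed

lemma theta_var:
  assumes t: "derivation_data B t" and x: "x \<in> X"
  shows "theta t (var x) = t x"
proof
  fix c
  have "pd R vdeg y (var x) = single A x \<one>\<^bsub>A\<^esub> y" for y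
    using R.pd_single[of \<one> vdeg y "{#x#}"]
    by (auto simp: gc_var_single single_def[of A] gc_one zero_A signed_def)
  then show "theta t (var x) c = t x c"
    using comb_single[of "\<one>\<^bsub>A\<^esub>" t x c] data_carrier[OF t] by (simp add: theta_def)
qed

lemma theta_const: "r \<in> carrier R \<Longrightarrow> theta t (single R {#} r) = (\<lambda>_. \<zero>\<^bsub>A\<^esub>)"
  using comb_zero[of t] by (auto simp: theta_def R.pd_single zero_A)

lemma theta_homog:
  assumes t: "derivation_data B t" and f: "f \<in> G n"
  shows "theta t f \<in> homog B (n - 1)"
  unfolding theta_def using R.pd_vector[OF G_carrier[OF f]]
proof (induction rule: free_module_induct)
  case zero
  then show ?case using homog_zero comb_zero[of t] by (simp add: fun_eq_iff cong: if_cong)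
next
  case (add g h)
  have "comb A t (\<lambda>j. g j \<oplus>\<^bsub>A\<^esub> h j) = (\<lambda>c. comb A t g c \<oplus>\<^bsub>A\<^esub> comb A t h c)"
    by (rule ext, rule comb_add[OF add(1,2)]) (rule data_carrier[OF t])
  then show ?case using homog_add add by simp
next
  case (single x)
  have "comb A t (single A x (pd R vdeg x f)) = (\<lambda>c. t x c \<otimes>\<^bsub>A\<^esub> pd R vdeg x f)"
    by (rule ext, rule comb_single[OF single(3)]) (rule data_carrier[OF t])
  moreover have "(\<lambda>c. t x c \<otimes>\<^bsub>A\<^esub> pd R vdeg x f) \<in> homog B ((vdeg x - 1) + (n - vdeg x))"
    by (rule homog_rmult[OF data_homog[OF t single(1)] pd_A_deg(3)[OF f single(2)]])
  moreover have "(vdeg x - 1) + (n - vdeg x) = n - 1"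
    using pd_A_deg(1)[OF f single(2)] vdeg_pos[OF single(1)] by simp
  ultimately show ?case by simp
qed

lemma theta_cong:
  assumes t: "derivation_data B t" and f: "f \<in> G n" and eq: "\<And>x. vdeg x \<le> n \<Longrightarrow> t x = t' x"
  shows "theta t f = theta t' f"
proof
  fix c
  show "theta t f c = theta t' f c"
    unfolding theta_def
  proof (rule comb_cong)
    fix x assume "pd R vdeg x f \<noteq> \<zero>\<^bsub>A\<^esub>"
    then show "t x c = t' x c" using pd_A_deg(1)[OF f] eq by simp
  qed (use data_carrier[OF t] pd_A[OF G_carrier[OF f]] in auto)
qed

text \<open>Both sides are derivations up to sign, so it suffices to check the variables.\<close>

lemma theta_chain_map:
  fixes B :: "nat \<Rightarrow> 'i set"
  assumes W: "semifree B W" and t: "derivation_data B t"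
    and var: "\<And>x. x \<in> X \<Longrightarrow> vdeg x \<le> n \<Longrightarrow> bd W (t x) = (\<lambda>c. \<ominus>\<^bsub>A\<^esub> theta t (d (var x)) c)"
    and f: "f \<in> G n"
  shows "bd W (theta t f) = (\<lambda>c. \<ominus>\<^bsub>A\<^esub> theta t (d f) c)"
proof -
  have mono: "bd W (theta t (single R m r)) c = \<ominus>\<^bsub>A\<^esub> theta t (d (single R m r)) c"
    if "m \<in> gc_monos X vdeg" "r \<in> carrier R" "gc_deg vdeg m \<le> n" for m r c
    using that
  proof (induction m arbitrary: r c)
    case empty
    then show ?case
      by (simp add: bd_zero theta_const d_deg0[OF const_G] theta_zero)
  next
    case (add x m)
    let ?a = "var x"
    let ?b = "single R m (signed R (inversions vdeg {#x#} m) r)"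
    let ?q = "gc_deg vdeg m"
    have x: "x \<in> X" and m: "m \<in> gc_monos X vdeg"
      using add.prems by (auto simp: gc_monos_add_mset)
    have r': "signed R (inversions vdeg {#x#} m) r \<in> carrier R" using add.prems by simp
    obtain p0 where p: "vdeg x = Suc p0" using vdeg_pos[OF x] by (cases "vdeg x") auto
    have deg: "vdeg x \<le> n" "?q \<le> n" using add.prems by (auto simp: gc_deg_add_mset)
    have ab: "single R (add_mset x m) r = ?a \<otimes>\<^bsub>A\<^esub> ?b"
      using R.gc_mult_single[OF R.one_closed r', of X vdeg "{#x#}" m] add.prems
      by (simp add: gc_var_single R.signed_signed) (simp add: signed_def)
    have aG: "?a \<in> G (Suc p0)" using var_G[OF x] p by simp
    have bG: "?b \<in> G ?q" by (rule R.gc_comp_single[OF m r'])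
    have aA: "?a \<in> carrier A" and bA: "?b \<in> carrier A" using aG bG G_carrier by auto
    have daG: "d ?a \<in> G p0" using d_deg[OF aG] .
    have daA: "d ?a \<in> carrier A" and dbA: "d ?b \<in> carrier A" using aA bA d_closed by auto
    have ta: "theta t ?a = t x" by (rule theta_var[OF t x])
    have tah: "theta t ?a \<in> homog B p0" using data_homog[OF t x] p ta by simp
    have A1: "bd W (theta t ?a) c = \<ominus>\<^bsub>A\<^esub> theta t (d ?a) c" for c
      using var[OF x deg(1)] ta by simp
    have A2: "bd W (theta t ?b) c = \<ominus>\<^bsub>A\<^esub> theta t (d ?b) c" for c
      by (rule add.IH[OF m r' deg(2)])
    have c1: "theta t (d ?a) c \<in> carrier A" "theta t (d ?b) c \<in> carrier A"
      "theta t ?a c \<in> carrier A" "theta t ?b c \<in> carrier A" for c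
      using vectors_carrier[OF theta_vectors[OF t daA]] vectors_carrier[OF theta_vectors[OF t dbA]]
        vectors_carrier[OF theta_vectors[OF t aA]] vectors_carrier[OF theta_vectors[OF t bA]] by blast+
    have tab: "theta t (?a \<otimes>\<^bsub>A\<^esub> ?b) = (\<lambda>c. (theta t ?a c \<otimes>\<^bsub>A\<^esub> ?b) \<oplus>\<^bsub>A\<^esub>
        signed A (Suc p0 * ?q) (theta t ?b c \<otimes>\<^bsub>A\<^esub> ?a))"
      by (rule ext, rule theta_mult[OF t aG bG])
    have v1: "(\<lambda>c. theta t ?a c \<otimes>\<^bsub>A\<^esub> ?b) \<in> vectors B" "(\<lambda>c. theta t ?b c \<otimes>\<^bsub>A\<^esub> ?a) \<in> vectors B"
      using free_module_rmult[OF theta_vectors[OF t aA] bA] free_module_rmult[OF theta_vectors[OF t bA] aA] by auto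
    have v2: "(\<lambda>c. signed A (Suc p0 * ?q) (theta t ?b c \<otimes>\<^bsub>A\<^esub> ?a)) \<in> vectors B"
      by (rule free_module_map[OF v1(2), where h = "\<lambda>_. signed A (Suc p0 * ?q)"]) simp_all
    have bd_a: "bd W (\<lambda>c. theta t ?a c \<otimes>\<^bsub>A\<^esub> ?b) c =
        (\<ominus>\<^bsub>A\<^esub> theta t (d ?a) c \<otimes>\<^bsub>A\<^esub> ?b) \<oplus>\<^bsub>A\<^esub> signed A p0 (theta t ?a c \<otimes>\<^bsub>A\<^esub> d ?b)"
      using bd_rmult[OF W tah bA] A1 by simp
    have bd_ab: "bd W (theta t (?a \<otimes>\<^bsub>A\<^esub> ?b)) c = bd W (\<lambda>c. theta t ?a c \<otimes>\<^bsub>A\<^esub> ?b) c \<oplus>\<^bsub>A\<^esub>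
        signed A (Suc p0 * ?q) (bd W (\<lambda>c. theta t ?b c \<otimes>\<^bsub>A\<^esub> ?a) c)"
      unfolding tab using bd_add[OF W v1(1) v2] bd_signed[OF W v1(2)] by simp
    have d_ab: "theta t (d (?a \<otimes>\<^bsub>A\<^esub> ?b)) c = theta t (d ?a \<otimes>\<^bsub>A\<^esub> ?b) c \<oplus>\<^bsub>A\<^esub>
        signed A (Suc p0) (theta t (?a \<otimes>\<^bsub>A\<^esub> d ?b) c)"
      using d_mult[OF aG bA] aA bA daA dbA by (simp add: theta_add[OF t] theta_signed[OF t])
    have d1: "theta t (d ?a \<otimes>\<^bsub>A\<^esub> ?b) c = (theta t (d ?a) c \<otimes>\<^bsub>A\<^esub> ?b) \<oplus>\<^bsub>A\<^esub>
        signed A (p0 * ?q) (theta t ?b c \<otimes>\<^bsub>A\<^esub> d ?a)"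
      by (rule theta_mult[OF t daG bG])
    show ?case
    proof (cases ?q)
      case 0
      then have b0: "theta t ?b = (\<lambda>_. \<zero>\<^bsub>A\<^esub>)" "d ?b = \<zero>\<^bsub>A\<^esub>"
        using mono_deg_0[OF m] theta_const[OF r'] d_deg0[of ?b] bG by auto
      have "bd W (\<lambda>c. theta t ?b c \<otimes>\<^bsub>A\<^esub> ?a) = (\<lambda>_. \<zero>\<^bsub>A\<^esub>)"
        using aA by (simp add: b0 bd_zero)
      then show ?thesis
        unfolding ab bd_ab d_ab d1 bd_a using c1 aA bA daA
        by (simp add: b0 l_minus theta_zero)
    next
      case (Suc q0)
      have dbG: "d ?b \<in> G q0" using d_deg[of ?b q0] bG Suc by simp
      have tbh: "theta t ?b \<in> homog B q0" using theta_homog[OF t bG] Suc by simp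
      have bd_b: "bd W (\<lambda>c. theta t ?b c \<otimes>\<^bsub>A\<^esub> ?a) c =
          (\<ominus>\<^bsub>A\<^esub> theta t (d ?b) c \<otimes>\<^bsub>A\<^esub> ?a) \<oplus>\<^bsub>A\<^esub> signed A q0 (theta t ?b c \<otimes>\<^bsub>A\<^esub> d ?a)"
        using bd_rmult[OF W tbh aA] A2 by simp
      have d2: "theta t (?a \<otimes>\<^bsub>A\<^esub> d ?b) c = (theta t ?a c \<otimes>\<^bsub>A\<^esub> d ?b) \<oplus>\<^bsub>A\<^esub>
          signed A (Suc p0 * q0) (theta t (d ?b) c \<otimes>\<^bsub>A\<^esub> ?a)"
        by (rule theta_mult[OF t aG dbG])
      have signs: "((\<ominus>\<^bsub>A\<^esub> u1) \<oplus>\<^bsub>A\<^esub> signed A p0 u2) \<oplus>\<^bsub>A\<^esub>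
          signed A (Suc p0 * Suc q0) ((\<ominus>\<^bsub>A\<^esub> u4) \<oplus>\<^bsub>A\<^esub> signed A q0 u3) =
        \<ominus>\<^bsub>A\<^esub> ((u1 \<oplus>\<^bsub>A\<^esub> signed A (p0 * Suc q0) u3) \<oplus>\<^bsub>A\<^esub> signed A (Suc p0) (u2 \<oplus>\<^bsub>A\<^esub> signed A (Suc p0 * q0) u4))"
        if "u1 \<in> carrier A" "u2 \<in> carrier A" "u3 \<in> carrier A" "u4 \<in> carrier A" for u1 u2 u3 u4
        using that by (cases "even p0"; cases "even q0") (simp_all add: signed_def minus_add a_ac)
      show ?thesis
        unfolding ab bd_ab d_ab d1 bd_a bd_b d2 Suc
        using signs[of "theta t (d ?a) c \<otimes>\<^bsub>A\<^esub> ?b" "theta t ?a c \<otimes>\<^bsub>A\<^esub> d ?b" "theta t ?b c \<otimes>\<^bsub>A\<^esub> d ?a"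
            "theta t (d ?b) c \<otimes>\<^bsub>A\<^esub> ?a"] c1 aA bA daA dbA by (simp add: l_minus)
    qed
  qed
  have "f \<in> carrier (free_module R (gc_monos X vdeg))"
    using G_carrier[OF f] by (simp add: carrier_A)
  then have "\<forall>c. bd W (theta t f) c = \<ominus>\<^bsub>A\<^esub> theta t (d f) c"
  proof (induction rule: R.free_module_induct)
    case zero
    then show ?case unfolding zero_A[symmetric] by (simp add: theta_zero d_zero bd_zero)
  next
    case (add g h)
    have g: "g \<in> carrier A" and h: "h \<in> carrier A" using add by (auto simp: carrier_A)
    have "theta t (g \<oplus>\<^bsub>A\<^esub> h) = (\<lambda>c. theta t g c \<oplus>\<^bsub>A\<^esub> theta t h c)"
      by (rule ext, rule theta_add[OF t g h])
    then have "bd W (theta t (g \<oplus>\<^bsub>A\<^esub> h)) c = bd W (theta t g) c \<oplus>\<^bsub>A\<^esub> bd W (theta t h) c" for c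
      using bd_add[OF W theta_vectors[OF t g] theta_vectors[OF t h]] by simp
    moreover have "theta t (d (g \<oplus>\<^bsub>A\<^esub> h)) c = theta t (d g) c \<oplus>\<^bsub>A\<^esub> theta t (d h) c" for c
      using d_add[OF g h] theta_add[OF t d_closed[OF g] d_closed[OF h]] by simp
    ultimately have "bd W (theta t (g \<oplus>\<^bsub>A\<^esub> h)) c = \<ominus>\<^bsub>A\<^esub> theta t (d (g \<oplus>\<^bsub>A\<^esub> h)) c" for c
      using add vectors_carrier[OF theta_vectors[OF t d_closed[OF g]]]
        vectors_carrier[OF theta_vectors[OF t d_closed[OF h]]] by (simp add: minus_add a_comm)
    then show ?case by (simp add: add_A)
  next
    case (single m)
    then show ?case using mono[OF single(1,3)] R.gc_comp_deg[OF f] by simp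
  qed
  then show ?thesis by blast
qed

text \<open>The map \<open>\<gamma>\<close> stands for \<open>I \<rightarrow> I/I\<^sup>2 \<rightarrow> N\<close>; it prescribes the derivation on variables of degree \<open>1\<close>.
  These span the component of degree \<open>1\<close> over \<open>R\<close>, and both sides are linear over \<open>R\<close>.\<close>

lemma reduction_theta_degree_1:
  assumes t: "derivation_data B t" and \<eta>: "\<eta> \<in> lin_maps S (free_module S (B 0)) N" and N: "abelian_group N"
    and \<gamma>_add: "\<And>a b. a \<in> carrier R \<Longrightarrow> b \<in> carrier R \<Longrightarrow> \<alpha> (single R {#} a) = \<zero>\<^bsub>S\<^esub> \<Longrightarrow>
      \<alpha> (single R {#} b) = \<zero>\<^bsub>S\<^esub> \<Longrightarrow> \<gamma> (a \<oplus> b) = \<gamma> a \<oplus>\<^bsub>N\<^esub> \<gamma> b"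
    and \<gamma>_mult: "\<And>r a. r \<in> carrier R \<Longrightarrow> a \<in> carrier R \<Longrightarrow> \<alpha> (single R {#} a) = \<zero>\<^bsub>S\<^esub> \<Longrightarrow>
      \<gamma> (r \<otimes> a) = \<alpha> (single R {#} r) \<odot>\<^bsub>N\<^esub> \<gamma> a"
    and \<gamma>_zero: "\<gamma> \<zero> = \<zero>\<^bsub>N\<^esub>"
    and d_lin: "\<And>r f. r \<in> carrier R \<Longrightarrow> f \<in> carrier A \<Longrightarrow> d (\<lambda>m. r \<otimes> f m) = (\<lambda>m. r \<otimes> d f m)"
    and var: "\<And>x. x \<in> X \<Longrightarrow> vdeg x = 1 \<Longrightarrow> \<eta> (\<lambda>i. \<alpha> (t x (0, i))) = \<gamma> (d (var x) {#})"
    and f: "f \<in> G 1"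
  shows "\<eta> (\<lambda>i. \<alpha> (theta t f (0, i))) = \<gamma> (d f {#})"
proof -
  interpret N: abelian_group N by fact
  have aug: "\<alpha> (single R {#} (d u {#})) = \<zero>\<^bsub>S\<^esub>" if "u \<in> G 1" for u
    using G0_const[of "d u"] d_deg[of u 0] that \<alpha>_d[OF G_carrier[OF that]] by simp
  have "f \<in> carrier (free_module R (gc_monos X vdeg))"
    using G_carrier[OF f] by (simp add: carrier_A)
  then have "f \<in> G 1 \<and> \<eta> (\<lambda>i. \<alpha> (theta t f (0, i))) = \<gamma> (d f {#})"
  proof (induction rule: R.free_module_induct)
    case zero
    have "\<eta> (\<lambda>_. \<zero>\<^bsub>S\<^esub>) = \<zero>\<^bsub>N\<^esub>"
      using lin_maps_zero[OF \<eta> S.free_module_abelian_group N] by simp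
    then show ?case using theta_zero[of t] d_zero \<gamma>_zero \<alpha>_zero G_zero by (simp add: zero_A)
  next
    case (add g h)
    then have gG: "g \<in> G 1" and hG: "h \<in> G 1" by auto
    then have g: "g \<in> carrier A" and h: "h \<in> carrier A" using G_carrier by auto
    have "(\<lambda>i. \<alpha> (theta t (g \<oplus>\<^bsub>A\<^esub> h) (0, i))) = (\<lambda>i. \<alpha> (theta t g (0, i)) \<oplus>\<^bsub>S\<^esub> \<alpha> (theta t h (0, i)))"
      using vectors_carrier[OF theta_vectors[OF t g]] vectors_carrier[OF theta_vectors[OF t h]]
      by (simp add: theta_add[OF t g h] \<alpha>_add)
    then have "\<eta> (\<lambda>i. \<alpha> (theta t (g \<oplus>\<^bsub>A\<^esub> h) (0, i))) = \<gamma> (d g {#}) \<oplus>\<^bsub>N\<^esub> \<gamma> (d h {#})"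
      using lin_maps_add[OF \<eta> reduction_mem[OF theta_vectors[OF t g]] reduction_mem[OF theta_vectors[OF t h]]] add
      by simp
    also have "\<dots> = \<gamma> (d (g \<oplus>\<^bsub>A\<^esub> h) {#})"
      using \<gamma>_add[OF A_coeff[OF d_closed[OF g]] A_coeff[OF d_closed[OF h]] aug[OF gG] aug[OF hG]] d_add[OF g h]
      by (simp add: add_A)
    finally show ?case using G_add[OF gG hG] by (simp add: add_A)
  next
    case (single m)
    obtain x where x: "m = {#x#}" "x \<in> X" "vdeg x = 1"
      using mono_deg_1[OF single(1)] R.gc_comp_deg[OF f single(2)] by auto
    let ?r = "f m"
    have vA: "var x \<in> carrier A" and vG: "var x \<in> G 1" using var_G[OF x(2)] x(3) G_carrier by auto
    have s: "single R m ?r = (\<lambda>m'. ?r \<otimes> var x m')"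
      using single by (auto simp: gc_var_single x single_def)
    have mul: "single R m ?r = var x \<otimes>\<^bsub>A\<^esub> single R {#} ?r"
      using R.gc_mult_const_right[OF single(3) vA] single R.m_comm A_coeff[OF vA] by (simp add: s)
    have tx: "t x (0, i) \<in> carrier A" for i by (rule data_carrier[OF t])
    have cA: "single R {#} ?r \<in> carrier A" using const_G[OF single(3)] G_carrier by blast
    have "theta t (single R m ?r) c = t x c \<otimes>\<^bsub>A\<^esub> single R {#} ?r" for c
      using theta_mult[OF t vG const_G[OF single(3)], of c] theta_const[OF single(3), of t] theta_var[OF t x(2)] vA cA
        data_carrier[OF t] by (simp add: mul)
    then have "(\<lambda>i. \<alpha> (theta t (single R m ?r) (0, i))) = (\<lambda>i. \<alpha> (single R {#} ?r) \<otimes>\<^bsub>S\<^esub> \<alpha> (t x (0, i)))"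
      using tx cA \<alpha>_closed by (auto simp: \<alpha>_mult S.m_comm)
    then have "\<eta> (\<lambda>i. \<alpha> (theta t (single R m ?r) (0, i))) = \<alpha> (single R {#} ?r) \<odot>\<^bsub>N\<^esub> \<gamma> (d (var x) {#})"
      using lin_maps_smult[OF \<eta> \<alpha>_closed[OF cA] reduction_mem[OF data_vectors[OF t]]] var[OF x(2,3)] by simp
    also have "\<dots> = \<gamma> (d (single R m ?r) {#})"
      using \<gamma>_mult[OF single(3) A_coeff[OF d_closed[OF vA]] aug[OF vG]] d_lin[OF single(3) vA] by (simp add: s)
    finally show ?case
      using R.gc_comp_single[OF single(1,3)] R.gc_comp_deg[OF f single(2)] by simp
  qed
  then show ?thesis by blast
qed

text \<open>The value \<open>v\<close> at a variable \<open>x\<close> has to solve the equation \<open>\<partial> v = - \<theta>(\<partial> x)\<close>, whose right-hand side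
  only involves the values on variables of lower degree. It is a cycle by \<open>theta_chain_map\<close>, and
  \<open>lifts_exact\<close> provides the solution.\<close>

lemma derivation_lifts:
  fixes B :: "nat \<Rightarrow> 'i set"
  assumes W: "lifts B D W" and res: "free_resolution S N B D \<eta>" and N: "abelian_group N"
    and \<gamma>_closed: "\<And>a. a \<in> carrier R \<Longrightarrow> \<alpha> (single R {#} a) = \<zero>\<^bsub>S\<^esub> \<Longrightarrow> \<gamma> a \<in> carrier N"
    and \<gamma>_add: "\<And>a b. a \<in> carrier R \<Longrightarrow> b \<in> carrier R \<Longrightarrow> \<alpha> (single R {#} a) = \<zero>\<^bsub>S\<^esub> \<Longrightarrow>
      \<alpha> (single R {#} b) = \<zero>\<^bsub>S\<^esub> \<Longrightarrow> \<gamma> (a \<oplus> b) = \<gamma> a \<oplus>\<^bsub>N\<^esub> \<gamma> b"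
    and \<gamma>_mult: "\<And>r a. r \<in> carrier R \<Longrightarrow> a \<in> carrier R \<Longrightarrow> \<alpha> (single R {#} a) = \<zero>\<^bsub>S\<^esub> \<Longrightarrow>
      \<gamma> (r \<otimes> a) = \<alpha> (single R {#} r) \<odot>\<^bsub>N\<^esub> \<gamma> a"
    and \<gamma>_zero: "\<gamma> \<zero> = \<zero>\<^bsub>N\<^esub>"
    and d_lin: "\<And>r f. r \<in> carrier R \<Longrightarrow> f \<in> carrier A \<Longrightarrow> d (\<lambda>m. r \<otimes> f m) = (\<lambda>m. r \<otimes> d f m)"
  obtains t where "derivation_data B t"
    "\<And>x. x \<in> X \<Longrightarrow> bd W (t x) = (\<lambda>c. \<ominus>\<^bsub>A\<^esub> theta t (d (var x)) c)"
    "\<And>x. x \<in> X \<Longrightarrow> vdeg x = 1 \<Longrightarrow> \<eta> (\<lambda>i. \<alpha> (t x (0, i))) = \<gamma> (d (var x) {#})"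
proof -
  interpret N: abelian_group N by fact
  have Wf: "semifree B W" using W by (simp add: lifts_def)
  have D: "D j \<in> lin_maps S (free_module S (B (Suc j))) (free_module S (B j))" for j
    using res by (simp add: free_resolution_def)
  have \<eta>: "\<eta> \<in> lin_maps S (free_module S (B 0)) N" and \<eta>surj: "\<eta> ` carrier (free_module S (B 0)) = carrier N"
    using res by (auto simp: free_resolution_def)
  \<comment> \<open>For the recursion over the degrees of variables, the conditions on the value \<open>v\<close> at \<open>x\<close> must only
    depend on the values at variables of lower degree; \<open>below\<close> discards the others.\<close>
  define below :: "nat \<Rightarrow> ('x \<Rightarrow> nat \<times> 'i \<Rightarrow> 'x multiset \<Rightarrow> 'a) \<Rightarrow> 'x \<Rightarrow> nat \<times> 'i \<Rightarrow> 'x multiset \<Rightarrow> 'a"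
    where "below = (\<lambda>n t x. if vdeg x < n then t x else (\<lambda>_. \<zero>\<^bsub>A\<^esub>))"
  define good where "good = (\<lambda>t x v. if x \<in> X then v \<in> homog B (vdeg x - 1) \<and>
      bd W v = (\<lambda>c. \<ominus>\<^bsub>A\<^esub> theta (below (vdeg x) t) (d (var x)) c) \<and>
      (vdeg x = 1 \<longrightarrow> \<eta> (\<lambda>i. \<alpha> (v (0, i))) = \<gamma> (d (var x) {#})) else v = (\<lambda>_. \<zero>\<^bsub>A\<^esub>))"
  have data: "derivation_data B (below n t)" if "\<And>x. vdeg x < n \<Longrightarrow> good t x (t x)" for n t
    unfolding derivation_data_def
  proof
    fix x
    show "if x \<in> X then below n t x \<in> homog B (vdeg x - 1) else below n t x = (\<lambda>_. \<zero>\<^bsub>A\<^esub>)"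
      using that[of x] homog_zero by (auto simp: below_def good_def)
  qed
  have dvar: "d (var x) \<in> G (vdeg x - 1)" "vdeg x = Suc (vdeg x - 1)" if "x \<in> X" for x
    using d_deg[of "var x" "vdeg x - 1"] var_G[OF that] vdeg_pos[OF that] by auto
  have "\<exists>t. \<forall>x. good t x (t x)"
  proof (rule dependent_wf_choice)
    show "wf (inv_image less_than vdeg)" by simp
  next
    fix f g :: "'x \<Rightarrow> nat \<times> 'i \<Rightarrow> 'x multiset \<Rightarrow> 'a" and x r
    assume "\<And>z. (z, x) \<in> inv_image less_than vdeg \<Longrightarrow> f z = g z"
    then have "below (vdeg x) f = below (vdeg x) g"
      by (auto simp: below_def fun_eq_iff)
    then show "good f x r = good g x r" by (simp add: good_def)
  next
    fix x t assume IH: "\<And>y. (y, x) \<in> inv_image less_than vdeg \<Longrightarrow> good t y (t y)"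
    show "\<exists>v. good t x v"
    proof (cases "x \<in> X")
      case False
      then show ?thesis by (simp add: good_def)
    next
      case x: True
      define t' where "t' = below (vdeg x) t"
      have t': "derivation_data B t'"
        unfolding t'_def by (rule data) (use IH in auto)
      note dx = dvar(1)[OF x]
      have dxA: "d (var x) \<in> carrier A" by (rule G_carrier[OF dx])
      have y: "theta t' (d (var x)) \<in> homog B (vdeg x - 1 - 1)" by (rule theta_homog[OF t' dx])
      consider (one) "vdeg x = 1" | (more) p where "vdeg x = Suc (Suc p)"
        using dvar(2)[OF x] by (metis One_nat_def not0_implies_Suc)
      then show ?thesis
      proof cases
        case one
        have "\<gamma> (d (var x) {#}) \<in> carrier N"
          using G0_const[of "d (var x)"] dx one \<alpha>_d[OF G_carrier[OF var_G[OF x]]] A_coeff[OF dxA]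
          by (intro \<gamma>_closed) auto
        then have "\<gamma> (d (var x) {#}) \<in> \<eta> ` carrier (free_module S (B 0))" using \<eta>surj by simp
        then obtain l where l: "l \<in> carrier (free_module S (B 0))" "\<eta> l = \<gamma> (d (var x) {#})"
          by (elim imageE) simp
        obtain v where v: "v \<in> homog B 0" "\<And>i. \<alpha> (v (0, i)) = l i"
          using lift_vector[where B = B and m = 0, OF l(1)] by blast
        have "theta t' (d (var x)) = (\<lambda>_. \<zero>\<^bsub>A\<^esub>)"
          using G0_const[of "d (var x)"] dx one theta_const[OF A_coeff[OF dxA], of t' "{#}"] by simp
        then have "good t x v"
          using x v bd_homog0[OF Wf v(1)] l one by (simp add: good_def t'_def)
        then show ?thesis by blast
      next
        case (more p)
        have tvar: "bd W (t' z) = (\<lambda>c. \<ominus>\<^bsub>A\<^esub> theta t' (d (var z)) c)" if z: "z \<in> X" "vdeg z \<le> Suc p" for z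
        proof -
          have g: "good t z (t z)" using IH more z by simp
          have "theta (below (vdeg z) t) (d (var z)) = theta t' (d (var z))"
          proof (rule theta_cong[OF data dvar(1)[OF z(1)]])
            fix y assume "vdeg y < vdeg z"
            then show "good t y (t y)" using IH more z by simp
          next
            fix y assume "vdeg y \<le> vdeg z - 1"
            then show "below (vdeg z) t y = t' y"
              using dvar(2)[OF z(1)] z more by (auto simp: below_def t'_def)
          qed
          then show ?thesis using g z more by (simp add: good_def t'_def below_def)
        qed
        let ?y = "\<lambda>c. \<ominus>\<^bsub>A\<^esub> theta t' (d (var x)) c"
        have y': "?y \<in> homog B p" using homog_uminus[OF y] more by simp
        have ty: "theta t' (d (var x)) \<in> vectors B" by (rule theta_vectors[OF t' dxA])
        have "bd W (theta t' (d (var x))) = (\<lambda>c. \<ominus>\<^bsub>A\<^esub> theta t' (d (d (var x))) c)"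
          by (rule theta_chain_map[OF Wf t' tvar, of "Suc p"]) (use dx more in auto)
        then have cyc: "bd W ?y = (\<lambda>_. \<zero>\<^bsub>A\<^esub>)"
          using bd_uminus[OF Wf ty] d_d[OF G_carrier[OF var_G[OF x]]] theta_zero[of t'] by simp
        have mem: "(\<lambda>i. \<alpha> (?y (p, i))) \<in> carrier (free_module S (B p))"
          by (rule reduction_mem[OF homog_vectors[OF y']])
        have "(\<lambda>i. \<alpha> (?y (p, i))) \<in> D p ` carrier (free_module S (B (Suc p)))"
        proof (cases p)
          case 0
          \<comment> \<open>Over \<open>S\<close>, the cycle lies in the kernel of \<open>\<eta>\<close>, because \<open>\<gamma>\<close> is defined on \<open>I\<close> and \<open>\<partial> \<partial> x = 0\<close>.\<close>
          have "\<eta> (\<lambda>i. \<alpha> (theta t' (d (var x)) (0, i))) = \<gamma> (d (d (var x)) {#})"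
          proof (rule reduction_theta_degree_1[OF t' \<eta> N \<gamma>_add \<gamma>_mult \<gamma>_zero d_lin])
            fix z assume z: "z \<in> X" "vdeg z = 1"
            then have "good t z (t z)" using IH more by simp
            then show "\<eta> (\<lambda>i. \<alpha> (t' z (0, i))) = \<gamma> (d (var z) {#})"
              using z more by (simp add: good_def t'_def below_def)
          qed (use dx more 0 in auto)
          also have "\<dots> = \<zero>\<^bsub>N\<^esub>"
            using d_d[OF G_carrier[OF var_G[OF x]]] \<gamma>_zero by (simp add: zero_A)
          finally have e0: "\<eta> (\<lambda>i. \<alpha> (theta t' (d (var x)) (0, i))) = \<zero>\<^bsub>N\<^esub>" .
          have m0: "(\<lambda>i. \<alpha> (theta t' (d (var x)) (0, i))) \<in> carrier (free_module S (B 0))"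
            by (rule reduction_mem[OF ty])
          have "(\<lambda>i. \<alpha> (?y (0, i))) = (\<lambda>i. \<ominus>\<^bsub>S\<^esub> \<alpha> (theta t' (d (var x)) (0, i)))"
            using vectors_carrier[OF ty] by (auto simp: \<alpha>_uminus)
          also have "\<dots> = \<ominus>\<^bsub>free_module S (B 0)\<^esub> (\<lambda>i. \<alpha> (theta t' (d (var x)) (0, i)))"
            by (rule S.free_module_uminus_eq[OF m0, symmetric])
          finally have "\<eta> (\<lambda>i. \<alpha> (?y (0, i))) = \<ominus>\<^bsub>N\<^esub> \<zero>\<^bsub>N\<^esub>"
            using lin_maps_uminus[OF \<eta> S.free_module_abelian_group N m0] e0 by simp
          then have "\<eta> (\<lambda>i. \<alpha> (?y (0, i))) = \<zero>\<^bsub>N\<^esub>"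
            by simp
          then show ?thesis using res mem 0 by (auto simp: free_resolution_def)
        next
          case (Suc p')
          have "D p' (\<lambda>i. \<alpha> (?y (p, i))) = (\<lambda>_. \<zero>\<^bsub>S\<^esub>)"
            using lifts_\<alpha>_bd[OF W D, of ?y p'] y' Suc cyc \<alpha>_zero by simp
          then show ?thesis using res mem Suc unfolding free_resolution_def free_module_simps by blast
        qed
        then obtain v where v: "v \<in> homog B (Suc p)" "bd W v = ?y"
          using lifts_exact[OF W D y' cyc] by blast
        then have "good t x v"
          using x more by (simp add: good_def t'_def)
        then show ?thesis by blast
      qed
    qed
  qed
  then obtain t where t: "\<And>x. good t x (t x)" by blast
  have dt: "derivation_data B t"
    unfolding derivation_data_def
  proof
    fix x show "if x \<in> X then t x \<in> homog B (vdeg x - 1) else t x = (\<lambda>_. \<zero>\<^bsub>A\<^esub>)"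
      using t[of x] by (simp add: good_def split: if_splits)
  qed
  show thesis
  proof (rule that[OF dt])
    fix x assume x: "x \<in> X"
    have "theta (below (vdeg x) t) (d (var x)) = theta t (d (var x))"
      by (rule theta_cong[OF data[OF t] dvar(1)[OF x]])
        (use dvar(2)[OF x] in \<open>auto simp: below_def\<close>)
    then show "bd W (t x) = (\<lambda>c. \<ominus>\<^bsub>A\<^esub> theta t (d (var x)) c)"
      using t[of x] x by (simp add: good_def)
    show "vdeg x = 1 \<Longrightarrow> \<eta> (\<lambda>i. \<alpha> (t x (0, i))) = \<gamma> (d (var x) {#})"
      using t[of x] x by (simp add: good_def)
  qed
qed

end

section \<open>Powers of the augmentation ideal\<close>

text \<open>The powers of the ideal generated by the variables, for \<open>s \<ge> 1\<close>, in terms of coefficients: \<open>size m\<close> is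
  the number of factors of the monomial \<open>m\<close>. See \<open>size_ideal_1_genideal\<close> and \<open>size_ideal_prod\<close>.\<close>

definition size_ideal :: "('a, 'm) ring_scheme \<Rightarrow> 'x::linorder set \<Rightarrow> ('x \<Rightarrow> nat) \<Rightarrow> nat \<Rightarrow> ('x multiset \<Rightarrow> 'a) set" where
  "size_ideal R X vdeg s = {f \<in> carrier (gc_algebra R X vdeg). \<forall>m. size m < s \<longrightarrow> f m = \<zero>\<^bsub>R\<^esub>}"

context cring
begin

lemma size_ideal_carrier: "f \<in> size_ideal R X vdeg s \<Longrightarrow> f \<in> carrier (gc_algebra R X vdeg)"
  by (simp add: size_ideal_def)

lemma size_ideal_coeff: "f \<in> size_ideal R X vdeg s \<Longrightarrow> size m < s \<Longrightarrow> f m = \<zero>"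
  by (simp add: size_ideal_def)

lemma gc_coeff: "f \<in> carrier (gc_algebra R X vdeg) \<Longrightarrow> f m \<in> carrier R"
  by (simp add: gc_algebra_simps mem_free_module)

lemma gc_coeff_outside: "f \<in> carrier (gc_algebra R X vdeg) \<Longrightarrow> m \<notin> gc_monos X vdeg \<Longrightarrow> f m = \<zero>"
  by (simp add: gc_algebra_simps mem_free_module)

lemma gc_single_mem:
  "m \<in> gc_monos X vdeg \<Longrightarrow> r \<in> carrier R \<Longrightarrow> single R m r \<in> carrier (gc_algebra R X vdeg)"
  by (simp add: gc_algebra_simps single_mem)

lemma gc_var_mem: "x \<in> X \<Longrightarrow> gc_var R x \<in> carrier (gc_algebra R X vdeg)"
  using gc_single_mem[of "{#x#}" X vdeg \<one>] by (simp add: gc_var_single gc_monos_def)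

lemma size_ideal_mult:
  assumes f: "f \<in> size_ideal R X vdeg p" and g: "g \<in> size_ideal R X vdeg q"
  shows "f \<otimes>\<^bsub>gc_algebra R X vdeg\<^esub> g \<in> size_ideal R X vdeg (p + q)"
proof -
  note fA = size_ideal_carrier[OF f] and gA = size_ideal_carrier[OF g]
  have "(f \<otimes>\<^bsub>gc_algebra R X vdeg\<^esub> g) m = \<zero>" if m: "size m < p + q" for m
  proof -
    have "(\<Oplus>a\<in>{a. a \<subseteq># m}. signed R (inversions vdeg a (m - a)) (f a \<otimes> g (m - a))) = \<zero>"
    proof (rule add.finprod_one_eqI)
      fix a assume a: "a \<in> {a. a \<subseteq># m}"
      then have "size a + size (m - a) = size m"
        by (simp add: size_Diff_submset size_mset_mono)
      then have "size a < p \<or> size (m - a) < q" using m by linarith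
      then have "f a = \<zero> \<or> g (m - a) = \<zero>"
        using size_ideal_coeff[OF f] size_ideal_coeff[OF g] by blast
      then show "signed R (inversions vdeg a (m - a)) (f a \<otimes> g (m - a)) = \<zero>"
        using gc_coeff[OF fA] gc_coeff[OF gA] by auto
    qed
    then show ?thesis by (simp add: gc_mult)
  qed
  then show ?thesis
    using gc_mult_closed[OF fA gA] by (simp add: size_ideal_def)
qed

lemma size_ideal_0: "size_ideal R X vdeg 0 = carrier (gc_algebra R X vdeg)"
  by (simp add: size_ideal_def)

lemma size_ideal_ideal: "ideal (size_ideal R X vdeg s) (gc_algebra R X vdeg)"
proof -
  interpret A: ring "gc_algebra R X vdeg" by (rule gc_ring)
  show ?thesis
  proof (rule idealI[OF gc_ring])
    show "subgroup (size_ideal R X vdeg s) (add_monoid (gc_algebra R X vdeg))"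
    proof (rule A.add.subgroupI)
      show "size_ideal R X vdeg s \<noteq> {}"
        using A.zero_closed by (auto simp: size_ideal_def gc_algebra_simps)
    next
      fix f assume f: "f \<in> size_ideal R X vdeg s"
      then show "\<ominus>\<^bsub>gc_algebra R X vdeg\<^esub> f \<in> size_ideal R X vdeg s"
        using A.a_inv_closed[OF size_ideal_carrier[OF f]] gc_uminus[OF size_ideal_carrier[OF f]]
        by (auto simp: size_ideal_def)
    next
      fix f g assume fg: "f \<in> size_ideal R X vdeg s" "g \<in> size_ideal R X vdeg s"
      then show "f \<oplus>\<^bsub>gc_algebra R X vdeg\<^esub> g \<in> size_ideal R X vdeg s"
        using A.a_closed[OF size_ideal_carrier[OF fg(1)] size_ideal_carrier[OF fg(2)]]
        by (auto simp: size_ideal_def gc_algebra_simps(3))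
    qed (auto simp: size_ideal_def)
  next
    fix f g assume "f \<in> size_ideal R X vdeg s" "g \<in> carrier (gc_algebra R X vdeg)"
    then show "g \<otimes>\<^bsub>gc_algebra R X vdeg\<^esub> f \<in> size_ideal R X vdeg s"
      "f \<otimes>\<^bsub>gc_algebra R X vdeg\<^esub> g \<in> size_ideal R X vdeg s"
      using size_ideal_mult[of g X vdeg 0 f s] size_ideal_mult[of f X vdeg s g 0] by (auto simp: size_ideal_0)
  qed
qed

lemma gc_single_split:
  assumes "add_mset x m \<in> gc_monos X vdeg" "r \<in> carrier R"
  shows "single R (add_mset x m) r =
    gc_var R x \<otimes>\<^bsub>gc_algebra R X vdeg\<^esub> single R m (signed R (inversions vdeg {#x#} m) r)"
  using gc_mult_single[of \<one> "signed R (inversions vdeg {#x#} m) r" X vdeg "{#x#}" m] assms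
  by (simp add: gc_var_single signed_signed) (simp add: signed_def)

text \<open>The monomials of size at least \<open>s\<close> generate \<open>size_ideal R X vdeg s\<close> additively.\<close>

lemma size_ideal_induct [consumes 1, case_names add single zero]:
  assumes f: "f \<in> size_ideal R X vdeg s"
    and add: "\<And>g h. g \<in> carrier (gc_algebra R X vdeg) \<Longrightarrow> h \<in> carrier (gc_algebra R X vdeg) \<Longrightarrow>
      P g \<Longrightarrow> P h \<Longrightarrow> P (g \<oplus>\<^bsub>gc_algebra R X vdeg\<^esub> h)"
    and single: "\<And>m r. m \<in> gc_monos X vdeg \<Longrightarrow> s \<le> size m \<Longrightarrow> r \<in> carrier R \<Longrightarrow> P (single R m r)"
    and zero: "P \<zero>\<^bsub>gc_algebra R X vdeg\<^esub>"
  shows "P f"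
proof -
  have "f \<in> carrier (free_module R (gc_monos X vdeg))"
    using size_ideal_carrier[OF f] by (simp add: gc_algebra_simps)
  then show ?thesis
  proof (induction rule: free_module_induct)
    case zero
    then show ?case using assms(4) by (simp add: gc_algebra_simps)
  next
    case (add g h)
    then show ?case using assms(2)[of g h] by (simp add: gc_algebra_simps)
  next
    case (single m)
    have "s \<le> size m" using size_ideal_coeff[OF f] single by (meson not_le_imp_less)
    then show ?case using assms(3) single by simp
  qed
qed

lemma size_ideal_1_genideal: "Idl\<^bsub>gc_algebra R X vdeg\<^esub> (gc_var R ` X) = size_ideal R X vdeg 1"
proof -
  let ?A = "gc_algebra R X vdeg"
  interpret A: ring ?A by (rule gc_ring)
  have sub: "gc_var R ` X \<subseteq> carrier ?A" using gc_var_mem by auto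
  interpret I: ideal "Idl\<^bsub>?A\<^esub> (gc_var R ` X)" ?A by (rule A.genideal_ideal[OF sub])
  show ?thesis
  proof
    show "Idl\<^bsub>?A\<^esub> (gc_var R ` X) \<subseteq> size_ideal R X vdeg 1"
      using gc_var_mem by (intro A.genideal_minimal size_ideal_ideal) (auto simp: size_ideal_def gc_var_def)
  next
    show "size_ideal R X vdeg 1 \<subseteq> Idl\<^bsub>?A\<^esub> (gc_var R ` X)"
    proof
      fix f assume "f \<in> size_ideal R X vdeg 1"
      then show "f \<in> Idl\<^bsub>?A\<^esub> (gc_var R ` X)"
      proof (induction rule: size_ideal_induct)
        case (single m r)
        then obtain x m' where m: "m = add_mset x m'" by (cases m) auto
        then have "x \<in> X" "m' \<in> gc_monos X vdeg" using single by (auto simp: gc_monos_add_mset)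
        then show ?case
          using single A.genideal_self[OF sub] m
          by (auto simp: gc_single_split intro!: I.I_r_closed gc_single_mem)
      qed (auto intro: I.a_closed)
    qed
  qed
qed

lemma size_ideal_prod:
  "ideal_prod (gc_algebra R X vdeg) (size_ideal R X vdeg s) (size_ideal R X vdeg 1) = size_ideal R X vdeg (s + 1)"
    if "s > 0" for s
proof -
  let ?A = "gc_algebra R X vdeg"
  interpret A: ring ?A by (rule gc_ring)
  interpret I: ideal "size_ideal R X vdeg (s + 1)" ?A by (rule size_ideal_ideal)
  interpret J: ideal "ideal_prod ?A (size_ideal R X vdeg s) (size_ideal R X vdeg 1)" ?A
    by (intro A.ideal_prod_is_ideal size_ideal_ideal)
  show ?thesis
  proof
    show "ideal_prod ?A (size_ideal R X vdeg s) (size_ideal R X vdeg 1) \<subseteq> size_ideal R X vdeg (s + 1)"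
    proof
      fix f assume "f \<in> ideal_prod ?A (size_ideal R X vdeg s) (size_ideal R X vdeg 1)"
      then show "f \<in> size_ideal R X vdeg (s + 1)"
      proof (induction rule: ideal_prod.induct)
        case (prod f g)
        then show ?case by (rule size_ideal_mult)
      next
        case (sum f g)
        then show ?case by (intro I.a_closed)
      qed
    qed
  next
    show "size_ideal R X vdeg (s + 1) \<subseteq> ideal_prod ?A (size_ideal R X vdeg s) (size_ideal R X vdeg 1)"
    proof
      fix f assume "f \<in> size_ideal R X vdeg (s + 1)"
      then show "f \<in> ideal_prod ?A (size_ideal R X vdeg s) (size_ideal R X vdeg 1)"
      proof (induction rule: size_ideal_induct)
        case (single m r)
        then obtain x m' where m: "m = m' + {#x#}" by (cases m) auto
        have x: "x \<in> X" "m' \<in> gc_monos X vdeg" "s \<le> size m'"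
          using single m by (auto simp: gc_monos_add_mset)
        let ?t = "signed R (inversions vdeg m' {#x#}) r"
        have "single R m r = single R m' ?t \<otimes>\<^bsub>?A\<^esub> gc_var R x"
          using gc_mult_single[of ?t \<one> X vdeg m' "{#x#}"] single m
          by (simp add: gc_var_single signed_signed) (simp add: signed_def)
        moreover have t: "?t \<in> carrier R" using single(3) by simp
        moreover have "single R m' ?t \<in> size_ideal R X vdeg s"
          unfolding size_ideal_def using gc_single_mem[OF x(2) t] x(3)
          by (simp add: single_def[of R m'])
        moreover have "gc_var R x \<in> size_ideal R X vdeg 1"
          unfolding size_ideal_def using gc_var_mem[OF x(1)] by (simp add: gc_var_def[of R x])
        ultimately show ?case by (simp only: ideal_prod.prod)
      next
        case (add g h)
        then show ?case by (intro J.a_closed)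
      next
        case zero
        show ?case by (rule J.zero_closed)
      qed
    qed
  qed
qed

lemma gc_mult_coeff_1:
  assumes "f \<in> carrier (gc_algebra R X vdeg)" "g \<in> carrier (gc_algebra R X vdeg)" "x \<in> X"
  shows "(f \<otimes>\<^bsub>gc_algebra R X vdeg\<^esub> g) {#x#} = (f {#} \<otimes> g {#x#}) \<oplus> (f {#x#} \<otimes> g {#})"
proof -
  have c: "f m \<in> carrier R" "g m \<in> carrier R" for m using gc_coeff assms by blast+
  have "{a. a \<subseteq># {#x#}} = {{#}, {#x#}}"
  proof (intro equalityI subsetI)
    fix a assume a: "a \<in> {a. a \<subseteq># {#x#}}"
    show "a \<in> {{#}, {#x#}}"
    proof (cases a)
      case (add y b)
      have "y \<in># {#x#}" "size a \<le> size {#x#}"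
        using a add mset_subset_eqD[of a "{#x#}" y] size_mset_mono[of a "{#x#}"] by auto
      then show ?thesis using add by simp
    qed simp
  qed auto
  then show ?thesis
    using assms(3) c by (simp add: gc_mult gc_monos_def) (simp add: signed_def)
qed

end

section \<open>Linear coefficients of the lifted derivation\<close>

lemma (in ring) module_via_abelian_group: "abelian_group (module_via f R)"
  by (rule abelian_groupI)
    (auto simp: module_via_def a_assoc intro: bexI[of _ "\<ominus> _"] l_neg a_comm)

context gc_resolution
begin

abbreviation "phi r \<equiv> \<alpha> (single R {#} r)"

lemma const_A: "r \<in> carrier R \<Longrightarrow> single R {#} r \<in> carrier A"
  using const_G G_carrier by blast

lemma phi_closed: "r \<in> carrier R \<Longrightarrow> phi r \<in> carrier S"
  by (simp add: \<alpha>_closed const_A)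

lemma phi_zero: "phi \<zero> = \<zero>\<^bsub>S\<^esub>"
  using \<alpha>_zero by (simp add: R.single_zero zero_A)

lemma phi_add: "a \<in> carrier R \<Longrightarrow> b \<in> carrier R \<Longrightarrow> phi (a \<oplus> b) = phi a \<oplus>\<^bsub>S\<^esub> phi b"
  using \<alpha>_add[OF const_A const_A, of a b] by (simp add: add_A R.single_add)

lemma phi_mult: "a \<in> carrier R \<Longrightarrow> b \<in> carrier R \<Longrightarrow> phi (a \<otimes> b) = phi a \<otimes>\<^bsub>S\<^esub> phi b"
  using \<alpha>_mult[OF const_A const_A, of a b] R.gc_mult_single[of a b X vdeg "{#}" "{#}"] empty_mono
  by (simp add: signed_def)

lemma coeff_vector:
  assumes f: "f \<in> vectors B"
  shows "(\<lambda>i. phi (f (0, i) m)) \<in> carrier (free_module S (B 0))"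
proof -
  have "finite ((\<lambda>i. (0, i)) -` {c. f c \<noteq> \<zero>\<^bsub>A\<^esub>})"
    using f by (intro finite_vimageI) (auto simp: mem_free_module inj_on_def)
  then have "finite {i. phi (f (0, i) m) \<noteq> \<zero>\<^bsub>S\<^esub>}"
    by (rule finite_subset[rotated]) (auto simp: zero_A phi_zero)
  moreover have "phi (f (0, i) m) \<in> carrier S" for i
    by (rule phi_closed[OF A_coeff[OF vectors_carrier[OF f]]])
  moreover have "phi (f (0, i) m) = \<zero>\<^bsub>S\<^esub>" if "i \<notin> B 0" for i
    using f that by (simp add: mem_free_module zero_A phi_zero)
  ultimately show ?thesis by (simp add: mem_free_module)
qed

text \<open>Apply \<open>h \<circ> \<eta>\<close> and \<open>\<epsilon>\<close> to the coefficient of \<open>x'\<close>, on the cells of degree \<open>0\<close>, in the equation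
  \<open>\<partial>(t x) = - \<theta>(\<partial> x)\<close>. On the left, minimality disposes of the differentials of coefficients, exactness
  at \<open>N\<close> of the cells of degree \<open>1\<close>; cells of higher degree contribute products of two elements of the
  augmentation ideal, except for cells of degree \<open>n + 1\<close>, and there are none. On the right, only the
  products \<open>y x'\<close> of two variables in \<open>\<partial> x\<close> survive.\<close>

lemma obstruction_vanishes:
  fixes B :: "nat \<Rightarrow> 'i set"
  assumes W: "lifts B D W" and res: "free_resolution S N B D \<eta>" and N: "abelian_group N"
    and k: "cring k" and \<epsilon>: "\<epsilon> \<in> ring_hom S k" and h: "h \<in> lin_maps S N (module_via \<epsilon> k)"
    and minimal: "\<And>f m. f \<in> carrier A \<Longrightarrow> f {#} = \<zero> \<Longrightarrow> size m \<le> 1 \<Longrightarrow> \<epsilon> (phi (d f m)) = \<zero>\<^bsub>k\<^esub>"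
    and t: "derivation_data B t" and tx: "bd W (t x) = (\<lambda>c. \<ominus>\<^bsub>A\<^esub> theta t (d (var x)) c)"
    and x: "x \<in> X" "vdeg x = Suc (Suc n)" and n: "n > 0" "B (Suc n) = {}" and x': "x' \<in> X"
  shows "comb k (\<lambda>y _. h (\<eta> (\<lambda>i. phi (t y (0, i) {#})))) (\<lambda>y. \<epsilon> (phi (pd R vdeg y (d (var x)) {#x'#}))) () = \<zero>\<^bsub>k\<^esub>"
proof -
  interpret k: cring k by fact
  interpret N: abelian_group N by fact
  have Wf: "semifree B W" using W by (simp add: lifts_def)
  have \<eta>: "\<eta> \<in> lin_maps S (free_module S (B 0)) N" using res by (simp add: free_resolution_def)
  have kg: "abelian_group (module_via \<epsilon> k)" by (rule k.module_via_abelian_group)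
  have \<epsilon>c: "s \<in> carrier S \<Longrightarrow> \<epsilon> s \<in> carrier k" for s using \<epsilon> by (simp add: ring_hom_closed)
  have \<epsilon>0: "\<epsilon> \<zero>\<^bsub>S\<^esub> = \<zero>\<^bsub>k\<^esub>" using \<epsilon> S.ring_axioms k.ring_axioms by (simp add: ring_hom_zero)
  define \<kappa> where "\<kappa> = (\<lambda>l. h (\<eta> l))"
  have \<kappa>l: "\<kappa> \<in> lin_maps S (free_module S (B 0)) (module_via \<epsilon> k)"
    unfolding \<kappa>_def by (rule lin_maps_compose[OF \<eta> h])
  have \<kappa>_closed: "\<kappa> l \<in> carrier k" if "l \<in> carrier (free_module S (B 0))" for l
    using lin_maps_mem[OF \<kappa>l that] by (simp add: module_via_def)
  have \<kappa>_add: "\<kappa> (\<lambda>i. l i \<oplus>\<^bsub>S\<^esub> l' i) = \<kappa> l \<oplus>\<^bsub>k\<^esub> \<kappa> l'"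
    if "l \<in> carrier (free_module S (B 0))" "l' \<in> carrier (free_module S (B 0))" for l l'
    using lin_maps_add[OF \<kappa>l that] by (simp add: module_via_def)
  have \<kappa>_smult: "\<kappa> (\<lambda>i. s \<otimes>\<^bsub>S\<^esub> l i) = \<epsilon> s \<otimes>\<^bsub>k\<^esub> \<kappa> l"
    if "l \<in> carrier (free_module S (B 0))" "s \<in> carrier S" for l s
    using lin_maps_smult[OF \<kappa>l that(2,1)] by (simp add: module_via_def)
  have \<kappa>_zero: "\<kappa> (\<lambda>_. \<zero>\<^bsub>S\<^esub>) = \<zero>\<^bsub>k\<^esub>"
    using lin_maps_zero[OF \<kappa>l S.free_module_abelian_group kg] by (simp add: module_via_def)
  \<comment> \<open>\<open>\<kappa>\<close> only sees the entries modulo the kernel of \<open>\<epsilon>\<close>, since it is linear over \<open>S\<close> with values in \<open>k\<close>.\<close>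
  have \<kappa>_max: "\<kappa> l = \<zero>\<^bsub>k\<^esub>" if l: "l \<in> carrier (free_module S (B 0))" and l0: "\<And>i. \<epsilon> (l i) = \<zero>\<^bsub>k\<^esub>" for l
    using l
  proof (induction rule: S.free_module_induct)
    case (single i)
    have one: "single S i \<one>\<^bsub>S\<^esub> \<in> carrier (free_module S (B 0))" using single by (intro S.single_mem) auto
    have "single S i (l i) = (\<lambda>j. l i \<otimes>\<^bsub>S\<^esub> single S i \<one>\<^bsub>S\<^esub> j)" using single by (auto simp: single_def)
    then show ?case using \<kappa>_smult[OF one single(3)] l0[of i] \<kappa>_closed[OF one] by simp
  qed (simp_all add: \<kappa>_zero \<kappa>_add)
  \<comment> \<open>the coefficients of \<open>x'\<close> on the cells of degree \<open>0\<close>, mapped to \<open>k\<close>\<close>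
  define \<Lambda> where "\<Lambda> = (\<lambda>f :: nat \<times> 'i \<Rightarrow> 'x multiset \<Rightarrow> 'a. \<kappa> (\<lambda>i. phi (f (0, i) {#x'#})))"
  have \<Lambda>_closed: "\<Lambda> f \<in> carrier k" if "f \<in> vectors B" for f
    unfolding \<Lambda>_def by (rule \<kappa>_closed[OF coeff_vector[OF that]])
  have \<Lambda>_add: "\<Lambda> (\<lambda>c. f c \<oplus>\<^bsub>A\<^esub> g c) = \<Lambda> f \<oplus>\<^bsub>k\<^esub> \<Lambda> g" if f: "f \<in> vectors B" and g: "g \<in> vectors B" for f g
    unfolding \<Lambda>_def using \<kappa>_add[OF coeff_vector[OF f] coeff_vector[OF g]]
    by (simp add: add_A phi_add A_coeff[OF vectors_carrier[OF f]] A_coeff[OF vectors_carrier[OF g]])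
  have \<Lambda>_zero: "\<Lambda> (\<lambda>_. \<zero>\<^bsub>A\<^esub>) = \<zero>\<^bsub>k\<^esub>"
    by (simp add: \<Lambda>_def zero_A phi_zero \<kappa>_zero)
  have \<Lambda>_uminus: "\<Lambda> (\<lambda>c. \<ominus>\<^bsub>A\<^esub> f c) = \<ominus>\<^bsub>k\<^esub> \<Lambda> f" if f: "f \<in> vectors B" for f
  proof -
    have f': "(\<lambda>c. \<ominus>\<^bsub>A\<^esub> f c) \<in> vectors B" by (rule free_module_uminus[OF f])
    have "\<Lambda> (\<lambda>c. \<ominus>\<^bsub>A\<^esub> f c) \<oplus>\<^bsub>k\<^esub> \<Lambda> f = \<zero>\<^bsub>k\<^esub>"
      using \<Lambda>_add[OF f' f] \<Lambda>_zero vectors_carrier[OF f] by (simp add: l_neg)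
    then show ?thesis using \<Lambda>_closed[OF f] \<Lambda>_closed[OF f'] by (simp add: k.minus_equality)
  qed
  define dx where "dx = d (var x)"
  have vG: "var x \<in> G (Suc (Suc n))" using var_G[OF x(1)] x(2) by simp
  have dxG: "dx \<in> G (Suc n)" unfolding dx_def by (rule d_deg[OF vG])
  have dxA: "dx \<in> carrier A" by (rule G_carrier[OF dxG])
  have txh: "t x \<in> homog B (Suc n)" using data_homog[OF t x(1)] x(2) by simp
  have txv: "t x \<in> vectors B" by (rule homog_vectors[OF txh])
  have size1: "f \<in> size_ideal R X vdeg 1" if "f \<in> G (Suc j)" for f j
    using G_pos_empty[OF that] G_carrier[OF that] by (simp add: size_ideal_def)
  \<comment> \<open>In the boundary of \<open>t x\<close>, a cell \<open>e\<close> of degree \<open>j\<close> contributes \<open>W e\<close> times a coefficient of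
    degree \<open>n + 1 - j\<close>.\<close>
  have cells: "\<Lambda> (comb A W (t x)) = \<zero>\<^bsub>k\<^esub>"
    using txv
  proof (induction rule: free_module_induct)
    case zero
    have "comb A W (\<lambda>_. \<zero>\<^bsub>A\<^esub>) = (\<lambda>_. \<zero>\<^bsub>A\<^esub>)" by (rule ext) (rule comb_zero)
    then show ?case using \<Lambda>_zero by simp
  next
    case (add f g)
    have "comb A W (\<lambda>c. f c \<oplus>\<^bsub>A\<^esub> g c) = (\<lambda>c. comb A W f c \<oplus>\<^bsub>A\<^esub> comb A W g c)"
      by (rule ext, rule comb_add[OF add(1,2)]) (rule semifree_carrier[OF Wf])
    then show ?case using \<Lambda>_add[OF comb_vectors[OF Wf add(1)] comb_vectors[OF Wf add(2)]] add by simp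
  next
    case (single e)
    obtain j i0 where e: "e = (j, i0)" by (cases e)
    let ?a = "t x e"
    have jn: "j \<le> Suc n" using homog_above[OF txh, of j i0] single(2) e by (cases "j \<le> Suc n") auto
    have i0: "i0 \<in> B j" using single(1) e by simp
    then have jn': "j \<noteq> Suc n" using n by auto
    have aG: "?a \<in> G (Suc n - j)" using homog_G[OF txh jn] e by simp
    have eq: "comb A W (single A e ?a) = (\<lambda>c. W e c \<otimes>\<^bsub>A\<^esub> ?a)"
      by (rule ext, rule comb_single[OF single(3)]) (rule semifree_carrier[OF Wf])
    consider "j = 0" | "j = 1" | j' where "j = Suc (Suc j')"
      by (metis One_nat_def not0_implies_Suc)
    then show ?case
    proof cases
      case 1
      then show ?thesis using eq semifree_0[OF Wf] single(3) \<Lambda>_zero by (simp add: e)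
    next
      case 2
      have w: "W e (0, i) \<in> G 0" for i
        using homog_G[OF semifree_homog[OF Wf], of 0 0 i0 i] 2 e by simp
      let ?s = "phi (?a {#x'#})"
      have s: "?s \<in> carrier S" by (rule phi_closed[OF A_coeff[OF single(3)]])
      have "phi ((W e (0, i) \<otimes>\<^bsub>A\<^esub> ?a) {#x'#}) = ?s \<otimes>\<^bsub>S\<^esub> \<alpha> (W e (0, i))" for i
      proof -
        let ?w = "W e (0, i) {#}"
        have wc: "?w \<in> carrier R" by (rule A_coeff[OF G_carrier[OF w]])
        have "(W e (0, i) \<otimes>\<^bsub>A\<^esub> ?a) {#x'#} = ?w \<otimes> ?a {#x'#}"
          by (subst G0_const[OF w]) (simp add: R.gc_mult_const_left[OF wc single(3)])
        then show ?thesis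
          using phi_mult[OF wc A_coeff[OF single(3)]] phi_closed[OF wc] s G0_const[OF w, of i]
          by (simp add: S.m_comm)
      qed
      then have "\<Lambda> (comb A W (single A e ?a)) = \<epsilon> ?s \<otimes>\<^bsub>k\<^esub> \<kappa> (\<lambda>i. \<alpha> (W e (0, i)))"
        unfolding eq \<Lambda>_def using \<kappa>_smult[OF reduction_mem[OF semifree_vectors[OF Wf]] s] by simp
      moreover have "\<kappa> (\<lambda>i. \<alpha> (W e (0, i))) = \<zero>\<^bsub>k\<^esub>"
      proof -
        have one: "single S i0 \<one>\<^bsub>S\<^esub> \<in> carrier (free_module S (B (Suc 0)))"
          using i0 2 by (intro S.single_mem) auto
        have "(\<lambda>i. \<alpha> (W e (0, i))) = D 0 (single S i0 \<one>\<^bsub>S\<^esub>)"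
          using W i0 2 by (auto simp: lifts_def e)
        then have "\<eta> (\<lambda>i. \<alpha> (W e (0, i))) = \<zero>\<^bsub>N\<^esub>"
          using res one by (auto simp: free_resolution_def)
        then show ?thesis
          using lin_maps_zero[OF h N kg] by (simp add: \<kappa>_def module_via_def)
      qed
      ultimately show ?thesis using s \<epsilon>c by simp
    next
      case (3 j')
      have "(W e (0, i) \<otimes>\<^bsub>A\<^esub> ?a) {#x'#} = \<zero>" for i
      proof -
        have "W e (0, i) \<in> G (Suc j')"
          using homog_G[OF semifree_homog[OF Wf], of 0 "Suc j'" i0 i] 3 e by simp
        moreover have "?a \<in> G (Suc (n - j))" using aG jn jn' by (simp add: Suc_diff_le)
        ultimately have "W e (0, i) \<otimes>\<^bsub>A\<^esub> ?a \<in> size_ideal R X vdeg (1 + 1)"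
          by (intro R.size_ideal_mult size1)
        then show ?thesis by (rule R.size_ideal_coeff) simp
      qed
      then show ?thesis unfolding eq \<Lambda>_def by (simp add: phi_zero \<kappa>_zero)
    qed
  qed
  have dv: "(\<lambda>c. signed A (fst c) (d (t x c))) \<in> vectors B"
    by (rule free_module_map[OF txv, where h = "\<lambda>c a. signed A (fst c) (d a)"]) (use d_zero d_closed in auto)
  have "\<Lambda> (\<lambda>c. signed A (fst c) (d (t x c))) = \<zero>\<^bsub>k\<^esub>"
    unfolding \<Lambda>_def
  proof (rule \<kappa>_max[OF coeff_vector[OF dv]])
    fix i
    have "t x (0, i) \<in> G (Suc n)" using homog_G[OF txh, of 0 i] by simp
    then show "\<epsilon> (phi (signed A (fst (0 :: nat, i)) (d (t x (0, i))) {#x'#})) = \<zero>\<^bsub>k\<^esub>"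
      using minimal[OF G_carrier[OF \<open>t x (0, i) \<in> G (Suc n)\<close>] G_pos_empty[OF \<open>t x (0, i) \<in> G (Suc n)\<close>], of "{#x'#}"]
      by (simp add: signed_def)
  qed
  then have "\<Lambda> (bd W (t x)) = \<zero>\<^bsub>k\<^esub>"
    unfolding bd_def using \<Lambda>_add[OF comb_vectors[OF Wf txv] dv] cells by simp
  then have "\<Lambda> (theta t dx) = \<zero>\<^bsub>k\<^esub>"
    using tx \<Lambda>_uminus[OF theta_vectors[OF t dxA]] \<Lambda>_closed[OF theta_vectors[OF t dxA]]
    by (simp add: dx_def) (metis k.minus_minus k.minus_zero)
  \<comment> \<open>A linear term of the product of \<open>t y\<close> and \<open>g y\<close> needs the constant term of one factor, and the
    constant term of \<open>g y\<close> is zero in \<open>k\<close>.\<close>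
  moreover have "\<Lambda> (comb A t g) = comb k (\<lambda>y _. \<kappa> (\<lambda>i. phi (t y (0, i) {#}))) (\<lambda>y. \<epsilon> (phi (g y {#x'#}))) ()"
    if g: "g \<in> carrier (free_module A X)" and g0: "\<And>y. \<epsilon> (phi (g y {#})) = \<zero>\<^bsub>k\<^esub>" for g
    using g
  proof (induction rule: free_module_induct)
    case zero
    have "comb A t (\<lambda>_. \<zero>\<^bsub>A\<^esub>) = (\<lambda>_. \<zero>\<^bsub>A\<^esub>)" by (rule ext) (rule comb_zero)
    then show ?case by (simp add: \<Lambda>_zero) (simp add: zero_A phi_zero \<epsilon>0 k.comb_zero)
  next
    case (add f g)
    have kv: "(\<lambda>y. \<epsilon> (phi (f y {#x'#}))) \<in> carrier (free_module k X)" if f: "f \<in> carrier (free_module A X)" for f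
    proof -
      have "{y. \<epsilon> (phi (f y {#x'#})) \<noteq> \<zero>\<^bsub>k\<^esub>} \<subseteq> {y. f y \<noteq> \<zero>\<^bsub>A\<^esub>}"
        by (auto simp: zero_A phi_zero \<epsilon>0)
      moreover have "finite {y. f y \<noteq> \<zero>\<^bsub>A\<^esub>}" and fA: "\<And>y. f y \<in> carrier A" and f0: "\<And>y. y \<notin> X \<Longrightarrow> f y = \<zero>\<^bsub>A\<^esub>"
        using f by (auto simp: mem_free_module)
      ultimately show ?thesis
        using \<epsilon>c phi_closed A_coeff[OF fA] by (auto simp: mem_free_module zero_A phi_zero \<epsilon>0 intro: finite_subset)
    qed
    have fg: "f y \<in> carrier A" "g y \<in> carrier A" for y using add by (auto simp: mem_free_module)
    have "comb A t (\<lambda>c. f c \<oplus>\<^bsub>A\<^esub> g c) = (\<lambda>c. comb A t f c \<oplus>\<^bsub>A\<^esub> comb A t g c)"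
      by (rule ext, rule comb_add[OF add(1,2)]) (rule data_carrier[OF t])
    then have "\<Lambda> (comb A t (\<lambda>c. f c \<oplus>\<^bsub>A\<^esub> g c)) = \<Lambda> (comb A t f) \<oplus>\<^bsub>k\<^esub> \<Lambda> (comb A t g)"
      using \<Lambda>_add[OF comb_mem[OF add(1)] comb_mem[OF add(2)]] data_vectors[OF t] by simp
    also have "\<dots> = comb k (\<lambda>y _. \<kappa> (\<lambda>i. phi (t y (0, i) {#})))
        (\<lambda>y. \<epsilon> (phi (f y {#x'#})) \<oplus>\<^bsub>k\<^esub> \<epsilon> (phi (g y {#x'#}))) ()"
      unfolding add.IH
      by (rule k.comb_add[OF kv[OF add(1)] kv[OF add(2)], symmetric])
        (rule \<kappa>_closed[OF coeff_vector[OF data_vectors[OF t]]])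
    also have "(\<lambda>y. \<epsilon> (phi (f y {#x'#})) \<oplus>\<^bsub>k\<^esub> \<epsilon> (phi (g y {#x'#}))) = (\<lambda>y. \<epsilon> (phi ((f y \<oplus>\<^bsub>A\<^esub> g y) {#x'#})))"
      using fg by (simp add: add_A phi_add A_coeff phi_closed ring_hom_add[OF \<epsilon>])
    finally show ?case .
  next
    case (single y)
    let ?a = "g y"
    have tyA: "t y c \<in> carrier A" for c by (rule data_carrier[OF t])
    have ac: "?a m \<in> carrier R" for m by (rule A_coeff[OF single(3)])
    have tc: "t y c m \<in> carrier R" for c m by (rule A_coeff[OF tyA])
    have eq: "comb A t (single A y ?a) = (\<lambda>c. t y c \<otimes>\<^bsub>A\<^esub> ?a)"
      by (rule ext, rule comb_single[OF single(3)]) (rule tyA)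
    have "(\<lambda>i. phi ((t y (0, i) \<otimes>\<^bsub>A\<^esub> ?a) {#x'#})) =
      (\<lambda>i. (phi (?a {#x'#}) \<otimes>\<^bsub>S\<^esub> phi (t y (0, i) {#})) \<oplus>\<^bsub>S\<^esub> (phi (?a {#}) \<otimes>\<^bsub>S\<^esub> phi (t y (0, i) {#x'#})))"
      using ac tc phi_closed by (auto simp: R.gc_mult_coeff_1[OF tyA single(3) x'] phi_add phi_mult S.m_comm)
    then have "\<Lambda> (comb A t (single A y ?a)) =
        (\<epsilon> (phi (?a {#x'#})) \<otimes>\<^bsub>k\<^esub> \<kappa> (\<lambda>i. phi (t y (0, i) {#}))) \<oplus>\<^bsub>k\<^esub>
        (\<epsilon> (phi (?a {#})) \<otimes>\<^bsub>k\<^esub> \<kappa> (\<lambda>i. phi (t y (0, i) {#x'#})))"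
      unfolding eq \<Lambda>_def
      using \<kappa>_add[OF S.free_module_lmult[OF coeff_vector[OF data_vectors[OF t]] phi_closed[OF ac]]
          S.free_module_lmult[OF coeff_vector[OF data_vectors[OF t]] phi_closed[OF ac]]]
        \<kappa>_smult[OF coeff_vector[OF data_vectors[OF t]] phi_closed[OF ac]] by simp
    also have "\<dots> = \<kappa> (\<lambda>i. phi (t y (0, i) {#})) \<otimes>\<^bsub>k\<^esub> \<epsilon> (phi (?a {#x'#}))"
      using g0[of y] \<kappa>_closed[OF coeff_vector[OF data_vectors[OF t]]] \<epsilon>c phi_closed ac by (simp add: k.m_comm)
    also have "\<dots> = comb k (\<lambda>y _. \<kappa> (\<lambda>i. phi (t y (0, i) {#}))) (single k y (\<epsilon> (phi (?a {#x'#})))) ()"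
      by (rule k.comb_single[symmetric])
        (use \<kappa>_closed[OF coeff_vector[OF data_vectors[OF t]]] \<epsilon>c phi_closed ac in auto)
    also have "single k y (\<epsilon> (phi (?a {#x'#}))) = (\<lambda>y'. \<epsilon> (phi (single A y ?a y' {#x'#})))"
    proof
      fix y'
      show "single k y (\<epsilon> (phi (?a {#x'#}))) y' = \<epsilon> (phi (single A y ?a y' {#x'#}))"
        by (cases "y' = y") (simp_all add: single_def[of k] single_def[of A] zero_A phi_zero \<epsilon>0)
    qed
    finally show ?case .
  qed
  moreover have "\<epsilon> (phi (pd R vdeg y dx {#})) = \<zero>\<^bsub>k\<^esub>" for y
  proof -
    have "pd R vdeg y dx {#} = dx {#y#}" using A_coeff[OF dxA] by (simp add: pd_def signed_def)
    then show ?thesis using minimal[OF G_carrier[OF vG] G_pos_empty[OF vG], of "{#y#}"] by (simp add: dx_def)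
  qed
  ultimately show ?thesis
    using R.pd_vector[OF dxA] unfolding theta_def dx_def \<kappa>_def by simp
qed

end

section \<open>Change of coefficients\<close>

context ring_hom_cring
begin

lemma hom_signed: "r \<in> carrier R \<Longrightarrow> h (signed R n r) = signed S n (h r)"
  by (simp add: signed_def)

lemma hom_add_pow: "r \<in> carrier R \<Longrightarrow> h (add_pow R (n :: nat) r) = add_pow S n (h r)"
  by (induction n) simp_all

lemma gc_map_mem:
  assumes "f \<in> carrier (gc_algebra R X vdeg)"
  shows "h \<circ> f \<in> carrier (gc_algebra S X vdeg)"
proof -
  have "{m. h (f m) \<noteq> \<zero>\<^bsub>S\<^esub>} \<subseteq> {m. f m \<noteq> \<zero>}" by auto
  then show ?thesis
    using assms by (auto simp: gc_algebra_simps mem_free_module intro: finite_subset)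
qed

lemma gc_map_add:
  assumes "f \<in> carrier (gc_algebra R X vdeg)" "g \<in> carrier (gc_algebra R X vdeg)"
  shows "h \<circ> (f \<oplus>\<^bsub>gc_algebra R X vdeg\<^esub> g) = (h \<circ> f) \<oplus>\<^bsub>gc_algebra S X vdeg\<^esub> (h \<circ> g)"
  using assms by (auto simp: gc_algebra_simps mem_free_module)

lemma gc_map_mult:
  assumes f: "f \<in> carrier (gc_algebra R X vdeg)" and g: "g \<in> carrier (gc_algebra R X vdeg)"
  shows "h \<circ> (f \<otimes>\<^bsub>gc_algebra R X vdeg\<^esub> g) = (h \<circ> f) \<otimes>\<^bsub>gc_algebra S X vdeg\<^esub> (h \<circ> g)"
proof
  fix m
  have c: "f a \<in> carrier R" "g a \<in> carrier R" for a using R.gc_coeff f g by blast+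
  have "h (\<Oplus>a\<in>{a. a \<subseteq># m}. signed R (inversions vdeg a (m - a)) (f a \<otimes> g (m - a))) =
      (\<Oplus>\<^bsub>S\<^esub>a\<in>{a. a \<subseteq># m}. signed S (inversions vdeg a (m - a)) (h (f a) \<otimes>\<^bsub>S\<^esub> h (g (m - a))))"
    using c by (subst hom_finsum) (auto simp: hom_signed intro!: S.finsum_cong')
  then show "(h \<circ> (f \<otimes>\<^bsub>gc_algebra R X vdeg\<^esub> g)) m = ((h \<circ> f) \<otimes>\<^bsub>gc_algebra S X vdeg\<^esub> (h \<circ> g)) m"
    by (simp add: R.gc_mult S.gc_mult)
qed

lemma gc_map_single: "r \<in> carrier R \<Longrightarrow> h \<circ> single R m r = single S m (h r)"
  by (auto simp: single_def)

lemma gc_map_var: "h \<circ> gc_var R x = gc_var S x"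
  by (simp add: gc_var_single gc_map_single)

lemma gc_map_pd:
  assumes f: "f \<in> carrier (gc_algebra R X vdeg)"
  shows "h \<circ> pd R vdeg x f = pd S vdeg x (h \<circ> f)"
proof
  fix m
  have "f (add_mset x m) \<in> carrier R" by (rule R.gc_coeff[OF f])
  then show "(h \<circ> pd R vdeg x f) m = pd S vdeg x (h \<circ> f) m"
    by (simp add: pd_def hom_signed hom_add_pow del: R.add.nat_pow_Suc S.add.nat_pow_Suc)
qed

lemma gc_map_ring_hom: "ring_hom_ring (gc_algebra R X vdeg) (gc_algebra S X vdeg) (\<lambda>f. h \<circ> f)"
proof (rule ring_hom_ringI[OF R.gc_ring S.gc_ring])
  show "h \<circ> \<one>\<^bsub>gc_algebra R X vdeg\<^esub> = \<one>\<^bsub>gc_algebra S X vdeg\<^esub>"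
    by (simp add: gc_one gc_map_single)
qed (auto simp: gc_map_mem gc_map_add gc_map_mult)

lemma gc_map_surj:
  assumes surj: "h ` carrier R = carrier S" and g: "g \<in> carrier (gc_algebra S X vdeg)"
  obtains f where "f \<in> carrier (gc_algebra R X vdeg)" "h \<circ> f = g" "\<And>m. g m = \<zero>\<^bsub>S\<^esub> \<Longrightarrow> f m = \<zero>"
proof -
  have "\<exists>r\<in>carrier R. h r = g m \<and> (g m = \<zero>\<^bsub>S\<^esub> \<longrightarrow> r = \<zero>)" for m
  proof (cases "g m = \<zero>\<^bsub>S\<^esub>")
    case True
    then show ?thesis by (intro bexI[of _ \<zero>]) auto
  next
    case False
    have "g m \<in> h ` carrier R" using S.gc_coeff[OF g] surj by simp
    then show ?thesis using False by auto
  qed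
  then obtain f where f: "\<And>m. f m \<in> carrier R" "\<And>m. h (f m) = g m" "\<And>m. g m = \<zero>\<^bsub>S\<^esub> \<Longrightarrow> f m = \<zero>"
    by metis
  have "{m. f m \<noteq> \<zero>} \<subseteq> {m. g m \<noteq> \<zero>\<^bsub>S\<^esub>}" using f(3) by auto
  then have "f \<in> carrier (gc_algebra R X vdeg)"
    using g f by (auto simp: gc_algebra_simps mem_free_module intro: finite_subset)
  moreover have "h \<circ> f = g" using f(2) by auto
  ultimately show thesis using f(3) by (rule that)
qed

text \<open>By linearity, \<open>d f\<close> is a combination of the images of the monomials, with the coefficients of \<open>f\<close>.\<close>

lemma gc_map_kernel:
  assumes d: "d \<in> lin_maps R (gc_algebra R X vdeg) (gc_algebra R X vdeg)"
    and f: "f \<in> carrier (gc_algebra R X vdeg)" and f0: "\<And>m. h (f m) = \<zero>\<^bsub>S\<^esub>"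
  shows "h (d f m) = \<zero>\<^bsub>S\<^esub>"
proof -
  let ?A = "gc_algebra R X vdeg"
  have "f \<in> carrier (free_module R (gc_monos X vdeg))" using f by (simp add: gc_algebra_simps)
  then have "\<forall>m. h (d f m) = \<zero>\<^bsub>S\<^esub>"
  proof (induction rule: R.free_module_induct)
    case zero
    have "d \<zero>\<^bsub>?A\<^esub> = \<zero>\<^bsub>?A\<^esub>" by (rule lin_maps_zero[OF d R.gc_abelian_group R.gc_abelian_group])
    then show ?case by (simp add: gc_algebra_simps)
  next
    case (add u v)
    then have uv: "u \<in> carrier ?A" "v \<in> carrier ?A" by (simp_all add: gc_algebra_simps)
    have "d (u \<oplus>\<^bsub>?A\<^esub> v) = d u \<oplus>\<^bsub>?A\<^esub> d v" by (rule lin_maps_add[OF d uv])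
    then show ?case
      using add R.gc_coeff[OF lin_maps_mem[OF d uv(1)]] R.gc_coeff[OF lin_maps_mem[OF d uv(2)]]
      by (simp add: gc_algebra_simps)
  next
    case (single m')
    have s: "single R m' \<one> \<in> carrier ?A" using single by (simp add: R.gc_single_mem)
    have "single R m' (f m') = f m' \<odot>\<^bsub>?A\<^esub> single R m' \<one>"
      using single by (auto simp: gc_algebra_simps single_def)
    then have "d (single R m' (f m')) = (\<lambda>m. f m' \<otimes> d (single R m' \<one>) m)"
      using lin_maps_smult[OF d single(3) s] by (simp add: gc_algebra_simps)
    then show ?case
      using f0[of m'] R.gc_coeff[OF lin_maps_mem[OF d s]] single by simp
  qed
  then show ?thesis by blast
qed

text \<open>The description that defines \<open>fibre_diff\<close> determines it, because \<open>h\<close> is surjective, and it is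
  consistent by \<open>gc_map_kernel\<close>.\<close>

lemma fibre_diff_properties:
  assumes surj: "h ` carrier R = carrier S" and d: "d \<in> lin_maps R (gc_algebra R X vdeg) (gc_algebra R X vdeg)"
  shows "fibre_diff R S h X vdeg d \<in> lin_maps S (gc_algebra S X vdeg) (gc_algebra S X vdeg)"
    and "f \<in> carrier (gc_algebra R X vdeg) \<Longrightarrow> fibre_diff R S h X vdeg d (h \<circ> f) = h \<circ> d f"
proof -
  let ?A = "gc_algebra R X vdeg" and ?K = "gc_algebra S X vdeg"
  interpret A: ring ?A by (rule R.gc_ring)
  let ?P = "\<lambda>D. D \<in> lin_maps S ?K ?K \<inter> extensional (carrier ?K) \<and> (\<forall>f\<in>carrier ?A. D (h \<circ> f) = h \<circ> d f)"
  have wd: "h \<circ> d f = h \<circ> d f'" if f: "f \<in> carrier ?A" and f': "f' \<in> carrier ?A" and eq: "h \<circ> f = h \<circ> f'" for f f'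
  proof
    fix m
    have c: "f m \<in> carrier R" "f' m \<in> carrier R" "d f m \<in> carrier R" "d f' m \<in> carrier R" for m
      using R.gc_coeff f f' lin_maps_mem[OF d] by blast+
    have g: "f \<ominus>\<^bsub>?A\<^esub> f' \<in> carrier ?A" using f f' by simp
    have gm: "(f \<ominus>\<^bsub>?A\<^esub> f') m = f m \<ominus> f' m" for m
      using R.gc_uminus[OF f'] by (simp add: a_minus_def gc_algebra_simps(3))
    have "d (f \<ominus>\<^bsub>?A\<^esub> f') = d f \<ominus>\<^bsub>?A\<^esub> d f'"
      using lin_maps_add[OF d f A.a_inv_closed[OF f']]
        lin_maps_uminus[OF d R.gc_abelian_group R.gc_abelian_group f'] by (simp add: a_minus_def)
    then have "d (f \<ominus>\<^bsub>?A\<^esub> f') m = d f m \<ominus> d f' m"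
      using R.gc_uminus[OF lin_maps_mem[OF d f']] by (simp add: a_minus_def gc_algebra_simps(3))
    moreover have "h ((f \<ominus>\<^bsub>?A\<^esub> f') m) = \<zero>\<^bsub>S\<^esub>" for m
      using fun_cong[OF eq, of m] c by (simp add: gm R.minus_eq S.r_neg)
    then have "h (d (f \<ominus>\<^bsub>?A\<^esub> f') m) = \<zero>\<^bsub>S\<^esub>" by (rule gc_map_kernel[OF d g])
    ultimately have "h (d f m) \<ominus>\<^bsub>S\<^esub> h (d f' m) = \<zero>\<^bsub>S\<^esub>"
      using c by (simp add: R.minus_eq S.minus_eq)
    then show "(h \<circ> d f) m = (h \<circ> d f') m"
      using c by (simp add: S.r_right_minus_eq)
  qed
  define D where "D = restrict (\<lambda>g. h \<circ> d (SOME f. f \<in> carrier ?A \<and> h \<circ> f = g)) (carrier ?K)"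
  have D: "D (h \<circ> f) = h \<circ> d f" if f: "f \<in> carrier ?A" for f
  proof -
    let ?f = "SOME f'. f' \<in> carrier ?A \<and> h \<circ> f' = h \<circ> f"
    have "?f \<in> carrier ?A \<and> h \<circ> ?f = h \<circ> f" by (rule someI[of _ f]) (use f in auto)
    then have "h \<circ> d ?f = h \<circ> d f" using wd f by blast
    then show ?thesis using gc_map_mem[OF f] by (simp add: D_def)
  qed
  have surjA: "\<exists>f\<in>carrier ?A. h \<circ> f = g" if "g \<in> carrier ?K" for g
    using gc_map_surj[OF surj that] by blast
  have "D \<in> lin_maps S ?K ?K"
    unfolding lin_maps_def
  proof (intro CollectI conjI ballI Pi_I)
    fix g assume "g \<in> carrier ?K"
    then obtain f where f: "f \<in> carrier ?A" "g = h \<circ> f" using surjA by blast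
    then show "D g \<in> carrier ?K" using D gc_map_mem[OF lin_maps_mem[OF d f(1)]] by simp
  next
    fix g g' assume "g \<in> carrier ?K" "g' \<in> carrier ?K"
    then obtain f f' where f: "f \<in> carrier ?A" "g = h \<circ> f" "f' \<in> carrier ?A" "g' = h \<circ> f'" using surjA by metis
    have "D (g \<oplus>\<^bsub>?K\<^esub> g') = D (h \<circ> (f \<oplus>\<^bsub>?A\<^esub> f'))" using f by (simp add: gc_map_add)
    also have "\<dots> = h \<circ> d (f \<oplus>\<^bsub>?A\<^esub> f')" using f by (intro D) simp
    also have "\<dots> = D g \<oplus>\<^bsub>?K\<^esub> D g'"
      using f D lin_maps_add[OF d f(1,3)] gc_map_add[OF lin_maps_mem[OF d f(1)] lin_maps_mem[OF d f(3)]] by simp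
    finally show "D (g \<oplus>\<^bsub>?K\<^esub> g') = D g \<oplus>\<^bsub>?K\<^esub> D g'" .
  next
    fix s g assume "s \<in> carrier S" "g \<in> carrier ?K"
    then obtain r f where r: "r \<in> carrier R" "s = h r" and f: "f \<in> carrier ?A" "g = h \<circ> f" using surjA surj by blast
    have sm: "h \<circ> (r \<odot>\<^bsub>?A\<^esub> f) = h r \<odot>\<^bsub>?K\<^esub> (h \<circ> f)" if "f \<in> carrier ?A" for f
      using R.gc_coeff[OF that] r by (auto simp: gc_algebra_simps(4))
    have rf: "r \<odot>\<^bsub>?A\<^esub> f \<in> carrier ?A"
      using R.free_module_lmult[of f "gc_monos X vdeg" r] f r by (simp add: gc_algebra_simps)
    show "D (s \<odot>\<^bsub>?K\<^esub> g) = s \<odot>\<^bsub>?K\<^esub> D g"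
      using sm[OF f(1)] sm[OF lin_maps_mem[OF d f(1)]] D[OF rf] D[OF f(1)] lin_maps_smult[OF d r(1) f(1)] r f by simp
  qed
  then have PD: "?P D" using D by (auto simp: D_def)
  have "\<exists>!D. ?P D"
  proof (rule ex1I[of ?P D, OF PD])
    fix E assume E: "?P E"
    show "E = D"
    proof
      fix g
      show "E g = D g"
      proof (cases "g \<in> carrier ?K")
        case True
        then obtain f where "f \<in> carrier ?A" "g = h \<circ> f" using surjA by blast
        then show ?thesis using E D by simp
      next
        case False
        then show ?thesis using E PD by (auto simp: extensional_def)
      qed
    qed
  qed
  then have "?P (fibre_diff R S h X vdeg d)"
    unfolding fibre_diff_def by (rule theI')
  then show "fibre_diff R S h X vdeg d \<in> lin_maps S ?K ?K"
    and "f \<in> carrier ?A \<Longrightarrow> fibre_diff R S h X vdeg d (h \<circ> f) = h \<circ> d f"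
    by auto
qed

end

section \<open>The pairing on indecomposables\<close>

text \<open>The functional \<open>\<langle>u \<otimes> v, -\<rangle>\<close>, up to sign, in terms of the values of \<open>u\<close> and \<open>v\<close> on the variables:
  differentiate by \<open>u\<close>, and apply \<open>v\<close> to the linear part.\<close>

definition dual_pairing :: "('a, 'm) ring_scheme \<Rightarrow> ('x::linorder \<Rightarrow> nat) \<Rightarrow> ('x \<Rightarrow> 'a) \<Rightarrow> ('x \<Rightarrow> 'a) \<Rightarrow> ('x multiset \<Rightarrow> 'a) \<Rightarrow> 'a" where
  "dual_pairing R vdeg u v q =
     comb R (\<lambda>x' _. v x') (\<lambda>x'. comb R (\<lambda>y _. u y) (\<lambda>y. pd R vdeg y q {#x'#}) ()) ()"

context cring
begin

lemma fibre_ideal_size: "fibre_ideal R X vdeg = size_ideal R X vdeg 1"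
  by (simp only: fibre_ideal_def size_ideal_1_genideal)

lemma fibre_ideal_sq_size: "fibre_ideal_sq R X vdeg = size_ideal R X vdeg 2"
  unfolding fibre_ideal_sq_def fibre_ideal_size by (subst size_ideal_prod) (simp_all add: numeral_2_eq_2)

lemma fibre_ideal_cube_size: "fibre_ideal_cube R X vdeg = size_ideal R X vdeg 3"
  unfolding fibre_ideal_cube_def fibre_ideal_size fibre_ideal_sq_size
  by (subst size_ideal_prod) (simp_all add: numeral_3_eq_3)

lemma pd_coeff_vector:
  assumes q: "q \<in> carrier (gc_algebra R X vdeg)"
  shows "(\<lambda>y. pd R vdeg y q m) \<in> carrier (free_module R X)"
proof -
  have v: "(\<lambda>y. pd R vdeg y q) \<in> carrier (free_module (gc_algebra R X vdeg) X)" by (rule pd_vector[OF q])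
  then have "finite {y. pd R vdeg y q \<noteq> (\<lambda>_. \<zero>)}" and out: "\<And>y. y \<notin> X \<Longrightarrow> pd R vdeg y q = (\<lambda>_. \<zero>)"
    by (auto simp: mem_free_module gc_algebra_simps)
  moreover have "{y. pd R vdeg y q m \<noteq> \<zero>} \<subseteq> {y. pd R vdeg y q \<noteq> (\<lambda>_. \<zero>)}" by auto
  ultimately show ?thesis
    using pd_closed[OF gc_coeff[OF q]] by (auto simp: mem_free_module intro: finite_subset)
qed

lemma dual_inner_vector:
  assumes q: "q \<in> carrier (gc_algebra R X vdeg)" and u: "\<And>y. u y \<in> carrier R"
  shows "(\<lambda>x'. comb R (\<lambda>y _. u y) (\<lambda>y. pd R vdeg y q {#x'#}) ()) \<in> carrier (free_module R X)"
proof -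
  let ?f = "\<lambda>x'. comb R (\<lambda>y _. u y) (\<lambda>y. pd R vdeg y q {#x'#}) ()"
  have nz: "\<exists>y. q {#y, x'#} \<noteq> \<zero>" if "?f x' \<noteq> \<zero>" for x'
  proof (rule ccontr)
    assume "\<not> ?thesis"
    then have "(\<lambda>y. pd R vdeg y q {#x'#}) = (\<lambda>_. \<zero>)" using pd_nonzero by blast
    then show False using that comb_zero[of "\<lambda>y _. u y" "()"] by simp
  qed
  have "{x'. ?f x' \<noteq> \<zero>} \<subseteq> (\<Union>m\<in>{m. q m \<noteq> \<zero>}. set_mset m)"
    using nz by fastforce
  then have "finite {x'. ?f x' \<noteq> \<zero>}"
    by (rule finite_subset) (use q in \<open>auto simp: gc_algebra_simps mem_free_module\<close>)
  moreover have "?f x' = \<zero>" if "x' \<notin> X" for x'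
  proof (rule ccontr)
    assume "?f x' \<noteq> \<zero>"
    then obtain y where "q {#y, x'#} \<noteq> \<zero>" using nz by blast
    then have "{#y, x'#} \<in> gc_monos X vdeg" using gc_coeff_outside[OF q] by blast
    then show False using that by (simp add: gc_monos_add_mset)
  qed
  moreover have "?f x' \<in> carrier R" for x'
    by (rule comb_closed[OF pd_coeff_vector[OF q]]) (rule u)
  ultimately show ?thesis by (simp add: mem_free_module)
qed

lemma dual_pairing_closed:
  assumes "q \<in> carrier (gc_algebra R X vdeg)" "\<And>y. u y \<in> carrier R" "\<And>y. v y \<in> carrier R"
  shows "dual_pairing R vdeg u v q \<in> carrier R"
  unfolding dual_pairing_def by (rule comb_closed[OF dual_inner_vector]) (use assms in auto)

lemma dual_pairing_add:
  assumes q: "q \<in> carrier (gc_algebra R X vdeg)" and q': "q' \<in> carrier (gc_algebra R X vdeg)"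
    and u: "\<And>y. u y \<in> carrier R" and v: "\<And>y. v y \<in> carrier R"
  shows "dual_pairing R vdeg u v (q \<oplus>\<^bsub>gc_algebra R X vdeg\<^esub> q') =
    dual_pairing R vdeg u v q \<oplus> dual_pairing R vdeg u v q'"
proof -
  have "comb R (\<lambda>y _. u y) (\<lambda>y. pd R vdeg y (q \<oplus>\<^bsub>gc_algebra R X vdeg\<^esub> q') {#x'#}) () =
      comb R (\<lambda>y _. u y) (\<lambda>y. pd R vdeg y q {#x'#}) () \<oplus> comb R (\<lambda>y _. u y) (\<lambda>y. pd R vdeg y q' {#x'#}) ()" for x'
    using comb_add[OF pd_coeff_vector[OF q] pd_coeff_vector[OF q'], of "\<lambda>y _. u y"] u
    by (simp add: gc_algebra_simps(3) pd_add[OF q q'])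
  then show ?thesis
    unfolding dual_pairing_def
    using comb_add[OF dual_inner_vector[OF q u] dual_inner_vector[OF q' u], of "\<lambda>y _. v y"] v by simp
qed

lemma dual_pairing_smult:
  assumes q: "q \<in> carrier (gc_algebra R X vdeg)" and r: "r \<in> carrier R"
    and u: "\<And>y. u y \<in> carrier R" and v: "\<And>y. v y \<in> carrier R"
  shows "dual_pairing R vdeg u v (r \<odot>\<^bsub>gc_algebra R X vdeg\<^esub> q) = r \<otimes> dual_pairing R vdeg u v q"
proof -
  have pd: "pd R vdeg y (r \<odot>\<^bsub>gc_algebra R X vdeg\<^esub> q) m = pd R vdeg y q m \<otimes> r" for y m
  proof -
    have c: "q (add_mset y m) \<in> carrier R" by (rule gc_coeff[OF q])
    have "add_pow R (Suc (count m y)) (r \<otimes> q (add_mset y m)) = add_pow R (Suc (count m y)) (q (add_mset y m)) \<otimes> r"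
      using c r by (simp only: add_pow_ldistr m_comm[of r])
    then show ?thesis
      using c r by (simp add: pd_def gc_algebra_simps(4) signed_rmult del: add.nat_pow_Suc)
  qed
  have "comb R (\<lambda>y _. u y) (\<lambda>y. pd R vdeg y (r \<odot>\<^bsub>gc_algebra R X vdeg\<^esub> q) {#x'#}) () =
      comb R (\<lambda>y _. u y) (\<lambda>y. pd R vdeg y q {#x'#}) () \<otimes> r" for x'
    unfolding pd by (rule comb_rmult[OF pd_coeff_vector[OF q] _ r]) (rule u)
  then have "dual_pairing R vdeg u v (r \<odot>\<^bsub>gc_algebra R X vdeg\<^esub> q) = dual_pairing R vdeg u v q \<otimes> r"
    unfolding dual_pairing_def using comb_rmult[OF dual_inner_vector[OF q u] _ r, of "\<lambda>y _. v y"] v by simp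
  then show ?thesis using dual_pairing_closed[OF q, of u v] u v r by (simp add: m_comm)
qed

lemma dual_pairing_cube:
  assumes q: "q \<in> size_ideal R X vdeg 3"
  shows "dual_pairing R vdeg u v q = \<zero>"
proof -
  have "pd R vdeg y q {#x'#} = \<zero>" for y x'
    using size_ideal_coeff[OF q, of "{#y, x'#}"] pd_nonzero by fastforce
  then show ?thesis by (simp add: dual_pairing_def comb_zero)
qed

lemma dual_pairing_var_var:
  assumes p: "p \<in> X" and q: "q \<in> X" and r: "r \<in> carrier R" and s: "s \<in> carrier R"
    and u: "\<And>y. u y \<in> carrier R" and v: "\<And>y. v y \<in> carrier R"
  shows "dual_pairing R vdeg u v (single R {#p#} r \<otimes>\<^bsub>gc_algebra R X vdeg\<^esub> single R {#q#} s) =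
    (v q \<otimes> (u p \<otimes> (r \<otimes> s))) \<oplus> signed R (vdeg p * vdeg q) (v p \<otimes> (u q \<otimes> (r \<otimes> s)))"
proof -
  have rs: "r \<otimes> s \<in> carrier R" using r s by simp
  have mono: "{#p#} \<in> gc_monos X vdeg" "{#q#} \<in> gc_monos X vdeg" "{#} \<in> gc_monos X vdeg"
    using p q by (auto simp: gc_monos_def)
  have pd1: "pd R vdeg y (single R {#x#} t) = (if y = x then single R {#} t else (\<lambda>_. \<zero>))" if "t \<in> carrier R" for x y t
    using that by (auto simp: pd_single signed_def)
  have z: "(\<lambda>_. \<zero>) \<otimes>\<^bsub>gc_algebra R X vdeg\<^esub> single R c t = (\<lambda>_. \<zero>)" if "t \<in> carrier R" for c t
    using gc_mult_single[of \<zero> t X vdeg c c] that by (simp add: single_zero)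
  have pdy: "pd R vdeg y (single R {#p#} r \<otimes>\<^bsub>gc_algebra R X vdeg\<^esub> single R {#q#} s) {#x'#} =
      single R p (if x' = q then r \<otimes> s else \<zero>) y \<oplus>
      single R q (if x' = p then signed R (vdeg p * vdeg q) (r \<otimes> s) else \<zero>) y" for y x'
  proof -
    have 1: "(pd R vdeg y (single R {#p#} r) \<otimes>\<^bsub>gc_algebra R X vdeg\<^esub> single R {#q#} s) {#x'#} =
        single R p (if x' = q then r \<otimes> s else \<zero>) y"
      unfolding pd1[OF r] using z[OF s] r s mono
      by (cases "y = p") (simp_all add: gc_mult_single, auto simp: single_def signed_def)
    have 2: "(pd R vdeg y (single R {#q#} s) \<otimes>\<^bsub>gc_algebra R X vdeg\<^esub> single R {#p#} r) {#x'#} =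
        single R q (if x' = p then r \<otimes> s else \<zero>) y"
      unfolding pd1[OF s] using z[OF r] r s mono m_comm[OF s r]
      by (cases "y = q") (simp_all add: gc_mult_single, auto simp: single_def signed_def)
    show ?thesis
      unfolding pd_mult_single[OF mono(1,2) r s] 1 2
      by (simp add: gc_deg_def single_def)
  qed
  have sm: "single R a t \<in> carrier (free_module R X)" if "a \<in> X" "t \<in> carrier R" for a t
    using that by (rule single_mem)
  have inner: "comb R (\<lambda>y _. u y)
      (\<lambda>y. pd R vdeg y (single R {#p#} r \<otimes>\<^bsub>gc_algebra R X vdeg\<^esub> single R {#q#} s) {#x'#}) () =
      single R q (u p \<otimes> (r \<otimes> s)) x' \<oplus> single R p (u q \<otimes> signed R (vdeg p * vdeg q) (r \<otimes> s)) x'" for x'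
    unfolding pdy
    using comb_add[OF sm[OF p, of "if x' = q then r \<otimes> s else \<zero>"]
        sm[OF q, of "if x' = p then signed R (vdeg p * vdeg q) (r \<otimes> s) else \<zero>"], of "\<lambda>y _. u y" "()"]
      comb_single[of "if x' = q then r \<otimes> s else \<zero>" "\<lambda>y _. u y" p "()"]
      comb_single[of "if x' = p then signed R (vdeg p * vdeg q) (r \<otimes> s) else \<zero>" "\<lambda>y _. u y" q "()"] rs u
    by (auto simp: single_def)
  have "dual_pairing R vdeg u v (single R {#p#} r \<otimes>\<^bsub>gc_algebra R X vdeg\<^esub> single R {#q#} s) =
      (v q \<otimes> (u p \<otimes> (r \<otimes> s))) \<oplus> (v p \<otimes> (u q \<otimes> signed R (vdeg p * vdeg q) (r \<otimes> s)))"
    unfolding dual_pairing_def inner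
    using comb_add[OF sm[OF q, of "u p \<otimes> (r \<otimes> s)"] sm[OF p, of "u q \<otimes> signed R (vdeg p * vdeg q) (r \<otimes> s)"],
        of "\<lambda>y _. v y" "()"]
      comb_single[of "u p \<otimes> (r \<otimes> s)" "\<lambda>y _. v y" q "()"]
      comb_single[of "u q \<otimes> signed R (vdeg p * vdeg q) (r \<otimes> s)" "\<lambda>y _. v y" p "()"] rs u v
    by simp
  then show ?thesis using rs u v by (simp add: signed_lmult)
qed

lemma size_ideal_smult:
  assumes f: "f \<in> size_ideal R X vdeg s" and r: "r \<in> carrier R"
  shows "r \<odot>\<^bsub>gc_algebra R X vdeg\<^esub> f \<in> size_ideal R X vdeg s"
  using free_module_lmult[of f "gc_monos X vdeg" r] f r by (auto simp: size_ideal_def gc_algebra_simps)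

text \<open>In a quotient module a scalar acts on all elements of a coset; as the submodule is stable, this
  amounts to the action on one representative.\<close>

lemma quot_smult:
  assumes f: "f \<in> carrier (gc_algebra R X vdeg)" and r: "r \<in> carrier R"
  shows "size_ideal R X vdeg s <+>\<^bsub>gc_algebra R X vdeg\<^esub>
      ((\<lambda>y. r \<odot>\<^bsub>gc_algebra R X vdeg\<^esub> y) ` (size_ideal R X vdeg s +>\<^bsub>gc_algebra R X vdeg\<^esub> f)) =
    size_ideal R X vdeg s +>\<^bsub>gc_algebra R X vdeg\<^esub> (r \<odot>\<^bsub>gc_algebra R X vdeg\<^esub> f)"
proof -
  let ?A = "gc_algebra R X vdeg" and ?Q = "size_ideal R X vdeg s"
  interpret A: ring ?A by (rule gc_ring)
  interpret Q: ideal ?Q ?A by (rule size_ideal_ideal)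
  have rf: "r \<odot>\<^bsub>?A\<^esub> f \<in> carrier ?A"
    using free_module_lmult[of f "gc_monos X vdeg" r] f r by (simp add: gc_algebra_simps)
  have dist: "r \<odot>\<^bsub>?A\<^esub> (a \<oplus>\<^bsub>?A\<^esub> f) = (r \<odot>\<^bsub>?A\<^esub> a) \<oplus>\<^bsub>?A\<^esub> (r \<odot>\<^bsub>?A\<^esub> f)" if "a \<in> carrier ?A" for a
    using gc_coeff[OF that] gc_coeff[OF f] r by (simp add: gc_algebra_simps(3,4) r_distr)
  show ?thesis
  proof (intro equalityI subsetI)
    fix y assume "y \<in> ?Q <+>\<^bsub>?A\<^esub> ((\<lambda>y. r \<odot>\<^bsub>?A\<^esub> y) ` (?Q +>\<^bsub>?A\<^esub> f))"
    then obtain b a where ab: "b \<in> ?Q" "a \<in> ?Q" "y = b \<oplus>\<^bsub>?A\<^esub> (r \<odot>\<^bsub>?A\<^esub> (a \<oplus>\<^bsub>?A\<^esub> f))"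
      by (auto simp: set_add_def' a_r_coset_def')
    have "y = (b \<oplus>\<^bsub>?A\<^esub> (r \<odot>\<^bsub>?A\<^esub> a)) \<oplus>\<^bsub>?A\<^esub> (r \<odot>\<^bsub>?A\<^esub> f)"
      using ab size_ideal_smult[OF ab(2) r] rf by (simp add: dist size_ideal_carrier A.a_assoc)
    moreover have "b \<oplus>\<^bsub>?A\<^esub> (r \<odot>\<^bsub>?A\<^esub> a) \<in> ?Q" using ab size_ideal_smult[OF ab(2) r] by (intro Q.a_closed)
    ultimately show "y \<in> ?Q +>\<^bsub>?A\<^esub> (r \<odot>\<^bsub>?A\<^esub> f)" by (auto simp: a_r_coset_def')
  next
    fix y assume "y \<in> ?Q +>\<^bsub>?A\<^esub> (r \<odot>\<^bsub>?A\<^esub> f)"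
    then obtain b where b: "b \<in> ?Q" "y = b \<oplus>\<^bsub>?A\<^esub> (r \<odot>\<^bsub>?A\<^esub> f)" by (auto simp: a_r_coset_def')
    have "f \<in> ?Q +>\<^bsub>?A\<^esub> f" by (rule Q.a_rcos_self[OF f])
    then show "y \<in> ?Q <+>\<^bsub>?A\<^esub> ((\<lambda>y. r \<odot>\<^bsub>?A\<^esub> y) ` (?Q +>\<^bsub>?A\<^esub> f))"
      using b by (auto simp: set_add_def')
  qed
qed

lemma ind_class_size: "ind_class R X vdeg f = size_ideal R X vdeg 2 +>\<^bsub>gc_algebra R X vdeg\<^esub> f"
  and ind2_class_size: "ind2_class R X vdeg f = size_ideal R X vdeg 3 +>\<^bsub>gc_algebra R X vdeg\<^esub> f"
  by (simp_all add: ind_class_def ind2_class_def fibre_ideal_sq_size fibre_ideal_cube_size)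

lemma ind_carrier: "carrier (ind R X vdeg) = ind_class R X vdeg ` size_ideal R X vdeg 1"
  by (simp add: ind_def quot_module_def fibre_ideal_size ind_class_def)

lemma ind2_carrier: "carrier (ind2 R X vdeg) = ind2_class R X vdeg ` size_ideal R X vdeg 2"
  by (simp add: ind2_def quot_module_def fibre_ideal_sq_size ind2_class_def)

lemma ind_class_eq:
  assumes "f \<in> size_ideal R X vdeg 1" "g \<in> size_ideal R X vdeg 1"
  shows ind_class_add: "ind_class R X vdeg f \<oplus>\<^bsub>ind R X vdeg\<^esub> ind_class R X vdeg g =
      ind_class R X vdeg (f \<oplus>\<^bsub>gc_algebra R X vdeg\<^esub> g)"
    and ind_class_smult: "r \<in> carrier R \<Longrightarrow> r \<odot>\<^bsub>ind R X vdeg\<^esub> ind_class R X vdeg f =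
      ind_class R X vdeg (r \<odot>\<^bsub>gc_algebra R X vdeg\<^esub> f)"
proof -
  interpret Q: ideal "size_ideal R X vdeg 2" "gc_algebra R X vdeg" by (rule size_ideal_ideal)
  show "ind_class R X vdeg f \<oplus>\<^bsub>ind R X vdeg\<^esub> ind_class R X vdeg g =
      ind_class R X vdeg (f \<oplus>\<^bsub>gc_algebra R X vdeg\<^esub> g)"
    using Q.a_rcos_sum[OF size_ideal_carrier size_ideal_carrier, OF assms]
    by (simp add: ind_def quot_module_def ind_class_size)
  show "r \<odot>\<^bsub>ind R X vdeg\<^esub> ind_class R X vdeg f = ind_class R X vdeg (r \<odot>\<^bsub>gc_algebra R X vdeg\<^esub> f)"
    if "r \<in> carrier R"
    using quot_smult[OF size_ideal_carrier[OF assms(1)] that, of 2]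
    by (simp add: ind_def quot_module_def ind_class_size fibre_ideal_sq_size)
qed

lemma ind2_class_eq:
  assumes "f \<in> size_ideal R X vdeg 2" "g \<in> size_ideal R X vdeg 2"
  shows ind2_class_add: "ind2_class R X vdeg f \<oplus>\<^bsub>ind2 R X vdeg\<^esub> ind2_class R X vdeg g =
      ind2_class R X vdeg (f \<oplus>\<^bsub>gc_algebra R X vdeg\<^esub> g)"
    and ind2_class_smult: "r \<in> carrier R \<Longrightarrow> r \<odot>\<^bsub>ind2 R X vdeg\<^esub> ind2_class R X vdeg f =
      ind2_class R X vdeg (r \<odot>\<^bsub>gc_algebra R X vdeg\<^esub> f)"
proof -
  interpret Q: ideal "size_ideal R X vdeg 3" "gc_algebra R X vdeg" by (rule size_ideal_ideal)
  show "ind2_class R X vdeg f \<oplus>\<^bsub>ind2 R X vdeg\<^esub> ind2_class R X vdeg g =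
      ind2_class R X vdeg (f \<oplus>\<^bsub>gc_algebra R X vdeg\<^esub> g)"
    using Q.a_rcos_sum[OF size_ideal_carrier size_ideal_carrier, OF assms]
    by (simp add: ind2_def quot_module_def ind2_class_size)
  show "r \<odot>\<^bsub>ind2 R X vdeg\<^esub> ind2_class R X vdeg f = ind2_class R X vdeg (r \<odot>\<^bsub>gc_algebra R X vdeg\<^esub> f)"
    if "r \<in> carrier R"
    using quot_smult[OF size_ideal_carrier[OF assms(1)] that, of 3]
    by (simp add: ind2_def quot_module_def ind2_class_size fibre_ideal_cube_size)
qed

lemma size_ideal_mono: "s \<le> s' \<Longrightarrow> size_ideal R X vdeg s' \<subseteq> size_ideal R X vdeg s"
  by (auto simp: size_ideal_def)

lemma gc_var_size: "x \<in> X \<Longrightarrow> gc_var R x \<in> size_ideal R X vdeg 1"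
  unfolding size_ideal_def using gc_var_mem[of x X vdeg] by (auto simp: gc_var_def[of R])

text \<open>Functionals on the indecomposables, as functions on the augmentation ideal.\<close>

lemma functional:
  assumes u: "u \<in> lin_maps R (ind R X vdeg) (module_via id R)"
  shows functional_closed: "f \<in> size_ideal R X vdeg 1 \<Longrightarrow> u (ind_class R X vdeg f) \<in> carrier R"
    and functional_add: "f \<in> size_ideal R X vdeg 1 \<Longrightarrow> g \<in> size_ideal R X vdeg 1 \<Longrightarrow>
      u (ind_class R X vdeg (f \<oplus>\<^bsub>gc_algebra R X vdeg\<^esub> g)) = u (ind_class R X vdeg f) \<oplus> u (ind_class R X vdeg g)"
    and functional_smult: "f \<in> size_ideal R X vdeg 1 \<Longrightarrow> r \<in> carrier R \<Longrightarrow>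
      u (ind_class R X vdeg (r \<odot>\<^bsub>gc_algebra R X vdeg\<^esub> f)) = r \<otimes> u (ind_class R X vdeg f)"
    and functional_square: "f \<in> size_ideal R X vdeg 2 \<Longrightarrow> u (ind_class R X vdeg f) = \<zero>"
proof -
  interpret A: ring "gc_algebra R X vdeg" by (rule gc_ring)
  interpret Q: ideal "size_ideal R X vdeg 2" "gc_algebra R X vdeg" by (rule size_ideal_ideal)
  have cl: "ind_class R X vdeg f \<in> carrier (ind R X vdeg)" if "f \<in> size_ideal R X vdeg 1" for f
    using that by (simp add: ind_carrier)
  show c: "u (ind_class R X vdeg f) \<in> carrier R" if "f \<in> size_ideal R X vdeg 1" for f
    using lin_maps_mem[OF u cl[OF that]] by (simp add: module_via_def)
  show add: "u (ind_class R X vdeg (f \<oplus>\<^bsub>gc_algebra R X vdeg\<^esub> g)) = u (ind_class R X vdeg f) \<oplus> u (ind_class R X vdeg g)"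
    if "f \<in> size_ideal R X vdeg 1" "g \<in> size_ideal R X vdeg 1" for f g
    using lin_maps_add[OF u cl[OF that(1)] cl[OF that(2)]] by (simp add: ind_class_add[OF that] module_via_def)
  show "u (ind_class R X vdeg (r \<odot>\<^bsub>gc_algebra R X vdeg\<^esub> f)) = r \<otimes> u (ind_class R X vdeg f)"
    if "f \<in> size_ideal R X vdeg 1" "r \<in> carrier R" for f r
    using lin_maps_smult[OF u that(2) cl[OF that(1)]] by (simp add: ind_class_smult[OF that(1,1,2)] module_via_def)
  show "u (ind_class R X vdeg f) = \<zero>" if f: "f \<in> size_ideal R X vdeg 2"
  proof -
    have f1: "f \<in> size_ideal R X vdeg 1" using f size_ideal_mono[of 1 2 X vdeg] by auto
    have "ind_class R X vdeg (f \<oplus>\<^bsub>gc_algebra R X vdeg\<^esub> f) = ind_class R X vdeg f"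
      using Q.a_rcos_const[OF f] Q.a_rcos_const[OF Q.a_closed[OF f f]] by (simp add: ind_class_size)
    then show ?thesis using add[OF f1 f1] c[OF f1] by (metis add.l_cancel_one)
  qed
qed

lemma homotopy_pi_lin: "u \<in> homotopy_pi R X vdeg i \<Longrightarrow> u \<in> lin_maps R (ind R X vdeg) (module_via id R)"
  by (simp add: homotopy_pi_def)

lemma homotopy_pi_var:
  assumes "u \<in> homotopy_pi R X vdeg i" "x \<in> X" "Suc (vdeg x) \<noteq> i"
  shows "u (ind_class R X vdeg (gc_var R x)) = \<zero>"
proof -
  have "gc_var R x \<in> fibre_ideal R X vdeg \<inter> gc_comp R X vdeg (vdeg x)"
    using gc_comp_single[of "{#x#}" X vdeg \<one>] gc_var_size[OF assms(2)] assms(2)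
    by (simp add: fibre_ideal_size gc_var_single gc_monos_def gc_deg_def)
  then show ?thesis using assms by (auto simp: homotopy_pi_def)
qed

text \<open>The values of a functional on the variables, extended by \<open>0\<close> so that they can serve as matrix
  entries for \<open>comb\<close>.\<close>

definition on_var :: "'x::linorder set \<Rightarrow> ('x \<Rightarrow> nat) \<Rightarrow> (('x multiset \<Rightarrow> 'a) set \<Rightarrow> 'a) \<Rightarrow> 'x \<Rightarrow> 'a" where
  "on_var X vdeg u x = (if x \<in> X then u (ind_class R X vdeg (gc_var R x)) else \<zero>)"

lemma on_var_closed: "u \<in> lin_maps R (ind R X vdeg) (module_via id R) \<Longrightarrow> on_var X vdeg u x \<in> carrier R"
  using functional_closed[OF _ gc_var_size, of u X vdeg x] by (simp add: on_var_def)

lemma functional_single: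
  assumes u: "u \<in> lin_maps R (ind R X vdeg) (module_via id R)" and x: "x \<in> X" and r: "r \<in> carrier R"
  shows "u (ind_class R X vdeg (single R {#x#} r)) = r \<otimes> on_var X vdeg u x"
proof -
  have "single R {#x#} r = r \<odot>\<^bsub>gc_algebra R X vdeg\<^esub> gc_var R x"
    using r by (auto simp: gc_algebra_simps gc_var_single single_def)
  then show ?thesis using functional_smult[OF u gc_var_size[OF x] r] x by (simp add: on_var_def)
qed

text \<open>The signs match because a product \<open>u(q) v(p)\<close> of values on variables vanishes unless the
  degrees of \<open>p\<close> and \<open>q\<close> are \<open>j - 1\<close> and \<open>i - 1\<close>.\<close>

lemma dual_pairing_mult:
  assumes u: "u \<in> homotopy_pi R X vdeg i" and v: "v \<in> homotopy_pi R X vdeg j"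
    and f: "f \<in> size_ideal R X vdeg 1" and g: "g \<in> size_ideal R X vdeg 1"
  shows "signed R ((i + 1) * (j + 1)) (dual_pairing R vdeg (on_var X vdeg u) (on_var X vdeg v) (f \<otimes>\<^bsub>gc_algebra R X vdeg\<^esub> g)) =
    (v (ind_class R X vdeg f) \<otimes> u (ind_class R X vdeg g)) \<oplus>
    signed R ((i + 1) * (j + 1)) (u (ind_class R X vdeg f) \<otimes> v (ind_class R X vdeg g))"
proof -
  let ?A = "gc_algebra R X vdeg"
  let ?B = "dual_pairing R vdeg (on_var X vdeg u) (on_var X vdeg v)"
  let ?s = "signed R ((i + 1) * (j + 1))"
  interpret A: ring ?A by (rule gc_ring)
  note ul = homotopy_pi_lin[OF u] and vl = homotopy_pi_lin[OF v]
  note uc = on_var_closed[OF ul] and vc = on_var_closed[OF vl]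
  let ?u = "\<lambda>f. u (ind_class R X vdeg f)" and ?v = "\<lambda>f. v (ind_class R X vdeg f)"
  note Badd = dual_pairing_add[of _ X vdeg _ "on_var X vdeg u" "on_var X vdeg v", OF _ _ uc vc]
  note Bc = dual_pairing_closed[of _ X vdeg "on_var X vdeg u" "on_var X vdeg v", OF _ uc vc]
  have zero1: "\<zero>\<^bsub>?A\<^esub> \<in> size_ideal R X vdeg s" for s
    using additive_subgroup.zero_closed[OF ideal.axioms(1)[OF size_ideal_ideal]] .
  have B0: "?B \<zero>\<^bsub>?A\<^esub> = \<zero>" by (rule dual_pairing_cube[OF zero1])
  have single_size: "single R m r \<in> size_ideal R X vdeg s" if "m \<in> gc_monos X vdeg" "s \<le> size m" "r \<in> carrier R" for m s r
    unfolding size_ideal_def using gc_single_mem[OF that(1,3)] that(2) by (auto simp: single_def[of R m])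
  define P where "P = (\<lambda>f g. f \<in> size_ideal R X vdeg 1 \<and> g \<in> size_ideal R X vdeg 1 \<and>
    ?s (?B (f \<otimes>\<^bsub>?A\<^esub> g)) = (?v f \<otimes> ?u g) \<oplus> ?s (?u f \<otimes> ?v g))"
  have fc: "?u f \<in> carrier R" "?v f \<in> carrier R" if "f \<in> size_ideal R X vdeg 1" for f
    using functional_closed[OF ul that] functional_closed[OF vl that] by auto
  have addI: "f \<oplus>\<^bsub>?A\<^esub> f' \<in> size_ideal R X vdeg 1" if "f \<in> size_ideal R X vdeg 1" "f' \<in> size_ideal R X vdeg 1" for f f'
    using additive_subgroup.a_closed[OF ideal.axioms(1)[OF size_ideal_ideal] that] .
  have 4: "(a \<oplus> b) \<oplus> (a' \<oplus> b') = (a \<oplus> a') \<oplus> (b \<oplus> b')"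
    if "a \<in> carrier R" "b \<in> carrier R" "a' \<in> carrier R" "b' \<in> carrier R" for a b a' b'
    using that by (simp add: a_ac)
  have Padd_left: "P (f \<oplus>\<^bsub>?A\<^esub> f') g" if "P f g" "P f' g" for f f' g
  proof -
    have I: "f \<in> size_ideal R X vdeg 1" "f' \<in> size_ideal R X vdeg 1" "g \<in> size_ideal R X vdeg 1"
      using that by (auto simp: P_def)
    note C = size_ideal_carrier[OF I(1)] size_ideal_carrier[OF I(2)] size_ideal_carrier[OF I(3)]
    have "?s (?B ((f \<oplus>\<^bsub>?A\<^esub> f') \<otimes>\<^bsub>?A\<^esub> g)) = ?s (?B (f \<otimes>\<^bsub>?A\<^esub> g)) \<oplus> ?s (?B (f' \<otimes>\<^bsub>?A\<^esub> g))"
      using C Badd Bc by (simp add: A.l_distr signed_add)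
    also have "\<dots> = ((?v f \<otimes> ?u g) \<oplus> ?s (?u f \<otimes> ?v g)) \<oplus> ((?v f' \<otimes> ?u g) \<oplus> ?s (?u f' \<otimes> ?v g))"
      using that by (simp add: P_def)
    also have "\<dots> = ((?v f \<otimes> ?u g) \<oplus> (?v f' \<otimes> ?u g)) \<oplus> (?s (?u f \<otimes> ?v g) \<oplus> ?s (?u f' \<otimes> ?v g))"
      using fc I by (intro 4) auto
    also have "\<dots> = (?v (f \<oplus>\<^bsub>?A\<^esub> f') \<otimes> ?u g) \<oplus> ?s (?u (f \<oplus>\<^bsub>?A\<^esub> f') \<otimes> ?v g)"
      using fc[OF I(1)] fc[OF I(2)] fc[OF I(3)]
      by (simp add: functional_add[OF ul I(1,2)] functional_add[OF vl I(1,2)] l_distr signed_add)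
    finally show ?thesis using I addI by (simp add: P_def)
  qed
  have Padd_right: "P f (g \<oplus>\<^bsub>?A\<^esub> g')" if "P f g" "P f g'" for f g g'
  proof -
    have I: "g \<in> size_ideal R X vdeg 1" "g' \<in> size_ideal R X vdeg 1" "f \<in> size_ideal R X vdeg 1"
      using that by (auto simp: P_def)
    note C = size_ideal_carrier[OF I(1)] size_ideal_carrier[OF I(2)] size_ideal_carrier[OF I(3)]
    have "?s (?B (f \<otimes>\<^bsub>?A\<^esub> (g \<oplus>\<^bsub>?A\<^esub> g'))) = ?s (?B (f \<otimes>\<^bsub>?A\<^esub> g)) \<oplus> ?s (?B (f \<otimes>\<^bsub>?A\<^esub> g'))"
      using C Badd Bc by (simp add: A.r_distr signed_add)
    also have "\<dots> = ((?v f \<otimes> ?u g) \<oplus> ?s (?u f \<otimes> ?v g)) \<oplus> ((?v f \<otimes> ?u g') \<oplus> ?s (?u f \<otimes> ?v g'))"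
      using that by (simp add: P_def)
    also have "\<dots> = ((?v f \<otimes> ?u g) \<oplus> (?v f \<otimes> ?u g')) \<oplus> (?s (?u f \<otimes> ?v g) \<oplus> ?s (?u f \<otimes> ?v g'))"
      using fc I by (intro 4) auto
    also have "\<dots> = (?v f \<otimes> ?u (g \<oplus>\<^bsub>?A\<^esub> g')) \<oplus> ?s (?u f \<otimes> ?v (g \<oplus>\<^bsub>?A\<^esub> g'))"
      using fc[OF I(1)] fc[OF I(2)] fc[OF I(3)]
      by (simp add: functional_add[OF ul I(1,2)] functional_add[OF vl I(1,2)] r_distr signed_add)
    finally show ?thesis using I addI by (simp add: P_def)
  qed
  have Phigh: "P f g" if fg: "f \<in> size_ideal R X vdeg 1" "g \<in> size_ideal R X vdeg 1"
    and high: "f \<in> size_ideal R X vdeg 2 \<or> g \<in> size_ideal R X vdeg 2" for f g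
  proof -
    have "f \<otimes>\<^bsub>?A\<^esub> g \<in> size_ideal R X vdeg 3"
      using high size_ideal_mult[of f X vdeg 2 g 1] size_ideal_mult[of f X vdeg 1 g 2] fg
      by (auto simp: numeral_3_eq_3)
    then have "?B (f \<otimes>\<^bsub>?A\<^esub> g) = \<zero>" by (rule dual_pairing_cube)
    then show ?thesis
      using high fc fg functional_square[OF ul] functional_square[OF vl] by (auto simp: P_def)
  qed
  have Pvar: "P (single R {#p#} r) (single R {#q#} s)"
    if p: "p \<in> X" and q: "q \<in> X" and r: "r \<in> carrier R" and s: "s \<in> carrier R" for p q r s
  proof -
    have I: "single R {#p#} r \<in> size_ideal R X vdeg 1" "single R {#q#} s \<in> size_ideal R X vdeg 1"
      using p q r s by (auto intro!: single_size simp: gc_monos_def)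
    let ?up = "on_var X vdeg u p" and ?uq = "on_var X vdeg u q"
      and ?vp = "on_var X vdeg v p" and ?vq = "on_var X vdeg v q"
    have c: "?up \<in> carrier R" "?uq \<in> carrier R" "?vp \<in> carrier R" "?vq \<in> carrier R" using uc vc by auto
    have sgn: "?s (signed R (vdeg p * vdeg q) (?vp \<otimes> (?uq \<otimes> (r \<otimes> s)))) = ?vp \<otimes> (?uq \<otimes> (r \<otimes> s))"
    proof (cases "Suc (vdeg q) = i \<and> Suc (vdeg p) = j")
      case True
      then have "even ((i + 1) * (j + 1) + vdeg p * vdeg q)" by auto
      then show ?thesis using c r s by (simp add: signed_signed) (simp add: signed_def)
    next
      case False
      then have "?uq = \<zero> \<or> ?vp = \<zero>"
        using homotopy_pi_var[OF u q] homotopy_pi_var[OF v p] p q by (auto simp: on_var_def)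
      then show ?thesis using c r s by auto
    qed
    have "?s (?B (single R {#p#} r \<otimes>\<^bsub>?A\<^esub> single R {#q#} s)) =
        ?s (?vq \<otimes> (?up \<otimes> (r \<otimes> s))) \<oplus> ?vp \<otimes> (?uq \<otimes> (r \<otimes> s))"
      unfolding dual_pairing_var_var[where u = "on_var X vdeg u" and v = "on_var X vdeg v", OF p q r s uc vc]
      using sgn c r s by (simp add: signed_add)
    also have "\<dots> = ((r \<otimes> ?vp) \<otimes> (s \<otimes> ?uq)) \<oplus> ?s ((r \<otimes> ?up) \<otimes> (s \<otimes> ?vq))"
    proof -
      have "?vp \<otimes> (?uq \<otimes> (r \<otimes> s)) = (r \<otimes> ?vp) \<otimes> (s \<otimes> ?uq)" "?vq \<otimes> (?up \<otimes> (r \<otimes> s)) = (r \<otimes> ?up) \<otimes> (s \<otimes> ?vq)"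
        using c r s by (simp_all add: m_ac)
      then show ?thesis using c r s by (simp add: a_comm)
    qed
    finally show ?thesis
      using I by (simp add: P_def functional_single[OF ul] functional_single[OF vl] p q r s)
  qed
  have Psingle: "P (single R m r) (single R m' s)"
    if m: "m \<in> gc_monos X vdeg" "1 \<le> size m" "r \<in> carrier R"
      and m': "m' \<in> gc_monos X vdeg" "1 \<le> size m'" "s \<in> carrier R" for m m' r s
  proof (cases "size m = 1 \<and> size m' = 1")
    case True
    then obtain p q where pq: "m = {#p#}" "m' = {#q#}" by (meson size_1_singleton_mset)
    then have "p \<in> X" "q \<in> X" using m m' by (auto simp: gc_monos_def)
    then show ?thesis using Pvar m m' pq by simp
  next
    case False
    then have "2 \<le> size m \<or> 2 \<le> size m'" using m m' by linarith
    then show ?thesis using single_size m m' by (intro Phigh) auto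
  qed
  have Pzero: "P \<zero>\<^bsub>?A\<^esub> g" "P g \<zero>\<^bsub>?A\<^esub>" if "g \<in> size_ideal R X vdeg 1" for g
    using Phigh zero1 that by auto
  have Pright: "P (single R m r) g" if m: "m \<in> gc_monos X vdeg" "1 \<le> size m" "r \<in> carrier R" for m r
    using g
  proof (induction rule: size_ideal_induct)
    case (single m' s)
    then show ?case using Psingle m by blast
  next
    case zero
    then show ?case using Pzero single_size m by blast
  qed (rule Padd_right)
  have "P f g"
    using f
  proof (induction rule: size_ideal_induct)
    case (single m r)
    then show ?case by (rule Pright)
  next
    case zero
    then show ?case using Pzero g by blast
  qed (rule Padd_left)
  then show ?thesis by (simp add: P_def)
qed

text \<open>The values on products determine a functional on \<open>ind2\<close>, since the products span the square of the
  augmentation ideal. The signed \<open>dual_pairing\<close> has these values by \<open>dual_pairing_mult\<close>, and it is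
  defined on classes by \<open>dual_pairing_cube\<close>.\<close>

lemma tensor_pairing_eq:
  assumes u: "u \<in> homotopy_pi R X vdeg i" and v: "v \<in> homotopy_pi R X vdeg j"
    and q: "q \<in> size_ideal R X vdeg 2"
  shows "tensor_pairing R X vdeg i j u v (ind2_class R X vdeg q) =
    signed R ((i + 1) * (j + 1)) (dual_pairing R vdeg (on_var X vdeg u) (on_var X vdeg v) q)"
proof -
  let ?A = "gc_algebra R X vdeg"
  let ?B = "dual_pairing R vdeg (on_var X vdeg u) (on_var X vdeg v)"
  let ?s = "signed R ((i + 1) * (j + 1))"
  interpret A: ring ?A by (rule gc_ring)
  interpret Q: ideal "size_ideal R X vdeg 3" ?A by (rule size_ideal_ideal)
  note ul = homotopy_pi_lin[OF u] and vl = homotopy_pi_lin[OF v]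
  note uc = on_var_closed[OF ul] and vc = on_var_closed[OF vl]
  note Badd = dual_pairing_add[of _ X vdeg _ "on_var X vdeg u" "on_var X vdeg v", OF _ _ uc vc]
  note Bsm = dual_pairing_smult[of _ X vdeg _ "on_var X vdeg u" "on_var X vdeg v", OF _ _ uc vc]
  note Bc = dual_pairing_closed[of _ X vdeg "on_var X vdeg u" "on_var X vdeg v", OF _ uc vc]
  let ?cl = "ind2_class R X vdeg"
  let ?P = "\<lambda>\<beta>. \<beta> \<in> lin_maps R (ind2 R X vdeg) (module_via id R) \<inter> extensional (carrier (ind2 R X vdeg)) \<and>
    (\<forall>x\<in>fibre_ideal R X vdeg. \<forall>y\<in>fibre_ideal R X vdeg. \<beta> (?cl (x \<otimes>\<^bsub>?A\<^esub> y)) =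
       (v (ind_class R X vdeg x) \<otimes> u (ind_class R X vdeg y)) \<oplus>
       signed R ((i + 1) * (j + 1)) (u (ind_class R X vdeg x) \<otimes> v (ind_class R X vdeg y)))"
  have wd: "?B f = ?B g" if f: "f \<in> size_ideal R X vdeg 2" and g: "g \<in> size_ideal R X vdeg 2" and eq: "?cl f = ?cl g" for f g
  proof -
    have C: "f \<in> carrier ?A" "g \<in> carrier ?A" using f g size_ideal_carrier by auto
    have "f \<in> size_ideal R X vdeg 3 +>\<^bsub>?A\<^esub> g"
      using Q.a_rcos_self[OF C(1)] eq by (simp add: ind2_class_size)
    then obtain w where w: "w \<in> size_ideal R X vdeg 3" "f = w \<oplus>\<^bsub>?A\<^esub> g" by (auto simp: a_r_coset_def')
    then show ?thesis using Badd[OF size_ideal_carrier[OF w(1)] C(2)] dual_pairing_cube[OF w(1)] Bc[OF C(2)] by simp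
  qed
  define \<beta> where "\<beta> = restrict (\<lambda>c. ?s (?B (SOME f. f \<in> size_ideal R X vdeg 2 \<and> ?cl f = c))) (carrier (ind2 R X vdeg))"
  have \<beta>: "\<beta> (?cl f) = ?s (?B f)" if f: "f \<in> size_ideal R X vdeg 2" for f
  proof -
    let ?f = "SOME f'. f' \<in> size_ideal R X vdeg 2 \<and> ?cl f' = ?cl f"
    have "?f \<in> size_ideal R X vdeg 2 \<and> ?cl ?f = ?cl f" by (rule someI[of _ f]) (use f in auto)
    then have "?B ?f = ?B f" using wd f by blast
    then show ?thesis using f by (simp add: \<beta>_def ind2_carrier)
  qed
  have add2: "f \<oplus>\<^bsub>?A\<^esub> g \<in> size_ideal R X vdeg 2" if "f \<in> size_ideal R X vdeg 2" "g \<in> size_ideal R X vdeg 2" for f g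
    using additive_subgroup.a_closed[OF ideal.axioms(1)[OF size_ideal_ideal] that] .
  have mult2: "x \<otimes>\<^bsub>?A\<^esub> y \<in> size_ideal R X vdeg 2" if "x \<in> fibre_ideal R X vdeg" "y \<in> fibre_ideal R X vdeg" for x y
    using size_ideal_mult[of x X vdeg 1 y 1] that by (simp add: fibre_ideal_size numeral_2_eq_2)
  have "\<beta> \<in> lin_maps R (ind2 R X vdeg) (module_via id R)"
    unfolding lin_maps_def
  proof (intro CollectI conjI ballI Pi_I)
    fix c assume "c \<in> carrier (ind2 R X vdeg)"
    then obtain f where "f \<in> size_ideal R X vdeg 2" "c = ?cl f" by (auto simp: ind2_carrier)
    then show "\<beta> c \<in> carrier (module_via id R)"
      using \<beta>[of f] Bc[OF size_ideal_carrier[of f X vdeg 2]] by (simp add: module_via_def)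
  next
    fix c c' assume "c \<in> carrier (ind2 R X vdeg)" "c' \<in> carrier (ind2 R X vdeg)"
    then obtain f f' where f: "f \<in> size_ideal R X vdeg 2" "c = ?cl f" "f' \<in> size_ideal R X vdeg 2" "c' = ?cl f'"
      by (auto simp: ind2_carrier)
    then show "\<beta> (c \<oplus>\<^bsub>ind2 R X vdeg\<^esub> c') = \<beta> c \<oplus>\<^bsub>module_via id R\<^esub> \<beta> c'"
      using \<beta>[OF add2[OF f(1,3)]] \<beta>[OF f(1)] \<beta>[OF f(3)] Badd Bc size_ideal_carrier[OF f(1)] size_ideal_carrier[OF f(3)]
      by (simp add: ind2_class_add module_via_def signed_add)
  next
    fix r c assume r: "r \<in> carrier R" and "c \<in> carrier (ind2 R X vdeg)"
    then obtain f where f: "f \<in> size_ideal R X vdeg 2" "c = ?cl f" by (auto simp: ind2_carrier)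
    then show "\<beta> (r \<odot>\<^bsub>ind2 R X vdeg\<^esub> c) = r \<odot>\<^bsub>module_via id R\<^esub> \<beta> c"
      using \<beta>[OF size_ideal_smult[OF f(1) r]] \<beta>[OF f(1)] Bsm[OF size_ideal_carrier[OF f(1)] r] Bc[OF size_ideal_carrier[OF f(1)]] r
      by (simp add: ind2_class_smult[OF f(1,1) r] module_via_def signed_lmult)
  qed
  then have P\<beta>: "?P \<beta>"
    using \<beta>[OF mult2] dual_pairing_mult[OF u v] by (auto simp: \<beta>_def fibre_ideal_size)
  have ex: "\<exists>!\<beta>. ?P \<beta>"
  proof (rule ex1I[of ?P \<beta>, OF P\<beta>])
    fix \<gamma> assume \<gamma>: "?P \<gamma>"
    then have \<gamma>l: "\<gamma> \<in> lin_maps R (ind2 R X vdeg) (module_via id R)" by auto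
    from P\<beta> have \<beta>l: "\<beta> \<in> lin_maps R (ind2 R X vdeg) (module_via id R)" by auto
    have on2: "\<gamma> (?cl f) = \<beta> (?cl f)" if "f \<in> fibre_ideal_sq R X vdeg" for f
      using that unfolding fibre_ideal_sq_def
    proof (induction rule: ideal_prod.induct)
      case (prod x y)
      then show ?case using \<gamma> P\<beta> by simp
    next
      case (sum f g)
      then have I: "f \<in> size_ideal R X vdeg 2" "g \<in> size_ideal R X vdeg 2"
        using fibre_ideal_sq_size[of X vdeg] by (auto simp: fibre_ideal_sq_def)
      then have C: "?cl f \<in> carrier (ind2 R X vdeg)" "?cl g \<in> carrier (ind2 R X vdeg)" by (auto simp: ind2_carrier)
      show ?case
        using lin_maps_add[OF \<gamma>l C] lin_maps_add[OF \<beta>l C] sum by (simp add: ind2_class_add[OF I])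
    qed
    show "\<gamma> = \<beta>"
    proof
      fix c
      show "\<gamma> c = \<beta> c"
      proof (cases "c \<in> carrier (ind2 R X vdeg)")
        case True
        then show ?thesis using on2 by (auto simp: ind2_carrier fibre_ideal_sq_size)
      next
        case False
        then show ?thesis using \<gamma> P\<beta> by (auto simp: extensional_def)
      qed
    qed
  qed
  have "tensor_pairing R X vdeg i j u v = \<beta>"
    unfolding tensor_pairing_def by (rule the1_equality[of ?P \<beta>, OF ex P\<beta>])
  then show ?thesis using \<beta>[OF q] by simp
qed

end

section \<open>Minimal models\<close>

lemma mem_a_kernel: "a \<in> a_kernel R S h \<longleftrightarrow> a \<in> carrier R \<and> h a = \<zero>\<^bsub>S\<^esub>"
  unfolding a_kernel_def' by blast

text \<open>The kernel of a surjective homomorphism to a field is a maximal ideal, and \<open>R\<close> has only one.\<close>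

lemma max_ideal_kernel:
  assumes R: "noetherian_local_ring R" and k: "field k"
    and \<rho>: "\<rho> \<in> ring_hom R k" and surj: "\<rho> ` carrier R = carrier k"
    and r: "r \<in> max_ideal R"
  shows "\<rho> r = \<zero>\<^bsub>k\<^esub>"
proof -
  interpret R: cring R using R by (simp add: noetherian_local_ring_def)
  interpret k: field k by fact
  interpret h: ring_hom_ring R k \<rho> by (rule ring_hom_ringI2[OF R.ring_axioms k.ring_axioms \<rho>])
  have ker: "maximalideal (a_kernel R k \<rho>) R"
  proof (rule maximalidealI[OF h.kernel_is_ideal])
    show "carrier R \<noteq> a_kernel R k \<rho>"
    proof
      assume eq: "carrier R = a_kernel R k \<rho>"
      have "\<one>\<^bsub>R\<^esub> \<in> a_kernel R k \<rho>" by (subst eq[symmetric]) simp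
      then have "\<rho> \<one>\<^bsub>R\<^esub> = \<zero>\<^bsub>k\<^esub>" unfolding mem_a_kernel by blast
      then show False using ring_hom_one[OF \<rho>] k.one_not_zero by metis
    qed
  next
    fix J assume J: "ideal J R" "a_kernel R k \<rho> \<subseteq> J" "J \<subseteq> carrier R"
    interpret J: ideal J R by fact
    show "J = a_kernel R k \<rho> \<or> J = carrier R"
    proof (rule ccontr)
      assume n: "\<not> (J = a_kernel R k \<rho> \<or> J = carrier R)"
      then obtain a where a: "a \<in> J" "a \<notin> a_kernel R k \<rho>" using J by blast
      then have aR: "a \<in> carrier R" using J by blast
      then have "\<rho> a \<noteq> \<zero>\<^bsub>k\<^esub>" using a(2) unfolding mem_a_kernel by blast
      then have "\<rho> a \<in> Units k" using ring_hom_closed[OF \<rho> aR] by (simp add: k.field_Units)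
      then obtain y where y: "y \<in> carrier k" "\<rho> a \<otimes>\<^bsub>k\<^esub> y = \<one>\<^bsub>k\<^esub>" by (auto simp: Units_def)
      then have "y \<in> \<rho> ` carrier R" using surj by simp
      then obtain b where b: "b \<in> carrier R" "y = \<rho> b" by blast
      have ab: "a \<otimes>\<^bsub>R\<^esub> b \<in> J" by (rule J.I_r_closed[OF a(1) b(1)])
      have "\<one>\<^bsub>R\<^esub> \<ominus>\<^bsub>R\<^esub> a \<otimes>\<^bsub>R\<^esub> b \<in> a_kernel R k \<rho>"
      proof -
        have "\<rho> (\<one>\<^bsub>R\<^esub> \<oplus>\<^bsub>R\<^esub> \<ominus>\<^bsub>R\<^esub> (a \<otimes>\<^bsub>R\<^esub> b)) = \<one>\<^bsub>k\<^esub> \<oplus>\<^bsub>k\<^esub> \<ominus>\<^bsub>k\<^esub> (\<rho> a \<otimes>\<^bsub>k\<^esub> \<rho> b)"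
          using aR b(1) by simp
        also have "\<dots> = \<zero>\<^bsub>k\<^esub>" using b(2) y(2) k.r_neg[OF k.one_closed] by simp
        finally show ?thesis
          unfolding mem_a_kernel a_minus_def using aR b(1) by blast
      qed
      then have "(\<one>\<^bsub>R\<^esub> \<ominus>\<^bsub>R\<^esub> a \<otimes>\<^bsub>R\<^esub> b) \<oplus>\<^bsub>R\<^esub> a \<otimes>\<^bsub>R\<^esub> b \<in> J"
        using J ab by (intro J.a_closed) auto
      moreover have "(\<one>\<^bsub>R\<^esub> \<ominus>\<^bsub>R\<^esub> a \<otimes>\<^bsub>R\<^esub> b) \<oplus>\<^bsub>R\<^esub> a \<otimes>\<^bsub>R\<^esub> b = \<one>\<^bsub>R\<^esub>"
        using aR b by (simp add: R.minus_eq R.a_assoc R.l_neg)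
      ultimately show False using n J.one_imp_carrier by simp
    qed
  qed
  have ex: "\<exists>!\<mm>. maximalideal \<mm> R" using R unfolding noetherian_local_ring_def by blast
  have "max_ideal R = a_kernel R k \<rho>"
    unfolding max_ideal_def by (rule the1_equality[OF ex ker])
  with r have "r \<in> a_kernel R k \<rho>" by (simp only:)
  then show ?thesis unfolding mem_a_kernel by blast
qed

text \<open>Reduction to the residue field sends \<open>\<mm>\<^sub>R A + \<mm>\<^sub>A\<^sup>2\<close> to the square of the ideal generated by the
  variables.\<close>

lemma (in ring_hom_cring) minimal_reduction:
  assumes kernel: "\<And>r. r \<in> \<mm> \<Longrightarrow> h r = \<zero>\<^bsub>S\<^esub>" and \<mm>: "\<mm> \<subseteq> carrier R"
    and d: "d \<in> lin_maps R (gc_algebra R X vdeg) (gc_algebra R X vdeg)"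
    and minimal: "d ` (Idl\<^bsub>gc_algebra R X vdeg\<^esub> (gc_const R ` \<mm> \<union> gc_var R ` X)) \<subseteq>
      Idl\<^bsub>gc_algebra R X vdeg\<^esub> (gc_const R ` \<mm>) <+>\<^bsub>gc_algebra R X vdeg\<^esub>
      ideal_prod (gc_algebra R X vdeg) (Idl\<^bsub>gc_algebra R X vdeg\<^esub> (gc_const R ` \<mm> \<union> gc_var R ` X))
        (Idl\<^bsub>gc_algebra R X vdeg\<^esub> (gc_const R ` \<mm> \<union> gc_var R ` X))"
    and f: "f \<in> size_ideal R X vdeg 1"
  shows "h \<circ> d f \<in> size_ideal S X vdeg 2"
proof -
  let ?A = "gc_algebra R X vdeg" and ?K = "gc_algebra S X vdeg"
  interpret A: ring ?A by (rule R.gc_ring)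
  interpret K: ring ?K by (rule S.gc_ring)
  interpret \<Phi>: ring_hom_ring ?A ?K "\<lambda>f. h \<circ> f" by (rule gc_map_ring_hom)
  let ?m = "Idl\<^bsub>?A\<^esub> (gc_const R ` \<mm> \<union> gc_var R ` X)"
  have sub: "gc_const R ` \<mm> \<union> gc_var R ` X \<subseteq> carrier ?A"
    using \<mm> R.gc_single_mem[of "{#}" X vdeg] R.gc_var_mem by (auto simp: gc_const_single gc_monos_def)
  have const0: "h \<circ> gc_const R r = \<zero>\<^bsub>?K\<^esub>" if "r \<in> \<mm>" for r
    using kernel[OF that] that \<mm> by (simp add: gc_const_single gc_map_single subset_iff S.single_zero gc_algebra_simps)
  have zero: "\<zero>\<^bsub>?K\<^esub> \<in> size_ideal S X vdeg s" for s
    using additive_subgroup.zero_closed[OF ideal.axioms(1)[OF S.size_ideal_ideal]] .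
  have const: "Idl\<^bsub>?A\<^esub> (gc_const R ` \<mm>) \<subseteq> {f \<in> carrier ?A. h \<circ> f \<in> size_ideal S X vdeg 2}"
    by (rule A.genideal_minimal[OF \<Phi>.ideal_vimage[OF S.size_ideal_ideal]])
      (use sub const0 zero in auto)
  have m1: "?m \<subseteq> {f \<in> carrier ?A. h \<circ> f \<in> size_ideal S X vdeg 1}"
    by (rule A.genideal_minimal[OF \<Phi>.ideal_vimage[OF S.size_ideal_ideal]])
      (use sub const0 zero S.gc_var_size in \<open>auto simp: gc_map_var\<close>)
  have prod: "g \<in> carrier ?A \<and> h \<circ> g \<in> size_ideal S X vdeg 2" if "g \<in> ideal_prod ?A ?m ?m" for g
    using that
  proof (induction rule: ideal_prod.induct)
    case (prod x y)
    then have "x \<in> carrier ?A" "y \<in> carrier ?A" "h \<circ> x \<in> size_ideal S X vdeg 1" "h \<circ> y \<in> size_ideal S X vdeg 1"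
      using m1 by auto
    then show ?case
      using S.size_ideal_mult[of "h \<circ> x" X vdeg 1 "h \<circ> y" 1] by (simp add: gc_map_mult numeral_2_eq_2)
  next
    case (sum x y)
    then have x: "x \<in> carrier ?A" "h \<circ> x \<in> size_ideal S X vdeg 2"
      and y: "y \<in> carrier ?A" "h \<circ> y \<in> size_ideal S X vdeg 2" by blast+
    show ?case
      unfolding gc_map_add[OF x(1) y(1)]
      using A.a_closed[OF x(1) y(1)]
        additive_subgroup.a_closed[OF ideal.axioms(1)[OF S.size_ideal_ideal] x(2) y(2)] by blast
  qed
  have "size_ideal R X vdeg 1 \<subseteq> ?m"
    using A.subset_Idl_subset[OF sub, of "gc_var R ` X"] R.size_ideal_1_genideal[of X vdeg] by auto
  then have "d f \<in> Idl\<^bsub>?A\<^esub> (gc_const R ` \<mm>) <+>\<^bsub>?A\<^esub> ideal_prod ?A ?m ?m" using f minimal by blast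
  then obtain x y where xy: "x \<in> Idl\<^bsub>?A\<^esub> (gc_const R ` \<mm>)" "y \<in> ideal_prod ?A ?m ?m" "d f = x \<oplus>\<^bsub>?A\<^esub> y"
    by (auto simp: set_add_def')
  then have x: "x \<in> carrier ?A" "h \<circ> x \<in> size_ideal S X vdeg 2" using const by auto
  show ?thesis
    unfolding xy(3) gc_map_add[OF x(1) conjunct1[OF prod[OF xy(2)]]]
    by (rule additive_subgroup.a_closed[OF ideal.axioms(1)[OF S.size_ideal_ideal] x(2) conjunct2[OF prod[OF xy(2)]]])
qed

text \<open>By minimality the differential on the fibre adds a factor to each variable. By the Leibniz rule it
  adds a factor to products of two elements as well, and so it is defined on indecomposables.\<close>

lemma (in ring_hom_cring) fibre_diff_size:
  assumes surj: "h ` carrier R = carrier S"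
    and dg: "dg_differential R (gc_algebra R X vdeg) (gc_comp R X vdeg) d"
    and minimal: "\<And>f. f \<in> size_ideal R X vdeg 1 \<Longrightarrow> h \<circ> d f \<in> size_ideal S X vdeg 2"
  shows fibre_diff_square: "g \<in> size_ideal S X vdeg 1 \<Longrightarrow> fibre_diff R S h X vdeg d g \<in> size_ideal S X vdeg 2"
    and fibre_diff_cube: "g \<in> size_ideal S X vdeg 2 \<Longrightarrow> fibre_diff R S h X vdeg d g \<in> size_ideal S X vdeg 3"
    and ind_diff_class: "g \<in> size_ideal S X vdeg 1 \<Longrightarrow>
      ind_diff R S h X vdeg d (ind_class S X vdeg g) = ind2_class S X vdeg (fibre_diff R S h X vdeg d g)"
proof -
  let ?A = "gc_algebra R X vdeg" and ?K = "gc_algebra S X vdeg"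
  let ?D = "fibre_diff R S h X vdeg d"
  interpret A: ring ?A by (rule R.gc_ring)
  interpret K: ring ?K by (rule S.gc_ring)
  interpret dgA: dg_ring ?A "gc_comp R X vdeg" d by (rule R.dg_ring_gc_algebra[OF dg])
  have d: "d \<in> lin_maps R ?A ?A" using dg by (simp add: dg_differential_def)
  note Dl = fibre_diff_properties(1)[OF surj d] and Deq = fibre_diff_properties(2)[OF surj d]
  have lift: "\<exists>f\<in>size_ideal R X vdeg s. h \<circ> f = g" if g: "g \<in> size_ideal S X vdeg s" for g s
  proof -
    obtain f where f: "f \<in> carrier ?A" "h \<circ> f = g" "\<And>m. g m = \<zero>\<^bsub>S\<^esub> \<Longrightarrow> f m = \<zero>"
      using gc_map_surj[OF surj S.size_ideal_carrier[OF g]] by blast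
    then show ?thesis using S.size_ideal_coeff[OF g] by (intro bexI[of _ f]) (auto simp: size_ideal_def)
  qed
  show sq: "?D g \<in> size_ideal S X vdeg 2" if g: "g \<in> size_ideal S X vdeg 1" for g
  proof -
    obtain f where f: "f \<in> size_ideal R X vdeg 1" "h \<circ> f = g" using lift[OF g] by blast
    then show ?thesis using Deq[OF R.size_ideal_carrier[OF f(1)]] minimal[OF f(1)] by simp
  qed
  have closed: "f \<oplus>\<^bsub>?K\<^esub> g \<in> size_ideal S X vdeg s" if "f \<in> size_ideal S X vdeg s" "g \<in> size_ideal S X vdeg s" for f g s
    using additive_subgroup.a_closed[OF ideal.axioms(1)[OF S.size_ideal_ideal] that] .
  show cube: "?D g \<in> size_ideal S X vdeg 3" if g: "g \<in> size_ideal S X vdeg 2" for g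
    using g
  proof (induction rule: S.size_ideal_induct)
    case (add u v)
    then show ?case using lin_maps_add[OF Dl add(1,2)] closed by simp
  next
    case zero
    have "?D \<zero>\<^bsub>?K\<^esub> = \<zero>\<^bsub>?K\<^esub>" by (rule lin_maps_zero[OF Dl S.gc_abelian_group S.gc_abelian_group])
    then show ?case using additive_subgroup.zero_closed[OF ideal.axioms(1)[OF S.size_ideal_ideal]] by simp
  next
    case (single m s)
    then obtain x m' where m: "m = add_mset x m'" by (cases m) auto
    have x: "x \<in> X" "m' \<in> gc_monos X vdeg" "1 \<le> size m'" using single m by (auto simp: gc_monos_add_mset)
    have "s \<in> h ` carrier R" using single surj by simp
    then obtain r where r: "r \<in> carrier R" "s = h r" by blast
    let ?a = "gc_var R x" and ?b = "single R m' (signed R (inversions vdeg {#x#} m') r)"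
    have eq: "single R m r = ?a \<otimes>\<^bsub>?A\<^esub> ?b" using R.gc_single_split[of x m' X vdeg r] single m r by simp
    have a: "?a \<in> size_ideal R X vdeg 1" by (rule R.gc_var_size[OF x(1)])
    have bA: "?b \<in> carrier ?A" using R.gc_single_mem[OF x(2)] r by simp
    then have b: "?b \<in> size_ideal R X vdeg 1" using x(3) by (auto simp: size_ideal_def single_def[of R m'])
    have aA: "?a \<in> carrier ?A" by (rule R.size_ideal_carrier[OF a])
    have aG: "?a \<in> gc_comp R X vdeg (vdeg x)"
      using R.gc_comp_single[of "{#x#}" X vdeg \<one>] x(1) by (simp add: gc_var_single gc_monos_def gc_deg_def)
    have hm: "h \<circ> f \<in> size_ideal S X vdeg 1" if f: "f \<in> size_ideal R X vdeg 1" for f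
      using gc_map_mem[OF R.size_ideal_carrier[OF f]] R.size_ideal_coeff[OF f] by (simp add: size_ideal_def)
    have daA: "d ?a \<in> carrier ?A" and dbA: "d ?b \<in> carrier ?A" using aA bA dgA.d_closed by auto
    have t1: "h \<circ> (d ?a \<otimes>\<^bsub>?A\<^esub> ?b) \<in> size_ideal S X vdeg 3"
      using S.size_ideal_mult[OF minimal[OF a] hm[OF b]] gc_map_mult[OF daA bA] by (simp add: numeral_3_eq_3 numeral_2_eq_2)
    have t2: "h \<circ> (?a \<otimes>\<^bsub>?A\<^esub> d ?b) \<in> size_ideal S X vdeg 3"
      using S.size_ideal_mult[OF hm[OF a] minimal[OF b]] gc_map_mult[OF aA dbA] by (simp add: numeral_3_eq_3 numeral_2_eq_2)
    have t2': "h \<circ> signed ?A (vdeg x) (?a \<otimes>\<^bsub>?A\<^esub> d ?b) \<in> size_ideal S X vdeg 3"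
    proof -
      have c: "?a \<otimes>\<^bsub>?A\<^esub> d ?b \<in> carrier ?A" using aA dbA by simp
      have "h \<circ> signed ?A (vdeg x) (?a \<otimes>\<^bsub>?A\<^esub> d ?b) = signed ?K (vdeg x) (h \<circ> (?a \<otimes>\<^bsub>?A\<^esub> d ?b))"
        using R.gc_coeff[OF c] by (auto simp: R.gc_signed[OF c] S.gc_signed[OF gc_map_mem[OF c]] hom_signed)
      also have "\<dots> \<in> size_ideal S X vdeg 3"
        using t2 additive_subgroup.a_inv_closed[OF ideal.axioms(1)[OF S.size_ideal_ideal] t2] by (simp add: signed_def)
      finally show ?thesis .
    qed
    have cs: "d ?a \<otimes>\<^bsub>?A\<^esub> ?b \<in> carrier ?A" "signed ?A (vdeg x) (?a \<otimes>\<^bsub>?A\<^esub> d ?b) \<in> carrier ?A"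
      using daA bA aA dbA by auto
    have "h \<circ> d (single R m r) \<in> size_ideal S X vdeg 3"
      unfolding eq dgA.d_mult[OF aG bA] gc_map_add[OF cs] by (rule closed[OF t1 t2'])
    moreover have "?D (single S m s) = h \<circ> d (single R m r)"
      using Deq[of "single R m r"] r R.gc_single_mem[OF single(1) r(1)] by (simp add: gc_map_single)
    ultimately show ?case by (simp only:)
  qed
  show "ind_diff R S h X vdeg d (ind_class S X vdeg g) = ind2_class S X vdeg (?D g)" if g: "g \<in> size_ideal S X vdeg 1"
  proof -
    interpret Q: ideal "size_ideal S X vdeg 3" ?K by (rule S.size_ideal_ideal)
    interpret Q2: ideal "size_ideal S X vdeg 2" ?K by (rule S.size_ideal_ideal)
    have gK: "g \<in> carrier ?K" by (rule S.size_ideal_carrier[OF g])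
    have DgK: "?D g \<in> carrier ?K" by (rule lin_maps_mem[OF Dl gK])
    show ?thesis
      unfolding ind_diff_def S.ind_class_size S.ind2_class_size S.fibre_ideal_cube_size
    proof (intro equalityI subsetI)
      fix y assume "y \<in> size_ideal S X vdeg 3 <+>\<^bsub>?K\<^esub> (?D ` (size_ideal S X vdeg 2 +>\<^bsub>?K\<^esub> g))"
      then obtain b a where ab: "b \<in> size_ideal S X vdeg 3" "a \<in> size_ideal S X vdeg 2" "y = b \<oplus>\<^bsub>?K\<^esub> ?D (a \<oplus>\<^bsub>?K\<^esub> g)"
        by (auto simp: set_add_def' a_r_coset_def')
      have "y = (b \<oplus>\<^bsub>?K\<^esub> ?D a) \<oplus>\<^bsub>?K\<^esub> ?D g"
        using lin_maps_add[OF Dl S.size_ideal_carrier[OF ab(2)] gK] S.size_ideal_carrier[OF ab(1)]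
          S.size_ideal_carrier[OF cube[OF ab(2)]] DgK ab(3) by (simp add: K.a_assoc)
      moreover have "b \<oplus>\<^bsub>?K\<^esub> ?D a \<in> size_ideal S X vdeg 3" by (rule closed[OF ab(1) cube[OF ab(2)]])
      ultimately show "y \<in> size_ideal S X vdeg 3 +>\<^bsub>?K\<^esub> ?D g" by (auto simp: a_r_coset_def')
    next
      fix y assume "y \<in> size_ideal S X vdeg 3 +>\<^bsub>?K\<^esub> ?D g"
      then obtain b where "b \<in> size_ideal S X vdeg 3" "y = b \<oplus>\<^bsub>?K\<^esub> ?D g" by (auto simp: a_r_coset_def')
      then show "y \<in> size_ideal S X vdeg 3 <+>\<^bsub>?K\<^esub> (?D ` (size_ideal S X vdeg 2 +>\<^bsub>?K\<^esub> g))"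
        using Q2.a_rcos_self[OF gK] by (auto simp: set_add_def')
    qed
  qed
qed

lemma gc_resolution_minimal_model:
  assumes R: "cring R" and S: "cring S" and surj: "\<phi> ` carrier R = carrier S"
    and pos: "\<And>x. x \<in> X \<Longrightarrow> 1 \<le> vdeg x"
    and dg: "dg_differential R (gc_algebra R X vdeg) (gc_comp R X vdeg) d"
    and \<alpha>: "\<alpha> \<in> ring_hom (gc_algebra R X vdeg) S" and \<alpha>\<phi>: "\<And>r. r \<in> carrier R \<Longrightarrow> \<alpha> (gc_const R r) = \<phi> r"
    and qi: "quasi_iso (gc_algebra R X vdeg) (gc_comp R X vdeg) d
      S (\<lambda>n. if n = 0 then carrier S else {\<zero>\<^bsub>S\<^esub>}) (\<lambda>_. \<zero>\<^bsub>S\<^esub>) \<alpha>"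
  shows "gc_resolution R X vdeg d S \<alpha>"
proof -
  let ?A = "gc_algebra R X vdeg" and ?G = "gc_comp R X vdeg"
  interpret R: cring R by fact
  interpret S: cring S by fact
  interpret dgA: dg_ring ?A ?G d by (rule R.dg_ring_gc_algebra[OF dg])
  have G: "\<alpha> ` ?G n \<subseteq> (if n = 0 then carrier S else {\<zero>\<^bsub>S\<^esub>})" for n
    using qi by (auto simp: quasi_iso_def split: if_splits)
  show ?thesis
  proof unfold_locales
    show "\<alpha> a = \<zero>\<^bsub>S\<^esub>" if "a \<in> ?G (Suc n)" for a n using G[of "Suc n"] that by auto
    show "\<alpha> (d a) = \<zero>\<^bsub>S\<^esub>" if "a \<in> carrier ?A" for a using qi that by (simp add: quasi_iso_def)
    show "a \<in> d ` ?G (Suc n)" if "a \<in> ?G n" "d a = \<zero>\<^bsub>?A\<^esub>" "\<alpha> a = \<zero>\<^bsub>S\<^esub>" for a n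
      using qi that by (auto simp: quasi_iso_def)
    show "\<alpha> ` ?G 0 = carrier S"
    proof
      show "carrier S \<subseteq> \<alpha> ` ?G 0"
      proof
        fix s assume "s \<in> carrier S"
        then have "s \<in> \<phi> ` carrier R" using surj by simp
        then obtain r where r: "r \<in> carrier R" "s = \<phi> r" by blast
        have "gc_const R r \<in> ?G 0"
          using R.gc_comp_single[of "{#}" X vdeg r] r by (simp add: gc_const_single gc_monos_def gc_deg_def)
        then show "s \<in> \<alpha> ` ?G 0" using \<alpha>\<phi>[OF r(1)] r by (intro rev_image_eqI[of "gc_const R r"]) auto
      qed
    qed (use G[of 0] in auto)
  qed (use \<alpha> pos in auto)
qed

section \<open>The conormal module\<close>

text \<open>Two preimages of an element of \<open>S\<close> differ by an element of \<open>I\<close>, so that their multiples of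
  \<open>a \<in> I\<close> agree modulo \<open>I\<^sup>2\<close>.\<close>

lemma (in ring_hom_cring) conormal_operations:
  assumes a: "a \<in> a_kernel R S h" and b: "b \<in> a_kernel R S h"
  shows conormal_mem: "ideal_prod R (a_kernel R S h) (a_kernel R S h) +> a \<in> carrier (conormal_module R S h)"
    and conormal_add: "(ideal_prod R (a_kernel R S h) (a_kernel R S h) +> a) \<oplus>\<^bsub>conormal_module R S h\<^esub>
        (ideal_prod R (a_kernel R S h) (a_kernel R S h) +> b) =
      ideal_prod R (a_kernel R S h) (a_kernel R S h) +> (a \<oplus> b)"
    and conormal_smult: "r \<in> carrier R \<Longrightarrow>
      h r \<odot>\<^bsub>conormal_module R S h\<^esub> (ideal_prod R (a_kernel R S h) (a_kernel R S h) +> a) =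
      ideal_prod R (a_kernel R S h) (a_kernel R S h) +> (r \<otimes> a)"
proof -
  let ?I = "a_kernel R S h" and ?I2 = "ideal_prod R (a_kernel R S h) (a_kernel R S h)"
  have "ring_hom_ring R S h" by (rule ring_hom_ringI2[OF R.ring_axioms S.ring_axioms homh])
  then interpret I: ideal ?I R by (rule ring_hom_ring.kernel_is_ideal)
  interpret I2: ideal ?I2 R by (rule R.ideal_prod_is_ideal[OF I.is_ideal I.is_ideal])
  have aR: "a \<in> carrier R" and bR: "b \<in> carrier R" using a b by (auto intro: I.Icarr)
  show "?I2 +> a \<in> carrier (conormal_module R S h)" using a by (simp add: conormal_module_def Let_def)
  show "(?I2 +> a) \<oplus>\<^bsub>conormal_module R S h\<^esub> (?I2 +> b) = ?I2 +> (a \<oplus> b)"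
    using I2.a_rcos_sum[OF aR bR] by (simp add: conormal_module_def Let_def)
  assume r: "r \<in> carrier R"
  have "?I2 <+>\<^bsub>R\<^esub> {r' \<otimes> y | r' y. r' \<in> carrier R \<and> h r' = h r \<and> y \<in> ?I2 +> a} = ?I2 +> (r \<otimes> a)"
  proof (intro equalityI subsetI)
    fix y assume "y \<in> ?I2 <+>\<^bsub>R\<^esub> {r' \<otimes> y | r' y. r' \<in> carrier R \<and> h r' = h r \<and> y \<in> ?I2 +> a}"
    then obtain c r' e where c: "c \<in> ?I2" "e \<in> ?I2" and r': "r' \<in> carrier R" "h r' = h r"
      and y: "y = c \<oplus> (r' \<otimes> (e \<oplus> a))"
      by (auto simp: set_add_def' a_r_coset_def')
    have cR: "c \<in> carrier R" "e \<in> carrier R" using c I2.Icarr by auto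
    have "h (r' \<oplus> \<ominus> r) = h r' \<oplus>\<^bsub>S\<^esub> \<ominus>\<^bsub>S\<^esub> h r" using r r' by simp
    also have "\<dots> = \<zero>\<^bsub>S\<^esub>" unfolding r'(2) by (rule S.r_neg) (rule hom_closed[OF r])
    finally have "r' \<ominus> r \<in> ?I" unfolding mem_a_kernel a_minus_def using r r' by blast
    then have ra: "(r' \<ominus> r) \<otimes> a \<in> ?I2" using a by (rule ideal_prod.prod)
    have m: "(c \<oplus> (r' \<otimes> e)) \<oplus> ((r' \<ominus> r) \<otimes> a) \<in> ?I2"
      by (rule I2.a_closed[OF I2.a_closed[OF c(1) I2.I_l_closed[OF c(2) r'(1)]] ra])
    have "y = ((c \<oplus> (r' \<otimes> e)) \<oplus> ((r' \<ominus> r) \<otimes> a)) \<oplus> (r \<otimes> a)"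
    proof -
      have e: "r' \<otimes> (e \<oplus> a) = (r' \<otimes> e) \<oplus> (r' \<otimes> a)" using cR r' aR by (simp add: R.r_distr)
      have m: "(r' \<ominus> r) \<otimes> a = (r' \<otimes> a) \<oplus> \<ominus> (r \<otimes> a)" using r r' aR by (simp add: R.minus_eq R.l_distr R.l_minus)
      show ?thesis
        unfolding y e m using cR r' r aR by (simp add: R.a_assoc R.l_neg)
    qed
    with m show "y \<in> ?I2 +> (r \<otimes> a)" by (auto simp: a_r_coset_def')
  next
    fix y assume "y \<in> ?I2 +> (r \<otimes> a)"
    then obtain c where "c \<in> ?I2" "y = c \<oplus> (r \<otimes> a)" by (auto simp: a_r_coset_def')
    then show "y \<in> ?I2 <+>\<^bsub>R\<^esub> {r' \<otimes> y | r' y. r' \<in> carrier R \<and> h r' = h r \<and> y \<in> ?I2 +> a}"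
      using I2.a_rcos_self[OF aR] r unfolding set_add_def' by blast
  qed
  then show "h r \<odot>\<^bsub>conormal_module R S h\<^esub> (?I2 +> a) = ?I2 +> (r \<otimes> a)"
    by (simp add: conormal_module_def Let_def)
qed

section \<open>Vanishing of the bracket in high degrees\<close>

theorem theorem2p7:
  fixes R :: "'a ring" and S :: "'b ring" and \<phi> :: "'a \<Rightarrow> 'b"
    and k :: "'k ring" and \<epsilon> :: "'b \<Rightarrow> 'k"
    and X :: "'x::linorder set" and vdeg :: "'x \<Rightarrow> nat"
    and d :: "('x multiset \<Rightarrow> 'a) \<Rightarrow> ('x multiset \<Rightarrow> 'a)"
    and z :: "('x multiset \<Rightarrow> 'k) set \<Rightarrow> 'k" and \<zeta> :: "'a set \<Rightarrow> 'k"
    and N :: "('b, 'n) module" and g :: "'a set \<Rightarrow> 'n" and h :: "'n \<Rightarrow> 'k"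
  assumes "noetherian_local_ring R" and "noetherian_local_ring S"
    and "\<phi> \<in> ring_hom R S" and "\<phi> ` carrier R = carrier S"
    and "\<phi> ` max_ideal R \<subseteq> max_ideal S"
    and "field k" and "\<epsilon> \<in> ring_hom S k" and "\<epsilon> ` carrier S = carrier k"
    and "finite_projdim R (module_via \<phi> S)"
    and "minimal_model R S \<phi> X vdeg d"
    and "z \<in> homotopy_pi k X vdeg 2"
    and "conormal_hom R S \<phi> k \<epsilon> X vdeg d z \<zeta>"
    and "module S N" and "finitely_generated S N" and "finite_projdim S N"
    and "g \<in> lin_maps S (conormal_module R S \<phi>) N"
    and "h \<in> lin_maps S N (module_via \<epsilon> k)"
    and "\<forall>c\<in>carrier (conormal_module R S \<phi>). \<zeta> c = h (g c)"
  shows "in_radical R k (\<epsilon> \<circ> \<phi>) X vdeg d 2 z"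
proof -
  let ?A = "gc_algebra R X vdeg" and ?K = "gc_algebra k X vdeg"
  let ?\<rho> = "\<epsilon> \<circ> \<phi>"
  interpret R: cring R using assms(1) by (simp add: noetherian_local_ring_def)
  interpret S: cring S using assms(2) by (simp add: noetherian_local_ring_def)
  interpret k: field k by fact
  interpret \<phi>: ring_hom_cring R S \<phi>
    by (rule ring_hom_cring.intro) (use assms(3) R.cring_axioms S.cring_axioms in \<open>auto intro: ring_hom_cring_axioms.intro\<close>)
  have \<rho>: "?\<rho> \<in> ring_hom R k" by (rule ring_hom_trans[OF assms(3,7)])
  interpret \<rho>: ring_hom_cring R k ?\<rho>
    by (rule ring_hom_cring.intro) (use \<rho> R.cring_axioms k.cring_axioms in \<open>auto intro: ring_hom_cring_axioms.intro\<close>)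
  have \<rho>surj: "?\<rho> ` carrier R = carrier k" using assms(4,8) by (metis image_comp)
  interpret N: module S N by fact
  note model = assms(10)[unfolded minimal_model_def Let_def]
  have pos: "1 \<le> vdeg x" if "x \<in> X" for x using model that by blast
  have dg: "dg_differential R ?A (gc_comp R X vdeg) d" using model by blast
  have d: "d \<in> lin_maps R ?A ?A" using dg by (simp add: dg_differential_def)
  obtain \<alpha> where \<alpha>: "\<alpha> \<in> ring_hom ?A S" and \<alpha>\<phi>: "\<And>r. r \<in> carrier R \<Longrightarrow> \<alpha> (gc_const R r) = \<phi> r"
    and qi: "quasi_iso ?A (gc_comp R X vdeg) d S (\<lambda>n. if n = 0 then carrier S else {\<zero>\<^bsub>S\<^esub>}) (\<lambda>_. \<zero>\<^bsub>S\<^esub>) \<alpha>"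
    using model by blast
  interpret A: gc_resolution R X vdeg d S \<alpha>
    by (rule gc_resolution_minimal_model[OF R.cring_axioms S.cring_axioms assms(4) pos dg \<alpha> \<alpha>\<phi> qi])
  have phi: "A.phi r = \<phi> r" if "r \<in> carrier R" for r
    using \<alpha>\<phi>[OF that] by (simp add: gc_const_single)
  have max_sub: "max_ideal R \<subseteq> carrier R"
  proof -
    have "\<exists>!\<mm>. maximalideal \<mm> R" using assms(1) unfolding noetherian_local_ring_def by blast
    then have "maximalideal (max_ideal R) R" unfolding max_ideal_def by (rule theI')
    then have "ideal (max_ideal R) R" by (rule maximalideal.axioms(1))
    then show ?thesis by (rule additive_subgroup.a_subset[OF ideal.axioms(1)])
  qed
  have minimal: "?\<rho> \<circ> d f \<in> size_ideal k X vdeg 2" if "f \<in> size_ideal R X vdeg 1" for f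
  proof (rule \<rho>.minimal_reduction[OF _ max_sub d _ that])
    show "?\<rho> r = \<zero>\<^bsub>k\<^esub>" if "r \<in> max_ideal R" for r
      by (rule max_ideal_kernel[OF assms(1) assms(6) \<rho> \<rho>surj that])
  qed (use model in blast)
  have minimal': "\<epsilon> (A.phi (d f m)) = \<zero>\<^bsub>k\<^esub>" if f: "f \<in> carrier ?A" "f {#} = \<zero>\<^bsub>R\<^esub>" and m: "size m \<le> 1" for f m
  proof -
    have "f \<in> size_ideal R X vdeg 1" using f by (simp add: size_ideal_def)
    from k.size_ideal_coeff[OF minimal[OF this], of m] m show ?thesis
      using phi[OF A.A_coeff[OF A.d_closed[OF f(1)]]] by simp
  qed
  let ?I = "a_kernel R S \<phi>"
  let ?cl = "\<lambda>a. ideal_prod R ?I ?I +>\<^bsub>R\<^esub> a"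
  define \<gamma> where "\<gamma> = (\<lambda>a. g (?cl a))"
  have ker: "a \<in> ?I" if "a \<in> carrier R" "A.phi a = \<zero>\<^bsub>S\<^esub>" for a
    using that phi[OF that(1)] unfolding mem_a_kernel by simp
  have \<gamma>_closed: "\<gamma> a \<in> carrier N" if "a \<in> carrier R" "A.phi a = \<zero>\<^bsub>S\<^esub>" for a
    unfolding \<gamma>_def by (rule lin_maps_mem[OF assms(16) \<phi>.conormal_mem[OF ker[OF that] ker[OF that]]])
  have \<gamma>_add: "\<gamma> (a \<oplus>\<^bsub>R\<^esub> b) = \<gamma> a \<oplus>\<^bsub>N\<^esub> \<gamma> b"
    if "a \<in> carrier R" "b \<in> carrier R" "A.phi a = \<zero>\<^bsub>S\<^esub>" "A.phi b = \<zero>\<^bsub>S\<^esub>" for a b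
  proof -
    have I: "a \<in> ?I" "b \<in> ?I" using ker that by auto
    show ?thesis
      using lin_maps_add[OF assms(16) \<phi>.conormal_mem[OF I(1,1)] \<phi>.conormal_mem[OF I(2,2)]]
      by (simp add: \<gamma>_def \<phi>.conormal_add[OF I])
  qed
  have \<gamma>_mult: "\<gamma> (r \<otimes>\<^bsub>R\<^esub> a) = A.phi r \<odot>\<^bsub>N\<^esub> \<gamma> a"
    if r: "r \<in> carrier R" and a: "a \<in> carrier R" "A.phi a = \<zero>\<^bsub>S\<^esub>" for r a
  proof -
    have I: "a \<in> ?I" using ker a by auto
    show ?thesis
      using lin_maps_smult[OF assms(16) _ \<phi>.conormal_mem[OF I I], of "\<phi> r"] r
      by (simp add: \<gamma>_def \<phi>.conormal_smult[OF I I r] phi)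
  qed
  have \<gamma>_zero: "\<gamma> \<zero>\<^bsub>R\<^esub> = \<zero>\<^bsub>N\<^esub>"
  proof -
    have z: "\<zero>\<^bsub>R\<^esub> \<in> carrier R" "A.phi \<zero>\<^bsub>R\<^esub> = \<zero>\<^bsub>S\<^esub>" using phi by auto
    have "\<gamma> \<zero>\<^bsub>R\<^esub> = \<gamma> \<zero>\<^bsub>R\<^esub> \<oplus>\<^bsub>N\<^esub> \<gamma> \<zero>\<^bsub>R\<^esub>" using \<gamma>_add[OF z(1,1,2,2)] by simp
    then show ?thesis using \<gamma>_closed[OF z] by (metis N.add.l_cancel_one)
  qed
  have d_lin: "d (\<lambda>m. r \<otimes>\<^bsub>R\<^esub> f m) = (\<lambda>m. r \<otimes>\<^bsub>R\<^esub> d f m)" if "r \<in> carrier R" "f \<in> carrier ?A" for r f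
    using lin_maps_smult[OF d that] by (simp add: gc_algebra_simps)
  obtain P \<delta> e n0 where P: "projective_resolution S N P \<delta> e"
    "\<forall>i>n0. carrier ((P :: nat \<Rightarrow> ('b, nat \<times> 'n \<times> 'b \<Rightarrow> 'b) module) i) = {\<zero>\<^bsub>P i\<^esub>}"
    using assms(15) unfolding finite_projdim_def by blast
  obtain B :: "nat \<Rightarrow> (bool \<times> nat \<times> (nat \<times> 'n \<times> 'b \<Rightarrow> 'b)) set" and D \<eta> where
    res: "free_resolution S N B D \<eta>" and bound: "\<And>j. j > Suc n0 \<Longrightarrow> B j = {}"
    using free_resolution_of_projective_resolution[OF S.cring_axioms N.abelian_group_axioms P] by blast
  have D: "D j \<in> lin_maps S (free_module S (B (Suc j))) (free_module S (B j))" for j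
    using res by (simp add: free_resolution_def)
  have DD: "D j (D (Suc j) l) = (\<lambda>_. \<zero>\<^bsub>S\<^esub>)" if "l \<in> carrier (free_module S (B (Suc (Suc j))))" for j l
  proof -
    have "D (Suc j) l \<in> {x \<in> carrier (free_module S (B (Suc j))). D j x = \<zero>\<^bsub>free_module S (B j)\<^esub>}"
      using res that by (simp add: free_resolution_def)
    then show ?thesis by simp
  qed
  have \<eta>: "\<eta> \<in> lin_maps S (free_module S (B 0)) N" using res by (simp add: free_resolution_def)
  obtain W where W: "A.lifts B D W" using A.lifts_exist[where B = B and D = D, OF D DD] by blast
  obtain t where t: "A.derivation_data B t"
    and tx: "\<And>x. x \<in> X \<Longrightarrow> A.bd W (t x) = (\<lambda>c. \<ominus>\<^bsub>?A\<^esub> A.theta t (d (gc_var R x)) c)"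
    and t1: "\<And>x. x \<in> X \<Longrightarrow> vdeg x = 1 \<Longrightarrow> \<eta> (\<lambda>i. \<alpha> (t x (0, i))) = \<gamma> (d (gc_var R x) {#})"
    using A.derivation_lifts[OF W res N.abelian_group_axioms \<gamma>_closed \<gamma>_add \<gamma>_mult \<gamma>_zero d_lin] by blast
  note zl = k.homotopy_pi_lin[OF assms(11)]
  let ?z = "k.on_var X vdeg z"
  have h0: "h \<zero>\<^bsub>N\<^esub> = \<zero>\<^bsub>k\<^esub>"
    using lin_maps_zero[OF assms(17) N.abelian_group_axioms k.module_via_abelian_group] by (simp add: module_via_def)
  \<comment> \<open>\<open>h \<circ> \<eta>\<close> of the constant terms of the derivation recovers \<open>z\<close> on all variables\<close>
  have zt: "h (\<eta> (\<lambda>i. A.phi (t y (0, i) {#}))) = ?z y" if y: "y \<in> X" for y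
  proof (cases "vdeg y = 1")
    case True
    have "single R {#} (t y (0, i) {#}) = t y (0, i)" for i
      using A.G0_const[of "t y (0, i)"] A.homog_G[OF A.data_homog[OF t y], of 0 i] True by simp
    then have "h (\<eta> (\<lambda>i. A.phi (t y (0, i) {#}))) = h (g (?cl (d (gc_var R y) {#})))"
      using t1[OF y True] by (simp add: \<gamma>_def)
    also have "\<dots> = \<zeta> (?cl (d (gc_var R y) {#}))"
    proof -
      have yG: "gc_var R y \<in> gc_comp R X vdeg 1" using A.var_G[OF y] True by simp
      have dG: "d (gc_var R y) \<in> gc_comp R X vdeg 0" using A.d_deg[of _ 0] yG by simp
      have "A.phi (d (gc_var R y) {#}) = \<zero>\<^bsub>S\<^esub>"
        using A.G0_const[OF dG] A.\<alpha>_d[OF A.G_carrier[OF yG]] by simp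
      then have I: "d (gc_var R y) {#} \<in> ?I" by (intro ker A.A_coeff[OF A.G_carrier[OF dG]])
      show ?thesis using assms(18) \<phi>.conormal_mem[OF I I] by simp
    qed
    also have "\<dots> = z (ind_class k X vdeg (gc_var k y))"
      using assms(12) y True by (simp add: conormal_hom_def Let_def)
    finally show ?thesis using y by (simp add: k.on_var_def)
  next
    case False
    then obtain p where p: "vdeg y = Suc (Suc p)" using pos[OF y] by (metis One_nat_def not0_implies_Suc not_one_le_zero)
    have "t y (0, i) {#} = \<zero>\<^bsub>R\<^esub>" for i
      using A.homog_G[OF A.data_homog[OF t y], of 0 i] p by (intro A.G_pos_empty[of _ p]) simp
    then have "h (\<eta> (\<lambda>i. A.phi (t y (0, i) {#}))) = \<zero>\<^bsub>k\<^esub>"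
      using lin_maps_zero[OF \<eta> S.free_module_abelian_group N.abelian_group_axioms] h0 by (simp add: A.phi_zero)
    then show ?thesis
      using k.homotopy_pi_var[OF assms(11) y] p by (simp add: k.on_var_def)
  qed
  have zclosed: "?z y \<in> carrier k" for y by (rule k.on_var_closed[OF zl])
  \<comment> \<open>The factor \<open>y\<close> has degree \<open>1\<close> if \<open>z\<close> does not vanish on it; so \<open>y x'\<close> occurs in \<open>d x\<close> only if the degree
    of \<open>x\<close> is that of \<open>x'\<close> plus \<open>2\<close>.\<close>
  have vanish: "comb k (\<lambda>y _. ?z y) (\<lambda>y. pd k vdeg y (?\<rho> \<circ> d (gc_var R x)) {#x'#}) () = \<zero>\<^bsub>k\<^esub>"
    if x: "x \<in> X" and x': "x' \<in> X" "Suc (vdeg x') > Suc n0" for x x'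
  proof -
    let ?dx = "d (gc_var R x)"
    have xG: "gc_var R x \<in> gc_comp R X vdeg (Suc (vdeg x - 1))" using A.var_G[OF x] pos[OF x] by simp
    have dxG: "?dx \<in> gc_comp R X vdeg (vdeg x - 1)" by (rule A.d_deg[OF xG])
    have dxA: "?dx \<in> carrier ?A" by (rule A.G_carrier[OF dxG])
    have pd: "pd k vdeg y (?\<rho> \<circ> ?dx) {#x'#} = \<epsilon> (A.phi (pd R vdeg y ?dx {#x'#}))" for y
      using fun_cong[OF \<rho>.gc_map_pd[OF dxA, of y], of "{#x'#}"] phi[OF A.A_coeff[OF A.pd_A[OF dxA]]] by simp
    have vec: "(\<lambda>y. pd k vdeg y (?\<rho> \<circ> ?dx) {#x'#}) \<in> carrier (free_module k X)"
      by (rule k.pd_coeff_vector[OF \<rho>.gc_map_mem[OF dxA]])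
    show ?thesis
    proof (cases "vdeg x = Suc (Suc (vdeg x'))")
      case True
      have "comb k (\<lambda>y _. h (\<eta> (\<lambda>i. A.phi (t y (0, i) {#})))) (\<lambda>y. \<epsilon> (A.phi (pd R vdeg y ?dx {#x'#}))) () = \<zero>\<^bsub>k\<^esub>"
        by (rule A.obstruction_vanishes[OF W res N.abelian_group_axioms k.cring_axioms assms(7) assms(17) minimal' t
              tx[OF x] x True _ bound[OF x'(2)] x'(1)]) (use x'(2) in simp_all)
      moreover have "comb k (\<lambda>y _. ?z y) (\<lambda>y. pd k vdeg y (?\<rho> \<circ> ?dx) {#x'#}) () =
          comb k (\<lambda>y _. h (\<eta> (\<lambda>i. A.phi (t y (0, i) {#})))) (\<lambda>y. pd k vdeg y (?\<rho> \<circ> ?dx) {#x'#}) ()"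
      proof (rule k.comb_cong)
        fix y assume "pd k vdeg y (?\<rho> \<circ> ?dx) {#x'#} \<noteq> \<zero>\<^bsub>k\<^esub>"
        then have "y \<in> X" using vec by (auto simp: mem_free_module)
        then show "?z y = h (\<eta> (\<lambda>i. A.phi (t y (0, i) {#})))" using zt by simp
      qed (use vec zclosed in \<open>auto simp: mem_free_module\<close>)
      ultimately show ?thesis by (simp add: pd)
    next
      case False
      have "?z y \<otimes>\<^bsub>k\<^esub> pd k vdeg y (?\<rho> \<circ> ?dx) {#x'#} = \<zero>\<^bsub>k\<^esub>" for y
      proof (cases "y \<in> X \<and> vdeg y = 1")
        case True
        have "?dx {#y, x'#} = \<zero>\<^bsub>R\<^esub>"
        proof (rule ccontr)
          assume "?dx {#y, x'#} \<noteq> \<zero>\<^bsub>R\<^esub>"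
          from R.gc_comp_deg[OF dxG this] show False
            using True False pos[OF x] by (simp add: gc_deg_def)
        qed
        then have "pd R vdeg y ?dx {#x'#} = \<zero>\<^bsub>R\<^esub>" using R.pd_nonzero by blast
        then have "pd k vdeg y (?\<rho> \<circ> ?dx) {#x'#} = \<zero>\<^bsub>k\<^esub>"
          using \<rho>.hom_zero by (simp add: pd phi)
        then show ?thesis using zclosed by simp
      next
        case False
        then have "?z y = \<zero>\<^bsub>k\<^esub>" using k.homotopy_pi_var[OF assms(11), of y] by (auto simp: k.on_var_def)
        then show ?thesis using vec by (simp add: mem_free_module)
      qed
      then show ?thesis unfolding comb_def by (intro k.add.finprod_one_eqI) simp
    qed
  qed
  show ?thesis
    unfolding in_radical_def
  proof (intro exI allI impI ballI)
    fix j u c assume j: "j > Suc n0" and u: "u \<in> homotopy_pi k X vdeg j" and c: "c \<in> carrier (ind k X vdeg)"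
    note ul = k.homotopy_pi_lin[OF u]
    let ?u = "k.on_var X vdeg u"
    define D' where "D' = fibre_diff R k ?\<rho> X vdeg d"
    have uclosed: "?u y \<in> carrier k" for y by (rule k.on_var_closed[OF ul])
    note Dl = \<rho>.fibre_diff_properties(1)[OF \<rho>surj d, folded D'_def]
    let ?B = "dual_pairing k vdeg ?z ?u"
    have Bx: "?B (?\<rho> \<circ> d (gc_var R x)) = \<zero>\<^bsub>k\<^esub>" if x: "x \<in> X" for x
    proof -
      have dxA: "?\<rho> \<circ> d (gc_var R x) \<in> carrier ?K"
        by (rule \<rho>.gc_map_mem[OF A.d_closed[OF R.gc_var_mem[OF x]]])
      have "?u x' \<otimes>\<^bsub>k\<^esub> comb k (\<lambda>y _. ?z y) (\<lambda>y. pd k vdeg y (?\<rho> \<circ> d (gc_var R x)) {#x'#}) () = \<zero>\<^bsub>k\<^esub>" for x'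
      proof (cases "x' \<in> X \<and> Suc (vdeg x') = j")
        case True
        then show ?thesis using vanish[OF x, of x'] j uclosed by simp
      next
        case False
        then have "?u x' = \<zero>\<^bsub>k\<^esub>" using k.homotopy_pi_var[OF u, of x'] by (auto simp: k.on_var_def)
        then show ?thesis using k.dual_inner_vector[OF dxA zclosed] by (simp add: mem_free_module)
      qed
      then show ?thesis
        unfolding dual_pairing_def comb_def[of k "\<lambda>x' _. ?u x'"] by (intro k.add.finprod_one_eqI) simp
    qed
    have BD: "?B (D' f) = \<zero>\<^bsub>k\<^esub>" if f: "f \<in> size_ideal k X vdeg 1" for f
      using f
    proof (induction rule: k.size_ideal_induct)
      case (add f f')
      then show ?case
        using lin_maps_add[OF Dl add(1,2)] lin_maps_mem[OF Dl add(1)] lin_maps_mem[OF Dl add(2)]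
          k.dual_pairing_add[where u = ?z and v = ?u, OF _ _ zclosed uclosed] by simp
    next
      case zero
      have "D' \<zero>\<^bsub>?K\<^esub> = \<zero>\<^bsub>?K\<^esub>" by (rule lin_maps_zero[OF Dl k.gc_abelian_group k.gc_abelian_group])
      then show ?case
        using k.dual_pairing_cube[OF additive_subgroup.zero_closed[OF ideal.axioms(1)[OF k.size_ideal_ideal]]] by simp
    next
      case (single m r)
      have sm: "single k m r \<in> carrier ?K" by (rule k.gc_single_mem[OF single(1,3)])
      show ?case
      proof (cases "size m = 1")
        case True
        then obtain x where m: "m = {#x#}" using size_1_singleton_mset by blast
        then have x: "x \<in> X" using single by (simp add: gc_monos_def)
        have "single k m r = r \<odot>\<^bsub>?K\<^esub> gc_var k x"
          using single by (auto simp: m gc_algebra_simps gc_var_single single_def)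
        then have "D' (single k m r) = r \<odot>\<^bsub>?K\<^esub> (?\<rho> \<circ> d (gc_var R x))"
          using lin_maps_smult[OF Dl single(3) k.gc_var_mem[OF x]]
            \<rho>.fibre_diff_properties(2)[OF \<rho>surj d R.gc_var_mem[OF x], folded D'_def] by (simp only: \<rho>.gc_map_var)
        then show ?thesis
          using k.dual_pairing_smult[where u = ?z and v = ?u, OF \<rho>.gc_map_mem[OF A.d_closed[OF R.gc_var_mem[OF x]]] single(3) zclosed uclosed]
            Bx[OF x] single by simp
      next
        case False
        then have "single k m r \<in> size_ideal k X vdeg 2"
          using single sm by (auto simp: size_ideal_def single_def[of k m])
        then show ?thesis by (intro k.dual_pairing_cube[where X = X] \<rho>.fibre_diff_cube[OF \<rho>surj dg minimal, folded D'_def])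
      qed
    qed
    obtain f where f: "f \<in> size_ideal k X vdeg 1" "c = ind_class k X vdeg f"
      using c by (auto simp: k.ind_carrier)
    have "ind_diff R k ?\<rho> X vdeg d c = ind2_class k X vdeg (D' f)"
      unfolding f(2) D'_def by (rule \<rho>.ind_diff_class[OF \<rho>surj dg minimal f(1)])
    moreover have "D' f \<in> size_ideal k X vdeg 2"
      unfolding D'_def by (rule \<rho>.fibre_diff_square[OF \<rho>surj dg minimal f(1)])
    ultimately have "tensor_pairing k X vdeg 2 j z u (ind_diff R k ?\<rho> X vdeg d c) = \<zero>\<^bsub>k\<^esub>"
      using k.tensor_pairing_eq[OF assms(11) u, of "D' f"] BD[OF f(1)] by simp
    then show "lie_bracket R k ?\<rho> X vdeg d 2 j z u c = \<zero>\<^bsub>k\<^esub>"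
      by (simp add: lie_bracket_def)
  qed
qed

end
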